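(* Fix $\lambda>0$ and a typical (i.e. $\mu$-almost every) realization $\omega$ of the environment. For all $t\in[0,T]$ and $G\in\mathcal S_W(\mathbb T^d)$, $$\lim_{N\to\infty}E_{\nu_\rho}\Big[\big(Y^N_t(G)-Y^{N,\lambda}_t(G)\big)^2\Big]=0,$$ where $Y^N_t(G)=N^{-d/2}\sum_{x\in\mathbb T^d_N}G(x/N)[\eta_t(x)-\rho]$ is the density fluctuation field and $Y^{N,\lambda}_t(G)=N^{-d/2}\sum_{x\in\mathbb T^d_N}G^\lambda_N(x/N)[\eta_t(x)-\rho]$ is the corrected density fluctuation field, $G^\lambda_N$ being the solution of $\lambda G^\lambda_N-\mathbb L_NG^\lambda_N=\lambda G-\nabla A\nabla_WG$ on $N^{-1}\mathbb T^d_N$.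
   Context: $T>0$, $\rho\in(0,1]$, $b>-1/2$. **Torus and $W$.** $\mathbb T^d=(\mathbb R/\mathbb Z)^d$, $\mathbb T=\mathbb T^1$, $\mathbb T^d_N=(\mathbb Z/N\mathbb Z)^d$, $d\ge1$; $e_1,\dots,e_d$ is the canonical basis. $W(x)=\sum_{k=1}^dW_k(x_k)$ where each $W_k:\mathbb R\to\mathbb R$ is strictly increasing, càdlàg, and $W_k(u+1)-W_k(u)=W_k(1)-W_k(0)$ for all $u$. $d(x^j\otimes W_j)$ is the product measure $dx_1\cdots dx_{j-1}\,dW_j\,dx_{j+1}\cdots dx_d$ on $\mathbb T^d$, and $L^2_{x^j\otimes W_j}(\mathbb T^d)$ its $L^2$ space. $\partial_{W_k}f(x)=\lim_{\epsilon\to0}\frac{f(x+\epsilon e_k)-f(x)}{W_k(x_k+\epsilon)-W_k(x_k)}$ when the limit exists and is finite; $\nabla_W=(\partial_{W_1},\dots,\partial_{W_d})$. **The space $\mathcal S_W(\mathbb T^d)$.** For each $k$, $\mathcal L_{W_k}=\partial_{x_k}\partial_{W_k}$ acts on the domain $\mathcal D_{W_k}\subset L^2(\mathbb T)$ of functions $f(x)=a+cW_k(x)+\int_{(0,x]}W_k(dy)\int_0^y\mathfrak f(z)dz$ with $a,c\in\mathbb R$, $\mathfrak f\in L^2(\mathbb T)$, $\int_0^1\mathfrak f=0$ and $\int_{(0,1]}W_k(dy)\{c+\int_0^y\mathfrak f(z)dz\}=0$, and $\mathcal L_{W_k}f=\mathfrak f$. It is known that $\mathcal L_{W_k}$ has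 a countable complete orthonormal system of eigenvectors $\mathcal A_{W_k}$ in $L^2(\mathbb T)$. Let $\mathcal A_W=\{\prod_kf_k(x_k):f_k\in\mathcal A_{W_k}\}$ and $\mathbb D_W=\mathrm{span}(\mathcal A_W)$. $\mathcal A_W=\{\varphi_j\}_{j\ge1}$ is a complete orthonormal system of $L^2(\mathbb T^d)$, with $-\sum_k\mathcal L_{W_k}\varphi_j=\alpha_j\varphi_j$, enumerated so that $0=\alpha_1\le\alpha_2\le\cdots\to\infty$ (finite multiplicities). Put $\lambda_j=1+\alpha_j$, let $\mathbb P_k$ be the orthogonal projection on the span of $\varphi_k$, and for $n\in\mathbb N$ (including $0$) let $\|f\|_n^2=\sum_{k\ge1}\|\mathbb P_kf\|^2\lambda_k^{2n}k^{2n}$, where $\|\cdot\|$ is the $L^2(\mathbb T^d)$ norm. $\mathcal S_n$ is the completion of $\mathbb D_W$ under $\|\cdot\|_n$, and $\mathcal S_W(\mathbb T^d)=\bigcap_{n\ge0}\mathcal S_n$. Its elements are evaluated pointwise through their canonical càdlàg representatives. **Environment.** $(\Omega,\mathcal F,\mu)$ is a standard probability space, $\{T_x\}_{x\in\mathbb Z^d}$ a group of measurable, $\mu$-preserving transformations of $\Omega$ ($T_0=I$, $T_xT_y=T_{x+y}$), ergodic. $a_1,\dots,a_d:\Omega\to\mathbb R$ are measurable with $\theta^{-1}\le a_j\le\theta$ for some $\theta>0$. $A^N=\mathrm{diag}(a_1^N,\dots,a_d^N)$ with $a^N_j(x)=a^N_{jj}(x)=a_j(T_x\omega)$ for $x\in\mathbb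 T^d_N=\{0,\dots,N-1\}^d$. **Exclusion process.** Let $\xi_{x,x+e_j}=\xi_{x+e_j,x}=\dfrac{a^N_j(x)}{N[W((x+e_j)/N)-W(x/N)]}$ and $c_{x,x+e_j}(\eta)=1+b\{\eta(x-e_j)+\eta(x+2e_j)\}$ (sums modulo $N$). $\{\eta_t\}$ is the Markov process on $\{0,1\}^{\mathbb T^d_N}$ with generator $N^2L_N$, where $(L_Nf)(\eta)=\sum_{j=1}^d\sum_{x\in\mathbb T^d_N}\xi_{x,x+e_j}c_{x,x+e_j}(\eta)\{f(\sigma^{x,x+e_j}\eta)-f(\eta)\}$ and $\sigma^{x,x+e_j}\eta$ is $\eta$ with the values at $x$ and $x+e_j$ exchanged. $\nu_\rho$ is the Bernoulli product measure with $\nu_\rho\{\eta(x)=1\}=\rho$; it is reversible. $E_{\nu_\rho}$ is expectation for the process started from $\nu_\rho$. **Random walk generator.** For $g:N^{-1}\mathbb T^d_N\to\mathbb R$, $\mathbb L_Ng(x/N)=\sum_{j=1}^dN^2\{\xi_{x,x+e_j}[g(\tfrac{x+e_j}N)-g(\tfrac xN)]+\xi_{x-e_j,x}[g(\tfrac{x-e_j}N)-g(\tfrac xN)]\}$, also written $\nabla^NA^N\nabla^N_Wg$. In the equation for $G_N^\lambda$, the right-hand side is evaluated at the points $x/N$. **Homogenized matrix $A$.** $H_{1,W}(\mathbb T^d)$ is the completion of $\mathbb D_W$ for the norm squared $\|f\|^2+\sum_j\|\partial_{W_j}f\|^2_{L^2_{x^j\otimes W_j}}$, with $\partial_{W_j}$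 extended by continuity. A function $v$ on $N^{-1}\mathbb T^d_N$ is identified with its interpolant $v^*$ on $\mathbb T^d$, which in each cell is, in each coordinate $x_k$ separately, affine in $W_k(x_k)$. $\partial^N_{W_j}v(x/N)=\frac{v((x+e_j)/N)-v(x/N)}{W((x+e_j)/N)-W(x/N)}$. For $\lambda>0$ and $f$ a bounded linear functional on $H_{1,W}(\mathbb T^d)$, the weak solution $u_N$ of $\lambda u_N-\nabla^NA^N\nabla^N_Wu_N=f$ is defined by $\frac{\lambda}{N^d}\sum_xu_Nv+\frac1{N^{d-1}}\sum_j\sum_xa^N_{jj}(x)\,\partial^N_{W_j}u_N\,\partial^N_{W_j}v\,[W((x+e_j)/N)-W(x/N)]=f(v^* )$ for all $v$ on $N^{-1}\mathbb T_N^d$; the weak solution $u_0\in H_{1,W}(\mathbb T^d)$ of $\lambda u_0-\nabla A\nabla_Wu_0=f$ is defined by $\lambda\int u_0v\,dx+\sum_j\int a_{jj}\partial_{W_j}u_0\,\partial_{W_j}v\,d(x^j\otimes W_j)=f(v)$ for all $v\in H_{1,W}(\mathbb T^d)$. The diagonal matrix $A=\mathrm{diag}(a_{11},\dots,a_{dd})$ is the homogenization of $A^N$ if, for every such $\lambda,f$, $u_N\to u_0$ weakly in $H_{1,W}(\mathbb T^d)$ and $a_j^N\partial^N_{W_j}u_N\to a_{jj}\partial_{W_j}u_0$ weakly in $L^2_{x^j\otimes W_j}(\mathbb T^d)$ (the left side being extended as constant on cells) for each $j$. It is taken as known (from earlier work) that $\mu$-a.s. $A^N$ has a homogenization $A$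 not depending on $\omega$, with constant positive diagonal entries; $A$ denotes this matrix, and $\nabla A\nabla_WG=\sum_ja_{jj}\partial_{x_j}\partial_{W_j}G$. *)

theory Defs
  imports "HOL-Probability.Probability"
begin

section \<open>Functions and measures on the torus\<close>

text \<open>Functions on \<open>(\<real>/\<int>)\<^sup>d\<close> are 1-periodic functions on \<open>real^'d\<close>, with \<open>d = CARD('d)\<close>. Measures on
  the torus live on the cell \<open>(0,1]\<^sup>d\<close>; left-open intervals are the ones on which
  \<open>interval_measure F\<close> is given by increments of \<open>F\<close>. Elements of an \<open>L\<^sup>2\<close> space are represented by
  functions, and equality of classes is equality almost everywhere.\<close>

definition periodic :: "(real^'d \<Rightarrow> real) \<Rightarrow> bool" where
  "periodic G \<longleftrightarrow> (\<forall>x k. G (x + axis k 1) = G x)"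

text \<open>Right-continuity in the closed positive orthant at each point, and a limit in each of the
  \<open>2\<^sup>d\<close> orthants (closed in the coordinates \<open>K\<close> approached from the right, open in the others).\<close>

definition cadlag :: "(real^'d \<Rightarrow> real) \<Rightarrow> bool" where
  "cadlag G \<longleftrightarrow> (\<forall>x.
     (G \<longlongrightarrow> G x) (at x within {y. \<forall>k. x $ k \<le> y $ k}) \<and>
     (\<forall>K. \<exists>l. (G \<longlongrightarrow> l) (at x within {y. \<forall>k. if k \<in> K then x $ k \<le> y $ k else y $ k < x $ k})))"

definition L2 :: "'a measure \<Rightarrow> ('a \<Rightarrow> real) set" where
  "L2 M = {f \<in> borel_measurable M. integrable M (\<lambda>x. (f x)\<^sup>2)}"

definition L2_norm :: "'a measure \<Rightarrow> ('a \<Rightarrow> real) \<Rightarrow> real" where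
  "L2_norm M f = sqrt (\<integral>x. (f x)\<^sup>2 \<partial>M)"

definition circle :: "real measure" where
  "circle = restrict_space lborel {0<..1}"

definition torus_measure :: "('d \<Rightarrow> real measure) \<Rightarrow> (real^'d) measure" where
  "torus_measure \<nu> =
     distr (PiM UNIV (\<lambda>k. restrict_space (\<nu> k) {0<..1})) borel (\<lambda>f. \<chi> k. f k)"

definition torus :: "(real^'d) measure" where
  "torus = torus_measure (\<lambda>_. lborel)"

text \<open>The measure \<open>d(x\<^sup>j \<otimes> W\<^sub>j)\<close>.\<close>

definition torus_W :: "('d \<Rightarrow> real \<Rightarrow> real) \<Rightarrow> 'd \<Rightarrow> (real^'d) measure" where
  "torus_W W j = torus_measure (\<lambda>k. if k = j then interval_measure (W j) else lborel)"


section \<open>The function \<open>W\<close> and the operators \<open>\<partial>\<^bsub>W\<^esub>\<close> and \<open>L\<^bsub>W\<^esub>\<close>\<close>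

text \<open>Left limits exist by monotonicity.\<close>

definition admissible_W :: "('d \<Rightarrow> real \<Rightarrow> real) \<Rightarrow> bool" where
  "admissible_W W \<longleftrightarrow> (\<forall>k. strict_mono (W k) \<and> (\<forall>u. continuous (at_right u) (W k)) \<and>
     (\<forall>u. W k (u + 1) - W k u = W k 1 - W k 0))"

definition W_sum :: "('d \<Rightarrow> real \<Rightarrow> real) \<Rightarrow> real^'d \<Rightarrow> real" where
  "W_sum W x = (\<Sum>k\<in>UNIV. W k (x $ k))"

definition dW :: "('d \<Rightarrow> real \<Rightarrow> real) \<Rightarrow> 'd \<Rightarrow> (real^'d \<Rightarrow> real) \<Rightarrow> real^'d \<Rightarrow> real" where
  "dW W k f x =
     Lim (at 0) (\<lambda>\<epsilon>. (f (x + \<epsilon> *\<^sub>R axis k 1) - f x) / (W k (x $ k + \<epsilon>) - W k (x $ k)))"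

text \<open>\<open>LW_graph V f g\<close>: the function \<open>f\<close> is in the domain of \<open>L\<^bsub>V\<^esub> = \<partial>\<^sub>x \<partial>\<^bsub>V\<^esub>\<close> on the circle
  and \<open>L\<^bsub>V\<^esub> f = g\<close>. Here \<open>f\<close> is determined pointwise and \<open>g\<close> up to null sets.\<close>

definition LW_graph :: "(real \<Rightarrow> real) \<Rightarrow> (real \<Rightarrow> real) \<Rightarrow> (real \<Rightarrow> real) \<Rightarrow> bool" where
  "LW_graph V f g \<longleftrightarrow> g \<in> L2 circle \<and> (\<integral>z. g z \<partial>circle) = 0 \<and> (\<forall>x. f (x + 1) = f x) \<and>
     (\<exists>a c.
       (LINT y:{0<..1}|interval_measure V. c + (LINT z:{0..y}|lborel. g z)) = 0 \<and>
       (\<forall>x\<in>{0..<1}. f x = a + c * V x +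
          (LINT y:{0<..x}|interval_measure V. (LINT z:{0..y}|lborel. g z))))"

definition slice :: "'d \<Rightarrow> real^'d \<Rightarrow> (real^'d \<Rightarrow> real) \<Rightarrow> real \<Rightarrow> real" where
  "slice k x G = (\<lambda>u. G (\<chi> i. if i = k then u else x $ i))"

text \<open>\<open>L\<^bsub>W\<^sub>k\<^esub> = \<partial>\<^bsub>x\<^sub>k\<^esub> \<partial>\<^bsub>W\<^sub>k\<^esub>\<close> acting in the \<open>k\<close>-th variable. Since \<open>L\<^bsub>W\<^sub>k\<^esub>\<close> determines the slices of the
  result only up to null sets, the cadlag representative is taken; it is unique by
  right-continuity. (At a jump of \<open>W\<^sub>k\<close> the two-sided derivative \<open>\<partial>\<^bsub>x\<^sub>k\<^esub>\<close> need not exist pointwise.)\<close>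

definition LW :: "('d \<Rightarrow> real \<Rightarrow> real) \<Rightarrow> 'd \<Rightarrow> (real^'d \<Rightarrow> real) \<Rightarrow> real^'d \<Rightarrow> real" where
  "LW W k G = (THE H. periodic H \<and> cadlag H \<and>
                      (\<forall>x. LW_graph (W k) (slice k x G) (slice k x H)))"


section \<open>Eigenfunctions and the space \<open>S\<^bsub>W\<^esub>\<close>\<close>

definition complete_orthonormal :: "'a measure \<Rightarrow> ('a \<Rightarrow> real) set \<Rightarrow> bool" where
  "complete_orthonormal M S \<longleftrightarrow> S \<subseteq> L2 M \<and>
     (\<forall>f\<in>S. \<forall>g\<in>S. (\<integral>x. f x * g x \<partial>M) = (if f = g then 1 else 0)) \<and>
     (\<forall>h\<in>L2 M. (\<forall>f\<in>S. (\<integral>x. f x * h x \<partial>M) = 0) \<longrightarrow> (AE x in M. h x = 0))"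

definition eigenbasis :: "(real \<Rightarrow> real) \<Rightarrow> (real \<Rightarrow> real) set \<Rightarrow> bool" where
  "eigenbasis V S \<longleftrightarrow> countable S \<and> complete_orthonormal circle S \<and>
     (\<forall>f\<in>S. \<exists>\<beta>. LW_graph V f (\<lambda>x. - \<beta> * f x))"

definition product_functions :: "('d \<Rightarrow> (real \<Rightarrow> real) set) \<Rightarrow> (real^'d \<Rightarrow> real) set" where
  "product_functions B = {\<lambda>x. \<Prod>k\<in>UNIV. f k (x $ k) | f. \<forall>k. f k \<in> B k}"

definition D_W :: "('d \<Rightarrow> (real \<Rightarrow> real) set) \<Rightarrow> (real^'d \<Rightarrow> real) set" where
  "D_W B = {\<lambda>x. \<Sum>f\<in>F. c f * f x | F c. finite F \<and> F \<subseteq> product_functions B}"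

text \<open>The enumeration starts at index 1, as the index enters the norms below.\<close>

definition eigen_enumeration ::
  "('d \<Rightarrow> real \<Rightarrow> real) \<Rightarrow> ('d \<Rightarrow> (real \<Rightarrow> real) set) \<Rightarrow> (nat \<Rightarrow> real^'d \<Rightarrow> real) \<Rightarrow> (nat \<Rightarrow> real) \<Rightarrow> bool"
where
  "eigen_enumeration W B \<phi> \<alpha> \<longleftrightarrow>
     bij_betw \<phi> {1..} (product_functions B) \<and>
     (\<forall>j\<ge>1. \<forall>x. - (\<Sum>k\<in>UNIV. LW W k (\<phi> j) x) = \<alpha> j * \<phi> j x) \<and>
     \<alpha> 1 = 0 \<and> mono_on {1..} \<alpha> \<and> filterlim \<alpha> at_top sequentially"

definition proj :: "(nat \<Rightarrow> real^'d \<Rightarrow> real) \<Rightarrow> nat \<Rightarrow> (real^'d \<Rightarrow> real) \<Rightarrow> real^'d \<Rightarrow> real" where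
  "proj \<phi> k f = (\<lambda>x. (\<integral>y. f y * \<phi> k y \<partial>torus) * \<phi> k x)"

definition S_norm ::
  "(nat \<Rightarrow> real^'d \<Rightarrow> real) \<Rightarrow> (nat \<Rightarrow> real) \<Rightarrow> nat \<Rightarrow> (real^'d \<Rightarrow> real) \<Rightarrow> real" where
  "S_norm \<phi> \<alpha> n f = sqrt (\<Sum>\<^sub>\<infinity>k\<in>{1..}.
     (L2_norm torus (proj \<phi> k f))\<^sup>2 * (1 + \<alpha> k) ^ (2 * n) * real k ^ (2 * n))"

text \<open>The completion of \<open>D_W B\<close>, realised in \<open>L\<^sup>2\<close> (the norms dominate the \<open>L\<^sup>2\<close> norm).\<close>

definition S_n ::
  "('d \<Rightarrow> (real \<Rightarrow> real) set) \<Rightarrow> (nat \<Rightarrow> real^'d \<Rightarrow> real) \<Rightarrow> (nat \<Rightarrow> real) \<Rightarrow> nat \<Rightarrow> (real^'d \<Rightarrow> real) set"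
where
  "S_n B \<phi> \<alpha> n = {f \<in> L2 torus. \<exists>h. (\<forall>m. h m \<in> D_W B) \<and>
     (\<forall>\<epsilon>>0. \<exists>m0. \<forall>m\<ge>m0. \<forall>m'\<ge>m0. S_norm \<phi> \<alpha> n (\<lambda>x. h m x - h m' x) < \<epsilon>) \<and>
     (\<lambda>m. L2_norm torus (\<lambda>x. h m x - f x)) \<longlonglongrightarrow> 0}"

text \<open>Each class is represented by its unique cadlag periodic representative.\<close>

definition S_W ::
  "('d \<Rightarrow> (real \<Rightarrow> real) set) \<Rightarrow> (nat \<Rightarrow> real^'d \<Rightarrow> real) \<Rightarrow> (nat \<Rightarrow> real) \<Rightarrow> (real^'d \<Rightarrow> real) set"
where
  "S_W B \<phi> \<alpha> = {G. periodic G \<and> cadlag G \<and> (\<forall>n. G \<in> S_n B \<phi> \<alpha> n)}"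


section \<open>The Sobolev space \<open>H\<^bsub>1,W\<^esub>\<close>\<close>

definition weak_gradient ::
  "('d \<Rightarrow> real \<Rightarrow> real) \<Rightarrow> ('d \<Rightarrow> (real \<Rightarrow> real) set) \<Rightarrow> (real^'d \<Rightarrow> real) \<Rightarrow> ('d \<Rightarrow> real^'d \<Rightarrow> real) \<Rightarrow> bool"
where
  "weak_gradient W B f g \<longleftrightarrow> f \<in> L2 torus \<and> (\<forall>j. g j \<in> L2 (torus_W W j)) \<and>
     (\<exists>h. (\<forall>m. h m \<in> D_W B) \<and>
       (\<lambda>m. L2_norm torus (\<lambda>x. h m x - f x)) \<longlonglongrightarrow> 0 \<and>
       (\<forall>j. (\<lambda>m. L2_norm (torus_W W j) (\<lambda>x. dW W j (h m) x - g j x)) \<longlonglongrightarrow> 0))"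

definition H1_W ::
  "('d \<Rightarrow> real \<Rightarrow> real) \<Rightarrow> ('d \<Rightarrow> (real \<Rightarrow> real) set) \<Rightarrow> (real^'d \<Rightarrow> real) set" where
  "H1_W W B = {f. \<exists>g. weak_gradient W B f g}"

text \<open>The extension of \<open>\<partial>\<^bsub>W\<^sub>j\<^esub>\<close> by continuity; the gradient is unique up to null sets because
  \<open>\<partial>\<^bsub>W\<^sub>j\<^esub>\<close> is closable.\<close>

definition weak_dW ::
  "('d \<Rightarrow> real \<Rightarrow> real) \<Rightarrow> ('d \<Rightarrow> (real \<Rightarrow> real) set) \<Rightarrow> 'd \<Rightarrow> (real^'d \<Rightarrow> real) \<Rightarrow> real^'d \<Rightarrow> real" where
  "weak_dW W B j f = (SOME g. weak_gradient W B f g) j"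

definition H1_norm ::
  "('d \<Rightarrow> real \<Rightarrow> real) \<Rightarrow> ('d \<Rightarrow> (real \<Rightarrow> real) set) \<Rightarrow> (real^'d \<Rightarrow> real) \<Rightarrow> real" where
  "H1_norm W B f = sqrt ((L2_norm torus f)\<^sup>2 +
     (\<Sum>j\<in>UNIV. (L2_norm (torus_W W j) (weak_dW W B j f))\<^sup>2))"

text \<open>Boundedness makes the functional respect equality almost everywhere.\<close>

definition bounded_functional ::
  "('d \<Rightarrow> real \<Rightarrow> real) \<Rightarrow> ('d \<Rightarrow> (real \<Rightarrow> real) set) \<Rightarrow> ((real^'d \<Rightarrow> real) \<Rightarrow> real) \<Rightarrow> bool" where
  "bounded_functional W B \<ll> \<longleftrightarrow>
     (\<forall>f\<in>H1_W W B. \<forall>g\<in>H1_W W B. \<ll> (\<lambda>x. f x + g x) = \<ll> f + \<ll> g) \<and>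
     (\<forall>f\<in>H1_W W B. \<forall>c. \<ll> (\<lambda>x. c * f x) = c * \<ll> f) \<and>
     (\<exists>C. \<forall>f\<in>H1_W W B. \<bar>\<ll> f\<bar> \<le> C * H1_norm W B f)"


section \<open>The discrete torus\<close>

text \<open>The set \<open>{0,\<dots>,N-1}\<^sup>d\<close>; sums modulo \<open>N\<close> are taken by applying \<open>wrap N\<close>. A function on
  \<open>N\<^sup>-\<^sup>1 \<T>\<^sub>N\<^sup>d\<close> is a function of the site \<open>x\<close>, its value being the one at the point \<open>x/N\<close>.\<close>

definition sites :: "nat \<Rightarrow> (int^'d) set" where
  "sites N = {x. \<forall>k. 0 \<le> x $ k \<and> x $ k < int N}"

definition wrap :: "nat \<Rightarrow> int^'d \<Rightarrow> int^'d" where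
  "wrap N x = (\<chi> k. x $ k mod int N)"

definition grid :: "nat \<Rightarrow> int^'d \<Rightarrow> real^'d" where
  "grid N x = (\<chi> k. real_of_int (x $ k) / real N)"

definition W_incr :: "('d \<Rightarrow> real \<Rightarrow> real) \<Rightarrow> nat \<Rightarrow> 'd \<Rightarrow> int^'d \<Rightarrow> real" where
  "W_incr W N j x = W_sum W (grid N (x + axis j 1)) - W_sum W (grid N x)"

definition discrete_dW :: "('d \<Rightarrow> real \<Rightarrow> real) \<Rightarrow> nat \<Rightarrow> 'd \<Rightarrow> (int^'d \<Rightarrow> real) \<Rightarrow> int^'d \<Rightarrow> real" where
  "discrete_dW W N j v x = (v (wrap N (x + axis j 1)) - v x) / W_incr W N j x"

text \<open>On the cell with lower corner \<open>y/N\<close>, \<open>y\<^sub>k = \<lfloor>N x\<^sub>k\<rfloor>\<close>, interpolation between the \<open>2\<^sup>d\<close> corners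
  (indexed by the set \<open>S\<close> of raised coordinates) with the weight of \<open>W\<^sub>k(x\<^sub>k)\<close> between the values of
  \<open>W\<^sub>k\<close> at \<open>y\<^sub>k/N\<close> and \<open>(y\<^sub>k+1)/N\<close>.\<close>

definition interp :: "('d \<Rightarrow> real \<Rightarrow> real) \<Rightarrow> nat \<Rightarrow> (int^'d \<Rightarrow> real) \<Rightarrow> real^'d \<Rightarrow> real" where
  "interp W N v x =
     (let y = (\<chi> k. \<lfloor>real N * x $ k\<rfloor>) :: int^'d;
          w = (\<lambda>k. (W k (x $ k) - W k (real_of_int (y $ k) / real N)) /
                   (W k (real_of_int (y $ k + 1) / real N) - W k (real_of_int (y $ k) / real N)))
      in \<Sum>S\<in>UNIV. (\<Prod>k\<in>UNIV. if k \<in> S then w k else 1 - w k) *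
                   v (wrap N (y + (\<chi> k. if k \<in> S then 1 else 0))))"

text \<open>Constant extension to the cells \<open>\<Prod>\<^sub>k (x\<^sub>k/N, (x\<^sub>k+1)/N]\<close>. They are left-open because \<open>W\<^sub>j\<close> may jump at
  grid points and \<open>W\<^sub>j((x\<^sub>j+1)/N) - W\<^sub>j(x\<^sub>j/N)\<close> is the mass of the left-open interval.\<close>

definition cell_extension :: "nat \<Rightarrow> (int^'d \<Rightarrow> real) \<Rightarrow> real^'d \<Rightarrow> real" where
  "cell_extension N v x = v (wrap N (\<chi> k. \<lceil>real N * x $ k\<rceil> - 1))"


section \<open>Homogenization\<close>

text \<open>A realization of the environment is given as \<open>\<aa> j x = a\<^sub>j(T\<^sub>x \<omega>)\<close>; a diagonal matrix is given by its
  diagonal \<open>A :: 'd \<Rightarrow> real\<close>.\<close>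

definition discrete_weak_solution ::
  "('d \<Rightarrow> real \<Rightarrow> real) \<Rightarrow> ('d \<Rightarrow> int^'d \<Rightarrow> real) \<Rightarrow> nat \<Rightarrow> real \<Rightarrow> ((real^'d \<Rightarrow> real) \<Rightarrow> real) \<Rightarrow>
    (int^'d \<Rightarrow> real) \<Rightarrow> bool" where
  "discrete_weak_solution W \<aa> N l \<ll> u \<longleftrightarrow> (\<forall>v.
     l / real N ^ CARD('d) * (\<Sum>x\<in>sites N. u x * v x) +
     1 / real N ^ (CARD('d) - 1) *
       (\<Sum>j\<in>UNIV. \<Sum>x\<in>sites N. \<aa> j x * discrete_dW W N j u x * discrete_dW W N j v x * W_incr W N j x)
     = \<ll> (interp W N v))"

definition weak_solution ::
  "('d \<Rightarrow> real \<Rightarrow> real) \<Rightarrow> ('d \<Rightarrow> (real \<Rightarrow> real) set) \<Rightarrow> ('d \<Rightarrow> real) \<Rightarrow> real \<Rightarrow>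
    ((real^'d \<Rightarrow> real) \<Rightarrow> real) \<Rightarrow> (real^'d \<Rightarrow> real) \<Rightarrow> bool" where
  "weak_solution W B A l \<ll> u \<longleftrightarrow> u \<in> H1_W W B \<and> (\<forall>v\<in>H1_W W B.
     l * (\<integral>x. u x * v x \<partial>torus) +
     (\<Sum>j\<in>UNIV. \<integral>x. A j * weak_dW W B j u x * weak_dW W B j v x \<partial>torus_W W j) = \<ll> v)"

definition homogenization ::
  "('d \<Rightarrow> real \<Rightarrow> real) \<Rightarrow> ('d \<Rightarrow> (real \<Rightarrow> real) set) \<Rightarrow> ('d \<Rightarrow> int^'d \<Rightarrow> real) \<Rightarrow> ('d \<Rightarrow> real) \<Rightarrow> bool"
where
  "homogenization W B \<aa> A \<longleftrightarrow> (\<forall>l>0. \<forall>\<ll>. bounded_functional W B \<ll> \<longrightarrow>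
     (\<forall>u u0. (\<forall>N\<ge>1. discrete_weak_solution W \<aa> N l \<ll> (u N)) \<and> weak_solution W B A l \<ll> u0 \<longrightarrow>
       (\<forall>m. bounded_functional W B m \<longrightarrow> (\<lambda>N. m (interp W N (u N))) \<longlonglongrightarrow> m u0) \<and>
       (\<forall>j. \<forall>h\<in>L2 (torus_W W j).
          (\<lambda>N. \<integral>x. cell_extension N (\<lambda>y. \<aa> j y * discrete_dW W N j (u N) y) x * h x \<partial>torus_W W j)
            \<longlonglongrightarrow> (\<integral>x. A j * weak_dW W B j u0 x * h x \<partial>torus_W W j))))"


section \<open>The random environment\<close>

definition standard_borel :: "'w measure \<Rightarrow> bool" where
  "standard_borel M \<longleftrightarrow> (\<exists>X. topspace X = space M \<and> completely_metrizable_space X \<and>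
     second_countable X \<and> sets M = sigma_sets (space M) {U. openin X U})"

text \<open>Both conventions (with or without completion of the sigma-algebra) are allowed.\<close>

definition standard_prob_space :: "'w measure \<Rightarrow> bool" where
  "standard_prob_space M \<longleftrightarrow> prob_space M \<and>
     (\<exists>M0. standard_borel M0 \<and> (M = M0 \<or> M = completion M0))"

definition ergodic_action :: "'w measure \<Rightarrow> (int^'d \<Rightarrow> 'w \<Rightarrow> 'w) \<Rightarrow> bool" where
  "ergodic_action M T \<longleftrightarrow>
     (\<forall>x. T x \<in> M \<rightarrow>\<^sub>M M \<and> distr M M (T x) = M) \<and>
     (\<forall>\<omega>\<in>space M. T 0 \<omega> = \<omega>) \<and>
     (\<forall>x y. \<forall>\<omega>\<in>space M. T x (T y \<omega>) = T (x + y) \<omega>) \<and>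
     (\<forall>E\<in>sets M. (\<forall>x. T x -` E \<inter> space M = E) \<longrightarrow> measure M E = 0 \<or> measure M E = 1)"

definition elliptic :: "'w measure \<Rightarrow> ('d \<Rightarrow> 'w \<Rightarrow> real) \<Rightarrow> bool" where
  "elliptic M a \<longleftrightarrow> (\<forall>j. a j \<in> borel_measurable M) \<and>
     (\<exists>\<theta>>0. \<forall>j. \<forall>\<omega>\<in>space M. inverse \<theta> \<le> a j \<omega> \<and> a j \<omega> \<le> \<theta>)"


section \<open>Markov processes on a finite state space\<close>

text \<open>The semigroup \<open>exp (t L)\<close>.\<close>

definition markov_semigroup :: "(('s \<Rightarrow> real) \<Rightarrow> 's \<Rightarrow> real) \<Rightarrow> real \<Rightarrow> ('s \<Rightarrow> real) \<Rightarrow> 's \<Rightarrow> real" where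
  "markov_semigroup L t f s = (\<Sum>n. t ^ n / fact n * (L ^^ n) f s)"

definition markov_process ::
  "'s set \<Rightarrow> (('s \<Rightarrow> real) \<Rightarrow> 's \<Rightarrow> real) \<Rightarrow> 's pmf \<Rightarrow> 'p measure \<Rightarrow> (real \<Rightarrow> 'p \<Rightarrow> 's) \<Rightarrow> bool" where
  "markov_process S L \<nu> P X \<longleftrightarrow> prob_space P \<and>
     (\<forall>t\<ge>0. X t \<in> P \<rightarrow>\<^sub>M count_space S) \<and>
     (\<forall>w\<in>space P. (\<forall>t\<ge>0. \<exists>\<epsilon>>0. \<forall>s\<in>{t..<t+\<epsilon>}. X s w = X t w) \<and>
                  (\<forall>t>0. \<exists>\<epsilon>\<in>{0<..t}. \<exists>c. \<forall>s\<in>{t-\<epsilon><..<t}. X s w = c)) \<and>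
     (\<forall>n t c. t 0 = 0 \<and> (\<forall>i<n. t i \<le> t (Suc i)) \<and> (\<forall>i\<le>n. c i \<in> S) \<longrightarrow>
        measure P {w \<in> space P. \<forall>i\<le>n. X (t i) w = c i} =
        pmf \<nu> (c 0) * (\<Prod>i<n. markov_semigroup L (t (Suc i) - t i) (indicator {c (Suc i)}) (c i)))"


section \<open>The exclusion process\<close>

text \<open>A configuration is the function telling which sites are occupied, \<open>False\<close> off the torus.\<close>

definition configs :: "nat \<Rightarrow> (int^'d \<Rightarrow> bool) set" where
  "configs N = PiE_dflt (sites N) False (\<lambda>_. UNIV)"

definition bernoulli_product :: "nat \<Rightarrow> real \<Rightarrow> (int^'d \<Rightarrow> bool) pmf" where
  "bernoulli_product N \<rho> = Pi_pmf (sites N) False (\<lambda>_. bernoulli_pmf \<rho>)"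

text \<open>\<open>conductance W \<aa> N j x\<close> is the conductance of the bond between \<open>x\<close> and \<open>x + e\<^sub>j\<close>.\<close>

definition conductance ::
  "('d \<Rightarrow> real \<Rightarrow> real) \<Rightarrow> ('d \<Rightarrow> int^'d \<Rightarrow> real) \<Rightarrow> nat \<Rightarrow> 'd \<Rightarrow> int^'d \<Rightarrow> real" where
  "conductance W \<aa> N j x = \<aa> j x / (real N * W_incr W N j x)"

definition exclusion_rate :: "real \<Rightarrow> nat \<Rightarrow> 'd \<Rightarrow> int^'d \<Rightarrow> (int^'d \<Rightarrow> bool) \<Rightarrow> real" where
  "exclusion_rate b N j x \<eta> =
     1 + b * (of_bool (\<eta> (wrap N (x - axis j 1))) + of_bool (\<eta> (wrap N (x + axis j 2))))"

definition swap_sites :: "int^'d \<Rightarrow> int^'d \<Rightarrow> (int^'d \<Rightarrow> bool) \<Rightarrow> (int^'d \<Rightarrow> bool)" where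
  "swap_sites x y \<eta> = \<eta>(x := \<eta> y, y := \<eta> x)"

definition exclusion_generator ::
  "('d \<Rightarrow> real \<Rightarrow> real) \<Rightarrow> ('d \<Rightarrow> int^'d \<Rightarrow> real) \<Rightarrow> real \<Rightarrow> nat \<Rightarrow> ((int^'d \<Rightarrow> bool) \<Rightarrow> real) \<Rightarrow> (int^'d \<Rightarrow> bool) \<Rightarrow> real"
where
  "exclusion_generator W \<aa> b N f \<eta> = (\<Sum>j\<in>UNIV. \<Sum>x\<in>sites N.
     conductance W \<aa> N j x * exclusion_rate b N j x \<eta> *
     (f (swap_sites x (wrap N (x + axis j 1)) \<eta>) - f \<eta>))"

definition exclusion_process ::
  "('d \<Rightarrow> real \<Rightarrow> real) \<Rightarrow> ('d \<Rightarrow> int^'d \<Rightarrow> real) \<Rightarrow> real \<Rightarrow> real \<Rightarrow> nat \<Rightarrow>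
    'p measure \<Rightarrow> (real \<Rightarrow> 'p \<Rightarrow> (int^'d \<Rightarrow> bool)) \<Rightarrow> bool" where
  "exclusion_process W \<aa> b \<rho> N P \<eta> \<longleftrightarrow>
     markov_process (configs N) (\<lambda>f \<eta>. (real N)\<^sup>2 * exclusion_generator W \<aa> b N f \<eta>)
       (bernoulli_product N \<rho>) P \<eta>"


section \<open>Density fluctuation fields\<close>

definition random_walk_generator ::
  "('d \<Rightarrow> real \<Rightarrow> real) \<Rightarrow> ('d \<Rightarrow> int^'d \<Rightarrow> real) \<Rightarrow> nat \<Rightarrow> (int^'d \<Rightarrow> real) \<Rightarrow> int^'d \<Rightarrow> real" where
  "random_walk_generator W \<aa> N g x = (\<Sum>j\<in>UNIV. (real N)\<^sup>2 *
     (conductance W \<aa> N j x * (g (wrap N (x + axis j 1)) - g x) +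
      conductance W \<aa> N j (wrap N (x - axis j 1)) * (g (wrap N (x - axis j 1)) - g x)))"

definition corrected_function ::
  "('d \<Rightarrow> real \<Rightarrow> real) \<Rightarrow> ('d \<Rightarrow> int^'d \<Rightarrow> real) \<Rightarrow> ('d \<Rightarrow> real) \<Rightarrow> real \<Rightarrow> nat \<Rightarrow>
    (real^'d \<Rightarrow> real) \<Rightarrow> int^'d \<Rightarrow> real" where
  "corrected_function W \<aa> A l N G = (THE g. g \<in> extensional (sites N) \<and>
     (\<forall>x\<in>sites N. l * g x - random_walk_generator W \<aa> N g x =
        l * G (grid N x) - (\<Sum>j\<in>UNIV. A j * LW W j G (grid N x))))"

definition fluctuation_field ::
  "nat \<Rightarrow> real \<Rightarrow> (int^'d \<Rightarrow> real) \<Rightarrow> (int^'d \<Rightarrow> bool) \<Rightarrow> real" where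
  "fluctuation_field N \<rho> g \<eta> =
     real N powr (- real CARD('d) / 2) * (\<Sum>x\<in>sites N. g x * (of_bool (\<eta> x) - \<rho>))"

definition density_field ::
  "nat \<Rightarrow> real \<Rightarrow> (real^'d \<Rightarrow> real) \<Rightarrow> (int^'d \<Rightarrow> bool) \<Rightarrow> real" where
  "density_field N \<rho> G = fluctuation_field N \<rho> (\<lambda>x. G (grid N x))"

definition corrected_density_field ::
  "('d \<Rightarrow> real \<Rightarrow> real) \<Rightarrow> ('d \<Rightarrow> int^'d \<Rightarrow> real) \<Rightarrow> ('d \<Rightarrow> real) \<Rightarrow> real \<Rightarrow> nat \<Rightarrow> real \<Rightarrow>
    (real^'d \<Rightarrow> real) \<Rightarrow> (int^'d \<Rightarrow> bool) \<Rightarrow> real" where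
  "corrected_density_field W \<aa> A l N \<rho> G = fluctuation_field N \<rho> (corrected_function W \<aa> A l N G)"

end

theory Submission
  imports Defs
begin

text \<open>By stationarity the expectation equals \<open>\<rho> (1 - \<rho>)\<close> times the normalized squared \<open>\<ell>\<^sup>2\<close> norm of
  \<open>G - G\<^sub>N\<close> on the grid. An element of \<open>S\<^bsub>W\<^esub>\<close> is a series of product eigenfunctions \<open>\<phi>\<close> that converges
  uniformly together with the series of \<open>\<lambda> G - \<nabla> A \<nabla>\<^bsub>W\<^esub> G\<close>, and the discrete resolvent is bounded by
  \<open>1/\<lambda>\<close>, so it suffices to treat \<open>G = \<phi>\<close>. For every \<open>m > 0\<close> the function \<open>\<phi>\<close> is itself the homogenized
  solution for the functional \<open>(m + \<gamma>) \<langle>\<phi>, \<cdot>\<rangle>\<close>, so homogenization yields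
  \<open>\<langle>\<phi>, (m - L\<^sub>N)\<^sup>-\<^sup>1 \<phi>\<rangle> \<rightarrow> 1/(m + \<gamma>)\<close> for all \<open>m > 0\<close>. In other words, the spectral measures of \<open>-L\<^sub>N\<close> at \<open>\<phi>\<close>
  converge to the unit mass at \<open>\<gamma>\<close>, which turns the weak convergence of \<open>G\<^sub>N\<close> into strong convergence.\<close>

section \<open>Square-integrable functions\<close>

text \<open>The jumps of \<open>W\<close> shape the estimates. A single increment of
  \<open>W\<close> over a grid cell need not tend to 0, so neither an eigenfunction nor an
  interpolant need be uniformly close to its values at the nodes; only the average of the increments
  over the grid is of order \<open>1/N\<close>. Errors are therefore measured in the mean and paid
  for with the Dirichlet form. This also reconciles two kinds of right-hand side: homogenization
  speaks of functionals applied to interpolants, while the corrected function solves an equation at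
  the nodes. Homogenization gives weak convergence only, which by itself does not control the norms.
  The missing information lies in the freedom of the resolvent parameter: by symmetry of the form,
  the pairings for two different parameters determine the scalar product of the two discrete
  solutions. Eigenfunctions are accessible only through the integral formula that defines the graph
  of the operator. Their \<open>W\<close>-derivative, called flux below, is continuous even where
  \<open>W\<close> jumps; this yields bounds linear in the eigenvalue, and the weights of the
  \<open>S_n\<close> norms absorb their products.\<close>

lemma L2_D:
  assumes "f \<in> L2 M"
  shows "f \<in> borel_measurable M" "integrable M (\<lambda>x. (f x)\<^sup>2)"
  using assms by (auto simp: L2_def)

lemma L2_mult_integrable:
  assumes "f \<in> L2 M" "g \<in> L2 M"
  shows "integrable M (\<lambda>x. f x * g x)"
proof (rule Bochner_Integration.integrable_bound)
  show "integrable M (\<lambda>x. (f x)\<^sup>2 + (g x)\<^sup>2)"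
    using assms by (auto simp: L2_def)
  show "(\<lambda>x. f x * g x) \<in> borel_measurable M"
    using assms by (auto simp: L2_def)
  have "\<bar>a * b\<bar> \<le> a\<^sup>2 + b\<^sup>2" for a b :: real
  proof -
    have "0 \<le> \<bar>a\<bar> * \<bar>b\<bar>" by simp
    moreover have "2 * (\<bar>a\<bar> * \<bar>b\<bar>) \<le> a\<^sup>2 + b\<^sup>2"
      using sum_squares_bound[of "\<bar>a\<bar>" "\<bar>b\<bar>"] by (simp add: mult.assoc)
    ultimately show ?thesis unfolding abs_mult by linarith
  qed
  then show "AE x in M. norm (f x * g x) \<le> norm ((f x)\<^sup>2 + (g x)\<^sup>2)" by simp
qed

lemma L2_add: "f \<in> L2 M \<Longrightarrow> g \<in> L2 M \<Longrightarrow> (\<lambda>x. f x + g x) \<in> L2 M"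
  using L2_mult_integrable[of f M g]
  by (auto simp: L2_def power2_sum mult.assoc)

lemma L2_scale: "f \<in> L2 M \<Longrightarrow> (\<lambda>x. c * f x) \<in> L2 M"
  by (auto simp: L2_def power_mult_distrib)

lemma L2_diff: "f \<in> L2 M \<Longrightarrow> g \<in> L2 M \<Longrightarrow> (\<lambda>x. f x - g x) \<in> L2 M"
  using L2_add[of f M "\<lambda>x. -1 * g x"] L2_scale[of g M "-1"] by simp

lemma L2_sum: "finite F \<Longrightarrow> (\<And>i. i \<in> F \<Longrightarrow> f i \<in> L2 M) \<Longrightarrow> (\<lambda>x. \<Sum>i\<in>F. f i x) \<in> L2 M"
proof (induction F rule: finite_induct)
  case empty
  then show ?case by (simp add: L2_def)
next
  case (insert i F)
  then have "(\<lambda>x. f i x + (\<Sum>i\<in>F. f i x)) \<in> L2 M" by (intro L2_add) auto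
  then show ?case unfolding sum.insert[OF insert.hyps(1,2)] .
qed

lemma (in finite_measure) L2_bounded:
  assumes "f \<in> borel_measurable M" "\<And>x. x \<in> space M \<Longrightarrow> \<bar>f x\<bar> \<le> C"
  shows "f \<in> L2 M"
proof -
  have "integrable M (\<lambda>x. (f x)\<^sup>2)"
  proof (rule integrable_const_bound[where B = "C\<^sup>2"])
    show "AE x in M. norm ((f x)\<^sup>2) \<le> C\<^sup>2"
    proof (rule AE_I2)
      fix x assume "x \<in> space M"
      then have "\<bar>f x\<bar>\<^sup>2 \<le> C\<^sup>2" using assms(2) by (intro power_mono) auto
      then show "norm ((f x)\<^sup>2) \<le> C\<^sup>2" by simp
    qed
  qed (use assms in measurable)
  then show ?thesis using assms by (simp add: L2_def)
qed

lemma (in finite_measure) L2_integrable: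
  assumes "f \<in> L2 M"
  shows "integrable M f"
proof -
  have "(\<lambda>x. 1) \<in> L2 M" by (rule L2_bounded[of _ 1]) auto
  from L2_mult_integrable[OF assms this] show ?thesis by simp
qed

lemma L2_Cauchy_Schwarz:
  assumes f: "f \<in> L2 M" and g: "g \<in> L2 M"
  shows "(\<integral>x. f x * g x \<partial>M)\<^sup>2 \<le> (\<integral>x. (f x)\<^sup>2 \<partial>M) * (\<integral>x. (g x)\<^sup>2 \<partial>M)"
proof -
  define p q r where "p = (\<integral>x. (f x)\<^sup>2 \<partial>M)" and "q = (\<integral>x. f x * g x \<partial>M)" and "r = (\<integral>x. (g x)\<^sup>2 \<partial>M)"
  note int = L2_D(2)[OF f] L2_D(2)[OF g] L2_mult_integrable[OF f g]
  have nonneg: "0 \<le> p + 2 * s * q + s\<^sup>2 * r" for s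
  proof -
    have "0 \<le> (\<integral>x. (f x + s * g x)\<^sup>2 \<partial>M)" by simp
    also have "(\<lambda>x. (f x + s * g x)\<^sup>2) = (\<lambda>x. (f x)\<^sup>2 + (2 * s) * (f x * g x) + s\<^sup>2 * (g x)\<^sup>2)"
      by (auto simp: power2_eq_square algebra_simps)
    also have "(\<integral>x. (f x)\<^sup>2 + (2 * s) * (f x * g x) + s\<^sup>2 * (g x)\<^sup>2 \<partial>M) = p + 2 * s * q + s\<^sup>2 * r"
      using int by (simp add: p_def q_def r_def)
    finally show ?thesis .
  qed
  have "q\<^sup>2 \<le> p * r"
  proof (cases "r = 0")
    case True
    have "q = 0"
    proof (rule ccontr)
      assume "q \<noteq> 0"
      \<comment> \<open>With \<open>r = 0\<close> the bound is affine in \<open>s\<close>; this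
        choice of \<open>s\<close> gives it the value \<open>-1\<close>.\<close>
      have "0 \<le> p + 2 * (- (p + 1) / (2 * q)) * q" using nonneg[of "- (p + 1) / (2 * q)"] True by simp
      with \<open>q \<noteq> 0\<close> show False by (simp add: field_simps)
    qed
    then show ?thesis using True by simp
  next
    case False
    moreover have "0 \<le> r" by (simp add: r_def)
    ultimately have "0 < r" by simp
    \<comment> \<open>\<open>s = - q / r\<close> minimizes the quadratic; the factor
      \<open>r\<close> clears the denominator.\<close>
    then have "0 \<le> (p + 2 * (- q / r) * q + (- q / r)\<^sup>2 * r) * r"
      using nonneg[of "- q / r"] by (intro mult_nonneg_nonneg) auto
    also have "\<dots> = p * r - q\<^sup>2" using \<open>0 < r\<close> by (simp add: field_simps power2_eq_square)
    finally show ?thesis by simp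
  qed
  then show ?thesis by (simp add: p_def q_def r_def)
qed

lemma L2_norm_square: "(L2_norm M f)\<^sup>2 = (\<integral>x. (f x)\<^sup>2 \<partial>M)"
  by (simp add: L2_norm_def)

lemma L2_norm_nonneg: "0 \<le> L2_norm M f"
  by (simp add: L2_norm_def)

lemma L2_inner_le:
  assumes "f \<in> L2 M" "g \<in> L2 M"
  shows "\<bar>\<integral>x. f x * g x \<partial>M\<bar> \<le> L2_norm M f * L2_norm M g"
proof (rule power2_le_imp_le)
  show "\<bar>\<integral>x. f x * g x \<partial>M\<bar>\<^sup>2 \<le> (L2_norm M f * L2_norm M g)\<^sup>2"
    using L2_Cauchy_Schwarz[OF assms] by (simp add: power_mult_distrib L2_norm_square)
qed (simp add: L2_norm_nonneg)

lemma L2_inner_tendsto: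
  assumes f: "\<And>n. f n \<in> L2 M" "g \<in> L2 M" "(\<lambda>n. L2_norm M (\<lambda>x. f n x - g x)) \<longlonglongrightarrow> 0"
    and h: "h \<in> L2 M"
  shows "(\<lambda>n. \<integral>x. f n x * h x \<partial>M) \<longlonglongrightarrow> (\<integral>x. g x * h x \<partial>M)"
proof -
  have "(\<lambda>n. (\<integral>x. f n x * h x \<partial>M) - (\<integral>x. g x * h x \<partial>M)) \<longlonglongrightarrow> 0"
  proof (rule Lim_null_comparison)
    show "\<forall>\<^sub>F n in sequentially. norm ((\<integral>x. f n x * h x \<partial>M) - (\<integral>x. g x * h x \<partial>M))
        \<le> L2_norm M (\<lambda>x. f n x - g x) * L2_norm M h"
    proof (intro always_eventually allI)
      fix n
      have "(\<integral>x. f n x * h x \<partial>M) - (\<integral>x. g x * h x \<partial>M) = (\<integral>x. (f n x - g x) * h x \<partial>M)"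
        using L2_mult_integrable[OF f(1)[of n] h] L2_mult_integrable[OF f(2) h]
        by (simp add: left_diff_distrib)
      then show "norm ((\<integral>x. f n x * h x \<partial>M) - (\<integral>x. g x * h x \<partial>M))
        \<le> L2_norm M (\<lambda>x. f n x - g x) * L2_norm M h"
        using L2_inner_le[OF L2_diff[OF f(1)[of n] f(2)] h] by simp
    qed
    show "(\<lambda>n. L2_norm M (\<lambda>x. f n x - g x) * L2_norm M h) \<longlonglongrightarrow> 0"
      using tendsto_mult_left_zero[OF f(3)] .
  qed
  then show ?thesis by (simp add: LIM_zero_iff)
qed

section \<open>Functions in the domain of the one-dimensional operator\<close>

lemma prob_space_circle: "prob_space circle"
  unfolding circle_def by (rule prob_space_restrict_space) auto

interpretation circle: prob_space circle by (rule prob_space_circle)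

lemma space_circle: "space circle = {0<..1}"
  by (simp add: circle_def space_restrict_space)

lemma sets_circle_borel: "f \<in> borel_measurable borel \<Longrightarrow> f \<in> borel_measurable circle"
  unfolding circle_def by (rule measurable_restrict_space1) simp

lemma AE_circle_neq: "AE z in circle. z \<noteq> y"
  unfolding circle_def
  by (subst AE_restrict_space_iff) (use AE_lborel_singleton[of y] in auto)

text \<open>Because \<open>circle\<close> lives on \<open>(0,1]\<close>, this is the integral over
  \<open>(0,y]\<close> for \<open>y\<close> in the unit interval, extended by constants outside it.
  Continuity and Borel measurability then hold on the whole line.\<close>

definition primitive :: "(real \<Rightarrow> real) \<Rightarrow> real \<Rightarrow> real" where
  "primitive g y = (\<integral>z. indicat_real {..y} z * g z \<partial>circle)"

lemma indicator_circle_integrable: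
  assumes "integrable circle g" "S \<in> sets borel"
  shows "integrable circle (\<lambda>z. indicat_real S z * g z)"
proof (rule Bochner_Integration.integrable_bound[OF assms(1)])
  have [measurable]: "g \<in> borel_measurable circle" using assms(1) by auto
  have [measurable]: "indicat_real S \<in> borel_measurable circle"
    using assms(2) by (intro sets_circle_borel) auto
  show "(\<lambda>z. indicat_real S z * g z) \<in> borel_measurable circle" by measurable
qed (auto simp: indicator_def)

lemma primitive_eq_LINT:
  assumes g: "integrable circle g" and "0 \<le> y" "y \<le> 1"
  shows "(LINT z:{0..y}|lborel. g z) = primitive g y"
proof -
  \<comment> \<open>\<open>g\<close> is known to be measurable on \<open>(0,1]\<close> only, so its
    value at 0, which the closed interval includes, is split off as a function supported on a null
    set.\<close>
  have eq: "indicator {0<..1::real} z *\<^sub>R (indicator {..y} z * g z) + g 0 * indicator {0} z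
      = indicator {0..y} z *\<^sub>R g z" for z
    using assms by (auto simp: indicator_def)
  have A: "integrable lborel (\<lambda>z. indicator {0<..1::real} z *\<^sub>R (indicator {..y} z * g z))"
    using indicator_circle_integrable[OF g, of "{..y}"] unfolding circle_def
    by (simp add: integrable_restrict_space)
  have B: "integrable lborel (\<lambda>z. g 0 * indicator {0::real} z)"
    by (intro integrable_mult_right integrable_real_indicator) auto
  have "(LINT z:{0..y}|lborel. g z) = (\<integral>z. indicator {0<..1::real} z *\<^sub>R (indicator {..y} z * g z) \<partial>lborel)
      + (\<integral>z. g 0 * indicator {0::real} z \<partial>lborel)"
    unfolding set_lebesgue_integral_def eq[symmetric] using A B by simp
  also have "\<dots> = primitive g y"
    unfolding primitive_def circle_def by (subst integral_restrict_space) auto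
  finally show ?thesis .
qed

lemma primitive_0: "y \<le> 0 \<Longrightarrow> primitive g y = 0"
proof -
  assume "y \<le> 0"
  then have "primitive g y = (\<integral>z. 0 \<partial>circle)"
    unfolding primitive_def
    by (intro Bochner_Integration.integral_cong) (auto simp: space_circle indicator_def)
  then show ?thesis by simp
qed

lemma primitive_1: "1 \<le> y \<Longrightarrow> primitive g y = (\<integral>z. g z \<partial>circle)"
  unfolding primitive_def
  by (intro Bochner_Integration.integral_cong) (auto simp: space_circle indicator_def)

lemma primitive_abs_le:
  assumes "integrable circle g"
  shows "\<bar>primitive g y\<bar> \<le> (\<integral>z. \<bar>g z\<bar> \<partial>circle)"
proof -
  have "\<bar>primitive g y\<bar> \<le> (\<integral>z. \<bar>indicat_real {..y} z * g z\<bar> \<partial>circle)"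
    unfolding primitive_def by (rule integral_abs_bound)
  also have "\<dots> \<le> (\<integral>z. \<bar>g z\<bar> \<partial>circle)"
    using assms indicator_circle_integrable[OF assms, of "{..y}"]
    by (intro integral_mono) (auto simp: indicator_def)
  finally show ?thesis .
qed

lemma primitive_cont:
  assumes g: "integrable circle g"
  shows "continuous_on UNIV (primitive g)"
proof -
  have "isCont (primitive g) y" for y
    unfolding continuous_at_sequentially o_def
  proof (intro allI impI)
    fix u assume u: "u \<longlonglongrightarrow> y"
    show "(\<lambda>n. primitive g (u n)) \<longlonglongrightarrow> primitive g y"
      unfolding primitive_def
    proof (rule integral_dominated_convergence[where w = "\<lambda>z. \<bar>g z\<bar>"])
      show "AE z in circle. (\<lambda>n. indicat_real {..u n} z * g z) \<longlonglongrightarrow> indicat_real {..y} z * g z"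
        using AE_circle_neq[of y]
      proof (eventually_elim)
        case (elim z)
        have "\<forall>\<^sub>F n in sequentially. indicat_real {..u n} z = indicat_real {..y} z"
        proof (cases "z < y")
          case True
          from order_tendstoD(1)[OF u this] show ?thesis
            by (rule eventually_mono) (use True in \<open>auto simp: indicator_def\<close>)
        next
          case False
          with elim have "y < z" by auto
          from order_tendstoD(2)[OF u this] show ?thesis
            by (rule eventually_mono) (use \<open>y < z\<close> in \<open>auto simp: indicator_def\<close>)
        qed
        then have "(\<lambda>n. indicat_real {..u n} z) \<longlonglongrightarrow> indicat_real {..y} z"
          by (rule tendsto_eventually)
        then show ?case by (rule tendsto_mult_right)
      qed
      show "integrable circle (\<lambda>z. \<bar>g z\<bar>)" using g by auto
      show "(\<lambda>z. indicat_real {..y} z * g z) \<in> borel_measurable circle"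
        "(\<lambda>z. indicat_real {..u n} z * g z) \<in> borel_measurable circle" for n
        using indicator_circle_integrable[OF g, of "{..y}"]
          indicator_circle_integrable[OF g, of "{..u n}"] by auto
    qed (auto simp: indicator_def)
  qed
  then show ?thesis by (simp add: continuous_on_eq_continuous_at)
qed

lemma primitive_add:
  assumes "integrable circle g" "integrable circle g'"
  shows "primitive (\<lambda>x. g x + g' x) y = primitive g y + primitive g' y"
  using indicator_circle_integrable[OF assms(1), of "{..y}"] indicator_circle_integrable[OF assms(2), of "{..y}"]
  by (simp add: primitive_def distrib_left)

lemma primitive_scale: "primitive (\<lambda>x. c * g x) y = c * primitive g y"
  by (simp add: primitive_def mult.left_commute)

lemma periodic_int:
  fixes f :: "real \<Rightarrow> real"
  assumes "\<And>x. f (x + 1) = f x"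
  shows "f (x + of_int n) = f x"
proof (induction n rule: int_induct[where k = 0])
  case (step1 i)
  then show ?case using assms[of "x + of_int i"] by (simp add: algebra_simps)
next
  case (step2 i)
  then show ?case using assms[of "x + of_int (i - 1)"] by (simp add: algebra_simps)
qed simp

lemma mono_left_limit:
  fixes F :: "real \<Rightarrow> real"
  assumes "\<And>x y. x \<le> y \<Longrightarrow> F x \<le> F y"
  shows "\<exists>l. (F \<longlongrightarrow> l) (at_left u)"
proof -
  have bdd: "bdd_above (F ` {..<u})" using assms by (intro bdd_aboveI2[of _ _ "F u"]) auto
  have "(F \<longlongrightarrow> (SUP x\<in>{..<u}. F x)) (at_left u)"
  proof (rule increasing_tendsto)
    show "\<forall>\<^sub>F x in at_left u. F x \<le> (SUP x\<in>{..<u}. F x)"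
      by (auto simp: eventually_at_filter intro!: always_eventually cSUP_upper bdd)
    fix a assume "a < (SUP x\<in>{..<u}. F x)"
    then obtain x where x: "x < u" "a < F x"
      using less_cSUP_iff[of "{..<u}" F a] bdd by (auto simp: ex_in_conv[symmetric] intro: lt_ex)
    have "\<forall>\<^sub>F y in at_left u. y > x" by (rule eventually_at_leftI[OF _ x(1)]) auto
    then show "\<forall>\<^sub>F y in at_left u. a < F y"
      by (rule eventually_mono) (use x(2) assms in \<open>meson less_le_trans less_imp_le\<close>)
  qed
  then show ?thesis ..
qed

text \<open>The mean of \<open>g\<close> vanishes and the single point \<open>y\<close> is null, so
  the part beyond \<open>y\<close> is minus the part before it. This is the inner integral of
  Fubini's theorem in the integration by parts.\<close>

lemma tail_integral:
  assumes g: "integrable circle g" and 0: "(\<integral>z. g z \<partial>circle) = 0"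
  shows "(\<integral>x. indicat_real {y..} x * g x \<partial>circle) = - primitive g y"
proof -
  have "(\<integral>x. indicat_real {y..} x * g x \<partial>circle) = (\<integral>x. g x - indicat_real {..y} x * g x \<partial>circle)"
  proof (rule integral_cong_AE)
    show "(\<lambda>x. indicat_real {y..} x * g x) \<in> borel_measurable circle"
      using indicator_circle_integrable[OF g, of "{y..}"] by auto
    show "(\<lambda>x. g x - indicat_real {..y} x * g x) \<in> borel_measurable circle"
      using indicator_circle_integrable[OF g, of "{..y}"] g by auto
    show "AE x in circle. indicat_real {y..} x * g x = g x - indicat_real {..y} x * g x"
      using AE_circle_neq[of y] by eventually_elim (auto simp: indicator_def)
  qed
  also have "\<dots> = - primitive g y"
    using indicator_circle_integrable[OF g, of "{..y}"] g 0 by (simp add: primitive_def)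
  finally show ?thesis .
qed

text \<open>A positive value of \<open>d\<close> at \<open>x\<close> would persist on an interval to
  the right of \<open>x\<close>, over which the primitive would then grow. The one-sided form
  suffices: applied to both differences of two candidates it yields equality.\<close>

lemma primitive_0_right_cont_le:
  assumes d: "integrable circle d" and 0: "\<And>y. y \<in> {0<..1} \<Longrightarrow> primitive d y = 0"
    and rc: "(d \<longlongrightarrow> d x) (at_right x)" and x: "0 \<le> x" "x < 1"
  shows "d x \<le> 0"
proof (rule ccontr)
  assume "\<not> d x \<le> 0"
  then have pos: "0 < d x" by simp
  then have "\<forall>\<^sub>F y in at_right x. d x / 2 < d y" by (intro order_tendstoD(1)[OF rc]) auto
  then obtain b where b: "x < b" "\<And>y. x < y \<Longrightarrow> y < b \<Longrightarrow> d x / 2 < d y"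
    unfolding eventually_at_right_field by blast
  \<comment> \<open>The midpoint keeps \<open>c\<close> strictly below \<open>b\<close>; the minimum
    keeps \<open>(x,c]\<close> inside the cell \<open>(0,1]\<close>.\<close>
  define c where "c = min 1 ((x + b) / 2)"
  have c: "x < c" "c \<le> 1" "c < b" using b(1) x by (auto simp: c_def min_def)
  have int: "integrable circle (\<lambda>z. indicat_real {x<..c} z * d z)"
    by (rule indicator_circle_integrable[OF d]) auto
  have "primitive d c - primitive d x = (\<integral>z. indicat_real {..c} z * d z - indicat_real {..x} z * d z \<partial>circle)"
    using indicator_circle_integrable[OF d, of "{..c}"] indicator_circle_integrable[OF d, of "{..x}"]
    by (simp add: primitive_def)
  also have "\<dots> = (\<integral>z. indicat_real {x<..c} z * d z \<partial>circle)"
    using c by (intro Bochner_Integration.integral_cong) (auto simp: indicator_def)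
  also have "\<dots> \<ge> (\<integral>z. d x / 2 * indicat_real {x<..c} z \<partial>circle)"
  proof (rule integral_mono[OF _ int])
    show "integrable circle (\<lambda>z. d x / 2 * indicat_real {x<..c} z)"
      using indicator_circle_integrable[of "\<lambda>_. d x / 2" "{x<..c}"] by (simp add: mult.commute)
    show "d x / 2 * indicat_real {x<..c} z \<le> indicat_real {x<..c} z * d z" for z
      using b(2)[of z] c by (auto simp: indicator_def less_imp_le)
  qed
  also have "(\<integral>z. d x / 2 * indicat_real {x<..c} z \<partial>circle) = d x / 2 * (c - x)"
  proof -
    have "{x<..c} \<inter> {0<..1} = {x<..c}" using c x by auto
    then have "measure circle {x<..c} = c - x"
      using c x unfolding circle_def by (subst measure_restrict_space) auto
    moreover have "{x<..c} \<inter> space circle = {x<..c}" using c x by (auto simp: space_circle)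
    ultimately show ?thesis by simp
  qed
  finally have "d x / 2 * (c - x) \<le> primitive d c - primitive d x" by simp
  moreover have "primitive d c = 0" using c x by (intro 0) auto
  moreover have "primitive d x = 0" using x 0[of x] primitive_0[of x d] by (cases "x = 0") auto
  moreover have "0 < d x / 2 * (c - x)" using pos c by simp
  ultimately show False by linarith
qed

text \<open>The conditions on \<open>W\<^sub>k\<close>, for a single coordinate.\<close>

locale gauge =
  fixes V :: "real \<Rightarrow> real"
  assumes strict_mono: "strict_mono V"
    and right_cont: "\<And>u. continuous (at_right u) V"
    and shift: "\<And>u. V (u + 1) - V u = V 1 - V 0"
begin

lemma mono: "x \<le> y \<Longrightarrow> V x \<le> V y"
  using strict_mono by (simp add: strict_mono_less_eq)

lemma less: "x < y \<Longrightarrow> V x < V y"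
  using strict_mono by (simp add: strict_mono_less)

abbreviation "mass \<equiv> V 1 - V 0"

lemma mass_pos: "0 < mass"
  using less[of 0 1] by simp

abbreviation "dV \<equiv> interval_measure V"

lemma emeasure_dV: "a \<le> b \<Longrightarrow> emeasure dV {a<..b} = ennreal (V b - V a)"
  by (rule emeasure_interval_measure_Ioc) (auto intro: mono right_cont)

lemma measure_dV: "a \<le> b \<Longrightarrow> measure dV {a<..b} = V b - V a"
  by (rule measure_interval_measure_Ioc) (auto intro: mono right_cont)

lemma dV_finite: "emeasure dV {a<..b} < \<infinity>"
  by (cases "a \<le> b") (auto simp: emeasure_dV)

lemma dV_set_integrable:
  fixes k :: "real \<Rightarrow> real"
  assumes k: "k \<in> borel_measurable borel" and "\<And>y. \<bar>k y\<bar> \<le> C"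
  shows "set_integrable dV {a<..b} k"
  unfolding set_integrable_def
proof (rule Bochner_Integration.integrable_bound)
  show "integrable dV (\<lambda>x. C * indicat_real {a<..b} x)"
    using dV_finite[of a b] by (intro integrable_mult_right integrable_real_indicator) auto
  show "(\<lambda>x. indicator {a<..b} x *\<^sub>R k x) \<in> borel_measurable dV"
    using k by measurable
qed (use assms(2) in \<open>auto simp: indicator_def intro: order_trans[OF _ abs_ge_self]\<close>)

lemma LINT_dV_const: "a \<le> b \<Longrightarrow> (LINT y:{a<..b}|dV. c) = c * (V b - V a)"
  using dV_finite[of a b] by (simp add: measure_dV set_lebesgue_integral_def)

lemma LINT_dV_bound:
  fixes k :: "real \<Rightarrow> real"
  assumes ab: "a \<le> b" and k: "set_integrable dV {a<..b} k" and C: "\<And>y. a < y \<Longrightarrow> y \<le> b \<Longrightarrow> \<bar>k y\<bar> \<le> C"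
  shows "\<bar>LINT y:{a<..b}|dV. k y\<bar> \<le> C * (V b - V a)"
proof -
  have "\<bar>LINT y:{a<..b}|dV. k y\<bar> \<le> (LINT y:{a<..b}|dV. \<bar>k y\<bar>)"
    using set_integral_norm_bound[OF k] by simp
  also have "\<dots> \<le> (LINT y:{a<..b}|dV. C)"
  proof (rule set_integral_mono)
    show "set_integrable dV {a<..b} (\<lambda>x. \<bar>k x\<bar>)" using set_integrable_abs[OF k] .
    show "set_integrable dV {a<..b} (\<lambda>x. C)" by (rule dV_set_integrable[of _ "\<bar>C\<bar>"]) auto
  qed (use C in auto)
  finally show ?thesis by (simp add: LINT_dV_const[OF ab])
qed

lemma LINT_dV_split:
  fixes k :: "real \<Rightarrow> real"
  assumes "a \<le> b" "b \<le> c" "set_integrable dV {a<..c} k"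
  shows "(LINT y:{a<..c}|dV. k y) = (LINT y:{a<..b}|dV. k y) + (LINT y:{b<..c}|dV. k y)"
proof -
  have "{a<..c} = {a<..b} \<union> {b<..c}" using assms by auto
  moreover have "set_integrable dV {a<..b} k" "set_integrable dV {b<..c} k"
    using assms by (auto intro: set_integrable_subset)
  ultimately show ?thesis by (simp add: set_integral_Un)
qed

abbreviation "circle_V \<equiv> restrict_space dV {0<..1::real}"

lemma finite_measure_circle_V: "finite_measure circle_V"
  by (rule finite_measureI) (use dV_finite[of 0 1] in \<open>simp add: emeasure_restrict_space space_restrict_space\<close>)

sublocale V: finite_measure circle_V by (rule finite_measure_circle_V)

lemma LINT_circle_V:
  fixes k :: "real \<Rightarrow> real"
  assumes "0 \<le> a" "b \<le> 1"
  shows "(LINT y:{a<..b}|dV. k y) = (\<integral>y. indicat_real {a<..b} y * k y \<partial>circle_V)"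
  unfolding set_lebesgue_integral_def using assms
  by (subst integral_restrict_space) (auto simp: indicator_def intro!: Bochner_Integration.integral_cong)

lemma borel_circle_V: "f \<in> borel_measurable borel \<Longrightarrow> f \<in> borel_measurable circle_V"
  by (rule measurable_restrict_space1) simp

text \<open>The function \<open>c + primitive g\<close> of \<open>LW_graph\<close>, with the
  constant \<open>c\<close> already determined by the vanishing integral against \<open>dV\<close>.
  It turns out to be the derivative of \<open>f\<close> with respect to \<open>V\<close>.\<close>

definition flux :: "(real \<Rightarrow> real) \<Rightarrow> real \<Rightarrow> real" where
  "flux g y = primitive g y - (LINT z:{0<..1}|dV. primitive g z) / mass"

lemma primitive_dV_integrable:
  "integrable circle g \<Longrightarrow> set_integrable dV {a<..b} (primitive g)"
  by (rule dV_set_integrable[OF borel_measurable_continuous_onI[OF primitive_cont] primitive_abs_le])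

lemma flux_cont: "integrable circle g \<Longrightarrow> continuous_on UNIV (flux g)"
  unfolding flux_def by (intro continuous_intros primitive_cont)

lemma flux_borel: "integrable circle g \<Longrightarrow> flux g \<in> borel_measurable borel"
  by (rule borel_measurable_continuous_onI[OF flux_cont])

lemma flux_abs_le:
  assumes g: "integrable circle g"
  shows "\<bar>flux g y\<bar> \<le> 2 * (\<integral>z. \<bar>g z\<bar> \<partial>circle)"
proof -
  have "\<bar>LINT z:{0<..1}|dV. primitive g z\<bar> \<le> (\<integral>z. \<bar>g z\<bar> \<partial>circle) * mass"
    by (rule LINT_dV_bound) (auto intro: primitive_dV_integrable primitive_abs_le g)
  then have "\<bar>(LINT z:{0<..1}|dV. primitive g z) / mass\<bar> \<le> (\<integral>z. \<bar>g z\<bar> \<partial>circle)"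
    using mass_pos by (simp add: field_simps)
  then show ?thesis using primitive_abs_le[OF g, of y] unfolding flux_def by linarith
qed

lemma flux_dV_integrable:
  "integrable circle g \<Longrightarrow> set_integrable dV {a<..b} (flux g)"
  by (rule dV_set_integrable[OF flux_borel flux_abs_le])

lemma flux_mean_0:
  assumes g: "integrable circle g"
  shows "(LINT z:{0<..1}|dV. flux g z) = 0"
proof -
  have "(LINT z:{0<..1}|dV. flux g z) = (LINT z:{0<..1}|dV. primitive g z) -
      (LINT z:{0<..1}|dV. (LINT z:{0<..1}|dV. primitive g z) / mass)"
    unfolding flux_def
    by (rule set_integral_diff(2)) (auto intro: primitive_dV_integrable g dV_set_integrable[OF _ order_refl])
  then show ?thesis using mass_pos by (simp add: LINT_dV_const)
qed

lemma flux_add: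
  assumes "integrable circle g" "integrable circle g'"
  shows "flux (\<lambda>x. g x + g' x) y = flux g y + flux g' y"
proof -
  have "(LINT z:{0<..1}|dV. primitive (\<lambda>x. g x + g' x) z) =
    (LINT z:{0<..1}|dV. primitive g z) + (LINT z:{0<..1}|dV. primitive g' z)"
    by (simp add: primitive_add assms set_integral_add(2) primitive_dV_integrable)
  then show ?thesis by (simp add: flux_def primitive_add assms add_divide_distrib)
qed

lemma flux_scale: "flux (\<lambda>x. c * g x) y = c * flux g y"
  by (simp add: flux_def primitive_scale algebra_simps)

text \<open>The vanishing integral forces \<open>c = - m / mass\<close>, where \<open>m\<close> is
  the \<open>dV\<close>-integral of the primitive, and the value at 0 fixes \<open>a\<close>. With
  both constants eliminated, the graph is described by one formula that is linear in the pair
  \<open>f\<close>, \<open>g\<close> and stable under limits.\<close>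

lemma LW_graph_iff:
  "LW_graph V f g \<longleftrightarrow> g \<in> L2 circle \<and> (\<integral>z. g z \<partial>circle) = 0 \<and> (\<forall>x. f (x + 1) = f x) \<and>
     (\<forall>x\<in>{0..<1}. f x = f 0 + (LINT y:{0<..x}|dV. flux g y))"
proof (cases "g \<in> L2 circle")
  case True
  then have g: "integrable circle g" by (rule circle.L2_integrable)
  define m where "m = (LINT z:{0<..1}|dV. primitive g z)"
  have const: "set_integrable dV {a<..b} (\<lambda>_. c)" for a b c :: real
    by (rule dV_set_integrable[of _ "\<bar>c\<bar>"]) auto
  have 1: "(LINT y:{0<..1}|dV. c + (LINT z:{0..y}|lborel. g z)) = c * mass + m" for c
  proof -
    have "(LINT y:{0<..1}|dV. c + (LINT z:{0..y}|lborel. g z)) = (LINT y:{0<..1}|dV. c + primitive g y)"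
      by (rule set_lebesgue_integral_cong) (auto simp: primitive_eq_LINT g)
    also have "\<dots> = c * mass + m"
      by (simp add: set_integral_add(2) const primitive_dV_integrable[OF g] m_def LINT_dV_const)
    finally show ?thesis .
  qed
  have 2: "(LINT y:{0<..x}|dV. (LINT z:{0..y}|lborel. g z)) = (LINT y:{0<..x}|dV. primitive g y)"
    if "0 \<le> x" "x < 1" for x
    by (rule set_lebesgue_integral_cong) (use that in \<open>auto simp: primitive_eq_LINT g\<close>)
  have 3: "(LINT y:{0<..x}|dV. flux g y) = (LINT y:{0<..x}|dV. primitive g y) - m / mass * (V x - V 0)"
    if "0 \<le> x" for x
    unfolding flux_def m_def[symmetric] using that
    by (simp add: set_integral_diff(2) const primitive_dV_integrable[OF g] LINT_dV_const)
  have "(\<exists>a c. c * mass + m = 0 \<and> (\<forall>x\<in>{0..<1}. f x = a + c * V x + (LINT y:{0<..x}|dV. primitive g y))) \<longleftrightarrow>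
    (\<forall>x\<in>{0..<1}. f x = f 0 + (LINT y:{0<..x}|dV. flux g y))" (is "?L \<longleftrightarrow> ?R")
  proof
    assume ?L
    then obtain a c where c: "c * mass + m = 0"
      and f: "\<And>x. x \<in> {0..<1} \<Longrightarrow> f x = a + c * V x + (LINT y:{0<..x}|dV. primitive g y)" by blast
    have "c = - m / mass" using c mass_pos by (simp add: field_simps)
    moreover have "f 0 = a + c * V 0" using f[of 0] by (simp add: set_lebesgue_integral_def)
    ultimately show ?R by (auto simp: f 3 algebra_simps diff_divide_distrib)
  next
    assume R: ?R
    show ?L
    proof (intro exI conjI ballI)
      show "(- m / mass) * mass + m = 0" using mass_pos by simp
      fix x :: real assume "x \<in> {0..<1}"
      then show "f x = (f 0 + m / mass * V 0) + (- m / mass) * V x + (LINT y:{0<..x}|dV. primitive g y)"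
        using R[rule_format, of x] by (simp add: 3 algebra_simps diff_divide_distrib)
    qed
  qed
  with True show ?thesis unfolding LW_graph_def 1 by (auto simp: 2)
qed (simp add: LW_graph_def)

context
  fixes f g :: "real \<Rightarrow> real"
  assumes graph: "LW_graph V f g"
begin

lemma LW_graph_L2: "g \<in> L2 circle" and LW_graph_mean: "(\<integral>z. g z \<partial>circle) = 0"
  and LW_graph_periodic: "f (x + 1) = f x"
  and LW_graph_integrable: "integrable circle g"
  using graph by (auto simp: LW_graph_iff intro: circle.L2_integrable)

lemma LW_graph_increment:
  assumes "0 \<le> x" "x \<le> y" "y \<le> 1"
  shows "f y - f x = (LINT z:{x<..y}|dV. flux g z)"
proof -
  have 0: "f y - f 0 = (LINT z:{0<..y}|dV. flux g z)" if "0 \<le> y" "y \<le> 1" for y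
  proof (cases "y = 1")
    \<comment> \<open>The formula in \<open>LW_graph_iff\<close> stops short of 1; there periodicity
      and the vanishing integral of the flux take over.\<close>
    case True
    then show ?thesis using LW_graph_periodic[of 0] flux_mean_0[OF LW_graph_integrable] by simp
  next
    case False
    with that have "y \<in> {0..<1}" by simp
    moreover have "\<forall>x\<in>{0..<1}. f x = f 0 + (LINT y:{0<..x}|dV. flux g y)"
      using graph unfolding LW_graph_iff by (elim conjE)
    ultimately have "f y = f 0 + (LINT z:{0<..y}|dV. flux g z)" by (rule bspec[rotated])
    then show ?thesis by linarith
  qed
  have "(LINT z:{0<..y}|dV. flux g z) = (LINT z:{0<..x}|dV. flux g z) + (LINT z:{x<..y}|dV. flux g z)"
    using assms by (intro LINT_dV_split flux_dV_integrable LW_graph_integrable) auto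
  then show ?thesis using 0[of x] 0[of y] assms by simp
qed

text \<open>As \<open>g\<close> has mean 0, its primitive vanishes at both ends, so the flux closes
  up to a continuous function on the circle.\<close>

lemma flux_ends: "flux g 0 = flux g 1"
  using LW_graph_mean by (simp add: flux_def primitive_0 primitive_1)

end

lemma shift_int: "V (x + of_int n) = V x + of_int n * mass"
proof (induction n rule: int_induct[where k = 0])
  case (step1 i)
  then show ?case using shift[of "x + of_int i"] by (simp add: algebra_simps)
next
  case (step2 i)
  then show ?case using shift[of "x + of_int (i - 1)"] by (simp add: algebra_simps)
qed simp

text \<open>Over whole periods \<open>f\<close> gains nothing while \<open>V\<close> increases, so
  it is enough to treat the two incomplete periods at the ends of the interval.\<close>

lemma periodic_le_V:
  assumes per: "\<And>x. f (x + 1) = f x" and C: "0 \<le> C"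
    and le: "\<And>x y. 0 \<le> x \<Longrightarrow> x \<le> y \<Longrightarrow> y \<le> 1 \<Longrightarrow> f y - f x \<le> C * (V y - V x)"
    and "x \<le> y"
  shows "f y - f x \<le> C * (V y - V x)"
proof -
  have unit: "f y - f x \<le> C * (V y - V x)" if "of_int n \<le> x" "x \<le> y" "y \<le> of_int n + 1" for x y and n :: int
  proof -
    have "f (y + of_int (-n)) - f (x + of_int (-n)) \<le> C * (V (y + of_int (-n)) - V (x + of_int (-n)))"
      using that by (intro le) auto
    then show ?thesis unfolding periodic_int[of f, OF per] shift_int by (simp add: algebra_simps)
  qed
  show ?thesis
  proof (cases "\<lfloor>x\<rfloor> = \<lfloor>y\<rfloor>")
    case True
    show ?thesis by (rule unit[of "\<lfloor>x\<rfloor>"]) (use assms True in linarith)+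
  next
    case False
    with \<open>x \<le> y\<close> have less: "\<lfloor>x\<rfloor> + 1 \<le> \<lfloor>y\<rfloor>" by (meson floor_mono nless_le zless_imp_add1_zle)
    have "f (of_int (\<lfloor>x\<rfloor> + 1)) - f x \<le> C * (V (of_int (\<lfloor>x\<rfloor> + 1)) - V x)"
      using floor_correct[of x] by (intro unit[of "\<lfloor>x\<rfloor>"]) (auto simp: less_imp_le)
    moreover have "f y - f (of_int \<lfloor>y\<rfloor>) \<le> C * (V y - V (of_int \<lfloor>y\<rfloor>))"
      using floor_correct[of y] by (intro unit[of "\<lfloor>y\<rfloor>"]) (auto simp: less_imp_le)
    moreover have "f (of_int \<lfloor>y\<rfloor>) = f (of_int (\<lfloor>x\<rfloor> + 1))"
      using periodic_int[of f 0, OF per] by (metis add_0)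
    moreover have "C * V (of_int (\<lfloor>x\<rfloor> + 1)) \<le> C * V (of_int \<lfloor>y\<rfloor>)"
      using less by (intro mult_left_mono mono C) (simp only: of_int_le_iff)
    ultimately show ?thesis unfolding right_diff_distrib by linarith
  qed
qed

text \<open>Increments of \<open>f\<close> are \<open>dV\<close>-integrals of the bounded flux.
  Since \<open>V\<close> may jump, regularity relative to \<open>V\<close> replaces continuity:
  measurability, one-sided limits and the oscillation of \<open>f\<close> over a grid cell all come
  from this estimate.\<close>

lemma LW_graph_Lipschitz:
  assumes graph: "LW_graph V f g"
  shows "\<bar>f y - f x\<bar> \<le> 2 * (\<integral>z. \<bar>g z\<bar> \<partial>circle) * \<bar>V y - V x\<bar>"
proof -
  define C where "C = 2 * (\<integral>z. \<bar>g z\<bar> \<partial>circle)"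
  have C: "0 \<le> C" by (simp add: C_def)
  note int = LW_graph_integrable[OF graph]
  have le: "\<bar>f y - f x\<bar> \<le> C * (V y - V x)" if "0 \<le> x" "x \<le> y" "y \<le> 1" for x y
    unfolding LW_graph_increment[OF graph that] C_def
    using flux_abs_le[OF int] that by (intro LINT_dV_bound flux_dV_integrable[OF int]) auto
  have wlog: "\<bar>f y - f x\<bar> \<le> C * (V y - V x)" if "x \<le> y" for x y
  proof -
    have "f y - f x \<le> C * (V y - V x)"
    proof (rule periodic_le_V[where f = f, OF LW_graph_periodic[OF graph] C _ that])
      show "f y - f x \<le> C * (V y - V x)" if "0 \<le> x" "x \<le> y" "y \<le> 1" for x y
        using le[OF that] by linarith
    qed
    moreover have "- f y - - f x \<le> C * (V y - V x)"
    proof (rule periodic_le_V[where f = "\<lambda>x. - f x", OF _ C _ that])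
      show "- f y - - f x \<le> C * (V y - V x)" if "0 \<le> x" "x \<le> y" "y \<le> 1" for x y
        using le[OF that] by linarith
    qed (simp add: LW_graph_periodic[OF graph])
    ultimately show ?thesis by (simp add: abs_le_iff)
  qed
  show ?thesis
  proof (cases "x \<le> y")
    case True
    then show ?thesis using wlog[OF True] mono[OF True] by (simp add: C_def)
  next
    case False
    then have "y \<le> x" by simp
    from wlog[OF this] mono[OF this] show ?thesis by (simp add: C_def abs_minus_commute)
  qed
qed

text \<open>\<open>f + C V\<close> is increasing, so \<open>f\<close> is a difference of monotone
  functions. The same decomposition gives the left limits below.\<close>

lemma Lipschitz_V_borel:
  assumes "\<And>x y. \<bar>f y - f x\<bar> \<le> C * \<bar>V y - V x\<bar>"
  shows "f \<in> borel_measurable borel"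
proof -
  have "mono (\<lambda>x. f x + C * V x)"
  proof (rule monoI)
    fix x y :: real assume "x \<le> y"
    then show "f x + C * V x \<le> f y + C * V y"
      using assms[of y x] mono[of x y] by (simp add: algebra_simps abs_le_iff)
  qed
  then have "(\<lambda>x. f x + C * V x) \<in> borel_measurable borel" by (rule borel_measurable_mono)
  moreover have "V \<in> borel_measurable borel" by (rule borel_measurable_mono) (auto intro: monoI mono)
  ultimately have "(\<lambda>x. (f x + C * V x) - C * V x) \<in> borel_measurable borel" by measurable
  then show ?thesis by simp
qed

lemma Lipschitz_V_left_limit:
  assumes "\<And>x y. \<bar>f y - f x\<bar> \<le> C * \<bar>V y - V x\<bar>"
  shows "\<exists>l. (f \<longlongrightarrow> l) (at_left u)"
proof -
  have "\<exists>l. ((\<lambda>x. f x + C * V x) \<longlongrightarrow> l) (at_left u)"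
  proof (rule mono_left_limit)
    fix x y :: real assume "x \<le> y"
    then show "f x + C * V x \<le> f y + C * V y"
      using assms[of y x] mono[of x y] by (simp add: algebra_simps abs_le_iff)
  qed
  moreover have "\<exists>l. (V \<longlongrightarrow> l) (at_left u)" by (rule mono_left_limit) (rule mono)
  ultimately obtain l l' where "((\<lambda>x. f x + C * V x) \<longlongrightarrow> l) (at_left u)" "(V \<longlongrightarrow> l') (at_left u)" by blast
  then have "((\<lambda>x. (f x + C * V x) - C * V x) \<longlongrightarrow> l - C * l') (at_left u)" by (intro tendsto_intros)
  then show ?thesis by auto
qed

lemma Lipschitz_V_right_cont:
  assumes "\<And>x y. \<bar>f y - f x\<bar> \<le> C * \<bar>V y - V x\<bar>"
  shows "(f \<longlongrightarrow> f u) (at_right u)"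
proof -
  have "((\<lambda>x. f x - f u) \<longlongrightarrow> 0) (at_right u)"
  proof (rule Lim_null_comparison)
    show "\<forall>\<^sub>F x in at_right u. norm (f x - f u) \<le> C * \<bar>V x - V u\<bar>"
      using assms[of _ u] by (auto intro!: always_eventually)
    have "(V \<longlongrightarrow> V u) (at_right u)" using right_cont[of u] by (simp add: continuous_within)
    then have "((\<lambda>x. C * \<bar>V x - V u\<bar>) \<longlongrightarrow> C * \<bar>V u - V u\<bar>) (at_right u)" by (intro tendsto_intros)
    then show "((\<lambda>x. C * \<bar>V x - V u\<bar>) \<longlongrightarrow> 0) (at_right u)" by simp
  qed
  then show ?thesis by (simp add: LIM_zero_iff)
qed

text \<open>\<open>V\<close> is strictly increasing, so averages against \<open>dV\<close> are well
  defined; \<open>k\<close> is continuous, so they are close to \<open>k x\<close> even when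
  \<open>x\<close> is an atom of \<open>dV\<close>.\<close>

lemma average_tendsto:
  fixes k :: "real \<Rightarrow> real"
  assumes k: "continuous_on UNIV k" "\<And>a b. set_integrable dV {a<..b} k" and "0 < \<epsilon>"
  obtains \<delta> where "0 < \<delta>"
    "\<And>a b. a < b \<Longrightarrow> x - \<delta> < a \<Longrightarrow> b < x + \<delta> \<Longrightarrow>
      \<bar>(LINT z:{a<..b}|dV. k z) / (V b - V a) - k x\<bar> \<le> \<epsilon>"
proof -
  have "isCont k x" using k(1) by (simp add: continuous_on_eq_continuous_at)
  with \<open>0 < \<epsilon>\<close> obtain \<delta> where \<delta>: "0 < \<delta>" "\<And>y. \<bar>y - x\<bar> < \<delta> \<Longrightarrow> \<bar>k y - k x\<bar> < \<epsilon>"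
    unfolding continuous_at_eps_delta by (auto simp: dist_real_def)
  show ?thesis
  proof (rule that[OF \<delta>(1)])
    fix a b assume ab: "a < b" "x - \<delta> < a" "b < x + \<delta>"
    have c: "set_integrable dV {a<..b} (\<lambda>_. k x)" by (rule dV_set_integrable[of _ "\<bar>k x\<bar>"]) auto
    have "(LINT z:{a<..b}|dV. k z) - k x * (V b - V a) = (LINT z:{a<..b}|dV. k z - k x)"
      using ab by (simp add: set_integral_diff(2)[OF k(2) c] LINT_dV_const)
    also have "\<bar>\<dots>\<bar> \<le> \<epsilon> * (V b - V a)"
      using ab by (intro LINT_dV_bound set_integral_diff(1)[OF k(2) c] less_imp_le[OF \<delta>(2)]) auto
    finally have "\<bar>(LINT z:{a<..b}|dV. k z) - k x * (V b - V a)\<bar> \<le> \<epsilon> * (V b - V a)" .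
    moreover have "(LINT z:{a<..b}|dV. k z) / (V b - V a) - k x = ((LINT z:{a<..b}|dV. k z) - k x * (V b - V a)) / (V b - V a)"
      using less[OF ab(1)] by (simp add: field_simps)
    ultimately show "\<bar>(LINT z:{a<..b}|dV. k z) / (V b - V a) - k x\<bar> \<le> \<epsilon>"
      using less[OF ab(1)] by (simp add: abs_divide field_simps)
  qed
qed

text \<open>At \<open>x = 1\<close> the difference quotient from the right is the one at \<open>0\<close>, and the flux takes the same
  value at both ends.\<close>

lemma LW_graph_derivative:
  assumes graph: "LW_graph V f g" and x: "0 < x" "x \<le> 1"
  shows "((\<lambda>\<epsilon>. (f (x + \<epsilon>) - f x) / (V (x + \<epsilon>) - V x)) \<longlongrightarrow> flux g x) (at 0)"
proof -
  note int = LW_graph_integrable[OF graph]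
  have avg: "\<exists>\<delta>>0. \<forall>a b. a < b \<longrightarrow> x - \<delta> < a \<longrightarrow> b < x + \<delta> \<longrightarrow>
      \<bar>(LINT z:{a<..b}|dV. flux g z) / (V b - V a) - flux g x\<bar> \<le> \<epsilon>" if "0 < \<epsilon>" for \<epsilon> x
    using average_tendsto[OF flux_cont[OF int] flux_dV_integrable[OF int] that, of x] by metis
  have left: "((\<lambda>\<epsilon>. (f (x + \<epsilon>) - f x) / (V (x + \<epsilon>) - V x)) \<longlongrightarrow> flux g x) (at_left 0)"
  proof (rule tendstoI)
    fix e :: real assume "0 < e"
    then obtain \<delta> where \<delta>: "0 < \<delta>" "\<And>a b. a < b \<Longrightarrow> x - \<delta> < a \<Longrightarrow> b < x + \<delta> \<Longrightarrow>
      \<bar>(LINT z:{a<..b}|dV. flux g z) / (V b - V a) - flux g x\<bar> \<le> e / 2"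
      using avg[of "e / 2" x] by auto
    have "dist ((f (x + h) - f x) / (V (x + h) - V x)) (flux g x) < e" if "- min \<delta> x < h" "h < 0" for h
    proof -
      have "(f (x + h) - f x) / (V (x + h) - V x) = (f x - f (x + h)) / (V x - V (x + h))"
        by (metis minus_diff_eq minus_divide_divide)
      also have "f x - f (x + h) = (LINT z:{x + h<..x}|dV. flux g z)"
        using that x by (intro LW_graph_increment[OF graph]) auto
      finally have eq: "(f (x + h) - f x) / (V (x + h) - V x) = (LINT z:{x + h<..x}|dV. flux g z) / (V x - V (x + h))" .
      have "\<bar>(LINT z:{x + h<..x}|dV. flux g z) / (V x - V (x + h)) - flux g x\<bar> \<le> e / 2"
        using that \<open>0 < \<delta>\<close> by (intro \<delta>(2)) auto
      with \<open>0 < e\<close> show ?thesis unfolding eq dist_real_def by linarith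
    qed
    moreover have "\<forall>\<^sub>F h in at_left (0::real). - min \<delta> x < h \<and> h < 0"
      using \<delta>(1) x by (intro eventually_at_leftI[of "- min \<delta> x"]) auto
    ultimately show "\<forall>\<^sub>F h in at_left 0. dist ((f (x + h) - f x) / (V (x + h) - V x)) (flux g x) < e"
      by (auto elim: eventually_mono)
  qed
  have right: "((\<lambda>\<epsilon>. (f (x + \<epsilon>) - f x) / (V (x + \<epsilon>) - V x)) \<longlongrightarrow> flux g x) (at_right 0)"
    if x: "0 \<le> x" "x < 1" for x
  proof (rule tendstoI)
    fix e :: real assume "0 < e"
    then obtain \<delta> where \<delta>: "0 < \<delta>" "\<And>a b. a < b \<Longrightarrow> x - \<delta> < a \<Longrightarrow> b < x + \<delta> \<Longrightarrow>
      \<bar>(LINT z:{a<..b}|dV. flux g z) / (V b - V a) - flux g x\<bar> \<le> e / 2"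
      using avg[of "e / 2" x] by auto
    have "dist ((f (x + h) - f x) / (V (x + h) - V x)) (flux g x) < e" if "0 < h" "h < min \<delta> (1 - x)" for h
    proof -
      have eq: "f (x + h) - f x = (LINT z:{x<..x + h}|dV. flux g z)"
        using that x by (intro LW_graph_increment[OF graph]) auto
      have "\<bar>(LINT z:{x<..x + h}|dV. flux g z) / (V (x + h) - V x) - flux g x\<bar> \<le> e / 2"
        using that \<open>0 < \<delta>\<close> by (intro \<delta>(2)) auto
      with \<open>0 < e\<close> show ?thesis unfolding eq dist_real_def by linarith
    qed
    moreover have "\<forall>\<^sub>F h in at_right (0::real). 0 < h \<and> h < min \<delta> (1 - x)"
      using \<delta>(1) x by (intro eventually_at_rightI[of 0 "min \<delta> (1 - x)"]) auto
    ultimately show "\<forall>\<^sub>F h in at_right 0. dist ((f (x + h) - f x) / (V (x + h) - V x)) (flux g x) < e"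
      by (auto elim: eventually_mono)
  qed
  have "((\<lambda>\<epsilon>. (f (x + \<epsilon>) - f x) / (V (x + \<epsilon>) - V x)) \<longlongrightarrow> flux g x) (at_right 0)"
  proof (cases "x = 1")
    case True
    have "f (1 + h) - f 1 = f (0 + h) - f 0" "V (1 + h) - V 1 = V (0 + h) - V 0" for h
      using LW_graph_periodic[OF graph, of h] LW_graph_periodic[OF graph, of 0] shift[of h]
      unfolding add.commute[of 1 h] add_0 by linarith+
    then show ?thesis using right[of 0] unfolding True flux_ends[OF graph, symmetric] by simp
  next
    case False
    then show ?thesis using x by (intro right) auto
  qed
  with left show ?thesis by (rule filterlim_split_at)
qed

end

section \<open>Integration by parts, eigenfunctions and closedness of the one-dimensional
  operator\<close>

lemma (in pair_sigma_finite) integrable_fst_finite: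
  fixes f :: "_ \<Rightarrow> real"
  assumes "finite_measure M2" "integrable M1 f"
  shows "integrable (M1 \<Otimes>\<^sub>M M2) (\<lambda>p. f (fst p))"
proof (rule Fubini_integrable)
  interpret M2: finite_measure M2 by fact
  show "(\<lambda>p. f (fst p)) \<in> borel_measurable (M1 \<Otimes>\<^sub>M M2)" using assms(2) by measurable
  show "integrable M1 (\<lambda>x. \<integral>y. norm (f (fst (x, y))) \<partial>M2)" using assms(2) by simp
  show "AE x in M1. integrable M2 (\<lambda>y. f (fst (x, y)))" by simp
qed

context gauge
begin

lemma integral_circle_V_flux:
  assumes "integrable circle g"
  shows "(\<integral>y. flux g y \<partial>circle_V) = 0"
proof -
  have "(\<integral>y. flux g y \<partial>circle_V) = (\<integral>y. indicat_real {0<..1} y * flux g y \<partial>circle_V)"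
    by (rule Bochner_Integration.integral_cong) (auto simp: space_restrict_space)
  then show ?thesis using LINT_circle_V[of 0 1 "flux g"] flux_mean_0[OF assms] by simp
qed

text \<open>Integration by parts, as Fubini's theorem for \<open>f x = f 0 + \<integral>\<^bsub>(0,x]\<^esub> flux g dV\<close>.\<close>

lemma LW_graph_parts:
  assumes fg: "LW_graph V f g" and fg': "LW_graph V f' g'"
  shows "(\<integral>x. f x * g' x \<partial>circle) = - (\<integral>y. flux g y * flux g' y \<partial>circle_V)"
proof -
  note int = LW_graph_integrable[OF fg] and int' = LW_graph_integrable[OF fg']
  interpret pair_sigma_finite circle circle_V ..
  define C where "C = 2 * (\<integral>z. \<bar>g z\<bar> \<partial>circle)"
  define F where "F x y = g' x * (indicat_real {..x} y * flux g y)" for x y :: real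
  have id1: "(\<lambda>x. x) \<in> borel_measurable circle" by (rule sets_circle_borel) auto
  have id2: "(\<lambda>x. x) \<in> borel_measurable circle_V" by (rule borel_circle_V) auto
  have F_int: "integrable (circle \<Otimes>\<^sub>M circle_V) (case_prod F)"
  proof (rule Bochner_Integration.integrable_bound)
    show "integrable (circle \<Otimes>\<^sub>M circle_V) (\<lambda>p. C * \<bar>g' (fst p)\<bar>)"
      using int' by (intro integrable_fst_finite[of "\<lambda>x. C * \<bar>g' x\<bar>"] V.finite_measure_axioms) auto
    have [measurable]: "g' \<in> borel_measurable circle" using int' by auto
    have [measurable]: "flux g \<in> borel_measurable circle_V" by (rule borel_circle_V[OF flux_borel[OF int]])
    have [measurable]: "fst \<in> borel_measurable (circle \<Otimes>\<^sub>M circle_V)" "snd \<in> borel_measurable (circle \<Otimes>\<^sub>M circle_V)"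
      using measurable_compose[OF measurable_fst id1] measurable_compose[OF measurable_snd id2] by auto
    have "case_prod F = (\<lambda>p. g' (fst p) * ((if snd p \<le> fst p then 1 else 0) * flux g (snd p)))"
      by (auto simp: F_def indicator_def fun_eq_iff)
    also have "\<dots> \<in> borel_measurable (circle \<Otimes>\<^sub>M circle_V)" by measurable
    finally show "case_prod F \<in> borel_measurable (circle \<Otimes>\<^sub>M circle_V)" .
    have "\<bar>F x y\<bar> \<le> \<bar>g' x\<bar> * C" for x y
      using flux_abs_le[OF int, of y]
      by (auto simp: F_def abs_mult indicator_def C_def intro!: mult_left_mono)
    then show "AE p in circle \<Otimes>\<^sub>M circle_V. norm (case_prod F p) \<le> norm (C * \<bar>g' (fst p)\<bar>)"
      by (auto intro!: AE_I2 order_trans[OF _ abs_ge_self] simp: mult.commute[of C])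
  qed
  have "(\<integral>x. f x * g' x \<partial>circle) = (\<integral>x. f 0 * g' x + (\<integral>y. F x y \<partial>circle_V) \<partial>circle)"
  proof (rule Bochner_Integration.integral_cong)
    fix x assume "x \<in> space circle"
    then have x: "0 \<le> x" "x \<le> 1" by (auto simp: space_circle)
    have "f x - f 0 = (\<integral>y. indicat_real {0<..x} y * flux g y \<partial>circle_V)"
      using LW_graph_increment[OF fg _ x] x by (simp add: LINT_circle_V)
    also have "\<dots> = (\<integral>y. indicat_real {..x} y * flux g y \<partial>circle_V)"
      by (rule Bochner_Integration.integral_cong) (auto simp: space_restrict_space indicator_def)
    finally have "f x = f 0 + (\<integral>y. indicat_real {..x} y * flux g y \<partial>circle_V)" by simp
    then show "f x * g' x = f 0 * g' x + (\<integral>y. F x y \<partial>circle_V)"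
      unfolding F_def by (simp add: algebra_simps)
  qed simp
  also have "\<dots> = (\<integral>x. (\<integral>y. F x y \<partial>circle_V) \<partial>circle)"
    using int' integrable_fst[OF F_int] LW_graph_mean[OF fg'] by simp
  also have "\<dots> = (\<integral>y. (\<integral>x. F x y \<partial>circle) \<partial>circle_V)"
    using Fubini_integral[OF F_int] by simp
  \<comment> \<open>The primitive of \<open>g'\<close> differs from its flux by a constant; paired
    with \<open>flux g\<close>, whose integral is 0, that constant disappears.\<close>
  also have "\<dots> = (\<integral>y. - (flux g y * flux g' y) - (LINT z:{0<..1}|dV. primitive g' z) / mass * flux g y \<partial>circle_V)"
  proof (rule Bochner_Integration.integral_cong)
    fix y
    have "(\<integral>x. F x y \<partial>circle) = (\<integral>x. flux g y * (indicat_real {y..} x * g' x) \<partial>circle)"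
      by (rule Bochner_Integration.integral_cong) (auto simp: F_def indicator_def)
    also have "\<dots> = flux g y * - primitive g' y"
      using tail_integral[OF int' LW_graph_mean[OF fg']] by simp
    finally show "(\<integral>x. F x y \<partial>circle) =
      - (flux g y * flux g' y) - (LINT z:{0<..1}|dV. primitive g' z) / mass * flux g y"
      by (simp add: flux_def[of g'] algebra_simps)
  qed simp
  also have "\<dots> = - (\<integral>y. flux g y * flux g' y \<partial>circle_V)"
  proof -
    have L2: "flux g \<in> L2 circle_V" "flux g' \<in> L2 circle_V"
      using V.L2_bounded[OF borel_circle_V[OF flux_borel[OF int]] flux_abs_le[OF int]]
        V.L2_bounded[OF borel_circle_V[OF flux_borel[OF int']] flux_abs_le[OF int']] by auto
    show ?thesis
      using L2_mult_integrable[OF L2] V.L2_integrable[OF L2(1)] integral_circle_V_flux[OF int] by simp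
  qed
  finally show ?thesis .
qed

lemma V_diff_le_mass:
  assumes "x \<in> {0..1}" "y \<in> {0..1}"
  shows "\<bar>V y - V x\<bar> \<le> mass"
  using mono[of 0 x] mono[of 0 y] mono[of x 1] mono[of y 1] assms by auto

text \<open>Integration by parts of \<open>f\<close> against itself makes \<open>\<beta>\<close> the
  squared norm of the flux. Normalization bounds the \<open>L1\<close> norm of \<open>f\<close> by
  1, which bounds the flux and the variation by multiples of \<open>\<beta>\<close>. Since the
  average of the absolute value is at most 1, adding the oscillation over a period bounds the
  supremum. The growth in \<open>\<beta>\<close> is linear, which the norms of \<open>S_W\<close>
  can compensate.\<close>

lemma eigenfunction_bounds:
  assumes graph: "LW_graph V f (\<lambda>x. - \<beta> * f x)" and f: "f \<in> L2 circle" "(\<integral>x. f x * f x \<partial>circle) = 1"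
  shows "0 \<le> \<beta>" and "\<bar>f x\<bar> \<le> 1 + 2 * \<beta> * mass" and "\<bar>f y - f x\<bar> \<le> 2 * \<beta> * \<bar>V y - V x\<bar>"
    and "\<bar>flux (\<lambda>x. - \<beta> * f x) y\<bar> \<le> 2 * \<beta>"
proof -
  have "- \<beta> = - (\<integral>y. (flux (\<lambda>x. - \<beta> * f x) y)\<^sup>2 \<partial>circle_V)"
    using LW_graph_parts[OF graph graph] f(2)
    by (simp add: power2_eq_square mult.left_commute)
  moreover have "0 \<le> (\<integral>y. (flux (\<lambda>x. - \<beta> * f x) y)\<^sup>2 \<partial>circle_V)" by simp
  ultimately show \<beta>: "0 \<le> \<beta>" by simp
  have f_int: "integrable circle (\<lambda>x. \<bar>f x\<bar>)" using circle.L2_integrable[OF f(1)] by simp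
  have "(\<integral>x. \<bar>f x\<bar> \<partial>circle) \<le> (\<integral>x. (1 + f x * f x) / 2 \<partial>circle)"
  proof (rule integral_mono[OF f_int])
    show "integrable circle (\<lambda>x. (1 + f x * f x) / 2)" using L2_mult_integrable[OF f(1) f(1)] by simp
    show "\<bar>f x\<bar> \<le> (1 + f x * f x) / 2" for x
      using sum_squares_bound[of 1 "\<bar>f x\<bar>"] by (simp add: power2_eq_square)
  qed
  also have "\<dots> = 1" using L2_mult_integrable[OF f(1) f(1)] f(2) by (simp add: circle.prob_space)
  finally have L1: "(\<integral>x. \<bar>f x\<bar> \<partial>circle) \<le> 1" .
  have "(\<integral>z. \<bar>- \<beta> * f z\<bar> \<partial>circle) = \<beta> * (\<integral>x. \<bar>f x\<bar> \<partial>circle)" using \<beta> by (simp add: abs_mult)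
  also have "\<dots> \<le> \<beta> * 1" using L1 \<beta> by (intro mult_left_mono)
  finally have C: "2 * (\<integral>z. \<bar>- \<beta> * f z\<bar> \<partial>circle) \<le> 2 * \<beta>" by simp
  show Lip: "\<bar>f y - f x\<bar> \<le> 2 * \<beta> * \<bar>V y - V x\<bar>" for x y
    using LW_graph_Lipschitz[OF graph, of y x] mult_right_mono[OF C, of "\<bar>V y - V x\<bar>"] by simp
  show "\<bar>flux (\<lambda>x. - \<beta> * f x) y\<bar> \<le> 2 * \<beta>"
    using flux_abs_le[OF LW_graph_integrable[OF graph], of y] C by linarith
  have bound: "\<bar>f x\<bar> \<le> \<bar>f y\<bar> + 2 * \<beta> * mass" if "x \<in> {0..1}" "y \<in> {0..1}" for x y
  proof -
    have "2 * \<beta> * \<bar>V y - V x\<bar> \<le> 2 * \<beta> * mass"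
      using V_diff_le_mass[OF that] \<beta> by (intro mult_left_mono) auto
    then show ?thesis using Lip[of y x] by linarith
  qed
  have unit: "\<bar>f x\<bar> \<le> 1 + 2 * \<beta> * mass" if "x \<in> {0..1}" for x
  proof -
    have "(\<integral>y. \<bar>f x\<bar> \<partial>circle) \<le> (\<integral>y. \<bar>f y\<bar> + 2 * \<beta> * mass \<partial>circle)"
      by (rule integral_mono) (use f_int bound that in \<open>auto simp: space_circle\<close>)
    then show ?thesis using L1 f_int by (simp add: circle.prob_space)
  qed
  have "f x = f (frac x)"
    using periodic_int[of f "frac x" "\<lfloor>x\<rfloor>", OF LW_graph_periodic[OF graph]] by (simp add: frac_def)
  then show "\<bar>f x\<bar> \<le> 1 + 2 * \<beta> * mass"
    using unit[of "frac x"] frac_lt_1[of x] by (simp add: less_imp_le)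
qed

text \<open>The flux is the derivative of \<open>f\<close>, so it is determined by \<open>f\<close>; and \<open>g\<close> is the derivative of the flux.\<close>

lemma LW_graph_unique:
  assumes g: "LW_graph V f g" and g': "LW_graph V f g'"
    and rc: "\<And>x. (g \<longlongrightarrow> g x) (at_right x)" "\<And>x. (g' \<longlongrightarrow> g' x) (at_right x)"
    and x: "0 \<le> x" "x < 1"
  shows "g x = g' x"
proof -
  note int = LW_graph_integrable[OF g] and int' = LW_graph_integrable[OF g']
  have flux: "flux g y = flux g' y" if "y \<in> {0<..1}" for y
    using LW_graph_derivative[OF g, of y] LW_graph_derivative[OF g', of y] that
    by (intro tendsto_unique[OF trivial_limit_at]) auto
  define m where "m = (LINT z:{0<..1}|dV. primitive g z) / mass - (LINT z:{0<..1}|dV. primitive g' z) / mass"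
  have m: "primitive g y - primitive g' y = m" if "y \<in> {0<..1}" for y
    using flux[OF that] by (simp add: flux_def m_def)
  have "m = 0" using m[of 1] LW_graph_mean[OF g] LW_graph_mean[OF g'] by (simp add: primitive_1)
  then have eq: "primitive g y = primitive g' y" if "y \<in> {0<..1}" for y using m[OF that] by simp
  have neg: "primitive (\<lambda>x. - h x) y = - primitive h y" for h y
    using primitive_scale[of "-1" h y] by simp
  have "g x - g' x \<le> 0"
  proof (rule primitive_0_right_cont_le[OF _ _ tendsto_diff[OF rc] x])
    show "integrable circle (\<lambda>x. g x - g' x)" using int int' by simp
    show "primitive (\<lambda>x. g x - g' x) y = 0" if "y \<in> {0<..1}" for y
      using primitive_add[of g "\<lambda>x. - g' x" y] int int' eq[OF that] by (simp add: neg)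
  qed
  moreover have "g' x - g x \<le> 0"
  proof (rule primitive_0_right_cont_le[OF _ _ tendsto_diff[OF rc(2) rc(1)] x])
    show "integrable circle (\<lambda>x. g' x - g x)" using int int' by simp
    show "primitive (\<lambda>x. g' x - g x) y = 0" if "y \<in> {0<..1}" for y
      using primitive_add[of g' "\<lambda>x. - g x" y] int int' eq[OF that] by (simp add: neg)
  qed
  ultimately show ?thesis by simp
qed

lemma LW_graphI:
  assumes "g \<in> L2 circle" "(\<integral>z. g z \<partial>circle) = 0" "\<And>x. f (x + 1) = f x"
    "\<forall>x\<in>{0..<1}. f x = f 0 + (LINT y:{0<..x}|dV. flux g y)"
  shows "LW_graph V f g"
  unfolding LW_graph_iff using assms by (intro conjI allI)

lemma LW_graph_0: "LW_graph V (\<lambda>_. 0) (\<lambda>_. 0)"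
  by (simp add: LW_graph_iff L2_def flux_def primitive_def set_lebesgue_integral_def)

lemma LW_graph_scale:
  assumes "LW_graph V f g"
  shows "LW_graph V (\<lambda>x. c * f x) (\<lambda>x. c * g x)"
proof -
  have eq: "(LINT y:{0<..x}|dV. flux (\<lambda>x. c * g x) y) = c * (LINT y:{0<..x}|dV. flux g y)" for x
    unfolding flux_scale by (rule set_integral_mult_right)
  have int: "\<forall>x\<in>{0..<1}. c * f x = c * f 0 + (LINT y:{0<..x}|dV. flux (\<lambda>x. c * g x) y)"
  proof
    fix x :: real assume "x \<in> {0..<1}"
    then have "f x - f 0 = (LINT y:{0<..x}|dV. flux g y)" by (intro LW_graph_increment[OF assms]) auto
    then show "c * f x = c * f 0 + (LINT y:{0<..x}|dV. flux (\<lambda>x. c * g x) y)"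
      unfolding eq by (metis add_diff_cancel_left' diff_add_cancel distrib_left add.commute)
  qed
  show ?thesis
    by (rule LW_graphI[OF L2_scale[OF LW_graph_L2[OF assms]] _ _ int])
      (simp_all add: LW_graph_mean[OF assms] LW_graph_periodic[OF assms])
qed

lemma LW_graph_add:
  assumes fg: "LW_graph V f g" and fg': "LW_graph V f' g'"
  shows "LW_graph V (\<lambda>x. f x + f' x) (\<lambda>x. g x + g' x)"
proof -
  note int = LW_graph_integrable[OF fg] and int' = LW_graph_integrable[OF fg']
  have eq: "(LINT y:{0<..x}|dV. flux (\<lambda>x. g x + g' x) y) =
      (LINT y:{0<..x}|dV. flux g y) + (LINT y:{0<..x}|dV. flux g' y)" for x
    unfolding flux_add[OF int int']
    by (rule set_integral_add(2)[OF flux_dV_integrable[OF int] flux_dV_integrable[OF int']])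
  have incr: "\<forall>x\<in>{0..<1}. f x + f' x = f 0 + f' 0 + (LINT y:{0<..x}|dV. flux (\<lambda>x. g x + g' x) y)"
  proof
    fix x :: real assume x: "x \<in> {0..<1}"
    have "f x - f 0 = (LINT y:{0<..x}|dV. flux g y)" "f' x - f' 0 = (LINT y:{0<..x}|dV. flux g' y)"
      by (rule LW_graph_increment[OF fg] LW_graph_increment[OF fg'], use x in auto)+
    then show "f x + f' x = f 0 + f' 0 + (LINT y:{0<..x}|dV. flux (\<lambda>x. g x + g' x) y)"
      unfolding eq by linarith
  qed
  show ?thesis
    by (rule LW_graphI[OF L2_add[OF LW_graph_L2[OF fg] LW_graph_L2[OF fg']] _ _ incr])
      (simp_all add: LW_graph_mean[OF fg] LW_graph_periodic[OF fg]
        LW_graph_mean[OF fg'] LW_graph_periodic[OF fg'] int int')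
qed

lemma LW_graph_sum:
  assumes "finite K" "\<And>k. k \<in> K \<Longrightarrow> LW_graph V (f k) (g k)"
  shows "LW_graph V (\<lambda>x. \<Sum>k\<in>K. f k x) (\<lambda>x. \<Sum>k\<in>K. g k x)"
  using assms by (induction K rule: finite_induct) (auto intro: LW_graph_0 LW_graph_add)

text \<open>Dominated convergence passes successively through the primitive, the flux and its
  \<open>dV\<close>-integral, each time with a multiple of \<open>C\<close> as majorant on a bounded
  interval. This is what allows the operator to be applied to a series term by term.\<close>

lemma LW_graph_limit:
  assumes graph: "\<And>n. LW_graph V (f n) (g n)"
    and f: "\<And>x. (\<lambda>n. f n x) \<longlonglongrightarrow> F x" and g: "\<And>x. (\<lambda>n. g n x) \<longlonglongrightarrow> G x"
    and C: "\<And>n x. \<bar>g n x\<bar> \<le> C"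
  shows "LW_graph V F G"
proof -
  note int = LW_graph_integrable[OF graph]
  have meas_g: "g n \<in> borel_measurable circle" for n using int by auto
  have meas_G: "G \<in> borel_measurable circle"
    by (rule borel_measurable_LIMSEQ_real[OF _ meas_g]) (rule g)
  have C_G: "\<bar>G x\<bar> \<le> C" for x
    using tendsto_rabs[OF g[of x]] by (rule LIMSEQ_le_const2) (use C in auto)
  have L2: "G \<in> L2 circle" by (rule circle.L2_bounded[OF meas_G C_G])
  have int_G: "integrable circle G" by (rule circle.L2_integrable[OF L2])
  have ind_lim: "(\<lambda>n. \<integral>z. indicat_real S z * g n z \<partial>circle) \<longlonglongrightarrow> (\<integral>z. indicat_real S z * G z \<partial>circle)"
    if "S \<in> sets borel" for S
  proof (rule integral_dominated_convergence[where w = "\<lambda>_. \<bar>C\<bar>"])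
    show "AE x in circle. (\<lambda>n. indicat_real S x * g n x) \<longlonglongrightarrow> indicat_real S x * G x"
      by (intro AE_I2 tendsto_intros g)
    show "AE x in circle. norm (indicat_real S x * g n x) \<le> \<bar>C\<bar>" for n
      using C[of n] by (auto simp: indicator_def intro: order_trans[OF _ abs_ge_self])
  qed (use indicator_circle_integrable[OF int that] indicator_circle_integrable[OF int_G that] in auto)
  have prim: "(\<lambda>n. primitive (g n) y) \<longlonglongrightarrow> primitive G y" for y
    unfolding primitive_def by (rule ind_lim) auto
  have C_int: "(\<integral>z. \<bar>g n z\<bar> \<partial>circle) \<le> C" for n
  proof -
    have "(\<integral>z. \<bar>g n z\<bar> \<partial>circle) \<le> (\<integral>z. C \<partial>circle)"
      using int[of n] C by (intro integral_mono) auto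
    then show ?thesis by (simp add: circle.prob_space)
  qed
  have LINT_lim: "(\<lambda>n. LINT y:{a<..b}|dV. k n y) \<longlonglongrightarrow> (LINT y:{a<..b}|dV. K y)"
    if k: "\<And>n. k n \<in> borel_measurable borel" "K \<in> borel_measurable borel" "\<And>n y. \<bar>k n y\<bar> \<le> C'"
      "\<And>y. (\<lambda>n. k n y) \<longlonglongrightarrow> K y" for k :: "nat \<Rightarrow> real \<Rightarrow> real" and K a b C'
    unfolding set_lebesgue_integral_def
  proof (rule integral_dominated_convergence[where w = "\<lambda>y. C' * indicat_real {a<..b} y"])
    show "integrable dV (\<lambda>y. C' * indicat_real {a<..b} y)"
      using dV_finite[of a b] by (intro integrable_mult_right integrable_real_indicator) auto
    show "(\<lambda>x. indicat_real {a<..b} x *\<^sub>R K x) \<in> borel_measurable dV"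
      "(\<lambda>x. indicat_real {a<..b} x *\<^sub>R k n x) \<in> borel_measurable dV" for n
      using k(1)[of n] k(2) by measurable
    show "AE x in dV. (\<lambda>n. indicat_real {a<..b} x *\<^sub>R k n x) \<longlonglongrightarrow> indicat_real {a<..b} x *\<^sub>R K x"
      by (intro AE_I2 tendsto_intros k(4))
    show "AE x in dV. norm (indicat_real {a<..b} x *\<^sub>R k n x) \<le> C' * indicat_real {a<..b} x" for n
      using k(3)[of n] by (auto simp: indicator_def)
  qed
  have prim_C: "\<bar>primitive (g n) y\<bar> \<le> C" for n y
    using primitive_abs_le[OF int[of n], of y] C_int[of n] by linarith
  have flux_lim: "(\<lambda>n. flux (g n) y) \<longlonglongrightarrow> flux G y" for y
    unfolding flux_def
    by (intro tendsto_intros prim LINT_lim[OF _ _ prim_C] borel_measurable_continuous_onI[OF primitive_cont] int int_G)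
      (use mass_pos in auto)
  have flux_C: "\<bar>flux (g n) y\<bar> \<le> 2 * C" for n y
    using flux_abs_le[OF int[of n], of y] C_int[of n] by linarith
  have incr: "F x = F 0 + (LINT y:{0<..x}|dV. flux G y)" if x: "x \<in> {0..<1}" for x
  proof -
    have "f n x = f n 0 + (LINT y:{0<..x}|dV. flux (g n) y)" for n
    proof -
      have "f n x - f n 0 = (LINT y:{0<..x}|dV. flux (g n) y)"
        by (rule LW_graph_increment[OF graph]) (use x in auto)
      then show ?thesis by linarith
    qed
    moreover have "(\<lambda>n. f n 0 + (LINT y:{0<..x}|dV. flux (g n) y)) \<longlonglongrightarrow> F 0 + (LINT y:{0<..x}|dV. flux G y)"
      by (intro tendsto_intros f LINT_lim[OF flux_borel flux_borel flux_C] int int_G flux_lim)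
    ultimately show ?thesis using f[of x] by (intro LIMSEQ_unique) auto
  qed
  have per: "F (x + 1) = F x" for x
    using f[of "x + 1"] f[of x] by (simp add: LW_graph_periodic[OF graph] LIMSEQ_unique)
  have mean: "(\<integral>z. G z \<partial>circle) = 0"
    using ind_lim[of UNIV] LW_graph_mean[OF graph] by (simp add: LIMSEQ_const_iff)
  show ?thesis by (rule LW_graphI[OF L2 mean per ballI[OF incr]])
qed

end

section \<open>Product measures on the torus\<close>

lemma borel_measurable_vec_nth: "(\<lambda>x :: real^'d. x $ k) \<in> borel_measurable borel"
  by (intro borel_measurable_continuous_onI continuous_intros)

lemma nth_borel:
  "g \<in> borel_measurable borel \<Longrightarrow> (\<lambda>x. g (x $ k)) \<in> borel_measurable (borel :: (real^'d) measure)"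
  by (rule measurable_compose[OF borel_measurable_vec_nth])

text \<open>One setting for \<open>torus\<close> and for every \<open>torus_W W j\<close>, whose
  factors are Lebesgue measure except for one; integrals of products of one-variable functions are
  then computed once for both.\<close>

locale torus_factors =
  fixes \<nu> :: "'d::finite \<Rightarrow> real measure"
  assumes sets_factor: "\<And>k. sets (\<nu> k) = sets borel"
    and finite_factor: "\<And>k. finite_measure (restrict_space (\<nu> k) {0<..1})"
begin

abbreviation "factor k \<equiv> restrict_space (\<nu> k) {0<..1::real}"

lemma borel_factor: "f \<in> borel_measurable borel \<Longrightarrow> f \<in> borel_measurable (factor k)"
  by (intro measurable_restrict_space1) (simp only: measurable_cong_sets[OF sets_factor refl])

sublocale P: product_sigma_finite factor
  by (rule product_sigma_finite.intro) (meson finite_factor finite_measure.axioms(1))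

lemma vec_measurable: "(\<lambda>f. \<chi> k. f k) \<in> borel_measurable (PiM UNIV factor)"
proof -
  have "(\<lambda>f. f k) \<in> borel_measurable (PiM UNIV factor)" for k
    using measurable_compose[OF measurable_component_singleton[of k UNIV factor] borel_factor[of "\<lambda>x. x" k]] by simp
  then have "(\<lambda>f. \<Sum>k\<in>UNIV. f k *\<^sub>R (axis k 1 :: real^'d)) \<in> borel_measurable (PiM UNIV factor)"
    by (intro borel_measurable_sum borel_measurable_scaleR borel_measurable_const)
  moreover have "(\<chi> k. f k) = (\<Sum>k\<in>UNIV. f k *\<^sub>R (axis k 1 :: real^'d))" for f :: "'d \<Rightarrow> real"
    by (simp add: vec_eq_iff axis_def if_distrib[of "\<lambda>x. _ * x"] cong: if_cong)
  ultimately show ?thesis by simp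
qed

lemma sets_torus_measure: "sets (torus_measure \<nu>) = sets borel"
  and space_torus_measure: "space (torus_measure \<nu>) = UNIV"
  by (simp_all add: torus_measure_def)

lemma borel_torus_measure: "f \<in> borel_measurable borel \<Longrightarrow> f \<in> borel_measurable (torus_measure \<nu>)"
  by (simp add: torus_measure_def)

lemma torus_measure_integrable_prod:
  fixes g :: "'d \<Rightarrow> real \<Rightarrow> real"
  assumes g: "\<And>k. g k \<in> borel_measurable borel" "\<And>k. integrable (factor k) (g k)"
  shows "integrable (torus_measure \<nu>) (\<lambda>x. \<Prod>k\<in>UNIV. g k (x $ k))"
  unfolding torus_measure_def
proof (subst integrable_distr_eq[OF vec_measurable])
  show "(\<lambda>x. \<Prod>k\<in>UNIV. g k (x $ k)) \<in> borel_measurable (borel :: (real^'d) measure)"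
    by (intro borel_measurable_prod nth_borel g)
  show "integrable (PiM UNIV factor) (\<lambda>f. \<Prod>k\<in>UNIV. g k ((\<chi> k. f k) $ k))"
    using P.product_integrable_prod[of UNIV g] g by simp
qed

lemma torus_measure_integral_prod:
  fixes g :: "'d \<Rightarrow> real \<Rightarrow> real"
  assumes g: "\<And>k. g k \<in> borel_measurable borel" "\<And>k. integrable (factor k) (g k)"
  shows "(\<integral>x. (\<Prod>k\<in>UNIV. g k (x $ k)) \<partial>torus_measure \<nu>) = (\<Prod>k\<in>UNIV. \<integral>u. g k u \<partial>factor k)"
  unfolding torus_measure_def
proof (subst integral_distr[OF vec_measurable])
  show "(\<lambda>x. \<Prod>k\<in>UNIV. g k (x $ k)) \<in> borel_measurable (borel :: (real^'d) measure)"
    by (intro borel_measurable_prod nth_borel g)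
  show "(\<integral>f. (\<Prod>k\<in>UNIV. g k ((\<chi> k. f k) $ k)) \<partial>PiM UNIV factor) = (\<Prod>k\<in>UNIV. \<integral>u. g k u \<partial>factor k)"
    using P.product_integral_prod[of UNIV g] g by simp
qed

lemma finite_measure_torus_measure: "finite_measure (torus_measure \<nu>)"
proof -
  have "integrable (torus_measure \<nu>) (\<lambda>x. \<Prod>k\<in>(UNIV :: 'd set). (\<lambda>_ _. 1 :: real) k (x $ k))"
    by (rule torus_measure_integrable_prod) (auto intro: finite_measure.integrable_const[OF finite_factor])
  then have "integrable (torus_measure \<nu>) (\<lambda>x. 1 :: real)" by simp
  then have "integrable (torus_measure \<nu>) (indicat_real UNIV)" by (simp add: indicator_def)
  then have "emeasure (torus_measure \<nu>) UNIV < \<infinity>"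
    by (subst (asm) integrable_indicator_iff) (simp_all add: space_torus_measure sets_torus_measure)
  then show ?thesis by (intro finite_measureI) (simp add: space_torus_measure)
qed

end

lemma torus_factors_lborel: "torus_factors (\<lambda>_ :: 'd::finite. lborel)"
  by (rule torus_factors.intro[OF sets_lborel circle.finite_measure_axioms[unfolded circle_def]])

interpretation torus: torus_factors "\<lambda>_ :: 'd::finite. lborel"
  rewrites "torus_measure (\<lambda>_ :: 'd. lborel) = torus"
    and "restrict_space lborel {0<..1::real} = circle"
  by (rule torus_factors_lborel) (simp_all add: torus_def circle_def)

interpretation torus: finite_measure torus by (rule torus.finite_measure_torus_measure)

lemma sets_torus: "sets torus = sets borel"
  by (rule torus.sets_torus_measure)

section \<open>Periodic functions\<close>

lemma periodic_add_int:
  fixes G :: "real^'d \<Rightarrow> real"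
  assumes "periodic G"
  shows "G (x + (\<chi> k. real_of_int (n k))) = G x"
proof -
  have axis: "G (y + of_int i *\<^sub>R axis k 1) = G y" for y k i
  proof (induction i rule: int_induct[where k = 0])
    case (step1 i)
    then show ?case using assms[unfolded periodic_def, rule_format, of "y + of_int i *\<^sub>R axis k 1" k]
      by (simp add: algebra_simps)
  next
    case (step2 i)
    then show ?case using assms[unfolded periodic_def, rule_format, of "y + of_int (i - 1) *\<^sub>R axis k 1" k]
      by (simp add: algebra_simps)
  qed simp
  have "G (x + (\<Sum>k\<in>K. of_int (n k) *\<^sub>R axis k 1)) = G x" if "finite K" for K
    using that
  proof (induction K rule: finite_induct)
    case (insert k K)
    then show ?case using axis[of "x + (\<Sum>k\<in>K. of_int (n k) *\<^sub>R axis k 1)" "n k" k]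
      by (simp add: ac_simps)
  qed simp
  moreover have "(\<chi> k. real_of_int (n k)) = (\<Sum>k\<in>UNIV. of_int (n k) *\<^sub>R (axis k 1 :: real^'d))"
    by (simp add: vec_eq_iff axis_def if_distrib[of "\<lambda>x. _ * x"] cong: if_cong)
  ultimately show ?thesis by simp
qed

lemma periodic_frac:
  fixes G :: "real^'d \<Rightarrow> real"
  assumes "periodic G"
  shows "G x = G (\<chi> k. frac (x $ k))"
proof -
  have "(\<chi> k. frac (x $ k)) + (\<chi> k. real_of_int \<lfloor>x $ k\<rfloor>) = x" by (simp add: vec_eq_iff frac_def)
  then show ?thesis using periodic_add_int[OF assms, of "\<chi> k. frac (x $ k)" "\<lambda>k. \<lfloor>x $ k\<rfloor>"] by simp
qed

lemma circle_integral_Ioc: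
  assumes "0 \<le> a" "a \<le> b" "b \<le> 1"
  shows "(\<integral>u. indicat_real {a<..b} u \<partial>circle) = b - a"
proof -
  have "{a<..b} \<inter> {0<..1} = {a<..b}" using assms by auto
  moreover from this have "measure circle {a<..b} = b - a"
    using assms unfolding circle_def by (subst measure_restrict_space) auto
  ultimately show ?thesis by (simp add: space_circle)
qed

lemma indicator_product:
  "indicat_real {x :: real^'d. \<forall>k. x $ k \<in> S k} x = (\<Prod>k\<in>UNIV. indicat_real (S k) (x $ k))"
  by (auto simp: indicator_def)

lemma box_borel:
  assumes "\<And>k. S k \<in> sets borel"
  shows "{x :: real^'d. \<forall>k. x $ k \<in> S k} \<in> sets borel"
proof -
  have "indicat_real {x :: real^'d. \<forall>k. x $ k \<in> S k} \<in> borel_measurable borel"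
    unfolding indicator_product using assms
    by (intro borel_measurable_prod nth_borel) auto
  then show ?thesis by (simp add: borel_measurable_indicator_iff)
qed

lemma torus_measure_box:
  assumes S: "\<And>k :: 'd::finite. S k \<in> sets borel"
  shows "measure torus {x :: real^'d. \<forall>k. x $ k \<in> S k} = (\<Prod>k\<in>UNIV. \<integral>u. indicat_real (S k) u \<partial>circle)"
proof -
  have "measure torus {x :: real^'d. \<forall>k. x $ k \<in> S k} = (\<integral>x. indicat_real {x :: real^'d. \<forall>k. x $ k \<in> S k} x \<partial>torus)"
    using box_borel[of S, OF S] by (simp add: torus.space_torus_measure)
  also have "\<dots> = (\<Prod>k\<in>UNIV. \<integral>u. indicat_real (S k) u \<partial>circle)"
    unfolding indicator_product
  proof (rule torus.torus_measure_integral_prod)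
    show "integrable circle (indicat_real (S k))" for k
      using indicator_circle_integrable[of "\<lambda>_. 1" "S k"] S by simp
  qed (use S in auto)
  finally show ?thesis .
qed

lemma norm_le_coordinates:
  fixes x :: "real^'d"
  assumes "\<And>k. \<bar>x $ k\<bar> \<le> \<delta>"
  shows "norm x \<le> real CARD('d) * \<delta>"
proof -
  have "norm x \<le> (\<Sum>k\<in>UNIV. \<bar>x $ k\<bar>)" by (rule norm_le_l1_cart)
  also have "\<dots> \<le> real CARD('d) * \<delta>" using assms by (intro sum_bounded_above) auto
  finally show ?thesis .
qed

text \<open>Right-continuity in the closed upper orthant makes a difference at one point persist on
  a small box above it, and a box has positive measure. Periodicity first moves every coordinate of
  the point to \<open>[0,1)\<close>, where there is room above it inside the cell.\<close>

lemma cadlag_AE_eq: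
  fixes G H :: "real^'d \<Rightarrow> real"
  assumes G: "periodic G" "cadlag G" and H: "periodic H" "cadlag H" and ae: "AE x in torus. G x = H x"
  shows "G = H"
proof
  fix x0 :: "real^'d"
  define x where "x = (\<chi> k. frac (x0 $ k))"
  have x: "0 \<le> x $ k" "x $ k < 1" for k by (auto simp: x_def frac_lt_1)
  have lim: "((\<lambda>y. G y - H y) \<longlongrightarrow> G x - H x) (at x within {y. \<forall>k. x $ k \<le> y $ k})"
    using G(2) H(2) unfolding cadlag_def by (intro tendsto_diff) auto
  have "G x - H x = 0"
  proof (rule ccontr)
    assume neq: "G x - H x \<noteq> 0"
    obtain r where r: "0 < r" "\<And>y. y \<noteq> x \<Longrightarrow> dist y x < r \<Longrightarrow> \<forall>k. x $ k \<le> y $ k \<Longrightarrow> G y - H y \<noteq> 0"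
      using tendsto_imp_eventually_ne[OF lim neq] unfolding eventually_at by auto
    define m where "m = Min (range (\<lambda>k. 1 - x $ k))"
    have m: "0 < m" "m \<le> 1 - x $ k" for k
      unfolding m_def using x by (auto intro: Min_le)
    \<comment> \<open>\<open>m\<close> keeps the box inside the cell \<open>(0,1]\<close> in every
      coordinate; dividing by twice the dimension keeps it in the ball of radius \<open>r\<close>,
      since the norm is at most the sum of the absolute coordinates.\<close>
    define \<delta> where "\<delta> = min m (r / (2 * real CARD('d)))"
    have \<delta>: "0 < \<delta>" "\<delta> \<le> 1 - x $ k" "\<delta> \<le> r / (2 * real CARD('d))" for k
      using m r(1) by (auto simp: \<delta>_def intro: min.coboundedI1)
    define Q where "Q = {y :: real^'d. \<forall>k. y $ k \<in> {x $ k<..x $ k + \<delta>}}"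
    have Q_borel: "Q \<in> sets torus" unfolding Q_def sets_torus by (rule box_borel) auto
    have "measure torus Q = (\<Prod>k\<in>(UNIV :: 'd set). \<delta>)"
      unfolding Q_def using x \<delta> by (subst torus_measure_box) (auto simp: circle_integral_Ioc algebra_simps simp del: Bochner_Integration.integral_indicator)
    then have pos: "0 < measure torus Q" using \<delta>(1) by simp
    have ne: "G y \<noteq> H y" if "y \<in> Q" for y
    proof -
      have y: "x $ k < y $ k" "y $ k \<le> x $ k + \<delta>" for k using that by (auto simp: Q_def)
      have "norm (y - x) \<le> real CARD('d) * \<delta>"
      proof (rule norm_le_coordinates)
        show "\<bar>(y - x) $ k\<bar> \<le> \<delta>" for k using y[of k] by simp
      qed
      also have "\<dots> \<le> real CARD('d) * (r / (2 * real CARD('d)))" using \<delta>(3) by (intro mult_left_mono) auto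
      also have "\<dots> < r" using r(1) by simp
      finally have "dist y x < r" by (simp add: dist_norm)
      moreover have "y \<noteq> x" using y(1) by (metis less_irrefl)
      ultimately show ?thesis using r(2)[of y] y(1) by (auto intro: less_imp_le)
    qed
    have "AE y in torus. y \<notin> Q" using ae by eventually_elim (use ne in auto)
    then have "measure torus Q = 0" using Q_borel by (simp add: AE_iff_measurable[OF _ refl] measure_def torus.space_torus_measure)
    with pos show False by simp
  qed
  then show "G x0 = H x0" using periodic_frac[OF G(1), of x0] periodic_frac[OF H(1), of x0] by (simp add: x_def)
qed

section \<open>Cells of the grid\<close>

text \<open>Cells are closed on the left, as in \<open>interp\<close>. The corner is not reduced
  modulo \<open>N\<close>, because \<open>W\<close> at the corner is compared with \<open>W\<close>
  at \<open>x\<close> itself; \<open>wrap\<close> is applied only where a site is required.\<close>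

definition cell_of :: "nat \<Rightarrow> real^'d \<Rightarrow> int^'d" where
  "cell_of N x = (\<chi> k. \<lfloor>real N * x $ k\<rfloor>)"

lemma wrap_in_sites: "0 < N \<Longrightarrow> wrap N y \<in> sites N"
  by (simp add: wrap_def sites_def)

lemma wrap_sites: "y \<in> sites N \<Longrightarrow> wrap N y = y"
  by (simp add: wrap_def sites_def vec_eq_iff)

lemma finite_sites: "finite (sites N :: (int^'d) set)"
proof -
  have "sites N \<subseteq> (\<lambda>f. \<chi> k. f k) ` (PiE (UNIV :: 'd set) (\<lambda>_. {0..<int N}))"
  proof
    fix y :: "int^'d" assume "y \<in> sites N"
    then have "(\<lambda>k. y $ k) \<in> PiE UNIV (\<lambda>_. {0..<int N})" by (auto simp: sites_def)
    moreover have "y = (\<chi> k. y $ k)" by simp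
    ultimately show "y \<in> (\<lambda>f. \<chi> k. f k) ` (PiE (UNIV :: 'd set) (\<lambda>_. {0..<int N}))" by blast
  qed
  then show ?thesis by (rule finite_subset) (intro finite_imageI finite_PiE, auto)
qed

text \<open>For \<open>u\<close> in \<open>(0,1]\<close> the reduction modulo \<open>N\<close> takes
  effect only at \<open>u = 1\<close>, and passing from left-closed to left-open cells changes end
  points only. These are null sets.\<close>

lemma circle_integral_cell:
  assumes N: "0 < N" and i: "0 \<le> i" "i < int N"
  shows "(\<integral>u. indicat_real {u. \<lfloor>real N * u\<rfloor> mod int N = i} u \<partial>circle) = 1 / real N"
proof -
  have meas: "{u. \<lfloor>real N * u\<rfloor> mod int N = i} \<in> sets borel" by measurable
  have "(\<integral>u. indicat_real {u. \<lfloor>real N * u\<rfloor> mod int N = i} u \<partial>circle)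
     = (\<integral>u. indicat_real {of_int i / real N<..of_int (i + 1) / real N} u \<partial>circle)"
  proof (rule integral_cong_AE)
    show "AE u in circle. indicat_real {u. \<lfloor>real N * u\<rfloor> mod int N = i} u
        = indicat_real {of_int i / real N<..of_int (i + 1) / real N} u"
      using AE_circle_neq[of 1] AE_circle_neq[of "of_int i / real N"] AE_circle_neq[of "of_int (i + 1) / real N"]
        AE_space[of circle]
    proof eventually_elim
      case (elim u)
      then have u: "0 < u" "u < 1" by (auto simp: space_circle)
      then have "0 \<le> real N * u" "real N * u < real N" using N by auto
      then have "\<lfloor>real N * u\<rfloor> mod int N = \<lfloor>real N * u\<rfloor>"
        by (intro mod_pos_pos_trivial) (auto simp: floor_less_iff)
      then have "\<lfloor>real N * u\<rfloor> mod int N = i \<longleftrightarrow> of_int i \<le> real N * u \<and> real N * u < of_int i + 1"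
        by (simp add: floor_eq_iff)
      also have "\<dots> \<longleftrightarrow> of_int i / real N \<le> u \<and> u < of_int (i + 1) / real N"
        using N by (simp add: field_simps)
      also have "\<dots> \<longleftrightarrow> u \<in> {of_int i / real N<..of_int (i + 1) / real N}" using elim by auto
      finally show ?case by (simp add: indicator_def)
    qed
    show "indicat_real {u. \<lfloor>real N * u\<rfloor> mod int N = i} \<in> borel_measurable circle"
      using meas by (intro sets_circle_borel) auto
    show "indicat_real {of_int i / real N<..of_int (i + 1) / real N} \<in> borel_measurable circle"
      by (intro sets_circle_borel) auto
  qed
  also have "\<dots> = of_int (i + 1) / real N - of_int i / real N"
  proof (rule circle_integral_Ioc)
    have "of_int (i + 1) \<le> real N" using i by linarith
    then show "of_int (i + 1) / real N \<le> 1" using N by simp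
  qed (use i N in \<open>auto simp: divide_right_mono\<close>)
  also have "\<dots> = 1 / real N" using N by (simp add: field_simps)
  finally show ?thesis .
qed

lemma cell_set_eq:
  "{x :: real^'d. wrap N (cell_of N x) = y} = {x. \<forall>k. x $ k \<in> {u. \<lfloor>real N * u\<rfloor> mod int N = y $ k}}"
  by (auto simp: wrap_def cell_of_def vec_eq_iff)

lemma cell_borel: "{x :: real^'d. wrap N (cell_of N x) = y} \<in> sets borel"
  unfolding cell_set_eq by (rule box_borel) measurable

lemma torus_measure_cell:
  fixes y :: "int^'d"
  assumes N: "0 < N" and y: "y \<in> sites N"
  shows "measure torus {x. wrap N (cell_of N x) = y} = 1 / real N ^ CARD('d)"
proof -
  have "measure torus {x :: real^'d. wrap N (cell_of N x) = y} =
      (\<Prod>k\<in>UNIV. \<integral>u. indicat_real {u. \<lfloor>real N * u\<rfloor> mod int N = y $ k} u \<partial>circle)"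
    unfolding cell_set_eq by (rule torus_measure_box) measurable
  also have "\<dots> = (\<Prod>k\<in>(UNIV :: 'd set). 1 / real N)"
    using y by (intro prod.cong refl circle_integral_cell[OF N]) (auto simp: sites_def)
  finally show ?thesis by (simp add: power_one_over)
qed

lemma cell_sum_eq:
  fixes \<psi> :: "int^'d \<Rightarrow> real"
  assumes "0 < N"
  shows "\<psi> (wrap N (cell_of N x)) = (\<Sum>y\<in>sites N. \<psi> y * indicat_real {x. wrap N (cell_of N x) = y} x)"
proof -
  have "(\<Sum>y\<in>sites N. \<psi> y * indicat_real {x. wrap N (cell_of N x) = y} x) =
      (\<Sum>y\<in>sites N. if y = wrap N (cell_of N x) then \<psi> y else 0)"
    by (intro sum.cong) (auto simp: indicator_def)
  also have "\<dots> = \<psi> (wrap N (cell_of N x))"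
    using wrap_in_sites[OF assms, of "cell_of N x"] by (simp add: finite_sites)
  finally show ?thesis by simp
qed

lemma cell_function_measurable:
  fixes \<psi> :: "int^'d \<Rightarrow> real"
  assumes "0 < N"
  shows "(\<lambda>x :: real^'d. \<psi> (wrap N (cell_of N x))) \<in> borel_measurable borel"
  unfolding cell_sum_eq[OF assms, of \<psi>]
  by (intro borel_measurable_sum borel_measurable_times borel_measurable_const borel_measurable_indicator cell_borel)

lemma cell_function_integrable:
  fixes \<psi> :: "int^'d \<Rightarrow> real"
  assumes "0 < N"
  shows "integrable torus (\<lambda>x :: real^'d. \<psi> (wrap N (cell_of N x)))"
  unfolding cell_sum_eq[OF assms, of \<psi>]
  by (intro Bochner_Integration.integrable_sum integrable_mult_right integrable_real_indicator)
    (auto simp: sets_torus cell_borel less_top[symmetric])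

text \<open>All cells have the same measure, so averages over the grid are integrals of step
  functions. The comparisons between grid and torus start from this identity.\<close>

lemma cell_function_integral:
  fixes \<psi> :: "int^'d \<Rightarrow> real"
  assumes "0 < N"
  shows "(\<integral>x. \<psi> (wrap N (cell_of N x)) \<partial>torus) = (\<Sum>y\<in>sites N. \<psi> y) / real N ^ CARD('d)"
proof -
  have "(\<integral>x. \<psi> (wrap N (cell_of N x)) \<partial>torus) =
      (\<Sum>y\<in>sites N. \<integral>x. \<psi> y * indicat_real {x. wrap N (cell_of N x) = y} x \<partial>torus)"
    unfolding cell_sum_eq[OF assms, of \<psi>]
    by (intro Bochner_Integration.integral_sum integrable_mult_right integrable_real_indicator)
      (auto simp: sets_torus cell_borel less_top[symmetric])
  also have "\<dots> = (\<Sum>y\<in>sites N. \<psi> y * (1 / real N ^ CARD('d)))"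
    by (intro sum.cong refl) (simp add: torus_measure_cell assms torus.space_torus_measure)
  finally show ?thesis by (simp add: sum_divide_distrib)
qed

section \<open>Analysis on the discrete torus\<close>

lemma admissible_W_gauge: "admissible_W W \<Longrightarrow> gauge (W k)"
  unfolding admissible_W_def by (intro gauge.intro) auto

lemma wrap_wrap_add: "wrap N (wrap N x + v) = wrap N (x + v)"
  by (simp add: wrap_def vec_eq_iff mod_simps)

lemma wrap_wrap_diff: "wrap N (wrap N x - v) = wrap N (x - v)"
  by (simp add: wrap_def vec_eq_iff mod_simps)

lemma wrap_shift_bij:
  assumes "0 < N"
  shows "bij_betw (\<lambda>x. wrap N (x + v)) (sites N) (sites N)"
proof (rule bij_betw_byWitness[where f' = "\<lambda>x. wrap N (x - v)"])
  show "\<forall>x\<in>sites N. wrap N (wrap N (x + v) - v) = x"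
    by (simp add: wrap_wrap_diff wrap_sites)
  show "\<forall>x\<in>sites N. wrap N (wrap N (x - v) + v) = x"
    by (simp add: wrap_wrap_add wrap_sites)
qed (auto simp: wrap_in_sites[OF assms])

lemma sum_sites_shift:
  assumes "0 < N"
  shows "(\<Sum>x\<in>sites N. \<psi> (wrap N (x + v))) = (\<Sum>x\<in>sites N. \<psi> x)"
  by (rule sum.reindex_bij_betw[OF wrap_shift_bij[OF assms]])

lemma W_incr_eq:
  "W_incr W N j x = W j (real_of_int (x $ j + 1) / real N) - W j (real_of_int (x $ j) / real N)"
proof -
  have "W_incr W N j x = (\<Sum>k\<in>UNIV. W k (grid N (x + axis j 1) $ k) - W k (grid N x $ k))"
    by (simp add: W_incr_def W_sum_def sum_subtractf)
  also have "\<dots> = (\<Sum>k\<in>UNIV. if k = j then W j (real_of_int (x $ j + 1) / real N) - W j (real_of_int (x $ j) / real N) else 0)"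
    by (intro sum.cong refl) (auto simp: grid_def axis_def)
  finally show ?thesis by simp
qed

lemma W_incr_pos:
  assumes "admissible_W W" "0 < N"
  shows "0 < W_incr W N j x"
proof -
  interpret gauge "W j" by (rule admissible_W_gauge[OF assms(1)])
  show ?thesis unfolding W_incr_eq using assms(2)
    by (simp add: less divide_strict_right_mono)
qed

lemma W_incr_wrap:
  assumes "admissible_W W" "0 < N"
  shows "W_incr W N j (wrap N y) = W_incr W N j y"
proof -
  interpret gauge "W j" by (rule admissible_W_gauge[OF assms(1)])
  \<comment> \<open>\<open>wrap\<close> moves the point by an integer; \<open>W j\<close> then
    changes by that multiple of its mass, which cancels in the increment.\<close>
  have eq: "real_of_int (y $ j mod int N + m) / real N = real_of_int (y $ j + m) / real N + of_int (- (y $ j div int N))" for m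
  proof -
    have "y $ j mod int N = y $ j - int N * (y $ j div int N)" by (simp add: minus_mult_div_eq_mod)
    then have "real_of_int (y $ j mod int N) = real_of_int (y $ j) - real N * real_of_int (y $ j div int N)"
      by (metis of_int_diff of_int_mult of_int_of_nat_eq)
    then show ?thesis using assms(2) by (simp add: field_simps)
  qed
  show ?thesis unfolding W_incr_eq using eq[of 0] eq[of 1] by (simp add: wrap_def shift_int del: of_int_minus)
qed

lemma W_incr_le_mass:
  assumes "admissible_W W" "0 < N" "x \<in> sites N"
  shows "W_incr W N j x \<le> W j 1 - W j 0"
proof -
  interpret gauge "W j" by (rule admissible_W_gauge[OF assms(1)])
  have "x $ j < int N" using assms(3) by (auto simp: sites_def)
  then have x: "x $ j + 1 \<le> int N" "0 \<le> x $ j" using assms(3) by (linarith, simp add: sites_def)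
  then have "real_of_int (x $ j + 1) \<le> real N" by linarith
  then have "W j (real_of_int (x $ j + 1) / real N) \<le> W j 1" using assms(2) by (intro mono) simp
  moreover have "W j 0 \<le> W j (real_of_int (x $ j) / real N)" using x by (intro mono) auto
  ultimately show ?thesis unfolding W_incr_eq by linarith
qed

section \<open>Scalar product, Dirichlet form and resolvent on the grid\<close>

definition inner_N :: "nat \<Rightarrow> (int^'d \<Rightarrow> real) \<Rightarrow> (int^'d \<Rightarrow> real) \<Rightarrow> real" where
  "inner_N N u v = (\<Sum>x\<in>sites N. u x * v x) / real N ^ CARD('d)"

definition diff_N :: "nat \<Rightarrow> 'd \<Rightarrow> (int^'d \<Rightarrow> real) \<Rightarrow> int^'d \<Rightarrow> real" where
  "diff_N N j v x = v (wrap N (x + axis j 1)) - v x"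

text \<open>The Dirichlet form of the accelerated random walk, whose rates, \<open>N^2\<close> times
  the conductances, are \<open>N \<aa> / W_incr\<close>. With \<open>\<aa>\<close> replaced by 1 it
  serves as the reference energy.\<close>

definition form_N :: "('d \<Rightarrow> real \<Rightarrow> real) \<Rightarrow> ('d \<Rightarrow> int^'d \<Rightarrow> real) \<Rightarrow> nat \<Rightarrow>
    (int^'d \<Rightarrow> real) \<Rightarrow> (int^'d \<Rightarrow> real) \<Rightarrow> real" where
  "form_N W \<aa> N u v = (\<Sum>j\<in>UNIV. \<Sum>x\<in>sites N.
     real N * \<aa> j x / W_incr W N j x * diff_N N j u x * diff_N N j v x) / real N ^ CARD('d)"

lemma inner_N_commute: "inner_N N u v = inner_N N v u"
  by (simp add: inner_N_def mult.commute)

lemma form_N_commute: "form_N W \<aa> N u v = form_N W \<aa> N v u"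
  by (simp add: form_N_def mult.commute mult.left_commute)

lemma inner_N_add: "inner_N N (\<lambda>x. u x + v x) w = inner_N N u w + inner_N N v w"
  by (simp add: inner_N_def distrib_right sum.distrib add_divide_distrib)

lemma inner_N_diff: "inner_N N (\<lambda>x. u x - v x) w = inner_N N u w - inner_N N v w"
  by (simp add: inner_N_def left_diff_distrib sum_subtractf diff_divide_distrib)

lemma inner_N_scale: "inner_N N (\<lambda>x. c * u x) w = c * inner_N N u w"
  by (simp add: inner_N_def sum_distrib_left mult.assoc)

lemma inner_N_diff_right: "inner_N N w (\<lambda>x. u x - v x) = inner_N N w u - inner_N N w v"
  using inner_N_diff[of N u v w] by (simp add: inner_N_commute)

lemma inner_N_scale_right: "inner_N N w (\<lambda>x. c * u x) = c * inner_N N w u"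
  using inner_N_scale[of N c u w] by (simp add: inner_N_commute)

lemma form_N_diff: "form_N W \<aa> N (\<lambda>x. u x - v x) w = form_N W \<aa> N u w - form_N W \<aa> N v w"
proof -
  have "diff_N N j (\<lambda>x. u x - v x) x = diff_N N j u x - diff_N N j v x" for j x
    by (simp add: diff_N_def)
  then show ?thesis
    by (simp add: form_N_def right_diff_distrib left_diff_distrib sum_subtractf diff_divide_distrib)
qed

lemma inner_N_cong:
  "(\<And>x. x \<in> sites N \<Longrightarrow> u x = u' x) \<Longrightarrow> (\<And>x. x \<in> sites N \<Longrightarrow> v x = v' x) \<Longrightarrow> inner_N N u v = inner_N N u' v'"
  by (simp add: inner_N_def)

lemma inner_N_self_nonneg: "0 \<le> inner_N N u u"
  by (simp add: inner_N_def sum_nonneg)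

lemma inner_N_Cauchy_Schwarz:
  fixes u v :: "int^'d \<Rightarrow> real"
  shows "(inner_N N u v)\<^sup>2 \<le> inner_N N u u * inner_N N v v"
proof -
  have "(\<Sum>x\<in>sites N. u x * v x)\<^sup>2 \<le> (\<Sum>x\<in>sites N. (u x)\<^sup>2) * (\<Sum>x\<in>sites N. (v x)\<^sup>2)"
    by (rule Cauchy_Schwarz_ineq_sum)
  then have "(\<Sum>x\<in>sites N. u x * v x)\<^sup>2 / (real N ^ CARD('d))\<^sup>2 \<le>
      (\<Sum>x\<in>sites N. (u x)\<^sup>2) * (\<Sum>x\<in>sites N. (v x)\<^sup>2) / (real N ^ CARD('d))\<^sup>2"
    by (intro divide_right_mono) auto
  then show ?thesis by (simp add: inner_N_def power_divide power2_eq_square)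
qed

text \<open>The parallelogram identity, after dropping the square of the difference.\<close>

lemma inner_N_add_le:
  "inner_N N (\<lambda>x. u x + v x) (\<lambda>x. u x + v x) \<le> 2 * inner_N N u u + 2 * inner_N N v v"
proof -
  have "inner_N N (\<lambda>x. u x + v x) (\<lambda>x. u x + v x) + inner_N N (\<lambda>x. u x - v x) (\<lambda>x. u x - v x) =
      2 * inner_N N u u + 2 * inner_N N v v"
    by (simp add: inner_N_add inner_N_diff inner_N_diff_right inner_N_commute[of N _ "\<lambda>x. u x + v x"]
        inner_N_commute[of N v u])
  then show ?thesis using inner_N_self_nonneg[of N "\<lambda>x. u x - v x"] by linarith
qed

lemma form_N_ge:
  assumes "admissible_W W" "0 < N" "\<And>j x. \<kappa> \<le> \<aa> j x"
  shows "\<kappa> * form_N W (\<lambda>_ _. 1) N v v \<le> form_N W \<aa> N v v"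
proof -
  have "\<kappa> * (real N * 1 / W_incr W N j x * diff_N N j v x * diff_N N j v x) \<le>
      real N * \<aa> j x / W_incr W N j x * diff_N N j v x * diff_N N j v x" for j x
  proof -
    have "\<kappa> * (real N / W_incr W N j x * (diff_N N j v x * diff_N N j v x)) \<le>
        \<aa> j x * (real N / W_incr W N j x * (diff_N N j v x * diff_N N j v x))"
      using assms(3) W_incr_pos[OF assms(1,2), of j x] by (intro mult_right_mono) auto
    then show ?thesis by (simp add: mult.assoc mult.left_commute)
  qed
  then have "\<kappa> * (\<Sum>j\<in>UNIV. \<Sum>x\<in>sites N. real N * 1 / W_incr W N j x * diff_N N j v x * diff_N N j v x) \<le>
      (\<Sum>j\<in>UNIV. \<Sum>x\<in>sites N. real N * \<aa> j x / W_incr W N j x * diff_N N j v x * diff_N N j v x)"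
    unfolding sum_distrib_left by (intro sum_mono)
  then show ?thesis unfolding form_N_def times_divide_eq_right by (intro divide_right_mono) auto
qed

lemma form_N_self_nonneg:
  assumes "admissible_W W" "0 < N" "\<And>j x. 0 \<le> \<aa> j x"
  shows "0 \<le> form_N W \<aa> N v v"
  using form_N_ge[OF assms(1,2), of 0 \<aa> v] assms(3) by simp

lemma N2_conductance:
  assumes "0 < N"
  shows "(real N)\<^sup>2 * conductance W \<aa> N j x = real N * \<aa> j x / W_incr W N j x"
  using assms by (simp add: conductance_def power2_eq_square)

text \<open>Summation by parts: translating the sum of the backward terms by one step turns them
  into forward differences tested at the other end of the bond.\<close>

lemma random_walk_generator_form:
  fixes u v :: "int^'d \<Rightarrow> real"
  assumes N: "0 < N"
  shows "inner_N N (random_walk_generator W \<aa> N u) v = - form_N W \<aa> N u v"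
proof -
  define c where "c j x = real N * \<aa> j x / W_incr W N j x" for j x
  have gen: "random_walk_generator W \<aa> N u x * v x = (\<Sum>j\<in>UNIV. c j x * diff_N N j u x * v x +
      c j (wrap N (x - axis j 1)) * (u (wrap N (x - axis j 1)) - u x) * v x)" for x
    by (simp add: random_walk_generator_def sum_distrib_right distrib_left distrib_right
        mult.assoc[symmetric] N2_conductance[OF N] c_def diff_N_def)
  have bwd: "(\<Sum>x\<in>sites N. c j (wrap N (x - axis j 1)) * (u (wrap N (x - axis j 1)) - u x) * v x) =
      (\<Sum>x\<in>sites N. - (c j x * diff_N N j u x * v (wrap N (x + axis j 1))))" for j
  proof -
    have "(\<Sum>x\<in>sites N. c j (wrap N (x - axis j 1)) * (u (wrap N (x - axis j 1)) - u x) * v x) =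
      (\<Sum>x\<in>sites N. c j (wrap N (wrap N (x + axis j 1) - axis j 1)) *
        (u (wrap N (wrap N (x + axis j 1) - axis j 1)) - u (wrap N (x + axis j 1))) * v (wrap N (x + axis j 1)))"
      by (rule sum_sites_shift[OF N, symmetric])
    also have "\<dots> = (\<Sum>x\<in>sites N. - (c j x * diff_N N j u x * v (wrap N (x + axis j 1))))"
      by (rule sum.cong) (auto simp: wrap_wrap_diff wrap_sites diff_N_def algebra_simps)
    finally show ?thesis .
  qed
  have "(\<Sum>x\<in>sites N. random_walk_generator W \<aa> N u x * v x) =
      (\<Sum>j\<in>UNIV. \<Sum>x\<in>sites N. c j x * diff_N N j u x * v x +
      c j (wrap N (x - axis j 1)) * (u (wrap N (x - axis j 1)) - u x) * v x)"
    unfolding gen by (rule sum.swap)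
  also have "\<dots> = (\<Sum>j\<in>UNIV. \<Sum>x\<in>sites N. - (c j x * diff_N N j u x * diff_N N j v x))"
    unfolding sum.distrib bwd unfolding sum.distrib[symmetric]
    by (intro sum.cong refl) (simp add: diff_N_def[of N _ v] algebra_simps)
  finally show ?thesis
    unfolding inner_N_def form_N_def c_def by (simp add: sum_negf)
qed

text \<open>Two difference quotients times one increment leave one increment in the denominator, and
  \<open>1 / N ^ (d - 1)\<close> is \<open>N / N ^ d\<close>. The weak formulation is thus governed
  by the form of the random walk generator.\<close>

lemma discrete_weak_solution_iff:
  fixes u :: "int^'d \<Rightarrow> real"
  assumes W: "admissible_W W" and N: "0 < N"
  shows "discrete_weak_solution W \<aa> N l \<ll> u \<longleftrightarrow>
    (\<forall>v. l * inner_N N u v + form_N W \<aa> N u v = \<ll> (interp W N v))"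
proof -
  have pow: "real N ^ CARD('d) = real N * real N ^ (CARD('d) - 1)"
    by (simp add: power_Suc[symmetric])
  have "form_N W \<aa> N u v = 1 / real N ^ (CARD('d) - 1) *
       (\<Sum>j\<in>UNIV. \<Sum>x\<in>sites N. \<aa> j x * discrete_dW W N j u x * discrete_dW W N j v x * W_incr W N j x)" for v
  proof -
    have "real N * \<aa> j x / W_incr W N j x * diff_N N j u x * diff_N N j v x =
        real N * (\<aa> j x * discrete_dW W N j u x * discrete_dW W N j v x * W_incr W N j x)" for j x
      using W_incr_pos[OF W N, of j x] by (simp add: discrete_dW_def diff_N_def field_simps)
    then show ?thesis using N
      unfolding form_N_def pow by (simp add: sum_distrib_left[symmetric])
  qed
  then show ?thesis by (simp add: discrete_weak_solution_def inner_N_def)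
qed

text \<open>Banach's fixed point theorem for the supremum over the finite set \<open>S\<close>, by
  iteration from 0. Values off \<open>S\<close> are left open, so convergence and the fixed point
  equation are claimed on \<open>S\<close> only.\<close>

lemma sup_contraction_fixpoint:
  fixes \<Phi> :: "('a \<Rightarrow> real) \<Rightarrow> 'a \<Rightarrow> real"
  assumes S: "finite S" and q: "0 \<le> q" "q < 1"
    and contr: "\<And>u v M x. (\<And>y. y \<in> S \<Longrightarrow> \<bar>u y - v y\<bar> \<le> M) \<Longrightarrow> x \<in> S \<Longrightarrow> \<bar>\<Phi> u x - \<Phi> v x\<bar> \<le> q * M"
  obtains u where "\<And>x. x \<in> S \<Longrightarrow> \<Phi> u x = u x"
proof -
  define w where "w n = (\<Phi> ^^ n) (\<lambda>_. 0)" for n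
  have w_Suc: "w (Suc n) = \<Phi> (w n)" for n by (simp add: w_def)
  define M where "M = (\<Sum>x\<in>S. \<bar>w 1 x - w 0 x\<bar>)"
  have step: "\<bar>w (Suc n) x - w n x\<bar> \<le> q ^ n * M" if "x \<in> S" for n x
    using that
  proof (induction n arbitrary: x)
    case 0
    then show ?case unfolding M_def using S member_le_sum[of x S "\<lambda>x. \<bar>w 1 x - w 0 x\<bar>"] by simp
  next
    case (Suc n)
    have "\<bar>\<Phi> (w (Suc n)) x - \<Phi> (w n) x\<bar> \<le> q * (q ^ n * M)"
      by (rule contr[OF Suc.IH Suc.prems])
    then show ?case by (simp add: w_Suc[of "Suc n"] w_Suc[of n, symmetric] mult.assoc)
  qed
  have "convergent (\<lambda>n. w n x)" if "x \<in> S" for x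
  proof -
    have "summable (\<lambda>n. w (Suc n) x - w n x)"
    proof (rule summable_comparison_test)
      show "\<exists>N. \<forall>n\<ge>N. norm (w (Suc n) x - w n x) \<le> q ^ n * M" using step[OF that] by auto
      show "summable (\<lambda>n. q ^ n * M)" using q by (intro summable_mult2 summable_geometric) simp
    qed
    then have "convergent (\<lambda>n. \<Sum>i<n. w (Suc i) x - w i x)" by (simp add: summable_iff_convergent)
    then have "convergent (\<lambda>n. w n x - w 0 x)" by (simp add: sum_lessThan_telescope[of "\<lambda>n. w n x"])
    then have "convergent (\<lambda>n. (w n x - w 0 x) + w 0 x)" by (intro convergent_add convergent_const)
    then show ?thesis by simp
  qed
  then obtain u where u: "\<And>x. x \<in> S \<Longrightarrow> (\<lambda>n. w n x) \<longlonglongrightarrow> u x"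
    unfolding convergent_def by metis
  show ?thesis
  proof (rule that)
    fix x assume x: "x \<in> S"
    have "(\<lambda>n. w (Suc n) x) \<longlonglongrightarrow> \<Phi> u x"
    proof (rule LIMSEQ_I)
      fix e :: real assume e: "0 < e"
      have "\<forall>\<^sub>F n in sequentially. \<forall>y\<in>S. \<bar>w n y - u y\<bar> < e"
        using tendstoD[OF u e] by (intro eventually_ball_finite S) (auto simp: dist_real_def)
      then obtain n0 where n0: "\<And>n y. n \<ge> n0 \<Longrightarrow> y \<in> S \<Longrightarrow> \<bar>w n y - u y\<bar> < e"
        unfolding eventually_sequentially by blast
      have "norm (w (Suc n) x - \<Phi> u x) < e" if "n \<ge> n0" for n
      proof -
        have "\<bar>\<Phi> (w n) x - \<Phi> u x\<bar> \<le> q * e"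
          by (rule contr[OF _ x]) (use n0[OF that] in \<open>auto intro: less_imp_le\<close>)
        also have "\<dots> < e" using q e by simp
        finally show ?thesis by (simp add: w_Suc)
      qed
      then show "\<exists>no. \<forall>n\<ge>no. norm (w (Suc n) x - \<Phi> u x) < e" by blast
    qed
    moreover have "(\<lambda>n. w (Suc n) x) \<longlonglongrightarrow> u x" using u[OF x] by (rule LIMSEQ_Suc)
    ultimately show "\<Phi> u x = u x" by (rule LIMSEQ_unique)
  qed
qed

text \<open>The equation at a site is solved for \<open>u x\<close>: the neighbours enter through
  \<open>H\<close> with total weight \<open>D x\<close>, and the diagonal is \<open>l + D x\<close>.
  This Jacobi iteration contracts by \<open>D x / (l + D x)\<close>, which is below 1 because
  \<open>l > 0\<close>, and uniformly so on the finite grid.\<close>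

lemma resolvent_exists:
  fixes r :: "int^'d \<Rightarrow> real"
  assumes W: "admissible_W W" and N: "0 < N" and l: "0 < l" and \<aa>: "\<And>j x. 0 \<le> \<aa> j x"
  obtains u where "\<And>x. x \<in> sites N \<Longrightarrow> l * u x - random_walk_generator W \<aa> N u x = r x"
proof -
  define c where "c j x = (real N)\<^sup>2 * conductance W \<aa> N j x" for j x
  have c: "0 \<le> c j x" for j x
    using \<aa> W_incr_pos[OF W N, of j x] unfolding c_def N2_conductance[OF N]
    by (intro divide_nonneg_pos mult_nonneg_nonneg) auto
  define D where "D x = (\<Sum>j\<in>UNIV. c j x + c j (wrap N (x - axis j 1)))" for x
  have D: "0 \<le> D x" for x unfolding D_def by (intro sum_nonneg add_nonneg_nonneg c)
  \<comment> \<open>A crude common bound for all \<open>D x\<close>; the ratio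
    \<open>D / (l + D)\<close> increases with \<open>D\<close>.\<close>
  define Dm where "Dm = (\<Sum>x\<in>sites N. D x)"
  have Dm: "0 \<le> Dm" "D x \<le> Dm" if "x \<in> sites N" for x
    unfolding Dm_def using that finite_sites by (auto intro: sum_nonneg D member_le_sum)
  have Dm0: "0 \<le> Dm" unfolding Dm_def by (intro sum_nonneg D)
  define H where "H u x = (\<Sum>j\<in>UNIV. c j x * u (wrap N (x + axis j 1)) +
      c j (wrap N (x - axis j 1)) * u (wrap N (x - axis j 1)))" for u :: "int^'d \<Rightarrow> real" and x
  have gen: "random_walk_generator W \<aa> N u x = H u x - D x * u x" for u x
    by (simp add: random_walk_generator_def H_def D_def c_def sum_distrib_right sum_distrib_left sum_subtractf[symmetric] algebra_simps)
  define \<Phi> where "\<Phi> u x = (r x + H u x) / (l + D x)" for u x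
  obtain u where u: "\<And>x. x \<in> sites N \<Longrightarrow> \<Phi> u x = u x"
  proof (rule sup_contraction_fixpoint[of "sites N" "Dm / (l + Dm)" \<Phi>])
    fix u v :: "int^'d \<Rightarrow> real" and M and x :: "int^'d"
    assume uv: "\<And>y. y \<in> sites N \<Longrightarrow> \<bar>u y - v y\<bar> \<le> M" and x: "x \<in> sites N"
    have M: "0 \<le> M" using uv[OF x] by linarith
    have "H u x - H v x = (\<Sum>j\<in>UNIV. c j x * (u (wrap N (x + axis j 1)) - v (wrap N (x + axis j 1))) +
      c j (wrap N (x - axis j 1)) * (u (wrap N (x - axis j 1)) - v (wrap N (x - axis j 1))))"
      by (simp add: H_def sum_subtractf[symmetric] algebra_simps)
    also have "\<bar>\<dots>\<bar> \<le> (\<Sum>j\<in>UNIV. c j x * M + c j (wrap N (x - axis j 1)) * M)"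
    proof (intro order_trans[OF sum_abs] sum_mono order_trans[OF abs_triangle_ineq] add_mono)
      show "\<bar>c j x * (u (wrap N (x + axis j 1)) - v (wrap N (x + axis j 1)))\<bar> \<le> c j x * M"
        "\<bar>c j (wrap N (x - axis j 1)) * (u (wrap N (x - axis j 1)) - v (wrap N (x - axis j 1)))\<bar>
          \<le> c j (wrap N (x - axis j 1)) * M" for j
        using c uv[OF wrap_in_sites[OF N]] by (auto simp: abs_mult intro!: mult_left_mono)
    qed
    also have "\<dots> = D x * M" by (simp add: D_def sum_distrib_right distrib_right)
    finally have H: "\<bar>H u x - H v x\<bar> \<le> D x * M" .
    have "\<bar>\<Phi> u x - \<Phi> v x\<bar> = \<bar>H u x - H v x\<bar> / (l + D x)"
      using l D[of x] by (simp add: \<Phi>_def diff_divide_distrib[symmetric] abs_divide)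
    also have "\<dots> \<le> D x * M / (l + D x)" using H l D[of x] by (intro divide_right_mono) auto
    also have "D x / (l + D x) \<le> Dm / (l + Dm)"
      using l D[of x] Dm[OF x] by (simp add: field_simps)
    then have "D x * M / (l + D x) \<le> Dm / (l + Dm) * M" using mult_right_mono[OF _ M] by fastforce
    finally show "\<bar>\<Phi> u x - \<Phi> v x\<bar> \<le> Dm / (l + Dm) * M" .
  qed (use l Dm0 finite_sites in auto)
  show ?thesis
  proof (rule that)
    fix x :: "int^'d" assume "x \<in> sites N"
    from u[OF this] show "l * u x - random_walk_generator W \<aa> N u x = r x"
      using l D[of x] by (simp add: \<Phi>_def gen field_simps)
  qed
qed

lemma resolvent_weak:
  assumes "0 < N" and "\<And>x. x \<in> sites N \<Longrightarrow> l * u x - random_walk_generator W \<aa> N u x = r x"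
  shows "l * inner_N N u v + form_N W \<aa> N u v = inner_N N r v"
proof -
  have "inner_N N r v = inner_N N (\<lambda>x. l * u x - random_walk_generator W \<aa> N u x) v"
    by (rule inner_N_cong) (simp_all add: assms(2))
  also have "\<dots> = l * inner_N N u v + form_N W \<aa> N u v"
    by (simp add: inner_N_diff inner_N_scale random_walk_generator_form[OF assms(1)])
  finally show ?thesis by simp
qed

text \<open>The equation is tested with \<open>u\<close> itself: the form is nonnegative, and
  Cauchy-Schwarz does the rest. The constant depends neither on \<open>N\<close> nor on the
  environment, so truncating a series costs an error uniform in \<open>N\<close>.\<close>

lemma resolvent_bound:
  assumes W: "admissible_W W" and N: "0 < N" and l: "0 < l" and \<aa>: "\<And>j x. 0 \<le> \<aa> j x"
    and u: "\<And>x. x \<in> sites N \<Longrightarrow> l * u x - random_walk_generator W \<aa> N u x = r x"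
  shows "l\<^sup>2 * inner_N N u u \<le> inner_N N r r"
proof (cases "inner_N N u u = 0")
  case True
  then show ?thesis using inner_N_self_nonneg[of N r] by simp
next
  case False
  then have pos: "0 < inner_N N u u" using inner_N_self_nonneg[of N u] by simp
  have "l * inner_N N u u \<le> inner_N N r u"
    using resolvent_weak[OF N u, where v = u] form_N_self_nonneg[where \<aa> = \<aa> and v = u, OF W N \<aa>] by simp
  then have "(l * inner_N N u u)\<^sup>2 \<le> (inner_N N r u)\<^sup>2" using l pos by (intro power_mono) auto
  also have "\<dots> \<le> inner_N N r r * inner_N N u u" by (rule inner_N_Cauchy_Schwarz)
  finally have "(l\<^sup>2 * inner_N N u u) * inner_N N u u \<le> inner_N N r r * inner_N N u u"
    by (simp add: power2_eq_square mult.assoc mult.left_commute)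
  then show ?thesis using pos by (rule mult_right_le_imp_le)
qed

lemma inner_N_self_eq_0:
  assumes "0 < N" "inner_N N u u = 0" "x \<in> sites N"
  shows "u x = 0"
proof -
  have "(\<Sum>x\<in>sites N. u x * u x) = 0" using assms(1,2) by (simp add: inner_N_def)
  then show ?thesis using assms(3) finite_sites by (subst (asm) sum_nonneg_eq_0_iff) auto
qed

lemma random_walk_generator_diff:
  "random_walk_generator W \<aa> N (\<lambda>x. u x - v x) x = random_walk_generator W \<aa> N u x - random_walk_generator W \<aa> N v x"
  by (simp add: random_walk_generator_def sum_subtractf[symmetric] algebra_simps)

text \<open>Existence comes from the fixed point, uniqueness on the grid from
  \<open>resolvent_bound\<close> with right-hand side 0; \<open>extensional\<close> fixes the values
  elsewhere. This justifies the definite description.\<close>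

lemma corrected_function_spec:
  fixes G :: "real^'d \<Rightarrow> real"
  assumes W: "admissible_W W" and N: "0 < N" and l: "0 < l" and \<aa>: "\<And>j x. 0 \<le> \<aa> j x" and x: "x \<in> sites N"
  shows "l * corrected_function W \<aa> A l N G x - random_walk_generator W \<aa> N (corrected_function W \<aa> A l N G) x =
    l * G (grid N x) - (\<Sum>j\<in>UNIV. A j * LW W j G (grid N x))"
proof -
  let ?P = "\<lambda>g. g \<in> extensional (sites N) \<and>
     (\<forall>x\<in>sites N. l * g x - random_walk_generator W \<aa> N g x =
        l * G (grid N x) - (\<Sum>j\<in>UNIV. A j * LW W j G (grid N x)))"
  obtain u where u: "\<And>x. x \<in> sites N \<Longrightarrow> l * u x - random_walk_generator W \<aa> N u x =
      l * G (grid N x) - (\<Sum>j\<in>UNIV. A j * LW W j G (grid N x))"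
    using resolvent_exists[where \<aa> = \<aa> and r = "\<lambda>x. l * G (grid N x) - (\<Sum>j\<in>UNIV. A j * LW W j G (grid N x))", OF W N l \<aa>] by blast
  have "\<exists>!g. ?P g"
  proof (rule ex1I)
    have "random_walk_generator W \<aa> N (restrict u (sites N)) x = random_walk_generator W \<aa> N u x"
      if "x \<in> sites N" for x
      using that by (simp add: random_walk_generator_def wrap_in_sites[OF N])
    then show "?P (restrict u (sites N))" using u by simp
    fix g assume g: "?P g"
    have "u x = g x" if "x \<in> sites N" for x
    proof -
      have "l\<^sup>2 * inner_N N (\<lambda>x. u x - g x) (\<lambda>x. u x - g x) \<le> inner_N N (\<lambda>_ :: int^'d. 0) (\<lambda>_. 0)"
      proof (rule resolvent_bound[where \<aa> = \<aa>, OF W N l \<aa>])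
        fix x :: "int^'d" assume x: "x \<in> sites N"
        have "l * g x - random_walk_generator W \<aa> N g x =
          l * G (grid N x) - (\<Sum>j\<in>UNIV. A j * LW W j G (grid N x))" using g x by blast
        then show "l * (u x - g x) - random_walk_generator W \<aa> N (\<lambda>x. u x - g x) x = 0"
          using u[OF x] by (simp add: random_walk_generator_diff right_diff_distrib)
      qed
      then have "l\<^sup>2 * inner_N N (\<lambda>x. u x - g x) (\<lambda>x. u x - g x) \<le> 0" by (simp add: inner_N_def)
      then have "inner_N N (\<lambda>x. u x - g x) (\<lambda>x. u x - g x) = 0"
        using l inner_N_self_nonneg[of N "\<lambda>x. u x - g x"] by (simp add: mult_le_0_iff order.antisym)
      from inner_N_self_eq_0[OF N this that] show ?thesis by simp
    qed
    then show "g = restrict u (sites N)" using g by (auto simp: extensional_def restrict_def)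
  qed
  then have "?P (corrected_function W \<aa> A l N G)" unfolding corrected_function_def by (rule theI')
  with x show ?thesis by blast
qed

section \<open>Comparing grid functions with their interpolants\<close>

lemma torus_prob: "(\<integral>x. 1 \<partial>(torus :: (real^'d) measure)) = (1 :: real)"
proof -
  have "(\<integral>x. (\<Prod>k\<in>(UNIV :: 'd set). (\<lambda>_ _. 1 :: real) k (x $ k)) \<partial>torus) =
      (\<Prod>k\<in>(UNIV :: 'd set). \<integral>u. (\<lambda>_ _. 1 :: real) k u \<partial>circle)"
    by (rule torus.torus_measure_integral_prod) auto
  then show ?thesis by (simp add: circle.prob_space)
qed

lemma torus_measure_UNIV: "measure (torus :: (real^'d) measure) UNIV = 1"
  using torus_prob by (simp add: torus.space_torus_measure)

lemma card_sites:
  assumes "0 < N"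
  shows "real (card (sites N :: (int^'d) set)) = real N ^ CARD('d)"
proof -
  have "1 = (\<Sum>y\<in>(sites N :: (int^'d) set). 1) / real N ^ CARD('d)"
    using cell_function_integral[OF assms, of "\<lambda>_ :: int^'d. 1"] by (simp add: torus_measure_UNIV torus.space_torus_measure)
  then show ?thesis using assms by (simp add: field_simps)
qed

text \<open>The share of sites with a prescribed \<open>j\<close>-th coordinate is the measure of a
  slab of the torus, which is a product of one-dimensional integrals.\<close>

lemma sum_sites_coordinate:
  fixes h :: "int \<Rightarrow> real" and j :: "'d::finite"
  assumes N: "0 < N"
  shows "(\<Sum>y\<in>sites N. h (y $ j)) / real N ^ CARD('d) = (\<Sum>i\<in>{0..<int N}. h i) / real N"
proof -
  have ind: "(\<Sum>y\<in>sites N. if y $ j = i then 1 else 0) / real N ^ CARD('d) = 1 / real N"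
    if i: "i \<in> {0..<int N}" for i
  proof -
    define S where "S k = (if k = j then {u. \<lfloor>real N * u\<rfloor> mod int N = i} else UNIV)" for k
    have S: "S k \<in> sets borel" for k unfolding S_def by simp measurable
    have "(\<Sum>y\<in>sites N. if y $ j = i then 1 else 0) / real N ^ CARD('d) =
        (\<integral>x. (if wrap N (cell_of N x) $ j = i then 1 else 0) \<partial>torus)"
      by (rule cell_function_integral[OF N, symmetric])
    also have "\<dots> = (\<integral>x. indicat_real {x :: real^'d. \<forall>k. x $ k \<in> S k} x \<partial>torus)"
      by (rule Bochner_Integration.integral_cong) (auto simp: S_def wrap_def cell_of_def indicator_def)
    also have "\<dots> = measure torus {x :: real^'d. \<forall>k. x $ k \<in> S k}"
      by (simp add: torus.space_torus_measure)
    also have "\<dots> = (\<Prod>k\<in>UNIV. \<integral>u. indicat_real (S k) u \<partial>circle)"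
      by (rule torus_measure_box[OF S])
    also have "\<dots> = (\<Prod>k\<in>UNIV. if k = j then 1 / real N else 1)"
    proof (rule prod.cong[OF refl])
      fix k
      show "(\<integral>u. indicat_real (S k) u \<partial>circle) = (if k = j then 1 / real N else 1)"
        using circle_integral_cell[OF N, of i] i by (simp add: S_def circle.prob_space)
    qed
    finally show ?thesis by simp
  qed
  have "(\<Sum>y\<in>sites N. h (y $ j)) = (\<Sum>y\<in>sites N. \<Sum>i\<in>{0..<int N}. h i * (if y $ j = i then 1 else 0))"
    by (intro sum.cong refl) (simp add: sites_def if_distrib[of "\<lambda>x. _ * x"] cong: if_cong)
  also have "\<dots> = (\<Sum>i\<in>{0..<int N}. h i * (\<Sum>y\<in>sites N. if (y :: int^'d) $ j = i then 1 else 0))"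
    by (subst sum.swap) (simp add: sum_distrib_left)
  finally have "(\<Sum>y\<in>sites N. h (y $ j)) / real N ^ CARD('d) =
      (\<Sum>i\<in>{0..<int N}. h i * ((\<Sum>y\<in>sites N. if (y :: int^'d) $ j = i then 1 else 0) / real N ^ CARD('d)))"
    by (simp only: sum_divide_distrib[where A = "{0..<int N}"] times_divide_eq_right)
  also have "\<dots> = (\<Sum>i\<in>{0..<int N}. h i * (1 / real N))"
    by (intro sum.cong refl) (simp only: ind)
  finally show ?thesis by (simp add: sum_divide_distrib)
qed

text \<open>Increments along a line of the grid telescope to the mass. This is the source of the
  rate \<open>1 / N\<close>: at a jump of \<open>W\<close> a single increment stays bounded away
  from 0, so only the average can be small.\<close>

lemma W_incr_mean:
  fixes W :: "'d::finite \<Rightarrow> real \<Rightarrow> real"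
  assumes "0 < N"
  shows "(\<Sum>y\<in>sites N. W_incr W N j y) / real N ^ CARD('d) = (W j 1 - W j 0) / real N"
proof -
  have "(\<Sum>y\<in>sites N. W_incr W N j y) / real N ^ CARD('d) =
      (\<Sum>i\<in>{0..<int N}. W j (real_of_int (i + 1) / real N) - W j (real_of_int i / real N)) / real N"
    unfolding W_incr_eq by (rule sum_sites_coordinate[OF assms])
  also have "(\<Sum>i\<in>{0..<int N}. W j (real_of_int (i + 1) / real N) - W j (real_of_int i / real N)) =
      (\<Sum>i<N. W j (real (Suc i) / real N) - W j (real i / real N))"
    by (rule sum.reindex_bij_witness[of _ int nat]) (auto simp: add.commute)
  also have "\<dots> = W j 1 - W j 0"
    using assms by (subst sum_lessThan_telescope) simp
  finally show ?thesis .
qed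

lemma square_sum_le: "(a + b)\<^sup>2 \<le> 2 * a\<^sup>2 + 2 * b\<^sup>2" for a b :: real
  using sum_squares_bound[of a b] unfolding power2_sum by linarith

lemma sum_UNIV_power2_le:
  fixes f :: "'d::finite \<Rightarrow> real"
  shows "(\<Sum>j\<in>UNIV. f j)\<^sup>2 \<le> real CARD('d) * (\<Sum>j\<in>UNIV. (f j)\<^sup>2)"
  using Cauchy_Schwarz_ineq_sum[of "\<lambda>_. 1" f UNIV] by simp

text \<open>Cauchy--Schwarz against the increments of \<open>W\<close>, which are \<open>O(1/N)\<close> on average.\<close>

lemma diff_N_L1:
  fixes v :: "int^'d \<Rightarrow> real"
  assumes W: "admissible_W W" and N: "0 < N"
  shows "((\<Sum>j\<in>UNIV. \<Sum>x\<in>sites N. \<bar>diff_N N j v x\<bar>) / real N ^ CARD('d))\<^sup>2 \<le>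
    (\<Sum>j\<in>UNIV. W j 1 - W j 0) / (real N)\<^sup>2 * form_N W (\<lambda>_ _. 1) N v v"
proof -
  let ?I = "(UNIV :: 'd set) \<times> (sites N :: (int^'d) set)"
  let ?f = "\<lambda>p. sqrt (W_incr W N (fst p) (snd p) / real N)"
  let ?g = "\<lambda>p. \<bar>diff_N N (fst p) v (snd p)\<bar> / sqrt (W_incr W N (fst p) (snd p) / real N)"
  note pos = W_incr_pos[OF W N]
  have "(\<Sum>j\<in>UNIV. \<Sum>x\<in>sites N. \<bar>diff_N N j v x\<bar>) = (\<Sum>p\<in>?I. ?f p * ?g p)"
    unfolding sum.cartesian_product using pos N
    by (intro sum.cong) (auto simp: less_imp_neq[symmetric])
  also have "(\<Sum>p\<in>?I. ?f p * ?g p)\<^sup>2 \<le> (\<Sum>p\<in>?I. (?f p)\<^sup>2) * (\<Sum>p\<in>?I. (?g p)\<^sup>2)"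
    by (rule Cauchy_Schwarz_ineq_sum)
  also have "(\<Sum>p\<in>?I. (?f p)\<^sup>2) = (\<Sum>j\<in>UNIV. \<Sum>x\<in>sites N. W_incr W N j x) / real N"
    using pos by (simp add: sum.cartesian_product sum_divide_distrib less_imp_le case_prod_beta)
  also have "(\<Sum>p\<in>?I. (?g p)\<^sup>2) = (\<Sum>j\<in>UNIV. \<Sum>x\<in>sites N.
     real N * 1 / W_incr W N j x * diff_N N j v x * diff_N N j v x)"
    using pos by (simp add: sum.cartesian_product power_divide less_imp_le case_prod_beta power2_eq_square mult_ac)
  finally have "(\<Sum>j\<in>UNIV. \<Sum>x\<in>sites N. \<bar>diff_N N j v x\<bar>)\<^sup>2 / (real N ^ CARD('d))\<^sup>2 \<le>
     (\<Sum>j\<in>UNIV. \<Sum>x\<in>sites N. W_incr W N j x) / real N * (\<Sum>j\<in>UNIV. \<Sum>x\<in>sites N.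
     real N * 1 / W_incr W N j x * diff_N N j v x * diff_N N j v x) / (real N ^ CARD('d))\<^sup>2"
    by (intro divide_right_mono) auto
  also have "\<dots> = (\<Sum>j\<in>UNIV. (\<Sum>x\<in>sites N. W_incr W N j x) / real N ^ CARD('d)) / real N * form_N W (\<lambda>_ _. 1) N v v"
    by (simp add: form_N_def power2_eq_square sum_divide_distrib[symmetric])
  also have "(\<Sum>j\<in>UNIV. (\<Sum>x\<in>sites N. W_incr W N j x) / real N ^ CARD('d)) / real N = (\<Sum>j\<in>UNIV. W j 1 - W j 0) / (real N)\<^sup>2"
    by (simp add: W_incr_mean[OF N] sum_divide_distrib[symmetric] power2_eq_square)
  finally show ?thesis by (simp add: power_divide)
qed

text \<open>Of the two increments that Cauchy-Schwarz produces, one is bounded by the mass and the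
  other is averaged, which gains \<open>1 / N\<close>.\<close>

lemma W_incr_weighted_L1:
  fixes v :: "int^'d \<Rightarrow> real"
  assumes W: "admissible_W W" and N: "0 < N"
  shows "((\<Sum>j\<in>UNIV. \<Sum>x\<in>sites N. W_incr W N j x * \<bar>v x\<bar>) / real N ^ CARD('d))\<^sup>2 \<le>
    real CARD('d) * (\<Sum>j\<in>UNIV. (W j 1 - W j 0)\<^sup>2) / real N * inner_N N v v"
proof -
  have one: "((\<Sum>x\<in>sites N. W_incr W N j x * \<bar>v x\<bar>) / real N ^ CARD('d))\<^sup>2 \<le> (W j 1 - W j 0)\<^sup>2 / real N * inner_N N v v" for j
  proof -
    have "((\<Sum>x\<in>sites N. W_incr W N j x * \<bar>v x\<bar>) / real N ^ CARD('d))\<^sup>2 =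
        (inner_N N (W_incr W N j) (\<lambda>x. \<bar>v x\<bar>))\<^sup>2" by (simp add: inner_N_def)
    also have "\<dots> \<le> inner_N N (W_incr W N j) (W_incr W N j) * inner_N N (\<lambda>x. \<bar>v x\<bar>) (\<lambda>x. \<bar>v x\<bar>)"
      by (rule inner_N_Cauchy_Schwarz)
    also have "\<dots> = inner_N N (W_incr W N j) (W_incr W N j) * inner_N N v v" by (simp add: inner_N_def)
    also have "\<dots> \<le> ((\<Sum>x\<in>sites N. (W j 1 - W j 0) * W_incr W N j (x :: int^'d)) / real N ^ CARD('d)) * inner_N N v v"
      unfolding inner_N_def[of N "W_incr W N j"]
      using W_incr_le_mass[OF W N] W_incr_pos[OF W N]
      by (intro mult_right_mono divide_right_mono sum_mono inner_N_self_nonneg) (auto intro: less_imp_le)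
    also have "(\<Sum>x\<in>sites N. (W j 1 - W j 0) * W_incr W N j (x :: int^'d)) / real N ^ CARD('d) = (W j 1 - W j 0)\<^sup>2 / real N"
      unfolding sum_distrib_left[symmetric] times_divide_eq_right[symmetric] W_incr_mean[OF N]
      by (simp add: power2_eq_square)
    finally show ?thesis .
  qed
  have "((\<Sum>j\<in>UNIV. \<Sum>x\<in>sites N. W_incr W N j x * \<bar>v x\<bar>) / real N ^ CARD('d))\<^sup>2 =
      (\<Sum>j\<in>UNIV. (\<Sum>x\<in>sites N. W_incr W N j x * \<bar>v x\<bar>) / real N ^ CARD('d))\<^sup>2"
    by (simp add: sum_divide_distrib)
  also have "\<dots> \<le> real CARD('d) * (\<Sum>j\<in>UNIV. ((\<Sum>x\<in>sites N. W_incr W N j x * \<bar>v x\<bar>) / real N ^ CARD('d))\<^sup>2)"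
    by (rule sum_UNIV_power2_le)
  also have "\<dots> \<le> real CARD('d) * (\<Sum>j\<in>UNIV. (W j 1 - W j 0)\<^sup>2 / real N * inner_N N v v)"
    using one by (intro mult_left_mono sum_mono) auto
  finally show ?thesis by (simp add: sum_distrib_right[symmetric] sum_divide_distrib[symmetric])
qed

text \<open>The coordinates are raised one at a time; translation invariance of the sum puts every
  difference back at \<open>y\<close>.\<close>

lemma shift_set_L1:
  fixes v :: "int^'d \<Rightarrow> real"
  assumes N: "0 < N"
  shows "(\<Sum>y\<in>sites N. \<bar>v (wrap N (y + (\<chi> k. if k \<in> S then 1 else 0))) - v y\<bar>)
    \<le> (\<Sum>j\<in>S. \<Sum>y\<in>sites N. \<bar>diff_N N j v y\<bar>)"
proof -
  have "finite S" by simp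
  then show ?thesis
  proof (induction S rule: finite_induct)
    case empty
    have "(\<chi> k. 0) = (0 :: int^'d)" by (simp add: vec_eq_iff)
    then show ?case by (simp add: wrap_sites)
  next
    case (insert j S)
    define s where "s = ((\<chi> k. if k \<in> S then 1 else 0) :: int^'d)"
    have split: "(\<chi> k. if k \<in> insert j S then 1 else 0) = s + axis j 1"
      using insert.hyps by (auto simp: vec_eq_iff s_def axis_def)
    have "\<bar>v (wrap N (y + (s + axis j 1))) - v y\<bar> \<le> \<bar>diff_N N j v (wrap N (y + s))\<bar> + \<bar>v (wrap N (y + s)) - v y\<bar>" for y
    proof -
      have "wrap N (wrap N (y + s) + axis j 1) = wrap N (y + (s + axis j 1))"
        by (simp add: wrap_wrap_add add.assoc)
      then have "v (wrap N (y + (s + axis j 1))) - v y = diff_N N j v (wrap N (y + s)) + (v (wrap N (y + s)) - v y)"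
        by (simp add: diff_N_def)
      then show ?thesis using abs_triangle_ineq by metis
    qed
    then have "(\<Sum>y\<in>sites N. \<bar>v (wrap N (y + (s + axis j 1))) - v y\<bar>) \<le>
        (\<Sum>y\<in>sites N. \<bar>diff_N N j v (wrap N (y + s))\<bar>) + (\<Sum>y\<in>sites N. \<bar>v (wrap N (y + s)) - v y\<bar>)"
      unfolding sum.distrib[symmetric] by (rule sum_mono)
    also have "(\<Sum>y\<in>sites N. \<bar>diff_N N j v (wrap N (y + s))\<bar>) = (\<Sum>y\<in>sites N. \<bar>diff_N N j v y\<bar>)"
      by (rule sum_sites_shift[OF N])
    finally show ?case unfolding split using insert.IH insert.hyps by (simp add: s_def)
  qed
qed

section \<open>The interpolant compared with the step function of nodal values\<close>

definition interp_weight :: "('d \<Rightarrow> real \<Rightarrow> real) \<Rightarrow> nat \<Rightarrow> real^'d \<Rightarrow> 'd \<Rightarrow> real" where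
  "interp_weight W N x k = (W k (x $ k) - W k (real_of_int (cell_of N x $ k) / real N)) /
     (W k (real_of_int (cell_of N x $ k + 1) / real N) - W k (real_of_int (cell_of N x $ k) / real N))"

lemma interp_eq:
  "interp W N v x = (\<Sum>S\<in>UNIV. (\<Prod>k\<in>UNIV. if k \<in> S then interp_weight W N x k else 1 - interp_weight W N x k) *
     v (wrap N (cell_of N x + (\<chi> k. if k \<in> S then 1 else 0))))"
  unfolding interp_def interp_weight_def cell_of_def Let_def ..

lemma cell_of_bounds:
  assumes "0 < N"
  shows "real_of_int (cell_of N x $ k) / real N \<le> x $ k" "x $ k < real_of_int (cell_of N x $ k + 1) / real N"
  using assms floor_correct[of "real N * x $ k"] by (simp_all add: cell_of_def field_simps)

lemma interp_weight_bounds: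
  assumes W: "admissible_W W" and N: "0 < N"
  shows "0 \<le> interp_weight W N x k" "interp_weight W N x k \<le> 1"
proof -
  interpret gauge "W k" by (rule admissible_W_gauge[OF W])
  note c = cell_of_bounds[OF N, of x k]
  show "0 \<le> interp_weight W N x k" "interp_weight W N x k \<le> 1"
    unfolding interp_weight_def using mono[OF c(1)] less[OF c(2)] less[OF le_less_trans[OF c]]
    by (auto simp: divide_le_eq_1)
qed

text \<open>This is the expansion of the product of all \<open>w k + (1 - w k)\<close>.\<close>

lemma interp_coeff_sum: "(\<Sum>S\<in>UNIV. \<Prod>k\<in>(UNIV :: 'd::finite set). if k \<in> S then w k else 1 - w k) = (1 :: real)"
proof -
  have "(\<Prod>k\<in>(UNIV :: 'd set). w k + (1 - w k)) = (\<Sum>S\<in>Pow UNIV. (\<Prod>k\<in>S. w k) * (\<Prod>k\<in>UNIV - S. 1 - w k))"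
    by (rule prod_add) simp
  also have "\<dots> = (\<Sum>S\<in>UNIV. \<Prod>k\<in>UNIV. if k \<in> S then w k else 1 - w k)"
    by (rule sum.cong) (auto simp: prod.If_cases Compl_eq_Diff_UNIV)
  finally show ?thesis by simp
qed

lemma interp_near_cell_value:
  assumes W: "admissible_W W" and N: "0 < N"
  shows "\<bar>interp W N v x - v (wrap N (cell_of N x))\<bar> \<le>
    (\<Sum>S\<in>UNIV. \<bar>v (wrap N (wrap N (cell_of N x) + (\<chi> k. if k \<in> S then 1 else 0))) - v (wrap N (cell_of N x))\<bar>)"
proof -
  define c where "c S = (\<Prod>k\<in>UNIV. if k \<in> S then interp_weight W N x k else 1 - interp_weight W N x k)" for S
  have c: "0 \<le> c S" "c S \<le> 1" for S
    unfolding c_def using interp_weight_bounds[OF W N, of x]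
    by (auto intro!: prod_nonneg prod_le_1)
  have "interp W N v x - v (wrap N (cell_of N x)) =
      (\<Sum>S\<in>UNIV. c S * (v (wrap N (cell_of N x + (\<chi> k. if k \<in> S then 1 else 0))) - v (wrap N (cell_of N x))))"
    using interp_coeff_sum[of "interp_weight W N x"]
    by (simp add: interp_eq c_def[symmetric] right_diff_distrib sum_subtractf sum_distrib_right[symmetric])
  also have "\<bar>\<dots>\<bar> \<le> (\<Sum>S\<in>UNIV. 1 * \<bar>v (wrap N (cell_of N x + (\<chi> k. if k \<in> S then 1 else 0))) - v (wrap N (cell_of N x))\<bar>)"
    using c by (intro order_trans[OF sum_abs] sum_mono) (auto simp: abs_mult intro!: mult_left_le_one_le)
  finally show ?thesis by (simp add: wrap_wrap_add)
qed

lemma interp_measurable: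
  fixes W :: "'d::finite \<Rightarrow> real \<Rightarrow> real"
  assumes W: "admissible_W W" and N: "0 < N"
  shows "interp W N v \<in> borel_measurable borel"
proof -
  have W_meas[measurable]: "W k \<in> borel_measurable borel" for k
  proof -
    interpret gauge "W k" by (rule admissible_W_gauge[OF W])
    show ?thesis by (rule borel_measurable_mono) (auto intro: monoI mono)
  qed
  have "(\<lambda>x. interp_weight W N x k) \<in> borel_measurable borel" for k
    unfolding interp_weight_def cell_of_def vec_lambda_beta
    by (rule nth_borel[of "\<lambda>u. (W k u - W k (real_of_int \<lfloor>real N * u\<rfloor> / real N)) /
      (W k (real_of_int (\<lfloor>real N * u\<rfloor> + 1) / real N) - W k (real_of_int \<lfloor>real N * u\<rfloor> / real N))"]) measurable
  then have "(\<lambda>x. if k \<in> S then interp_weight W N x k else 1 - interp_weight W N x k) \<in> borel_measurable borel" for k S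
    by (cases "k \<in> S") auto
  moreover have "(\<lambda>x. v (wrap N (cell_of N x + s))) \<in> borel_measurable borel" for s
    using cell_function_measurable[OF N, of "\<lambda>y. v (wrap N (y + s))"] by (simp add: wrap_wrap_add)
  ultimately show ?thesis
    unfolding interp_eq[abs_def] by (intro borel_measurable_sum borel_measurable_times borel_measurable_prod)
qed

text \<open>The interpolant is a convex combination of the values at the \<open>2 ^ d\<close>
  corners, each reached from the lower corner along edges of the grid. Closeness to the step
  function is measured in \<open>L1\<close>, since the energy controls the differences of
  \<open>v\<close> only in the mean.\<close>

lemma interp_L1:
  fixes v :: "int^'d \<Rightarrow> real"
  assumes W: "admissible_W W" and N: "0 < N"
  shows "integrable torus (\<lambda>x. \<bar>interp W N v x - v (wrap N (cell_of N x))\<bar>)"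
    and "(\<integral>x. \<bar>interp W N v x - v (wrap N (cell_of N x))\<bar> \<partial>torus) \<le>
      2 ^ CARD('d) * ((\<Sum>j\<in>UNIV. \<Sum>y\<in>sites N. \<bar>diff_N N j v y\<bar>) / real N ^ CARD('d))"
    and "integrable torus (interp W N v)"
proof -
  define \<psi> where "\<psi> y = (\<Sum>S\<in>UNIV. \<bar>v (wrap N (y + (\<chi> k. if k \<in> S then 1 else 0))) - v y\<bar>)" for y
  have le: "\<bar>interp W N v x - v (wrap N (cell_of N x))\<bar> \<le> \<psi> (wrap N (cell_of N x))" for x
    unfolding \<psi>_def by (rule interp_near_cell_value[OF W N])
  have meas: "(\<lambda>x. interp W N v x - v (wrap N (cell_of N x))) \<in> borel_measurable torus"
    using interp_measurable[OF W N, of v] cell_function_measurable[OF N, of v]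
    by (intro torus.borel_torus_measure) auto
  have int: "integrable torus (\<lambda>x. interp W N v x - v (wrap N (cell_of N x)))"
    by (rule Bochner_Integration.integrable_bound[OF cell_function_integrable[OF N, of \<psi>] meas])
      (use le in \<open>auto intro!: AE_I2 order_trans[OF _ abs_ge_self]\<close>)
  then show int': "integrable torus (\<lambda>x. \<bar>interp W N v x - v (wrap N (cell_of N x))\<bar>)" by simp
  show "integrable torus (interp W N v)"
    using Bochner_Integration.integrable_add[OF int cell_function_integrable[OF N, of v]] by simp
  have "(\<integral>x. \<bar>interp W N v x - v (wrap N (cell_of N x))\<bar> \<partial>torus) \<le> (\<integral>x. \<psi> (wrap N (cell_of N x)) \<partial>torus)"
    by (rule integral_mono[OF int' cell_function_integrable[OF N]]) (rule le)
  also have "\<dots> = (\<Sum>y\<in>sites N. \<psi> y) / real N ^ CARD('d)"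
    by (rule cell_function_integral[OF N])
  also have "(\<Sum>y\<in>sites N. \<psi> y) \<le> (\<Sum>S\<in>(UNIV :: 'd set set). \<Sum>j\<in>UNIV. \<Sum>y\<in>sites N. \<bar>diff_N N j v y\<bar>)"
    unfolding \<psi>_def
    by (subst sum.swap) (intro sum_mono order_trans[OF shift_set_L1[OF N]] sum_mono2; auto intro: sum_nonneg)
  also have "\<dots> = 2 ^ CARD('d) * (\<Sum>j\<in>UNIV. \<Sum>y\<in>sites N. \<bar>diff_N N j v y\<bar>)"
    by (simp add: card_UNIV_set)
  finally show "(\<integral>x. \<bar>interp W N v x - v (wrap N (cell_of N x))\<bar> \<partial>torus) \<le>
      2 ^ CARD('d) * ((\<Sum>j\<in>UNIV. \<Sum>y\<in>sites N. \<bar>diff_N N j v y\<bar>) / real N ^ CARD('d))"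
    by (simp add: divide_right_mono)
qed

lemma grid_wrap_periodic:
  assumes "periodic \<phi>" "0 < N"
  shows "\<phi> (grid N (wrap N y)) = \<phi> (grid N y)"
proof -
  have "grid N (wrap N y) + (\<chi> k. real_of_int (y $ k div int N)) = grid N y"
  proof -
    have "real_of_int (y $ k) = real N * real_of_int (y $ k div int N) + real_of_int (y $ k mod int N)" for k
      by (metis mult_div_mod_eq of_int_add of_int_mult of_int_of_nat_eq)
    then have "real_of_int (y $ k mod int N) / real N + real_of_int (y $ k div int N) = real_of_int (y $ k) / real N" for k
      using assms(2) by (simp add: field_simps)
    then show ?thesis by (simp add: vec_eq_iff grid_def wrap_def)
  qed
  then show ?thesis using periodic_add_int[OF assms(1), of "grid N (wrap N y)" "\<lambda>k. y $ k div int N"] by simp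
qed

text \<open>The point \<open>x\<close> lies in the cell above the corner, so monotonicity bounds
  each difference of \<open>W k\<close> by the increment over the cell; by periodicity,
  \<open>wrap\<close> affects neither side.\<close>

lemma cell_oscillation:
  fixes W :: "'d::finite \<Rightarrow> real \<Rightarrow> real"
  assumes W: "admissible_W W" and N: "0 < N" and \<phi>: "periodic \<phi>"
    and C: "\<And>x y. \<bar>\<phi> x - \<phi> y\<bar> \<le> C * (\<Sum>k\<in>UNIV. \<bar>W k (x $ k) - W k (y $ k)\<bar>)" "0 \<le> C"
  shows "\<bar>\<phi> (grid N (wrap N (cell_of N x))) - \<phi> x\<bar> \<le> C * (\<Sum>k\<in>UNIV. W_incr W N k (wrap N (cell_of N x)))"
proof -
  have "\<bar>\<phi> (grid N (wrap N (cell_of N x))) - \<phi> x\<bar> = \<bar>\<phi> x - \<phi> (grid N (cell_of N x))\<bar>"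
    by (simp add: grid_wrap_periodic[OF \<phi> N] abs_minus_commute)
  also have "\<dots> \<le> C * (\<Sum>k\<in>UNIV. \<bar>W k (x $ k) - W k (grid N (cell_of N x) $ k)\<bar>)" by (rule C(1))
  also have "\<dots> \<le> C * (\<Sum>k\<in>UNIV. W_incr W N k (wrap N (cell_of N x)))"
  proof (intro mult_left_mono sum_mono C(2))
    fix k
    interpret gauge "W k" by (rule admissible_W_gauge[OF W])
    show "\<bar>W k (x $ k) - W k (grid N (cell_of N x) $ k)\<bar> \<le> W_incr W N k (wrap N (cell_of N x))"
      unfolding W_incr_wrap[OF W N] unfolding W_incr_eq
      using mono[OF cell_of_bounds(1)[OF N, of x k]] less[OF cell_of_bounds(2)[OF N, of x k]]
      by (simp add: grid_def)
  qed
  finally show ?thesis .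
qed

text \<open>This exchanges the nodal pairing, which enters the corrected function, for the integral
  against the interpolant, which homogenization sees. Two errors arise: \<open>\<phi>\<close> varies
  within a cell (\<open>P\<close>, weighted by increments of \<open>W\<close>), and the interpolant
  leaves the nodal value (\<open>Q\<close>). Their squares are \<open>O(1/N)\<close> times the
  energy of \<open>v\<close>, with \<open>K\<close> independent of \<open>v\<close>, as is needed
  for solutions that vary with \<open>N\<close>.\<close>

lemma interp_defect:
  fixes W :: "'d::finite \<Rightarrow> real \<Rightarrow> real"
  assumes W: "admissible_W W" and \<phi>: "periodic \<phi>" "\<phi> \<in> borel_measurable borel"
    and C0: "\<And>x. \<bar>\<phi> x\<bar> \<le> C0"
    and C1: "\<And>x y. \<bar>\<phi> x - \<phi> y\<bar> \<le> C1 * (\<Sum>k\<in>UNIV. \<bar>W k (x $ k) - W k (y $ k)\<bar>)" "0 \<le> C1"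
  obtains K where "0 \<le> K" "\<And>N v. 0 < N \<Longrightarrow>
    (inner_N N (\<lambda>x. \<phi> (grid N x)) v - (\<integral>x. \<phi> x * interp W N v x \<partial>torus))\<^sup>2
      \<le> K / real N * (inner_N N v v + form_N W (\<lambda>_ _. 1) N v v)"
proof -
  define mass2 where "mass2 = (\<Sum>j\<in>UNIV. (W j 1 - W j 0)\<^sup>2)"
  define mass1 where "mass1 = (\<Sum>j\<in>UNIV. W j 1 - W j 0)"
  \<comment> \<open>The factors 2 stem from the square of a sum; the power of 2 in \<open>K2\<close>
    counts the corners of a cell.\<close>
  define K1 where "K1 = 2 * (C1\<^sup>2 * (real CARD('d) * mass2))"
  define K2 where "K2 = 2 * (C0\<^sup>2 * ((2 ^ CARD('d))\<^sup>2 * mass1))"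
  have mass1: "0 \<le> mass1" unfolding mass1_def
    using gauge.mass_pos[OF admissible_W_gauge[OF W]] by (intro sum_nonneg) (auto intro: less_imp_le)
  have K12: "0 \<le> K1" "0 \<le> K2" using mass1 by (auto simp: K1_def K2_def mass2_def sum_nonneg)
  have C0': "0 \<le> C0" using C0[of 0] by linarith
  show ?thesis
  proof (rule that[of "K1 + K2"])
    show "0 \<le> K1 + K2" using K12 by simp
    fix N :: nat and v :: "int^'d \<Rightarrow> real"
    assume N: "0 < N"
    let ?c = "\<lambda>x. wrap N (cell_of N x)"
    define D where "D = inner_N N (\<lambda>x. \<phi> (grid N x)) v - (\<integral>x. \<phi> x * interp W N v x \<partial>torus)"
    define P where "P = (\<Sum>j\<in>UNIV. \<Sum>x\<in>sites N. W_incr W N j x * \<bar>v x\<bar>) / real N ^ CARD('d)"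
    define Q where "Q = (\<Sum>j\<in>UNIV. \<Sum>y\<in>sites N. \<bar>diff_N N j v y\<bar>) / real N ^ CARD('d)"
    have [measurable]: "\<phi> \<in> borel_measurable torus" by (rule torus.borel_torus_measure[OF \<phi>(2)])
    have [measurable]: "interp W N v \<in> borel_measurable torus"
      by (rule torus.borel_torus_measure[OF interp_measurable[OF W N]])
    have int_interp: "integrable torus (\<lambda>x. \<phi> x * interp W N v x)"
      by (rule Bochner_Integration.integrable_bound[OF integrable_mult_right[OF interp_L1(3)[OF W N, of v], of C0]])
        (use C0 C0' in \<open>auto simp: abs_mult intro!: AE_I2 mult_right_mono\<close>)
    have cell_int: "integrable torus (\<lambda>x. \<phi> (grid N (?c x)) * v (?c x))"
      by (rule cell_function_integrable[OF N, of "\<lambda>y. \<phi> (grid N y) * v y"])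
    have "inner_N N (\<lambda>x. \<phi> (grid N x)) v = (\<integral>x. \<phi> (grid N (?c x)) * v (?c x) \<partial>torus)"
      unfolding inner_N_def by (rule cell_function_integral[OF N, symmetric])
    then have "D = (\<integral>x. \<phi> (grid N (?c x)) * v (?c x) - \<phi> x * interp W N v x \<partial>torus)"
      using int_interp cell_int by (simp add: D_def)
    also have "\<bar>\<dots>\<bar> \<le> (\<integral>x. \<bar>\<phi> (grid N (?c x)) * v (?c x) - \<phi> x * interp W N v x\<bar> \<partial>torus)"
      by (rule integral_abs_bound)
    also have "\<dots> \<le> (\<integral>x. C1 * (\<Sum>j\<in>UNIV. W_incr W N j (?c x) * \<bar>v (?c x)\<bar>) + C0 * \<bar>interp W N v x - v (?c x)\<bar> \<partial>torus)"
    proof (rule integral_mono)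
      show "integrable torus (\<lambda>x. \<bar>\<phi> (grid N (?c x)) * v (?c x) - \<phi> x * interp W N v x\<bar>)"
        using int_interp cell_int by auto
      show "integrable torus (\<lambda>x. C1 * (\<Sum>j\<in>UNIV. W_incr W N j (?c x) * \<bar>v (?c x)\<bar>) + C0 * \<bar>interp W N v x - v (?c x)\<bar>)"
        using cell_function_integrable[OF N, of "\<lambda>y. \<Sum>j\<in>UNIV. W_incr W N j y * \<bar>v y\<bar>"] interp_L1(1)[OF W N, of v]
        by (intro Bochner_Integration.integrable_add integrable_mult_right) auto
      fix x :: "real^'d"
      have "\<bar>\<phi> (grid N (?c x)) - \<phi> x\<bar> \<le> C1 * (\<Sum>k\<in>UNIV. W_incr W N k (?c x))"
        by (rule cell_oscillation[OF W N \<phi>(1) C1])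
      then have "\<bar>(\<phi> (grid N (?c x)) - \<phi> x) * v (?c x)\<bar> \<le> (C1 * (\<Sum>k\<in>UNIV. W_incr W N k (?c x))) * \<bar>v (?c x)\<bar>"
        unfolding abs_mult by (rule mult_right_mono) simp
      also have "\<dots> = C1 * (\<Sum>j\<in>UNIV. W_incr W N j (?c x) * \<bar>v (?c x)\<bar>)"
        by (simp add: sum_distrib_right)
      finally have 1: "\<bar>(\<phi> (grid N (?c x)) - \<phi> x) * v (?c x)\<bar> \<le> C1 * (\<Sum>j\<in>UNIV. W_incr W N j (?c x) * \<bar>v (?c x)\<bar>)" .
      have 2: "\<bar>\<phi> x * (interp W N v x - v (?c x))\<bar> \<le> C0 * \<bar>interp W N v x - v (?c x)\<bar>"
        unfolding abs_mult by (intro mult_right_mono C0) simp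
      have "\<phi> (grid N (?c x)) * v (?c x) - \<phi> x * interp W N v x =
          (\<phi> (grid N (?c x)) - \<phi> x) * v (?c x) - \<phi> x * (interp W N v x - v (?c x))"
        by (simp add: algebra_simps)
      then show "\<bar>\<phi> (grid N (?c x)) * v (?c x) - \<phi> x * interp W N v x\<bar> \<le>
          C1 * (\<Sum>j\<in>UNIV. W_incr W N j (?c x) * \<bar>v (?c x)\<bar>) + C0 * \<bar>interp W N v x - v (?c x)\<bar>"
        using 1 2 abs_triangle_ineq4[of "(\<phi> (grid N (?c x)) - \<phi> x) * v (?c x)" "\<phi> x * (interp W N v x - v (?c x))"]
        by linarith
    qed
    also have "\<dots> = C1 * (\<integral>x. (\<Sum>j\<in>UNIV. W_incr W N j (?c x) * \<bar>v (?c x)\<bar>) \<partial>torus) +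
        C0 * (\<integral>x. \<bar>interp W N v x - v (?c x)\<bar> \<partial>torus)"
      using cell_function_integrable[OF N, of "\<lambda>y. \<Sum>j\<in>UNIV. W_incr W N j y * \<bar>v y\<bar>"] interp_L1(1)[OF W N, of v]
      by simp
    also have "(\<integral>x. (\<Sum>j\<in>UNIV. W_incr W N j (?c x) * \<bar>v (?c x)\<bar>) \<partial>torus) = P"
      unfolding P_def using cell_function_integral[OF N, of "\<lambda>y. \<Sum>j\<in>UNIV. W_incr W N j y * \<bar>v y\<bar>"]
      by (simp add: sum.swap[of _ UNIV])
    also have "C1 * P + C0 * (\<integral>x. \<bar>interp W N v x - v (?c x)\<bar> \<partial>torus) \<le> C1 * P + C0 * (2 ^ CARD('d) * Q)"
      unfolding Q_def by (intro add_left_mono mult_left_mono interp_L1(2)[OF W N] C0')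
    finally have "\<bar>D\<bar>\<^sup>2 \<le> (C1 * P + C0 * (2 ^ CARD('d) * Q))\<^sup>2" by (intro power_mono) auto
    also have "\<dots> \<le> 2 * (C1\<^sup>2 * P\<^sup>2) + 2 * (C0\<^sup>2 * ((2 ^ CARD('d))\<^sup>2 * Q\<^sup>2))"
      using square_sum_le[of "C1 * P" "C0 * (2 ^ CARD('d) * Q)"] by (simp only: power_mult_distrib)
    also have "\<dots> \<le> 2 * (C1\<^sup>2 * (real CARD('d) * mass2 / real N * inner_N N v v)) +
        2 * (C0\<^sup>2 * ((2 ^ CARD('d))\<^sup>2 * (mass1 / (real N)\<^sup>2 * form_N W (\<lambda>_ _. 1) N v v)))"
      using W_incr_weighted_L1[OF W N, of v] diff_N_L1[OF W N, of v]
      unfolding P_def Q_def mass1_def mass2_def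
      by (intro add_mono mult_left_mono) auto
    also have "\<dots> = K1 / real N * inner_N N v v + K2 / (real N)\<^sup>2 * form_N W (\<lambda>_ _. 1) N v v"
      by (simp add: K1_def K2_def)
    also have "\<dots> \<le> (K1 + K2) / real N * inner_N N v v + (K1 + K2) / real N * form_N W (\<lambda>_ _. 1) N v v"
    proof (intro add_mono mult_right_mono inner_N_self_nonneg form_N_self_nonneg[OF W N])
      show "K1 / real N \<le> (K1 + K2) / real N" using K12 by (intro divide_right_mono) auto
      have "K2 / (real N)\<^sup>2 \<le> K2 / real N"
        using N K12 by (intro divide_left_mono) (auto simp: power2_eq_square)
      also have "\<dots> \<le> (K1 + K2) / real N" using K12 by (intro divide_right_mono) auto
      finally show "K2 / (real N)\<^sup>2 \<le> (K1 + K2) / real N" .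
    qed simp
    finally show "(inner_N N (\<lambda>x. \<phi> (grid N x)) v - (\<integral>x. \<phi> x * interp W N v x \<partial>torus))\<^sup>2
      \<le> (K1 + K2) / real N * (inner_N N v v + form_N W (\<lambda>_ _. 1) N v v)"
      by (simp add: D_def distrib_left)
  qed
qed

section \<open>Product eigenfunctions\<close>

context gauge
begin

text \<open>The periodic extension of the flux from \<open>(0,1]\<close>. Subtracting the ceiling
  minus 1 leaves the point 1 in place instead of sending it to 0, in agreement with the left-open
  cell on which \<open>LW_graph_derivative\<close> is stated.\<close>

definition pflux :: "(real \<Rightarrow> real) \<Rightarrow> real \<Rightarrow> real" where
  "pflux g u = flux g (u - of_int (\<lceil>u\<rceil> - 1))"

lemma pflux_eq_flux: "0 < u \<Longrightarrow> u \<le> 1 \<Longrightarrow> pflux g u = flux g u"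
proof -
  assume "0 < u" "u \<le> 1"
  then have "\<lceil>u\<rceil> = 1" by (simp add: ceiling_eq_iff)
  then show ?thesis by (simp add: pflux_def)
qed

lemma pflux_borel:
  assumes "integrable circle g"
  shows "pflux g \<in> borel_measurable borel"
proof -
  have [measurable]: "flux g \<in> borel_measurable borel" by (rule flux_borel[OF assms])
  show ?thesis unfolding pflux_def by measurable
qed

lemma LW_graph_pderivative:
  assumes graph: "LW_graph V f g"
  shows "((\<lambda>\<epsilon>. (f (x + \<epsilon>) - f x) / (V (x + \<epsilon>) - V x)) \<longlongrightarrow> pflux g x) (at 0)"
proof -
  define n where "n = \<lceil>x\<rceil> - 1"
  define x' where "x' = x - of_int n"
  have x': "0 < x'" "x' \<le> 1" unfolding x'_def n_def by linarith+
  have f: "f (x + \<epsilon>) = f (x' + \<epsilon>)" for \<epsilon>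
    using periodic_int[of f "x' + \<epsilon>" n, OF LW_graph_periodic[OF graph]] by (simp add: x'_def algebra_simps)
  have V: "V (x + \<epsilon>) = V (x' + \<epsilon>) + of_int n * mass" for \<epsilon>
    using shift_int[of "x' + \<epsilon>" n] by (simp add: x'_def algebra_simps)
  have "((\<lambda>\<epsilon>. (f (x' + \<epsilon>) - f x') / (V (x' + \<epsilon>) - V x')) \<longlongrightarrow> flux g x') (at 0)"
    by (rule LW_graph_derivative[OF graph x'])
  moreover have "(f (x' + \<epsilon>) - f x') / (V (x' + \<epsilon>) - V x') = (f (x + \<epsilon>) - f x) / (V (x + \<epsilon>) - V x)" for \<epsilon>
    using f[of 0] f[of \<epsilon>] V[of 0] V[of \<epsilon>] by simp
  ultimately show ?thesis by (simp add: pflux_def x'_def n_def)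
qed

end

text \<open>The factors are exchanged one by one. With \<open>M\<close> at least 1, a single power
  of \<open>M\<close> bounds all the remaining products.\<close>

lemma abs_prod_diff_le:
  fixes a b :: "'i \<Rightarrow> real"
  assumes "finite I" and M: "1 \<le> M" and a: "\<And>i. i \<in> I \<Longrightarrow> \<bar>a i\<bar> \<le> M" and b: "\<And>i. i \<in> I \<Longrightarrow> \<bar>b i\<bar> \<le> M"
  shows "\<bar>(\<Prod>i\<in>I. a i) - (\<Prod>i\<in>I. b i)\<bar> \<le> M ^ card I * (\<Sum>i\<in>I. \<bar>a i - b i\<bar>)"
  using assms(1) a b
proof (induction I rule: finite_induct)
  case (insert i I)
  let ?A = "\<Prod>i\<in>I. a i" and ?B = "\<Prod>i\<in>I. b i" and ?S = "\<Sum>i\<in>I. \<bar>a i - b i\<bar>"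
  have B: "\<bar>?B\<bar> \<le> M ^ card I"
  proof -
    have "\<bar>?B\<bar> = (\<Prod>i\<in>I. \<bar>b i\<bar>)" by (rule abs_prod)
    also have "\<dots> \<le> (\<Prod>i\<in>I. M)" using insert.prems by (intro prod_mono) auto
    finally show ?thesis by simp
  qed
  have "a i * ?A - b i * ?B = a i * (?A - ?B) + (a i - b i) * ?B" by (simp add: algebra_simps)
  also have "\<bar>\<dots>\<bar> \<le> \<bar>a i * (?A - ?B)\<bar> + \<bar>(a i - b i) * ?B\<bar>" by (rule abs_triangle_ineq)
  also have "\<dots> \<le> M * (M ^ card I * ?S) + \<bar>a i - b i\<bar> * (M * M ^ card I)"
  proof (unfold abs_mult, intro add_mono mult_mono)
    show "\<bar>?A - ?B\<bar> \<le> M ^ card I * ?S" using insert by auto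
    have "M ^ card I \<le> M * M ^ card I" using M by simp
    then show "\<bar>?B\<bar> \<le> M * M ^ card I" using B by linarith
  qed (use insert.prems M in auto)
  also have "\<dots> = M ^ card (insert i I) * (\<Sum>i\<in>insert i I. \<bar>a i - b i\<bar>)"
    using insert.hyps by (simp add: algebra_simps)
  finally show ?case using insert.hyps by simp
qed simp

lemma prod_split_coordinate: "(\<Prod>k\<in>(UNIV :: 'd::finite set). h k) = h j * (\<Prod>k\<in>UNIV - {j}. h k)"
  by (rule prod.remove) auto

text \<open>A point \<open>y\<close> other than \<open>x\<close> may still agree with
  \<open>x\<close> in coordinate \<open>k\<close>, where the punctured one-variable limit says
  nothing; the hypothesis \<open>eq\<close> covers that case.\<close>

lemma coordinate_tendsto:
  fixes x :: "real^'d" and f :: "real \<Rightarrow> real"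
  assumes f: "(f \<longlongrightarrow> l) (at (x $ k) within T)" and S: "\<And>y. y \<in> S \<Longrightarrow> y $ k \<in> T"
    and eq: "\<And>y. y \<in> S \<Longrightarrow> y $ k = x $ k \<Longrightarrow> f (x $ k) = l"
  shows "((\<lambda>y. f (y $ k)) \<longlongrightarrow> l) (at x within S)"
proof (rule tendstoI)
  fix e :: real assume e: "0 < e"
  obtain d where d: "0 < d" "\<And>u. u \<in> T \<Longrightarrow> u \<noteq> x $ k \<Longrightarrow> dist u (x $ k) < d \<Longrightarrow> dist (f u) l < e"
    using tendstoD[OF f e] unfolding eventually_at by auto
  have "dist (f (y $ k)) l < e" if "y \<in> S" "dist y x < d" for y
  proof (cases "y $ k = x $ k")
    case True
    then show ?thesis using eq[OF that(1)] e by simp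
  next
    case False
    have "dist (y $ k) (x $ k) < d" using dist_vec_nth_le[of y k x] that(2) by linarith
    then show ?thesis using d(2)[OF S[OF that(1)] False] by simp
  qed
  then show "\<forall>\<^sub>F y in at x within S. dist (f (y $ k)) l < e"
    unfolding eventually_at using d(1) by blast
qed

lemma torus_factors_W:
  fixes W :: "'d::finite \<Rightarrow> real \<Rightarrow> real"
  assumes "admissible_W W"
  shows "torus_factors (\<lambda>k. if k = j then interval_measure (W j) else lborel)"
proof (rule torus_factors.intro)
  interpret gauge "W j" by (rule admissible_W_gauge[OF assms])
  fix k
  show "sets (if k = j then interval_measure (W j) else lborel) = sets borel" by simp
  show "finite_measure (restrict_space (if k = j then interval_measure (W j) else lborel) {0<..1})"
    using V.finite_measure_axioms circle.finite_measure_axioms by (simp add: circle_def)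
qed

locale eigen_system =
  fixes W :: "'d::finite \<Rightarrow> real \<Rightarrow> real" and B :: "'d \<Rightarrow> (real \<Rightarrow> real) set"
  assumes admissible: "admissible_W W" and basis: "\<And>k. eigenbasis (W k) (B k)"
begin

sublocale G: gauge "W k" for k
  by (rule admissible_W_gauge[OF admissible])

definition eigval :: "'d \<Rightarrow> (real \<Rightarrow> real) \<Rightarrow> real" where
  "eigval k f = (SOME \<beta>. LW_graph (W k) f (\<lambda>x. - \<beta> * f x))"

abbreviation "Lf k f \<equiv> (\<lambda>x. - eigval k f * f x)"

context
  fixes k f
  assumes f: "f \<in> B k"
begin

lemma eigval_graph: "LW_graph (W k) f (Lf k f)"
proof -
  have "\<exists>\<beta>. LW_graph (W k) f (\<lambda>x. - \<beta> * f x)" using basis[of k] f by (auto simp: eigenbasis_def)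
  then show ?thesis unfolding eigval_def by (rule someI_ex)
qed

lemma basis_L2: "f \<in> L2 circle"
  using basis[of k] f by (auto simp: eigenbasis_def complete_orthonormal_def)

lemma basis_inner: "g \<in> B k \<Longrightarrow> (\<integral>x. f x * g x \<partial>circle) = (if f = g then 1 else 0)"
  using basis[of k] f by (auto simp: eigenbasis_def complete_orthonormal_def)

lemmas basis_bounds = G.eigenfunction_bounds[OF eigval_graph basis_L2 basis_inner[OF f, unfolded if_P[OF refl]]]

lemma basis_borel: "f \<in> borel_measurable borel"
  by (rule G.Lipschitz_V_borel) (rule basis_bounds(3))

lemma Lf_integrable: "integrable circle (Lf k f)"
  by (rule G.LW_graph_integrable[OF eigval_graph])

end

definition families :: "('d \<Rightarrow> real \<Rightarrow> real) set" where
  "families = {f. \<forall>k. f k \<in> B k}"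

definition prodf :: "('d \<Rightarrow> real \<Rightarrow> real) \<Rightarrow> real^'d \<Rightarrow> real" where
  "prodf f x = (\<Prod>k\<in>UNIV. f k (x $ k))"

definition grad_factor :: "('d \<Rightarrow> real \<Rightarrow> real) \<Rightarrow> 'd \<Rightarrow> 'd \<Rightarrow> real \<Rightarrow> real" where
  "grad_factor f j k = (if k = j then G.pflux j (Lf j (f j)) else f k)"

definition gradf :: "('d \<Rightarrow> real \<Rightarrow> real) \<Rightarrow> 'd \<Rightarrow> real^'d \<Rightarrow> real" where
  "gradf f j x = (\<Prod>k\<in>UNIV. grad_factor f j k (x $ k))"

definition eigs :: "('d \<Rightarrow> real \<Rightarrow> real) \<Rightarrow> 'd \<Rightarrow> real" where
  "eigs f j = eigval j (f j)"

text \<open>The product of the one-dimensional sup bounds from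
  \<open>eigenfunction_bounds\<close>.\<close>

definition bnd :: "('d \<Rightarrow> real \<Rightarrow> real) \<Rightarrow> real" where
  "bnd f = (\<Prod>k\<in>UNIV. 1 + 2 * eigs f k * (W k 1 - W k 0))"

lemma product_functions_eq: "product_functions B = prodf ` families"
  by (auto simp: product_functions_def families_def prodf_def[abs_def])

lemma families_D: "f \<in> families \<Longrightarrow> f k \<in> B k"
  by (simp add: families_def)

lemma eigs_nonneg: "f \<in> families \<Longrightarrow> 0 \<le> eigs f j"
  unfolding eigs_def by (rule basis_bounds(1)[OF families_D])

lemma prodf_borel: "f \<in> families \<Longrightarrow> prodf f \<in> borel_measurable borel"
  unfolding prodf_def
  by (intro borel_measurable_prod nth_borel basis_borel[OF families_D])

lemma prodf_bound:
  assumes "f \<in> families"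
  shows "\<bar>prodf f x\<bar> \<le> bnd f"
  unfolding prodf_def bnd_def abs_prod eigs_def
  using basis_bounds(2)[OF families_D[OF assms]] by (intro prod_mono) auto

lemma prodf_periodic:
  assumes "f \<in> families"
  shows "periodic (prodf f)"
  unfolding periodic_def prodf_def
proof (intro allI prod.cong refl)
  fix x :: "real^'d" and k i
  show "f i ((x + axis k 1) $ i) = f i (x $ i)"
    using G.LW_graph_periodic[OF eigval_graph[OF families_D[OF assms]]] by (simp add: axis_def)
qed

lemma prodf_Lipschitz:
  assumes f: "f \<in> families"
  obtains C where "0 \<le> C" "\<And>x y. \<bar>prodf f x - prodf f y\<bar> \<le> C * (\<Sum>k\<in>UNIV. \<bar>W k (x $ k) - W k (y $ k)\<bar>)"
proof -
  define M where "M = 1 + (\<Sum>k\<in>UNIV. 2 * eigs f k * (W k 1 - W k 0))"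
  define E where "E = (\<Sum>k\<in>UNIV. 2 * eigs f k)"
  have nonneg: "0 \<le> 2 * eigs f k * (W k 1 - W k 0)" for k
    using eigs_nonneg[OF f, of k] G.mass_pos[of k] by simp
  have M: "1 \<le> M" unfolding M_def using nonneg by (simp add: sum_nonneg)
  have bound: "\<bar>f k u\<bar> \<le> M" for k u
  proof -
    have "\<bar>f k u\<bar> \<le> 1 + 2 * eigs f k * (W k 1 - W k 0)"
      unfolding eigs_def by (rule basis_bounds(2)[OF families_D[OF f]])
    also have "\<dots> \<le> M" unfolding M_def using nonneg member_le_sum[of k UNIV "\<lambda>k. 2 * eigs f k * (W k 1 - W k 0)"] by auto
    finally show ?thesis .
  qed
  have E: "2 * eigs f k \<le> E" for k
    unfolding E_def using eigs_nonneg[OF f] member_le_sum[of k UNIV "\<lambda>k. 2 * eigs f k"] by auto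
  have E0: "0 \<le> E" unfolding E_def using eigs_nonneg[OF f] by (intro sum_nonneg) auto
  show ?thesis
  proof (rule that)
    show "0 \<le> M ^ CARD('d) * E" using M E0 by simp
    fix x y :: "real^'d"
    have "\<bar>prodf f x - prodf f y\<bar> \<le> M ^ card (UNIV :: 'd set) * (\<Sum>k\<in>UNIV. \<bar>f k (x $ k) - f k (y $ k)\<bar>)"
      unfolding prodf_def by (rule abs_prod_diff_le) (use M bound in auto)
    also have "\<dots> \<le> M ^ card (UNIV :: 'd set) * (\<Sum>k\<in>UNIV. E * \<bar>W k (x $ k) - W k (y $ k)\<bar>)"
    proof (intro mult_left_mono sum_mono)
      fix k
      have "\<bar>f k (x $ k) - f k (y $ k)\<bar> \<le> 2 * eigs f k * \<bar>W k (x $ k) - W k (y $ k)\<bar>"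
        unfolding eigs_def by (rule basis_bounds(3)[OF families_D[OF f]])
      also have "\<dots> \<le> E * \<bar>W k (x $ k) - W k (y $ k)\<bar>" using E by (intro mult_right_mono) auto
      finally show "\<bar>f k (x $ k) - f k (y $ k)\<bar> \<le> E * \<bar>W k (x $ k) - W k (y $ k)\<bar>" .
    qed (use M in auto)
    finally show "\<bar>prodf f x - prodf f y\<bar> \<le> M ^ CARD('d) * E * (\<Sum>k\<in>UNIV. \<bar>W k (x $ k) - W k (y $ k)\<bar>)"
      by (simp add: sum_distrib_left mult.assoc)
  qed
qed

lemma prodf_cadlag:
  assumes f: "f \<in> families"
  shows "cadlag (prodf f)"
proof -
  note Lip = basis_bounds(3)[OF families_D[OF f]]
  have right: "((\<lambda>y. f k (y $ k)) \<longlongrightarrow> f k (x $ k)) (at x within S)" if "\<And>y. y \<in> S \<Longrightarrow> x $ k \<le> y $ k" for x k S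
  proof (rule coordinate_tendsto)
    show "(f k \<longlongrightarrow> f k (x $ k)) (at (x $ k) within {x $ k..})"
      unfolding at_within_Ici_at_right by (rule G.Lipschitz_V_right_cont[OF Lip])
  qed (use that in auto)
  have left: "\<exists>l. ((\<lambda>y. f k (y $ k)) \<longlongrightarrow> l) (at x within S)" if S: "\<And>y. y \<in> S \<Longrightarrow> y $ k < x $ k" for x k S
  proof -
    obtain l where "(f k \<longlongrightarrow> l) (at_left (x $ k))" using G.Lipschitz_V_left_limit[OF Lip] by blast
    then have "((\<lambda>y. f k (y $ k)) \<longlongrightarrow> l) (at x within S)"
      by (rule coordinate_tendsto) (use S in fastforce)+
    then show ?thesis ..
  qed
  have "(prodf f \<longlongrightarrow> prodf f x) (at x within {y. \<forall>k. x $ k \<le> y $ k})" for x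
    unfolding prodf_def by (intro tendsto_prod right) auto
  moreover have "\<exists>l. (prodf f \<longlongrightarrow> l) (at x within {y. \<forall>k. if k \<in> K then x $ k \<le> y $ k else y $ k < x $ k})"
    (is "\<exists>l. (_ \<longlongrightarrow> l) (at x within ?S)") for x K
  proof -
    have "\<exists>l. ((\<lambda>y. f k (y $ k)) \<longlongrightarrow> l) (at x within ?S)" for k
    proof (cases "k \<in> K")
      case True
      have "((\<lambda>y. f k (y $ k)) \<longlongrightarrow> f k (x $ k)) (at x within ?S)"
      proof (rule right)
        fix y assume "y \<in> ?S"
        then show "x $ k \<le> y $ k" using True by (auto dest: spec[of _ k])
      qed
      then show ?thesis ..
    next
      case False
      show ?thesis
      proof (rule left)
        fix y assume "y \<in> ?S"
        then show "y $ k < x $ k" using False by (auto dest: spec[of _ k])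
      qed
    qed
    then have "\<exists>l. \<forall>k. ((\<lambda>y. f k (y $ k)) \<longlongrightarrow> l k) (at x within ?S)" by (intro choice allI)
    then obtain l where "\<And>k. ((\<lambda>y. f k (y $ k)) \<longlongrightarrow> l k) (at x within ?S)" by blast
    then have "(prodf f \<longlongrightarrow> (\<Prod>k\<in>UNIV. l k)) (at x within ?S)"
      unfolding prodf_def by (intro tendsto_prod)
    then show ?thesis ..
  qed
  ultimately show ?thesis unfolding cadlag_def by blast
qed

lemma slice_prodf: "slice j x (prodf f) u = (\<Prod>k\<in>UNIV - {j}. f k (x $ k)) * f j u"
proof -
  have "slice j x (prodf f) u = f j u * (\<Prod>k\<in>UNIV - {j}. f k ((\<chi> i. if i = j then u else x $ i) $ k))"
    unfolding slice_def prodf_def by (subst prod_split_coordinate[of _ j]) simp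
  also have "(\<Prod>k\<in>UNIV - {j}. f k ((\<chi> i. if i = j then u else x $ i) $ k)) = (\<Prod>k\<in>UNIV - {j}. f k (x $ k))"
    by (rule prod.cong) auto
  finally show ?thesis by simp
qed

lemma prodf_graph:
  assumes "f \<in> families"
  shows "LW_graph (W j) (slice j x (prodf f)) (slice j x (\<lambda>y. - eigs f j * prodf f y))"
proof -
  have "slice j x (\<lambda>y. - eigs f j * prodf f y) = (\<lambda>u. (\<Prod>k\<in>UNIV - {j}. f k (x $ k)) * Lf j (f j) u)"
    using slice_prodf[where j = j and x = x and f = f] by (auto simp: slice_def eigs_def fun_eq_iff)
  then show ?thesis
    using G.LW_graph_scale[OF eigval_graph[OF families_D[OF assms]]] by (simp add: slice_prodf[abs_def])
qed

lemma prodf_dW_limit: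
  assumes "f \<in> families"
  shows "((\<lambda>\<epsilon>. (prodf f (x + \<epsilon> *\<^sub>R axis j 1) - prodf f x) / (W j (x $ j + \<epsilon>) - W j (x $ j))) \<longlongrightarrow> gradf f j x) (at 0)"
proof -
  define c where "c = (\<Prod>k\<in>UNIV - {j}. f k (x $ k))"
  have eq: "prodf f (x + \<epsilon> *\<^sub>R axis j 1) = c * f j (x $ j + \<epsilon>)" for \<epsilon>
  proof -
    have "prodf f (x + \<epsilon> *\<^sub>R axis j 1) = f j (x $ j + \<epsilon>) * (\<Prod>k\<in>UNIV - {j}. f k ((x + \<epsilon> *\<^sub>R axis j 1) $ k))"
      unfolding prodf_def by (subst prod_split_coordinate[of _ j]) (simp add: axis_def)
    also have "(\<Prod>k\<in>UNIV - {j}. f k ((x + \<epsilon> *\<^sub>R axis j 1) $ k)) = c"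
      unfolding c_def by (rule prod.cong) (auto simp: axis_def)
    finally show ?thesis by simp
  qed
  have "gradf f j x = G.pflux j (Lf j (f j)) (x $ j) * (\<Prod>k\<in>UNIV - {j}. grad_factor f j k (x $ k))"
    unfolding gradf_def by (subst prod_split_coordinate[of _ j]) (simp add: grad_factor_def)
  also have "(\<Prod>k\<in>UNIV - {j}. grad_factor f j k (x $ k)) = c"
    unfolding c_def by (rule prod.cong) (auto simp: grad_factor_def)
  finally have grad: "gradf f j x = c * G.pflux j (Lf j (f j)) (x $ j)" by simp
  have "((\<lambda>\<epsilon>. c * ((f j (x $ j + \<epsilon>) - f j (x $ j)) / (W j (x $ j + \<epsilon>) - W j (x $ j)))) \<longlongrightarrow> gradf f j x) (at 0)"
    unfolding grad by (intro tendsto_mult_left G.LW_graph_pderivative eigval_graph families_D assms)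
  moreover have "(\<lambda>\<epsilon>. c * ((f j (x $ j + \<epsilon>) - f j (x $ j)) / (W j (x $ j + \<epsilon>) - W j (x $ j)))) =
      (\<lambda>\<epsilon>. (prodf f (x + \<epsilon> *\<^sub>R axis j 1) - prodf f x) / (W j (x $ j + \<epsilon>) - W j (x $ j)))"
    using eq[of 0] by (simp add: eq right_diff_distrib)
  ultimately show ?thesis by (simp only:)
qed

definition combination :: "('d \<Rightarrow> real \<Rightarrow> real) set \<Rightarrow> (('d \<Rightarrow> real \<Rightarrow> real) \<Rightarrow> real) \<Rightarrow> real^'d \<Rightarrow> real" where
  "combination F c x = (\<Sum>f\<in>F. c f * prodf f x)"

text \<open>The span is formed over a set of functions, whereas the calculations index them by
  families; choosing preimages injectively keeps a function from being counted twice.\<close>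

lemma D_W_combination:
  assumes "h \<in> D_W B"
  obtains F c where "finite F" "F \<subseteq> families" "h = combination F c"
proof -
  obtain P c where P: "finite P" "P \<subseteq> prodf ` families" "h = (\<lambda>x. \<Sum>p\<in>P. c p * p x)"
    using assms by (auto simp: D_W_def product_functions_eq)
  obtain F where F: "F \<subseteq> families" "inj_on prodf F" "P = prodf ` F"
    using P(2) subset_image_inj[of P prodf families] by auto
  have "finite F" using P(1) F by (simp add: finite_image_iff)
  moreover have "h = combination F (c \<circ> prodf)"
    unfolding P(3) F(3) using F(2) by (auto simp: combination_def sum.reindex fun_eq_iff)
  ultimately show ?thesis using that F(1) by blast
qed

lemma dW_combination:
  assumes "F \<subseteq> families"
  shows "dW W j (combination F c) x = (\<Sum>f\<in>F. c f * gradf f j x)"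
proof -
  have "((\<lambda>\<epsilon>. \<Sum>f\<in>F. c f * ((prodf f (x + \<epsilon> *\<^sub>R axis j 1) - prodf f x) / (W j (x $ j + \<epsilon>) - W j (x $ j))))
      \<longlongrightarrow> (\<Sum>f\<in>F. c f * gradf f j x)) (at 0)"
    using assms by (intro tendsto_sum tendsto_mult_left prodf_dW_limit) auto
  moreover have "(\<Sum>f\<in>F. c f * ((prodf f (x + \<epsilon> *\<^sub>R axis j 1) - prodf f x) / (W j (x $ j + \<epsilon>) - W j (x $ j)))) =
      (combination F c (x + \<epsilon> *\<^sub>R axis j 1) - combination F c x) / (W j (x $ j + \<epsilon>) - W j (x $ j))" for \<epsilon>
    by (simp add: combination_def sum_subtractf[symmetric] sum_divide_distrib right_diff_distrib)
  ultimately show ?thesis unfolding dW_def by (intro tendsto_Lim) auto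
qed

lemma prodf_D_W: "f \<in> families \<Longrightarrow> prodf f \<in> D_W B"
  unfolding D_W_def product_functions_eq
  by (auto intro!: exI[of _ "{prodf f}"] exI[of _ "\<lambda>_. 1"] simp: fun_eq_iff)

lemma dW_prodf: "f \<in> families \<Longrightarrow> dW W j (prodf f) = gradf f j"
proof -
  assume "f \<in> families"
  moreover have eq: "combination {f} (\<lambda>_. 1) = prodf f" by (simp add: combination_def fun_eq_iff)
  ultimately have "dW W j (prodf f) x = gradf f j x" for x
    using dW_combination[of "{f}" j "\<lambda>_. 1" x] unfolding eq by simp
  then show ?thesis ..
qed

lemma prodf_L2: "f \<in> families \<Longrightarrow> prodf f \<in> L2 torus"
  by (rule torus.L2_bounded[OF torus.borel_torus_measure[OF prodf_borel] prodf_bound])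

lemma torus_W_eq: "torus_W W j = torus_measure (\<lambda>k. if k = j then interval_measure (W j) else lborel)"
  by (simp add: torus_W_def)

lemma factor_W: "restrict_space (if k = j then interval_measure (W j) else lborel) {0<..1} =
    (if k = j then restrict_space (interval_measure (W j)) {0<..1} else circle)"
  by (simp add: circle_def)

lemma grad_factor_borel:
  assumes "f \<in> families"
  shows "grad_factor f j k \<in> borel_measurable borel"
  using G.pflux_borel[OF Lf_integrable[OF families_D[OF assms]], of j] basis_borel[OF families_D[OF assms], of k]
  unfolding grad_factor_def by (cases "k = j") (simp_all only: if_True if_False refl simp_thms)

lemma grad_factor_bound:
  assumes "f \<in> families"
  obtains C where "\<And>u. \<bar>grad_factor f j k u\<bar> \<le> C"
proof (cases "k = j")
  case True
  then have "grad_factor f j k u = G.flux j (Lf j (f j)) (u - of_int (\<lceil>u\<rceil> - 1))" for u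
    by (simp add: grad_factor_def G.pflux_def)
  then show ?thesis
    using that[of "2 * eigval j (f j)"] basis_bounds(4)[OF families_D[OF assms]] by (simp only:)
next
  case False
  then have "grad_factor f j k u = f k u" for u by (simp add: grad_factor_def)
  then show ?thesis
    using that[of "1 + 2 * eigval k (f k) * G.mass k"] basis_bounds(2)[OF families_D[OF assms], of k]
    by (simp only:)
qed

lemma grad_factor_mult_integrable:
  assumes f: "f \<in> families" and g: "g \<in> families"
  shows "integrable (if k = j then restrict_space (interval_measure (W j)) {0<..1} else circle)
    (\<lambda>u. grad_factor f j k u * grad_factor g j k u)"
proof -
  obtain C D where C: "\<And>u. \<bar>grad_factor f j k u\<bar> \<le> C" and D: "\<And>u. \<bar>grad_factor g j k u\<bar> \<le> D"
    using grad_factor_bound[OF f] grad_factor_bound[OF g] by metis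
  note borel = grad_factor_borel[OF f, of j k] grad_factor_borel[OF g, of j k]
  show ?thesis
  proof (cases "k = j")
    case True
    then show ?thesis
      using L2_mult_integrable[OF G.V.L2_bounded[OF G.borel_circle_V[OF borel(1)] C] G.V.L2_bounded[OF G.borel_circle_V[OF borel(2)] D]]
      by simp
  next
    case False
    then show ?thesis
      using L2_mult_integrable[OF circle.L2_bounded[OF sets_circle_borel[OF borel(1)] C] circle.L2_bounded[OF sets_circle_borel[OF borel(2)] D]]
      by simp
  qed
qed

lemma gradf_borel: "f \<in> families \<Longrightarrow> gradf f j \<in> borel_measurable borel"
  unfolding gradf_def by (intro borel_measurable_prod nth_borel grad_factor_borel)

lemma gradf_L2:
  assumes f: "f \<in> families"
  shows "gradf f j \<in> L2 (torus_W W j)"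
proof -
  interpret T: torus_factors "\<lambda>k. if k = j then interval_measure (W j) else lborel"
    by (rule torus_factors_W[OF admissible])
  have "integrable (torus_W W j) (\<lambda>x. \<Prod>k\<in>UNIV. (\<lambda>u. grad_factor f j k u * grad_factor f j k u) (x $ k))"
    unfolding torus_W_eq
    by (rule T.torus_measure_integrable_prod)
      (use grad_factor_borel[OF f] grad_factor_mult_integrable[OF f f] in \<open>auto simp: factor_W\<close>)
  then show ?thesis
    using T.borel_torus_measure[OF gradf_borel[OF f, of j]]
    by (simp add: L2_def gradf_def power2_eq_square prod.distrib[symmetric] torus_W_eq)
qed

lemma prodf_inner:
  assumes f: "f \<in> families" and g: "g \<in> families"
  shows "(\<integral>x. prodf f x * prodf g x \<partial>torus) = (if f = g then 1 else 0)"
proof -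
  have "(\<integral>x. prodf f x * prodf g x \<partial>torus) = (\<integral>x. (\<Prod>k\<in>UNIV. (\<lambda>u. f k u * g k u) (x $ k)) \<partial>torus)"
    by (simp add: prodf_def prod.distrib)
  also have "\<dots> = (\<Prod>k\<in>UNIV. \<integral>u. f k u * g k u \<partial>circle)"
    using basis_borel[OF families_D[OF f]] basis_borel[OF families_D[OF g]]
      L2_mult_integrable[OF basis_L2[OF families_D[OF f]] basis_L2[OF families_D[OF g]]]
    by (intro torus.torus_measure_integral_prod) auto
  also have "\<dots> = (\<Prod>k\<in>UNIV. if f k = g k then 1 else 0)"
    by (rule prod.cong[OF refl]) (rule basis_inner[OF families_D[OF f] families_D[OF g]])
  also have "\<dots> = (if f = g then 1 else 0)"
    by (cases "f = g") (auto simp: fun_eq_iff)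
  finally show ?thesis .
qed

text \<open>Fubini's theorem splits off the coordinate \<open>j\<close>, where integration by parts
  trades the two fluxes for the eigenvalue; the other factors are those of \<open>prodf\<close>.
  Gradients of distinct product eigenfunctions are thus orthogonal for every single
  \<open>j\<close>.\<close>

lemma gradf_inner:
  assumes f: "f \<in> families" and g: "g \<in> families"
  shows "(\<integral>x. gradf f j x * gradf g j x \<partial>torus_W W j) = eigs g j * (\<integral>x. prodf f x * prodf g x \<partial>torus)"
proof -
  interpret T: torus_factors "\<lambda>k. if k = j then interval_measure (W j) else lborel"
    by (rule torus_factors_W[OF admissible])
  let ?h = "\<lambda>k u. grad_factor f j k u * grad_factor g j k u"
  have "(\<integral>x. gradf f j x * gradf g j x \<partial>torus_W W j) =
      (\<integral>x. (\<Prod>k\<in>UNIV. ?h k (x $ k)) \<partial>torus_W W j)"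
    by (simp add: gradf_def prod.distrib)
  also have "\<dots> = (\<Prod>k\<in>UNIV. \<integral>u. ?h k u \<partial>(if k = j then restrict_space (interval_measure (W j)) {0<..1} else circle))"
    unfolding torus_W_eq
    by (subst T.torus_measure_integral_prod)
      (use grad_factor_borel[OF f] grad_factor_borel[OF g] grad_factor_mult_integrable[OF f g] in \<open>auto simp: factor_W\<close>)
  also have "\<dots> = (\<integral>u. ?h j u \<partial>restrict_space (interval_measure (W j)) {0<..1}) * (\<Prod>k\<in>UNIV - {j}. \<integral>u. f k u * g k u \<partial>circle)"
    by (subst prod_split_coordinate[of _ j]) (auto simp: grad_factor_def intro!: prod.cong)
  also have "(\<integral>u. ?h j u \<partial>restrict_space (interval_measure (W j)) {0<..1}) =
      (\<integral>u. G.flux j (Lf j (f j)) u * G.flux j (Lf j (g j)) u \<partial>restrict_space (interval_measure (W j)) {0<..1})"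
    by (rule Bochner_Integration.integral_cong)
      (auto simp: grad_factor_def space_restrict_space G.pflux_eq_flux)
  also have "\<dots> = eigs g j * (\<integral>u. f j u * g j u \<partial>circle)"
  proof -
    have "(\<integral>u. f j u * Lf j (g j) u \<partial>circle) = - (eigs g j * (\<integral>u. f j u * g j u \<partial>circle))"
    proof -
      have "(\<integral>u. f j u * Lf j (g j) u \<partial>circle) = (\<integral>u. - eigs g j * (f j u * g j u) \<partial>circle)"
        by (rule Bochner_Integration.integral_cong) (simp_all add: eigs_def)
      then show ?thesis by simp
    qed
    then show ?thesis
      using G.LW_graph_parts[OF eigval_graph[OF families_D[OF f]] eigval_graph[OF families_D[OF g]], of j]
      by linarith
  qed
  also have "eigs g j * (\<integral>u. f j u * g j u \<partial>circle) * (\<Prod>k\<in>UNIV - {j}. \<integral>u. f k u * g k u \<partial>circle) =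
      eigs g j * (\<Prod>k\<in>UNIV. \<integral>u. f k u * g k u \<partial>circle)"
    by (subst prod_split_coordinate[of _ j]) simp
  also have "(\<Prod>k\<in>UNIV. \<integral>u. f k u * g k u \<partial>circle) = (\<Prod>k\<in>UNIV. if f k = g k then 1 else 0)"
    by (rule prod.cong[OF refl]) (rule basis_inner[OF families_D[OF f] families_D[OF g]])
  also have "\<dots> = (if f = g then 1 else 0)"
    by (cases "f = g") (auto simp: fun_eq_iff)
  finally show ?thesis by (simp add: prodf_inner[OF f g])
qed

section \<open>Weak solutions\<close>

lemma combination_L2: "F \<subseteq> families \<Longrightarrow> finite F \<Longrightarrow> combination F c \<in> L2 torus"
  unfolding combination_def by (intro L2_sum L2_scale prodf_L2) auto

lemma dW_combination_L2:
  assumes "F \<subseteq> families" "finite F"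
  shows "dW W j (combination F c) \<in> L2 (torus_W W j)"
proof -
  have "dW W j (combination F c) = (\<lambda>x. \<Sum>f\<in>F. c f * gradf f j x)"
    by (rule ext) (rule dW_combination[OF assms(1)])
  then show ?thesis using assms by (auto intro!: L2_sum L2_scale gradf_L2)
qed

lemma D_W_L2: "h \<in> D_W B \<Longrightarrow> h \<in> L2 torus"
  by (elim D_W_combination) (simp add: combination_L2)

lemma dW_D_W_L2: "h \<in> D_W B \<Longrightarrow> dW W j h \<in> L2 (torus_W W j)"
  by (elim D_W_combination) (simp add: dW_combination_L2)

lemma dW_D_W_inner_gradf:
  assumes h: "h \<in> D_W B" and f: "f \<in> families"
  shows "(\<integral>x. dW W j h x * gradf f j x \<partial>torus_W W j) = eigs f j * (\<integral>x. h x * prodf f x \<partial>torus)"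
proof -
  obtain F c where F: "finite F" "F \<subseteq> families" and h: "h = combination F c"
    by (rule D_W_combination[OF h])
  have "(\<integral>x. dW W j h x * gradf f j x \<partial>torus_W W j) = (\<integral>x. (\<Sum>g\<in>F. c g * (gradf g j x * gradf f j x)) \<partial>torus_W W j)"
    by (simp add: h dW_combination[OF F(2)] sum_distrib_right mult.assoc)
  also have "\<dots> = (\<Sum>g\<in>F. c g * (\<integral>x. gradf g j x * gradf f j x \<partial>torus_W W j))"
    using F L2_mult_integrable[OF gradf_L2 gradf_L2[OF f]]
    by (subst Bochner_Integration.integral_sum) (auto intro!: integrable_mult_right)
  also have "\<dots> = (\<Sum>g\<in>F. c g * (eigs f j * (\<integral>x. prodf g x * prodf f x \<partial>torus)))"
    using F f by (intro sum.cong refl) (simp add: gradf_inner subset_eq)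
  also have "\<dots> = eigs f j * (\<Sum>g\<in>F. c g * (\<integral>x. prodf g x * prodf f x \<partial>torus))"
    by (simp add: sum_distrib_left mult.left_commute)
  also have "(\<Sum>g\<in>F. c g * (\<integral>x. prodf g x * prodf f x \<partial>torus)) = (\<integral>x. (\<Sum>g\<in>F. c g * (prodf g x * prodf f x)) \<partial>torus)"
    using F L2_mult_integrable[OF prodf_L2 prodf_L2[OF f]]
    by (subst Bochner_Integration.integral_sum) (auto intro!: integrable_mult_right)
  also have "\<dots> = (\<integral>x. h x * prodf f x \<partial>torus)"
    by (simp add: h combination_def sum_distrib_right mult.assoc)
  finally show ?thesis .
qed

text \<open>Both sides of \<open>dW_D_W_inner_gradf\<close> are continuous in the respective
  \<open>L2\<close> norms, so the identity passes to the limit along a sequence defining the weak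
  gradient.\<close>

lemma weak_gradient_inner_gradf:
  assumes u: "weak_gradient W B u g" and f: "f \<in> families"
  shows "(\<integral>x. g j x * gradf f j x \<partial>torus_W W j) = eigs f j * (\<integral>x. u x * prodf f x \<partial>torus)"
proof -
  obtain h where h: "\<And>m. h m \<in> D_W B" "(\<lambda>m. L2_norm torus (\<lambda>x. h m x - u x)) \<longlonglongrightarrow> 0"
      "(\<lambda>m. L2_norm (torus_W W j) (\<lambda>x. dW W j (h m) x - g j x)) \<longlonglongrightarrow> 0"
    and L2: "u \<in> L2 torus" "g j \<in> L2 (torus_W W j)"
    using u unfolding weak_gradient_def by blast
  have "(\<lambda>m. \<integral>x. dW W j (h m) x * gradf f j x \<partial>torus_W W j) \<longlonglongrightarrow> (\<integral>x. g j x * gradf f j x \<partial>torus_W W j)"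
    by (rule L2_inner_tendsto[OF dW_D_W_L2[OF h(1)] L2(2) h(3) gradf_L2[OF f]])
  moreover have "(\<lambda>m. eigs f j * (\<integral>x. h m x * prodf f x \<partial>torus)) \<longlonglongrightarrow> eigs f j * (\<integral>x. u x * prodf f x \<partial>torus)"
    by (intro tendsto_mult_left L2_inner_tendsto[OF D_W_L2[OF h(1)] L2(1) h(2) prodf_L2[OF f]])
  ultimately show ?thesis by (simp add: dW_D_W_inner_gradf[OF h(1) f] LIMSEQ_unique)
qed

text \<open>Taking the limits of both approximating sequences one after the other avoids the uniqueness of
  weak gradients.\<close>

lemma weak_gradient_inner:
  assumes f: "f \<in> families" and g: "weak_gradient W B (prodf f) g" and v: "weak_gradient W B v g'"
  shows "(\<integral>x. g j x * g' j x \<partial>torus_W W j) = eigs f j * (\<integral>x. prodf f x * v x \<partial>torus)"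
proof -
  obtain h where h: "\<And>m. h m \<in> D_W B" "(\<lambda>m. L2_norm torus (\<lambda>x. h m x - v x)) \<longlonglongrightarrow> 0"
      "(\<lambda>m. L2_norm (torus_W W j) (\<lambda>x. dW W j (h m) x - g' j x)) \<longlonglongrightarrow> 0"
    and L2: "v \<in> L2 torus" "g' j \<in> L2 (torus_W W j)"
    using v unfolding weak_gradient_def by blast
  have gL2: "g j \<in> L2 (torus_W W j)" using g unfolding weak_gradient_def by blast
  have eq: "(\<integral>x. dW W j h x * g j x \<partial>torus_W W j) = eigs f j * (\<integral>x. h x * prodf f x \<partial>torus)"
    if h: "h \<in> D_W B" for h
  proof -
    obtain F c where F: "finite F" "F \<subseteq> families" and h: "h = combination F c"
      by (rule D_W_combination[OF h])
    have "(\<integral>x. dW W j h x * g j x \<partial>torus_W W j) = (\<integral>x. (\<Sum>e\<in>F. c e * (g j x * gradf e j x)) \<partial>torus_W W j)"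
      by (simp add: h dW_combination[OF F(2)] sum_distrib_right sum_distrib_left mult_ac)
    also have "\<dots> = (\<Sum>e\<in>F. c e * (\<integral>x. g j x * gradf e j x \<partial>torus_W W j))"
      using F L2_mult_integrable[OF gL2 gradf_L2]
      by (subst Bochner_Integration.integral_sum) (auto intro!: integrable_mult_right)
    also have "\<dots> = (\<Sum>e\<in>F. c e * (eigs f j * (\<integral>x. prodf e x * prodf f x \<partial>torus)))"
    proof (intro sum.cong refl)
      fix e assume "e \<in> F"
      then have e: "e \<in> families" using F by blast
      \<comment> \<open>\<open>weak_gradient_inner_gradf\<close> delivers the eigenvalue of
        \<open>e\<close> and not that of \<open>f\<close>; by orthonormality both terms vanish
        unless \<open>e = f\<close>, so they agree.\<close>
      show "c e * (\<integral>x. g j x * gradf e j x \<partial>torus_W W j) = c e * (eigs f j * (\<integral>x. prodf e x * prodf f x \<partial>torus))"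
        using weak_gradient_inner_gradf[OF g e] prodf_inner[OF f e] prodf_inner[OF e f] by auto
    qed
    also have "\<dots> = eigs f j * (\<Sum>e\<in>F. c e * (\<integral>x. prodf e x * prodf f x \<partial>torus))"
      by (simp add: sum_distrib_left mult.left_commute)
    also have "(\<Sum>e\<in>F. c e * (\<integral>x. prodf e x * prodf f x \<partial>torus)) = (\<integral>x. (\<Sum>e\<in>F. c e * (prodf e x * prodf f x)) \<partial>torus)"
      using F L2_mult_integrable[OF prodf_L2 prodf_L2[OF f]]
      by (subst Bochner_Integration.integral_sum) (auto intro!: integrable_mult_right)
    also have "\<dots> = (\<integral>x. h x * prodf f x \<partial>torus)"
      by (simp add: h combination_def sum_distrib_right mult.assoc)
    finally show ?thesis .
  qed
  have "(\<lambda>m. \<integral>x. dW W j (h m) x * g j x \<partial>torus_W W j) \<longlonglongrightarrow> (\<integral>x. g' j x * g j x \<partial>torus_W W j)"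
    by (rule L2_inner_tendsto[OF dW_D_W_L2[OF h(1)] L2(2) h(3) gL2])
  moreover have "(\<lambda>m. eigs f j * (\<integral>x. h m x * prodf f x \<partial>torus)) \<longlonglongrightarrow> eigs f j * (\<integral>x. v x * prodf f x \<partial>torus)"
    by (intro tendsto_mult_left L2_inner_tendsto[OF D_W_L2[OF h(1)] L2(1) h(2) prodf_L2[OF f]])
  ultimately show ?thesis by (simp add: eq[OF h(1)] LIMSEQ_unique mult.commute[of "g j _"] mult.commute[of "prodf f _"])
qed

lemma weak_dW_gradient: "u \<in> H1_W W B \<Longrightarrow> weak_gradient W B u (\<lambda>j. weak_dW W B j u)"
  using someI_ex[of "weak_gradient W B u"] by (simp add: H1_W_def weak_dW_def)

lemma prodf_H1:
  assumes f: "f \<in> families"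
  shows "prodf f \<in> H1_W W B"
proof -
  have "weak_gradient W B (prodf f) (gradf f)"
    unfolding weak_gradient_def using prodf_L2[OF f] gradf_L2[OF f] prodf_D_W[OF f]
    by (intro conjI allI exI[of _ "\<lambda>_. prodf f"]) (auto simp: dW_prodf[OF f] L2_norm_def)
  then show ?thesis by (auto simp: H1_W_def)
qed

lemma H1_L2: "u \<in> H1_W W B \<Longrightarrow> u \<in> L2 torus"
  by (auto simp: H1_W_def weak_gradient_def)

text \<open>The matrix is constant and diagonal, and \<open>prodf f\<close> is an eigenfunction in
  each coordinate separately, so every term of the form is a multiple of the scalar product with
  \<open>prodf f\<close>.\<close>

lemma prodf_weak_solution:
  assumes f: "f \<in> families"
  shows "weak_solution W B A l (\<lambda>v. (l + (\<Sum>j\<in>UNIV. A j * eigs f j)) * (\<integral>x. prodf f x * v x \<partial>torus)) (prodf f)"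
  unfolding weak_solution_def
proof (intro conjI ballI prodf_H1[OF f])
  fix v assume v: "v \<in> H1_W W B"
  have "(\<integral>x. A j * weak_dW W B j (prodf f) x * weak_dW W B j v x \<partial>torus_W W j) =
      A j * eigs f j * (\<integral>x. prodf f x * v x \<partial>torus)" for j
    using weak_gradient_inner[OF f weak_dW_gradient[OF prodf_H1[OF f]] weak_dW_gradient[OF v], of j]
    by (simp add: mult.assoc)
  then show "l * (\<integral>x. prodf f x * v x \<partial>torus) +
      (\<Sum>j\<in>UNIV. \<integral>x. A j * weak_dW W B j (prodf f) x * weak_dW W B j v x \<partial>torus_W W j) =
      (l + (\<Sum>j\<in>UNIV. A j * eigs f j)) * (\<integral>x. prodf f x * v x \<partial>torus)"
    by (simp add: distrib_right sum_distrib_right)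
qed

lemma prodf_bounded_functional:
  assumes f: "f \<in> families"
  shows "bounded_functional W B (\<lambda>v. c * (\<integral>x. prodf f x * v x \<partial>torus))"
  unfolding bounded_functional_def
proof (intro conjI ballI allI)
  fix u v assume u: "u \<in> H1_W W B" "v \<in> H1_W W B"
  show "c * (\<integral>x. prodf f x * (u x + v x) \<partial>torus) = c * (\<integral>x. prodf f x * u x \<partial>torus) + c * (\<integral>x. prodf f x * v x \<partial>torus)"
    using L2_mult_integrable[OF prodf_L2[OF f] H1_L2[OF u(1)]] L2_mult_integrable[OF prodf_L2[OF f] H1_L2[OF u(2)]]
    by (simp add: distrib_left)
next
  fix u a
  show "c * (\<integral>x. prodf f x * (a * u x) \<partial>torus) = a * (c * (\<integral>x. prodf f x * u x \<partial>torus))"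
    by (simp add: mult.left_commute)
next
  show "\<exists>C. \<forall>u\<in>H1_W W B. \<bar>c * (\<integral>x. prodf f x * u x \<partial>torus)\<bar> \<le> C * H1_norm W B u"
  proof (intro exI[of _ "\<bar>c\<bar> * L2_norm torus (prodf f)"] ballI)
    fix u assume u: "u \<in> H1_W W B"
    have "L2_norm torus u \<le> H1_norm W B u"
      unfolding H1_norm_def by (rule real_le_rsqrt) (simp add: sum_nonneg)
    then have "L2_norm torus (prodf f) * L2_norm torus u \<le> L2_norm torus (prodf f) * H1_norm W B u"
      by (intro mult_left_mono L2_norm_nonneg)
    then have "\<bar>\<integral>x. prodf f x * u x \<partial>torus\<bar> \<le> L2_norm torus (prodf f) * H1_norm W B u"
      using L2_inner_le[OF prodf_L2[OF f] H1_L2[OF u]] by linarith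
    then show "\<bar>c * (\<integral>x. prodf f x * u x \<partial>torus)\<bar> \<le> \<bar>c\<bar> * L2_norm torus (prodf f) * H1_norm W B u"
      by (simp add: abs_mult mult.assoc mult_left_mono)
  qed
qed

end

section \<open>Convergence of the resolvents of an eigenfunction\<close>

lemma inner_N_grid_le:
  fixes \<psi> :: "int^'d \<Rightarrow> real"
  assumes N: "0 < N" and C: "\<And>x. x \<in> sites N \<Longrightarrow> \<bar>\<psi> x\<bar> \<le> C"
  shows "inner_N N \<psi> \<psi> \<le> C\<^sup>2"
proof -
  have "(\<Sum>x\<in>sites N. \<psi> x * \<psi> x) \<le> (\<Sum>x\<in>(sites N :: (int^'d) set). C\<^sup>2)"
  proof (rule sum_mono)
    fix x :: "int^'d" assume "x \<in> sites N"
    from power_mono[OF C[OF this], of 2] show "\<psi> x * \<psi> x \<le> C\<^sup>2" by (simp add: power2_eq_square)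
  qed
  also have "\<dots> = real N ^ CARD('d) * C\<^sup>2" by (simp add: card_sites[OF N])
  finally show ?thesis using N by (simp add: inner_N_def field_simps)
qed

text \<open>A Riemann sum for the square of \<open>\<phi>\<close>. The error in a cell is at most
  \<open>2 * C0\<close> times the oscillation, whose average over the cells is \<open>O(1/N)\<close>
  although it need not be small in a cell containing a jump.\<close>

lemma inner_N_grid_limit:
  fixes W :: "'d::finite \<Rightarrow> real \<Rightarrow> real"
  assumes W: "admissible_W W" and \<phi>: "periodic \<phi>" "\<phi> \<in> borel_measurable borel"
    and C0: "\<And>x. \<bar>\<phi> x\<bar> \<le> C0"
    and C1: "\<And>x y. \<bar>\<phi> x - \<phi> y\<bar> \<le> C1 * (\<Sum>k\<in>UNIV. \<bar>W k (x $ k) - W k (y $ k)\<bar>)" "0 \<le> C1"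
  shows "(\<lambda>N. inner_N N (\<lambda>x. \<phi> (grid N x)) (\<lambda>x. \<phi> (grid N x))) \<longlonglongrightarrow> (\<integral>x. \<phi> x * \<phi> x \<partial>torus)"
proof -
  define mass1 where "mass1 = (\<Sum>j\<in>UNIV. W j 1 - W j 0)"
  have C0': "0 \<le> C0" using C0[of 0] by linarith
  have "\<phi> \<in> L2 torus" by (rule torus.L2_bounded[OF torus.borel_torus_measure[OF \<phi>(2)] C0])
  then have int: "integrable torus (\<lambda>x. \<phi> x * \<phi> x)" by (rule L2_mult_integrable) fact
  have bound: "\<bar>inner_N N (\<lambda>x. \<phi> (grid N x)) (\<lambda>x. \<phi> (grid N x)) - (\<integral>x. \<phi> x * \<phi> x \<partial>torus)\<bar> \<le>
      2 * C0 * C1 * mass1 / real N" if N: "0 < N" for N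
  proof -
    let ?c = "\<lambda>x. wrap N (cell_of N x)"
    have cell_int: "integrable torus (\<lambda>x. \<phi> (grid N (?c x)) * \<phi> (grid N (?c x)))"
      by (rule cell_function_integrable[OF N, of "\<lambda>y. \<phi> (grid N y) * \<phi> (grid N y)"])
    have "inner_N N (\<lambda>x. \<phi> (grid N x)) (\<lambda>x. \<phi> (grid N x)) = (\<integral>x. \<phi> (grid N (?c x)) * \<phi> (grid N (?c x)) \<partial>torus)"
      unfolding inner_N_def by (rule cell_function_integral[OF N, symmetric])
    then have "inner_N N (\<lambda>x. \<phi> (grid N x)) (\<lambda>x. \<phi> (grid N x)) - (\<integral>x. \<phi> x * \<phi> x \<partial>torus) =
        (\<integral>x. \<phi> (grid N (?c x)) * \<phi> (grid N (?c x)) - \<phi> x * \<phi> x \<partial>torus)"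
      using int cell_int by simp
    also have "\<bar>\<dots>\<bar> \<le> (\<integral>x. \<bar>\<phi> (grid N (?c x)) * \<phi> (grid N (?c x)) - \<phi> x * \<phi> x\<bar> \<partial>torus)"
      by (rule integral_abs_bound)
    also have "\<dots> \<le> (\<integral>x. 2 * C0 * C1 * (\<Sum>j\<in>UNIV. W_incr W N j (?c x)) \<partial>torus)"
    proof (rule integral_mono)
      show "integrable torus (\<lambda>x. \<bar>\<phi> (grid N (?c x)) * \<phi> (grid N (?c x)) - \<phi> x * \<phi> x\<bar>)"
        using int cell_int by auto
      show "integrable torus (\<lambda>x. 2 * C0 * C1 * (\<Sum>j\<in>UNIV. W_incr W N j (?c x)))"
        using cell_function_integrable[OF N, of "\<lambda>y. \<Sum>j\<in>UNIV. W_incr W N j y"] by simp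
      fix x :: "real^'d"
      have "\<phi> (grid N (?c x)) * \<phi> (grid N (?c x)) - \<phi> x * \<phi> x =
          (\<phi> (grid N (?c x)) - \<phi> x) * (\<phi> (grid N (?c x)) + \<phi> x)" by (simp add: algebra_simps)
      also have "\<bar>\<dots>\<bar> \<le> (C1 * (\<Sum>j\<in>UNIV. W_incr W N j (?c x))) * (2 * C0)"
        unfolding abs_mult
      proof (rule mult_mono)
        show "\<bar>\<phi> (grid N (?c x)) - \<phi> x\<bar> \<le> C1 * (\<Sum>j\<in>UNIV. W_incr W N j (?c x))"
          by (rule cell_oscillation[OF W N \<phi>(1) C1])
        show "\<bar>\<phi> (grid N (?c x)) + \<phi> x\<bar> \<le> 2 * C0"
          using C0[of "grid N (?c x)"] C0[of x] by linarith
        show "0 \<le> C1 * (\<Sum>j\<in>UNIV. W_incr W N j (?c x))"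
          using C1(2) less_imp_le[OF W_incr_pos[OF W N]] by (intro mult_nonneg_nonneg sum_nonneg)
      qed simp
      finally show "\<bar>\<phi> (grid N (?c x)) * \<phi> (grid N (?c x)) - \<phi> x * \<phi> x\<bar> \<le> 2 * C0 * C1 * (\<Sum>j\<in>UNIV. W_incr W N j (?c x))"
        by (simp add: mult_ac)
    qed
    also have "\<dots> = 2 * C0 * C1 * ((\<Sum>y\<in>sites N. \<Sum>j\<in>UNIV. W_incr W N j y) / real N ^ CARD('d))"
      using cell_function_integral[OF N, of "\<lambda>y. \<Sum>j\<in>UNIV. W_incr W N j y"] by simp
    also have "(\<Sum>y\<in>sites N. \<Sum>j\<in>UNIV. W_incr W N j y) / real N ^ CARD('d) = mass1 / real N"
      unfolding mass1_def
      by (subst sum.swap) (simp only: sum_divide_distrib[where A = "UNIV :: 'd set"] W_incr_mean[OF N])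
    finally show ?thesis by simp
  qed
  have "(\<lambda>N. inner_N N (\<lambda>x. \<phi> (grid N x)) (\<lambda>x. \<phi> (grid N x)) - (\<integral>x. \<phi> x * \<phi> x \<partial>torus)) \<longlonglongrightarrow> 0"
  proof (rule Lim_null_comparison)
    show "\<forall>\<^sub>F N in sequentially. norm (inner_N N (\<lambda>x. \<phi> (grid N x)) (\<lambda>x. \<phi> (grid N x)) - (\<integral>x. \<phi> x * \<phi> x \<partial>torus))
        \<le> 2 * C0 * C1 * mass1 / real N"
      using eventually_gt_at_top[of 0] by eventually_elim (use bound in simp)
    show "(\<lambda>N. 2 * C0 * C1 * mass1 / real N) \<longlonglongrightarrow> 0" by (rule lim_const_over_n)
  qed
  then show ?thesis by (simp add: LIM_zero_iff)
qed

lemma interp_unit_sum: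
  fixes v :: "int^'d \<Rightarrow> real"
  assumes N: "0 < N"
  shows "interp W N v x = (\<Sum>y\<in>sites N. v y * interp W N (\<lambda>z. if z = y then 1 else 0) x)"
proof -
  define c where "c S = (\<Prod>k\<in>UNIV. if k \<in> S then interp_weight W N x k else 1 - interp_weight W N x k)" for S
  define z where "z S = wrap N (cell_of N x + (\<chi> k. if k \<in> S then 1 else 0))" for S
  have "(\<Sum>y\<in>sites N. v y * interp W N (\<lambda>z. if z = y then 1 else 0) x) =
      (\<Sum>y\<in>sites N. \<Sum>S\<in>UNIV. v y * (c S * (if z S = y then 1 else 0)))"
    by (simp add: interp_eq c_def z_def sum_distrib_left)
  also have "\<dots> = (\<Sum>S\<in>UNIV. \<Sum>y\<in>sites N. if z S = y then c S * v y else 0)"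
    by (subst sum.swap) (intro sum.cong; simp)
  also have "\<dots> = (\<Sum>S\<in>UNIV. c S * v (z S))"
    by (intro sum.cong refl) (simp add: finite_sites z_def wrap_in_sites[OF N])
  finally show ?thesis by (simp add: interp_eq c_def z_def)
qed

text \<open>A functional of the interpolant is linear in the nodal values, hence a scalar product
  with the vector \<open>r\<close> built from its values at the unit functions; the power of
  \<open>N\<close> undoes the normalization of \<open>inner_N\<close>. This supplies the solutions
  to which homogenization applies.\<close>

lemma interp_solution_exists:
  fixes \<phi> :: "real^'d \<Rightarrow> real"
  assumes W: "admissible_W W" and N: "0 < N" and l: "0 < l" and \<aa>: "\<And>j x. 0 \<le> \<aa> j x"
    and \<phi>: "\<And>v. integrable torus (\<lambda>x. \<phi> x * interp W N v x)"
  obtains u where "\<And>v. l * inner_N N u v + form_N W \<aa> N u v = c * (\<integral>x. \<phi> x * interp W N v x \<partial>torus)"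
proof -
  define \<delta> :: "int^'d \<Rightarrow> int^'d \<Rightarrow> real" where "\<delta> y = (\<lambda>z. if z = y then 1 else 0)" for y
  define r where "r y = real N ^ CARD('d) * (c * (\<integral>x. \<phi> x * interp W N (\<delta> y) x \<partial>torus))" for y
  obtain u where u: "\<And>x. x \<in> sites N \<Longrightarrow> l * u x - random_walk_generator W \<aa> N u x = r x"
    using resolvent_exists[where \<aa> = \<aa> and r = r, OF W N l \<aa>] by blast
  show ?thesis
  proof (rule that)
    fix v :: "int^'d \<Rightarrow> real"
    have "(\<integral>x. \<phi> x * interp W N v x \<partial>torus) = (\<integral>x. (\<Sum>y\<in>sites N. v y * (\<phi> x * interp W N (\<delta> y) x)) \<partial>torus)"
      by (subst interp_unit_sum[OF N, of W v]) (simp add: \<delta>_def sum_distrib_left mult_ac)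
    also have "\<dots> = (\<Sum>y\<in>sites N. v y * (\<integral>x. \<phi> x * interp W N (\<delta> y) x \<partial>torus))"
      by (subst Bochner_Integration.integral_sum) (auto intro!: integrable_mult_right \<phi>)
    finally have "c * (\<integral>x. \<phi> x * interp W N v x \<partial>torus) = inner_N N r v"
      using N by (simp add: inner_N_def r_def sum_distrib_left sum_divide_distrib mult_ac)
    then show "l * inner_N N u v + form_N W \<aa> N u v = c * (\<integral>x. \<phi> x * interp W N v x \<partial>torus)"
      using resolvent_weak[OF N u, where v = v] by simp
  qed
qed

text \<open>Closes the energy estimates below, whose right-hand sides still contain the square root
  of the energy that is to be bounded.\<close>

lemma square_self_bound:
  fixes Q :: real
  assumes "0 < \<kappa>" "0 \<le> Q" "(\<kappa> * Q)\<^sup>2 \<le> C * Q" "0 \<le> C"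
  shows "Q \<le> C / \<kappa>\<^sup>2"
proof (cases "Q = 0")
  case False
  then have "\<kappa>\<^sup>2 * Q * Q \<le> C * Q" using assms(3) by (simp add: power2_eq_square mult_ac)
  then have "\<kappa>\<^sup>2 * Q \<le> C" using False assms(2) by (simp add: mult_le_cancel_right)
  then show ?thesis using assms(1) by (simp add: field_simps)
qed (use assms in simp)

context eigen_system
begin

text \<open>The eigenvalue at \<open>prodf f\<close> of the homogenized operator, with the sign
  reversed.\<close>

definition "hom_eig A f = (\<Sum>j\<in>UNIV. A j * eigs f j)"

context
  fixes \<aa> :: "'d \<Rightarrow> int^'d \<Rightarrow> real" and A :: "'d \<Rightarrow> real" and \<kappa> :: real and f
  assumes \<kappa>: "0 < \<kappa>" and ell: "\<And>j x. \<kappa> \<le> \<aa> j x" and hom: "homogenization W B \<aa> A" and A: "\<And>j. 0 < A j"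
    and f: "f \<in> families"
begin

abbreviation "\<gamma> \<equiv> hom_eig A f"

abbreviation "phi N \<equiv> (\<lambda>x. prodf f (grid N x))"

lemma hom_eig_nonneg: "0 \<le> \<gamma>"
  unfolding hom_eig_def using less_imp_le[OF A] eigs_nonneg[OF f] by (intro sum_nonneg mult_nonneg_nonneg)

lemma phi_norm_le: "0 < N \<Longrightarrow> inner_N N (phi N) (phi N) \<le> (bnd f)\<^sup>2"
  by (rule inner_N_grid_le) (auto intro: prodf_bound[OF f])

lemma ell_nonneg: "0 \<le> \<aa> j x"
  using \<kappa> ell[of j x] by linarith

text \<open>The function \<open>g\<close> has a nodal right-hand side, whereas homogenization
  concerns the solutions \<open>u\<close> for the interpolated functional. Their difference solves
  the equation with a multiple of the defect \<open>D\<close> on the right and has energy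
  \<open>O(1/N)\<close>. The factor \<open>l + \<gamma>\<close> makes \<open>prodf f\<close> the
  homogenized solution, so the limit is its squared norm 1.\<close>

lemma eigen_pairing:
  assumes l: "0 < l"
    and g: "\<And>N x. 0 < N \<Longrightarrow> x \<in> sites N \<Longrightarrow> l * g N x - random_walk_generator W \<aa> N (g N) x = (l + \<gamma>) * phi N x"
  shows "(\<lambda>N. inner_N N (phi N) (g N)) \<longlonglongrightarrow> 1"
proof -
  obtain C1 where C1: "0 \<le> C1"
    "\<And>x y. \<bar>prodf f x - prodf f y\<bar> \<le> C1 * (\<Sum>k\<in>UNIV. \<bar>W k (x $ k) - W k (y $ k)\<bar>)"
    using prodf_Lipschitz[OF f] by blast
  define Q where "Q N v = inner_N N v v + form_N W (\<lambda>_ _. 1) N v v" for N and v :: "int^'d \<Rightarrow> real"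
  define D where "D N v = inner_N N (phi N) v - (\<integral>x. prodf f x * interp W N v x \<partial>torus)" for N v
  obtain K where K: "0 \<le> K" "\<And>N v. 0 < N \<Longrightarrow> (D N v)\<^sup>2 \<le> K / real N * Q N v"
    using interp_defect[OF admissible prodf_periodic[OF f] prodf_borel[OF f] prodf_bound[OF f] C1(2,1)]
    unfolding D_def Q_def by blast
  have form1: "0 \<le> form_N W (\<lambda>_ _. 1) N v v" if "0 < N" for N v
    by (rule form_N_self_nonneg[OF admissible that]) simp
  have Q: "0 \<le> Q N v" "inner_N N v v \<le> Q N v" if "0 < N" for N v
    using inner_N_self_nonneg[of N v] form1[OF that, of v] by (auto simp: Q_def)
  \<comment> \<open>The coercivity constant: \<open>l\<close> comes from the scalar product,
    \<open>\<kappa>\<close> from the form by ellipticity.\<close>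
  define \<kappa>' where "\<kappa>' = min l \<kappa>"
  have \<kappa>': "0 < \<kappa>'" using l \<kappa> by (simp add: \<kappa>'_def)
  have coercive: "\<kappa>' * Q N v \<le> l * inner_N N v v + form_N W \<aa> N v v" if "0 < N" for N v
  proof -
    have "\<kappa>' * inner_N N v v \<le> l * inner_N N v v"
      by (rule mult_right_mono) (auto simp: \<kappa>'_def inner_N_self_nonneg)
    moreover have "\<kappa>' * form_N W (\<lambda>_ _. 1) N v v \<le> \<kappa> * form_N W (\<lambda>_ _. 1) N v v"
      using form1[OF that] by (intro mult_right_mono) (auto simp: \<kappa>'_def)
    ultimately show ?thesis
      using form_N_ge[where \<aa> = \<aa> and \<kappa> = \<kappa> and v = v, OF admissible that ell] by (simp add: Q_def distrib_left)
  qed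
  have int_interp: "integrable torus (\<lambda>x. prodf f x * interp W N v x)" if "0 < N" for N v
  proof (rule Bochner_Integration.integrable_bound[OF integrable_mult_right[OF interp_L1(3)[OF admissible that, of v], of "bnd f"]])
    show "(\<lambda>x. prodf f x * interp W N v x) \<in> borel_measurable torus"
      by (intro borel_measurable_times torus.borel_torus_measure prodf_borel[OF f] interp_measurable[OF admissible that])
    have "\<bar>prodf f x\<bar> \<le> \<bar>bnd f\<bar>" for x using prodf_bound[OF f, of x] by linarith
    then show "AE x in torus. norm (prodf f x * interp W N v x) \<le> norm (bnd f * interp W N v x)"
      by (auto simp: abs_mult intro!: AE_I2 mult_right_mono)
  qed
  have "\<exists>u. 0 < N \<longrightarrow> (\<forall>v. l * inner_N N u v + form_N W \<aa> N u v = (l + \<gamma>) * (\<integral>x. prodf f x * interp W N v x \<partial>torus))" for N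
  proof (cases "0 < N")
    case True
    then show ?thesis
      using interp_solution_exists[where \<aa> = \<aa>, OF admissible True l ell_nonneg int_interp[OF True]] by metis
  qed auto
  then obtain u where u: "\<And>N v. 0 < N \<Longrightarrow>
      l * inner_N N (u N) v + form_N W \<aa> N (u N) v = (l + \<gamma>) * (\<integral>x. prodf f x * interp W N v x \<partial>torus)"
    by metis
  \<comment> \<open>The factor 1 matches the shape of \<open>prodf_bounded_functional\<close>, whose
    functional with \<open>c = 1\<close> tests the weak convergence.\<close>
  have "(\<lambda>N. 1 * (\<integral>x. prodf f x * interp W N (u N) x \<partial>torus)) \<longlonglongrightarrow> 1 * (\<integral>x. prodf f x * prodf f x \<partial>torus)"
  proof -
    have "\<forall>N\<ge>1. discrete_weak_solution W \<aa> N l (\<lambda>v. (l + \<gamma>) * (\<integral>x. prodf f x * v x \<partial>torus)) (u N)"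
      using u by (simp add: discrete_weak_solution_iff[OF admissible])
    moreover have "weak_solution W B A l (\<lambda>v. (l + \<gamma>) * (\<integral>x. prodf f x * v x \<partial>torus)) (prodf f)"
      unfolding hom_eig_def by (rule prodf_weak_solution[OF f])
    ultimately show ?thesis
      using hom l prodf_bounded_functional[OF f, of "l + \<gamma>"] prodf_bounded_functional[OF f, of 1]
      unfolding homogenization_def by blast
  qed
  then have lim: "(\<lambda>N. \<integral>x. prodf f x * interp W N (u N) x \<partial>torus) \<longlonglongrightarrow> 1"
    using prodf_inner[OF f f] by simp
  \<comment> \<open>The first summand comes from the difference \<open>w\<close>, the second from
    the defect of \<open>u N\<close>.\<close>
  define E where "E = 2 * ((bnd f)\<^sup>2 * ((l + \<gamma>)\<^sup>2 * K / \<kappa>'\<^sup>2)) + 2 * (K * (2 * (l + \<gamma>)\<^sup>2 * ((bnd f)\<^sup>2 + K) / \<kappa>'\<^sup>2))"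
  have close: "(inner_N N (phi N) (g N) - (\<integral>x. prodf f x * interp W N (u N) x \<partial>torus))\<^sup>2 \<le> E / real N"
    if N: "0 < N" for N
  proof -
    define w where "w x = g N x - u N x" for x
    have "l * inner_N N w w + form_N W \<aa> N w w = (l + \<gamma>) * D N w"
    proof -
      have "l * inner_N N (g N) w + form_N W \<aa> N (g N) w = inner_N N (\<lambda>x. (l + \<gamma>) * phi N x) w"
        by (rule resolvent_weak[OF N g[OF N]])
      then have "l * (inner_N N (g N) w - inner_N N (u N) w) + (form_N W \<aa> N (g N) w - form_N W \<aa> N (u N) w) =
          (l + \<gamma>) * D N w"
        using u[OF N, of w] by (simp add: inner_N_scale D_def right_diff_distrib)
      then show ?thesis by (simp add: w_def[abs_def] inner_N_diff[symmetric] form_N_diff[symmetric])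
    qed
    then have "\<kappa>' * Q N w \<le> (l + \<gamma>) * D N w" using coercive[OF N, of w] by simp
    then have "(\<kappa>' * Q N w)\<^sup>2 \<le> ((l + \<gamma>) * D N w)\<^sup>2"
      using \<kappa>' Q(1)[OF N, of w] by (intro power_mono) auto
    also have "\<dots> \<le> (l + \<gamma>)\<^sup>2 * (K / real N * Q N w)"
      unfolding power_mult_distrib by (intro mult_left_mono K(2) N) auto
    finally have "(\<kappa>' * Q N w)\<^sup>2 \<le> ((l + \<gamma>)\<^sup>2 * K / real N) * Q N w" by simp
    then have Qw: "Q N w \<le> ((l + \<gamma>)\<^sup>2 * K / real N) / \<kappa>'\<^sup>2"
      using K(1) by (intro square_self_bound \<kappa>' Q(1) N) auto
    \<comment> \<open>The functional at \<open>u N\<close> is the nodal pairing minus the defect,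
      and the squares of both are at most constants times the energy; this bounds the energy of
      \<open>u N\<close> uniformly in \<open>N\<close>.\<close>
    have "\<kappa>' * Q N (u N) \<le> (l + \<gamma>) * (inner_N N (phi N) (u N) - D N (u N))"
      using coercive[OF N, of "u N"] u[OF N, of "u N"] by (simp add: D_def)
    then have "(\<kappa>' * Q N (u N))\<^sup>2 \<le> ((l + \<gamma>) * (inner_N N (phi N) (u N) - D N (u N)))\<^sup>2"
      using \<kappa>' Q(1)[OF N, of "u N"] by (intro power_mono) auto
    also have "\<dots> = (l + \<gamma>)\<^sup>2 * (inner_N N (phi N) (u N) + - D N (u N))\<^sup>2" by (simp add: power_mult_distrib)
    also have "\<dots> \<le> (l + \<gamma>)\<^sup>2 * (2 * (inner_N N (phi N) (u N))\<^sup>2 + 2 * (- D N (u N))\<^sup>2)"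
      by (intro mult_left_mono square_sum_le) auto
    also have "\<dots> \<le> (l + \<gamma>)\<^sup>2 * (2 * ((bnd f)\<^sup>2 * Q N (u N)) + 2 * (K * Q N (u N)))"
    proof (intro mult_left_mono add_mono)
      show "(inner_N N (phi N) (u N))\<^sup>2 \<le> (bnd f)\<^sup>2 * Q N (u N)"
        by (rule order_trans[OF inner_N_Cauchy_Schwarz])
          (intro mult_mono phi_norm_le[OF N] Q(2)[OF N] inner_N_self_nonneg zero_le_power2)
      have "K / real N \<le> K" using K(1) N by (simp add: field_simps mult_le_cancel_left1)
      then show "(- D N (u N))\<^sup>2 \<le> K * Q N (u N)"
        using K(2)[OF N, of "u N"] mult_right_mono[of "K / real N" K "Q N (u N)"] Q(1)[OF N, of "u N"] by simp
    qed auto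
    finally have "(\<kappa>' * Q N (u N))\<^sup>2 \<le> (2 * (l + \<gamma>)\<^sup>2 * ((bnd f)\<^sup>2 + K)) * Q N (u N)"
      by (simp add: algebra_simps)
    then have Qu: "Q N (u N) \<le> 2 * (l + \<gamma>)\<^sup>2 * ((bnd f)\<^sup>2 + K) / \<kappa>'\<^sup>2"
      using K(1) by (intro square_self_bound \<kappa>' Q(1) N) auto
    have "inner_N N (phi N) (g N) - (\<integral>x. prodf f x * interp W N (u N) x \<partial>torus) =
        inner_N N (phi N) w + D N (u N)"
      by (simp add: w_def[abs_def] inner_N_diff_right D_def)
    then have "(inner_N N (phi N) (g N) - (\<integral>x. prodf f x * interp W N (u N) x \<partial>torus))\<^sup>2 \<le>
        2 * (inner_N N (phi N) w)\<^sup>2 + 2 * (D N (u N))\<^sup>2" by (simp only: square_sum_le)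
    also have "\<dots> \<le> 2 * ((bnd f)\<^sup>2 * (((l + \<gamma>)\<^sup>2 * K / real N) / \<kappa>'\<^sup>2)) +
        2 * (K / real N * (2 * (l + \<gamma>)\<^sup>2 * ((bnd f)\<^sup>2 + K) / \<kappa>'\<^sup>2))"
    proof (intro add_mono mult_left_mono)
      have "(inner_N N (phi N) w)\<^sup>2 \<le> inner_N N (phi N) (phi N) * inner_N N w w" by (rule inner_N_Cauchy_Schwarz)
      also have "\<dots> \<le> (bnd f)\<^sup>2 * (((l + \<gamma>)\<^sup>2 * K / real N) / \<kappa>'\<^sup>2)"
        by (intro mult_mono phi_norm_le[OF N] order_trans[OF Q(2)[OF N] Qw] inner_N_self_nonneg zero_le_power2)
      finally show "(inner_N N (phi N) w)\<^sup>2 \<le> (bnd f)\<^sup>2 * (((l + \<gamma>)\<^sup>2 * K / real N) / \<kappa>'\<^sup>2)" .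
      show "(D N (u N))\<^sup>2 \<le> K / real N * (2 * (l + \<gamma>)\<^sup>2 * ((bnd f)\<^sup>2 + K) / \<kappa>'\<^sup>2)"
        by (rule order_trans[OF K(2)[OF N]]) (intro mult_left_mono Qu, use K(1) in simp)
    qed auto
    also have "\<dots> = E / real N" by (simp add: E_def add_divide_distrib mult.commute)
    finally show ?thesis .
  qed
  have "(\<lambda>N. (inner_N N (phi N) (g N) - (\<integral>x. prodf f x * interp W N (u N) x \<partial>torus))\<^sup>2) \<longlonglongrightarrow> 0"
  proof (rule Lim_null_comparison)
    show "\<forall>\<^sub>F N in sequentially. norm ((inner_N N (phi N) (g N) - (\<integral>x. prodf f x * interp W N (u N) x \<partial>torus))\<^sup>2) \<le> E / real N"
      using eventually_gt_at_top[of 0] by eventually_elim (use close in simp)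
    show "(\<lambda>N. E / real N) \<longlonglongrightarrow> 0" by (rule lim_const_over_n)
  qed
  then have "(\<lambda>N. inner_N N (phi N) (g N) - (\<integral>x. prodf f x * interp W N (u N) x \<partial>torus)) \<longlonglongrightarrow> 0"
    by (simp add: power_tendsto_0_iff)
  from tendsto_add[OF this lim] show ?thesis by simp
qed

text \<open>By the resolvent identity, \<open>\<langle>g\<^sub>l, g\<^sub>m\<rangle>\<close> is a divided difference of the pairings with \<open>\<phi>\<close>, hence
  tends to 1 for \<open>m \<noteq> l\<close>; letting \<open>m\<close> tend to \<open>l\<close> identifies the limit of \<open>\<parallel>g\<^sub>l\<parallel>\<^sup>2\<close> without any
  compactness argument.\<close>

lemma eigen_convergence:
  assumes l: "0 < l"
    and g: "\<And>N x. 0 < N \<Longrightarrow> x \<in> sites N \<Longrightarrow> l * g N x - random_walk_generator W \<aa> N (g N) x = (l + \<gamma>) * phi N x"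
  shows "(\<lambda>N. inner_N N (\<lambda>x. g N x - phi N x) (\<lambda>x. g N x - phi N x)) \<longlonglongrightarrow> 0"
proof -
  obtain C1 where C1: "0 \<le> C1"
    "\<And>x y. \<bar>prodf f x - prodf f y\<bar> \<le> C1 * (\<Sum>k\<in>UNIV. \<bar>W k (x $ k) - W k (y $ k)\<bar>)"
    using prodf_Lipschitz[OF f] by blast
  have norm_phi: "(\<lambda>N. inner_N N (phi N) (phi N)) \<longlonglongrightarrow> 1"
    using inner_N_grid_limit[OF admissible prodf_periodic[OF f] prodf_borel[OF f] prodf_bound[OF f] C1(2,1)]
      prodf_inner[OF f f] by simp
  \<comment> \<open>\<open>R\<close> bounds the squared norms of the solutions for all parameters in
    \<open>[l, l + 1]\<close>; \<open>sqrt C * \<delta>\<close> will bound the pairing of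
    \<open>g\<close> with the difference of the solutions for \<open>l\<close> and
    \<open>l + \<delta>\<close>.\<close>
  define R where "R = ((l + 1 + \<gamma>) / l)\<^sup>2 * (bnd f)\<^sup>2"
  define C where "C = R * (4 * R + 4 * (bnd f)\<^sup>2) / l\<^sup>2"
  have R: "0 \<le> R" by (simp add: R_def)
  have C: "0 \<le> C" using R by (simp add: C_def)
  have sol_bound: "inner_N N h h \<le> R" if N: "0 < N" and m: "l \<le> m" "m \<le> l + 1"
    and h: "\<And>x. x \<in> sites N \<Longrightarrow> m * h x - random_walk_generator W \<aa> N h x = (m + \<gamma>) * phi N x" for N m h
  proof -
    have "m\<^sup>2 * inner_N N h h \<le> inner_N N (\<lambda>x. (m + \<gamma>) * phi N x) (\<lambda>x. (m + \<gamma>) * phi N x)"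
      using l m by (intro resolvent_bound[where \<aa> = \<aa>, OF admissible N _ ell_nonneg h]) auto
    also have "\<dots> = (m + \<gamma>)\<^sup>2 * inner_N N (phi N) (phi N)"
      by (simp add: inner_N_scale inner_N_scale_right power2_eq_square)
    also have "\<dots> \<le> (l + 1 + \<gamma>)\<^sup>2 * (bnd f)\<^sup>2"
      using l m hom_eig_nonneg by (intro mult_mono phi_norm_le[OF N] power_mono inner_N_self_nonneg) auto
    finally have "m\<^sup>2 * inner_N N h h \<le> (l + 1 + \<gamma>)\<^sup>2 * (bnd f)\<^sup>2" .
    moreover have "l\<^sup>2 * inner_N N h h \<le> m\<^sup>2 * inner_N N h h"
      using l m by (intro mult_right_mono inner_N_self_nonneg power_mono) auto
    ultimately have "l\<^sup>2 * inner_N N h h \<le> (l + 1 + \<gamma>)\<^sup>2 * (bnd f)\<^sup>2" by linarith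
    then show ?thesis using l by (simp add: R_def power_divide field_simps)
  qed
  show ?thesis
  proof (rule LIMSEQ_I)
    fix e :: real assume e: "0 < e"
    \<comment> \<open>The summand 1 in the denominator avoids a division by 0 and makes the later
      inequality strict. The step \<open>\<delta>\<close> is fixed before \<open>N\<close> tends to
      infinity.\<close>
    define \<delta> where "\<delta> = min 1 (e / (2 * (sqrt C + 1)))"
    have sC: "0 \<le> sqrt C" using C by simp
    have \<delta>: "0 < \<delta>" "\<delta> \<le> 1" "sqrt C * \<delta> < e / 2"
    proof -
      have "0 < e / (2 * (sqrt C + 1))" using e sC by (intro divide_pos_pos mult_pos_pos add_nonneg_pos) simp_all
      then show "0 < \<delta>" "\<delta> \<le> 1" unfolding \<delta>_def by (simp_all only: min_less_iff_conj zero_less_one simp_thms min.cobounded1)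
      have "sqrt C * \<delta> \<le> sqrt C * (e / (2 * (sqrt C + 1)))"
        using sC by (intro mult_left_mono) (auto simp: \<delta>_def)
      also have "\<dots> = e / 2 * (sqrt C / (sqrt C + 1))" by simp
      also have "\<dots> < e / 2 * 1"
        using e add_nonneg_pos[OF sC zero_less_one] by (intro mult_strict_left_mono) (simp_all add: divide_less_eq)
      also have "\<dots> = e / 2" by simp
      finally show "sqrt C * \<delta> < e / 2" .
    qed
    define m where "m = l + \<delta>"
    have m: "0 < m" "l \<le> m" "m \<le> l + 1" "m - l = \<delta>" using l \<delta> by (auto simp: m_def)
    have "\<exists>h. 0 < N \<longrightarrow> (\<forall>x\<in>sites N. m * h x - random_walk_generator W \<aa> N h x = (m + \<gamma>) * phi N x)" for N
    proof (cases "0 < N")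
      case True
      then show ?thesis
        using resolvent_exists[where \<aa> = \<aa> and r = "\<lambda>x. (m + \<gamma>) * phi N x", OF admissible True m(1) ell_nonneg] by metis
    qed auto
    then obtain h where h: "\<And>N x. 0 < N \<Longrightarrow> x \<in> sites N \<Longrightarrow>
        m * h N x - random_walk_generator W \<aa> N (h N) x = (m + \<gamma>) * phi N x"
      by metis
    have pair_g: "(\<lambda>N. inner_N N (phi N) (g N)) \<longlonglongrightarrow> 1" by (rule eigen_pairing[OF l g])
    have pair_h: "(\<lambda>N. inner_N N (phi N) (h N)) \<longlonglongrightarrow> 1" by (rule eigen_pairing[OF m(1) h])
    \<comment> \<open>Each equation is tested with the other solution; by symmetry the forms cancel
      in the difference.\<close>
    have gh_eq: "inner_N N (g N) (h N) =
        ((m + \<gamma>) * inner_N N (phi N) (g N) - (l + \<gamma>) * inner_N N (phi N) (h N)) / \<delta>" if N: "0 < N" for N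
    proof -
      have "l * inner_N N (g N) (h N) + form_N W \<aa> N (g N) (h N) = inner_N N (\<lambda>x. (l + \<gamma>) * phi N x) (h N)"
        by (rule resolvent_weak[OF N g[OF N]])
      moreover have "m * inner_N N (h N) (g N) + form_N W \<aa> N (h N) (g N) = inner_N N (\<lambda>x. (m + \<gamma>) * phi N x) (g N)"
        by (rule resolvent_weak[OF N h[OF N]])
      moreover have "inner_N N (h N) (g N) = inner_N N (g N) (h N)" "form_N W \<aa> N (h N) (g N) = form_N W \<aa> N (g N) (h N)"
        by (rule inner_N_commute form_N_commute)+
      ultimately have "(m - l) * inner_N N (g N) (h N) =
          (m + \<gamma>) * inner_N N (phi N) (g N) - (l + \<gamma>) * inner_N N (phi N) (h N)"
        by (simp add: inner_N_scale left_diff_distrib)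
      then show ?thesis using \<delta>(1) m(4) by (simp add: field_simps)
    qed
    have "(\<lambda>N. ((m + \<gamma>) * inner_N N (phi N) (g N) - (l + \<gamma>) * inner_N N (phi N) (h N)) / \<delta>) \<longlonglongrightarrow>
        ((m + \<gamma>) * 1 - (l + \<gamma>) * 1) / \<delta>"
      using \<delta>(1) by (intro tendsto_intros pair_g pair_h) auto
    also have "((m + \<gamma>) * 1 - (l + \<gamma>) * 1) / \<delta> = 1" using m(4) \<delta>(1) by simp
    finally have "(\<lambda>N. ((m + \<gamma>) * inner_N N (phi N) (g N) - (l + \<gamma>) * inner_N N (phi N) (h N)) / \<delta>
        - 2 * inner_N N (phi N) (g N) + inner_N N (phi N) (phi N)) \<longlonglongrightarrow> 1 - 2 * 1 + 1"
      by (intro tendsto_intros pair_g norm_phi)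
    then have "\<forall>\<^sub>F N in sequentially. ((m + \<gamma>) * inner_N N (phi N) (g N) - (l + \<gamma>) * inner_N N (phi N) (h N)) / \<delta>
        - 2 * inner_N N (phi N) (g N) + inner_N N (phi N) (phi N) < e / 2"
      using e by (intro order_tendstoD(2)) auto
    then have "\<forall>\<^sub>F N in sequentially. norm (inner_N N (\<lambda>x. g N x - phi N x) (\<lambda>x. g N x - phi N x) - 0) < e"
      using eventually_gt_at_top[of 0]
    proof eventually_elim
      case (elim N)
      note N = \<open>0 < N\<close>
      let ?w = "\<lambda>x. g N x - h N x" and ?d = "\<lambda>x. h N x - phi N x"
      \<comment> \<open>Subtracting the two equations leaves \<open>\<delta>\<close> times
        \<open>h N - phi N\<close> on the right, so the solutions differ by
        \<open>O(\<delta>)\<close> in norm, uniformly in \<open>N\<close>.\<close>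
      have "l\<^sup>2 * inner_N N ?w ?w \<le> inner_N N (\<lambda>x. \<delta> * ?d x) (\<lambda>x. \<delta> * ?d x)"
      proof (rule resolvent_bound[where \<aa> = \<aa>, OF admissible N l ell_nonneg])
        fix x :: "int^'d" assume x: "x \<in> sites N"
        show "l * ?w x - random_walk_generator W \<aa> N ?w x = \<delta> * ?d x"
          using g[OF N x] h[OF N x] unfolding m(4)[symmetric] random_walk_generator_diff
          by (simp add: algebra_simps)
      qed
      also have "\<dots> = \<delta>\<^sup>2 * inner_N N ?d ?d"
        by (simp add: inner_N_scale inner_N_scale_right power2_eq_square)
      also have "inner_N N ?d ?d \<le> 4 * R + 4 * (bnd f)\<^sup>2"
      proof -
        have "inner_N N ?d ?d = inner_N N (h N) (h N) - 2 * inner_N N (phi N) (h N) + inner_N N (phi N) (phi N)"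
          by (simp add: inner_N_diff inner_N_diff_right inner_N_commute[of N "h N" "phi N"])
        \<comment> \<open>The square of the sum bounds the cross term from below.\<close>
        moreover have "0 \<le> inner_N N (h N) (h N) + 2 * inner_N N (phi N) (h N) + inner_N N (phi N) (phi N)"
          using inner_N_self_nonneg[of N "\<lambda>x. h N x + phi N x"]
          by (simp add: inner_N_add inner_N_commute[of N _ "\<lambda>x. h N x + phi N x"] inner_N_commute[of N "h N" "phi N"])
        moreover have "inner_N N (h N) (h N) \<le> R" by (rule sol_bound[OF N m(2,3) h[OF N]])
        ultimately show ?thesis using phi_norm_le[OF N] R zero_le_power2[of "bnd f"] by linarith
      qed
      finally have w: "l\<^sup>2 * inner_N N ?w ?w \<le> \<delta>\<^sup>2 * (4 * R + 4 * (bnd f)\<^sup>2)" by (simp add: mult_left_mono)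
      have "(inner_N N (g N) ?w)\<^sup>2 \<le> inner_N N (g N) (g N) * inner_N N ?w ?w" by (rule inner_N_Cauchy_Schwarz)
      also have "\<dots> \<le> R * (\<delta>\<^sup>2 * (4 * R + 4 * (bnd f)\<^sup>2) / l\<^sup>2)"
      proof (intro mult_mono inner_N_self_nonneg R)
        show "inner_N N (g N) (g N) \<le> R" by (rule sol_bound[OF N _ _ g[OF N]]) auto
        show "inner_N N ?w ?w \<le> \<delta>\<^sup>2 * (4 * R + 4 * (bnd f)\<^sup>2) / l\<^sup>2" using w l by (simp add: field_simps)
      qed
      also have "\<dots> = (sqrt C * \<delta>)\<^sup>2" using C by (simp add: C_def power_mult_distrib)
      finally have "inner_N N (g N) ?w \<le> sqrt C * \<delta>" by (rule power2_le_imp_le) (use sC \<delta>(1) in simp)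
      then have gg: "inner_N N (g N) (g N) < inner_N N (g N) (h N) + e / 2"
        using \<delta>(3) by (simp add: inner_N_diff_right)
      have "inner_N N (\<lambda>x. g N x - phi N x) (\<lambda>x. g N x - phi N x) =
          inner_N N (g N) (g N) - 2 * inner_N N (phi N) (g N) + inner_N N (phi N) (phi N)"
        by (simp add: inner_N_diff inner_N_diff_right inner_N_commute[of N "g N" "phi N"])
      then have "inner_N N (\<lambda>x. g N x - phi N x) (\<lambda>x. g N x - phi N x) < e"
        using gg elim(1) gh_eq[OF N] by linarith
      then show ?case using inner_N_self_nonneg[of N "\<lambda>x. g N x - phi N x"] by simp
    qed
    then show "\<exists>no. \<forall>N\<ge>no. norm (inner_N N (\<lambda>x. g N x - phi N x) (\<lambda>x. g N x - phi N x) - 0) < e"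
      by (simp add: eventually_sequentially)
  qed
qed

end

end

section \<open>Absolutely convergent series of eigenfunctions\<close>

lemma inner_N_sum_tendsto:
  fixes w :: "nat \<Rightarrow> nat \<Rightarrow> int^'d \<Rightarrow> real"
  assumes "\<And>k. k < n \<Longrightarrow> (\<lambda>N. inner_N N (w k N) (w k N)) \<longlonglongrightarrow> 0"
  shows "(\<lambda>N. inner_N N (\<lambda>x. \<Sum>k<n. c k * w k N x) (\<lambda>x. \<Sum>k<n. c k * w k N x)) \<longlonglongrightarrow> 0"
  using assms
proof (induction n)
  case 0
  then show ?case by (simp add: inner_N_def)
next
  case (Suc n)
  show ?case
  proof (rule Lim_null_comparison)
    show "\<forall>\<^sub>F N in sequentially. norm (inner_N N (\<lambda>x. \<Sum>k<Suc n. c k * w k N x) (\<lambda>x. \<Sum>k<Suc n. c k * w k N x)) \<le>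
        2 * inner_N N (\<lambda>x. \<Sum>k<n. c k * w k N x) (\<lambda>x. \<Sum>k<n. c k * w k N x) + 2 * ((c n)\<^sup>2 * inner_N N (w n N) (w n N))"
    proof (intro always_eventually allI)
      fix N
      have "inner_N N (\<lambda>x. c n * w n N x) (\<lambda>x. c n * w n N x) = (c n)\<^sup>2 * inner_N N (w n N) (w n N)"
        by (simp add: inner_N_scale inner_N_scale_right power2_eq_square)
      then show "norm (inner_N N (\<lambda>x. \<Sum>k<Suc n. c k * w k N x) (\<lambda>x. \<Sum>k<Suc n. c k * w k N x)) \<le>
        2 * inner_N N (\<lambda>x. \<Sum>k<n. c k * w k N x) (\<lambda>x. \<Sum>k<n. c k * w k N x) + 2 * ((c n)\<^sup>2 * inner_N N (w n N) (w n N))"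
        using inner_N_add_le[of N "\<lambda>x. \<Sum>k<n. c k * w k N x" "\<lambda>x. c n * w n N x"]
        by (simp add: inner_N_self_nonneg)
    qed
    have "(\<lambda>N. 2 * inner_N N (\<lambda>x. \<Sum>k<n. c k * w k N x) (\<lambda>x. \<Sum>k<n. c k * w k N x) + 2 * ((c n)\<^sup>2 * inner_N N (w n N) (w n N)))
        \<longlonglongrightarrow> 2 * 0 + 2 * ((c n)\<^sup>2 * 0)"
      using Suc by (intro tendsto_intros) auto
    then show "(\<lambda>N. 2 * inner_N N (\<lambda>x. \<Sum>k<n. c k * w k N x) (\<lambda>x. \<Sum>k<n. c k * w k N x) + 2 * ((c n)\<^sup>2 * inner_N N (w n N) (w n N)))
        \<longlonglongrightarrow> 0" by simp
  qed
qed

lemma random_walk_generator_sum: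
  "random_walk_generator W \<aa> N (\<lambda>x. \<Sum>k<n. c k * u k x) x = (\<Sum>k<(n::nat). c k * random_walk_generator W \<aa> N (u k) x)"
proof (induction n)
  case (Suc n)
  have "random_walk_generator W \<aa> N (\<lambda>x. v x + a * w x) x =
      random_walk_generator W \<aa> N v x + a * random_walk_generator W \<aa> N w x" for v w a
    by (simp add: random_walk_generator_def sum.distrib[symmetric] sum_distrib_left algebra_simps)
  with Suc show ?case by simp
qed (simp add: random_walk_generator_def)

lemma suminf_tendsto:
  fixes a :: "nat \<Rightarrow> 'a \<Rightarrow> real"
  assumes lim: "\<And>k. (a k \<longlongrightarrow> b k) F" and M: "\<And>k n. \<bar>a k n\<bar> \<le> M k" "summable M"
  shows "((\<lambda>n. \<Sum>k. a k n) \<longlongrightarrow> (\<Sum>k. b k)) F"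
proof (cases "F = bot")
  case False
  have "eventually (\<lambda>(k, n). norm (a k n) \<le> M k) (at_top \<times>\<^sub>F F)" using M(1) by (intro always_eventually) auto
  from tannerys_theorem[OF lim this M(2) False] show ?thesis by blast
qed simp

lemma cadlag_suminf:
  fixes f :: "nat \<Rightarrow> real^'d \<Rightarrow> real"
  assumes "\<And>k. cadlag (f k)" and M: "\<And>k x. \<bar>f k x\<bar> \<le> M k" "summable M"
  shows "cadlag (\<lambda>x. \<Sum>k. f k x)"
  unfolding cadlag_def
proof (intro allI conjI)
  fix x :: "real^'d"
  show "((\<lambda>x. \<Sum>k. f k x) \<longlongrightarrow> (\<Sum>k. f k x)) (at x within {y. \<forall>k. x $ k \<le> y $ k})"
    using assms(1) by (intro suminf_tendsto[OF _ M]) (auto simp: cadlag_def)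
  fix K :: "'d set"
  let ?F = "at x within {y. \<forall>k. if k \<in> K then x $ k \<le> y $ k else y $ k < x $ k}"
  have "\<forall>n. \<exists>l. (f n \<longlongrightarrow> l) ?F" using assms(1) by (auto simp: cadlag_def)
  then obtain l where "\<And>n. (f n \<longlongrightarrow> l n) ?F" using choice[of "\<lambda>n l. (f n \<longlongrightarrow> l) ?F"] by blast
  then have "((\<lambda>x. \<Sum>k. f k x) \<longlongrightarrow> (\<Sum>k. l k)) ?F" by (rule suminf_tendsto[OF _ M])
  then show "\<exists>l. ((\<lambda>x. \<Sum>k. f k x) \<longlongrightarrow> l) ?F" ..
qed

lemma cadlag_scale:
  fixes f :: "real^'d \<Rightarrow> real"
  assumes "cadlag f"
  shows "cadlag (\<lambda>x. a * f x)"
  using assms unfolding cadlag_def by (blast intro: tendsto_mult_left)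

lemma cadlag_slice_right:
  fixes H :: "real^'d \<Rightarrow> real"
  assumes "cadlag H"
  shows "(slice j x H \<longlongrightarrow> slice j x H u) (at_right u)"
proof -
  define X where "X v = (\<chi> i. if i = j then v else x $ i)" for v :: real
  have "(H \<longlongrightarrow> H (X u)) (at (X u) within {y. \<forall>k. X u $ k \<le> y $ k})"
    using assms unfolding cadlag_def by blast
  moreover have "filterlim X (at (X u) within {y. \<forall>k. X u $ k \<le> y $ k}) (at_right u)"
    unfolding filterlim_at
  proof
    show "\<forall>\<^sub>F v in at_right u. X v \<in> {y. \<forall>k. X u $ k \<le> y $ k} \<and> X v \<noteq> X u"
      unfolding eventually_at_filter by (intro always_eventually) (auto simp: X_def vec_eq_iff intro: less_imp_le)
    show "(X \<longlongrightarrow> X u) (at_right u)"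
      unfolding X_def by (intro tendsto_vec_lambda) (simp add: tendsto_intros)
  qed
  ultimately have "((\<lambda>v. H (X v)) \<longlongrightarrow> H (X u)) (at_right u)" by (rule filterlim_compose)
  then show ?thesis by (simp add: slice_def[abs_def] X_def)
qed

section \<open>The operator applied term by term to absolutely convergent series\<close>

context eigen_system
begin

text \<open>Slices of a cadlag function are right-continuous, so \<open>LW_graph_unique\<close>
  identifies two candidates pointwise where the coordinates lie in \<open>[0,1)\<close>, and
  periodicity reaches the remaining points.\<close>

lemma LW_eqI:
  assumes H: "periodic H" "cadlag H" "\<And>x. LW_graph (W j) (slice j x G) (slice j x H)"
  shows "LW W j G = H"
  unfolding LW_def
proof (rule the_equality)
  show "periodic H \<and> cadlag H \<and> (\<forall>x. LW_graph (W j) (slice j x G) (slice j x H))" using H by blast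
  fix H' assume H': "periodic H' \<and> cadlag H' \<and> (\<forall>x. LW_graph (W j) (slice j x G) (slice j x H'))"
  show "H' = H"
  proof
    fix x0 :: "real^'d"
    define x where "x = (\<chi> k. frac (x0 $ k))"
    have "slice j x H' (x $ j) = slice j x H (x $ j)"
      using H H' by (intro G.LW_graph_unique[of j "slice j x G"] cadlag_slice_right) (auto simp: x_def frac_lt_1)
    moreover have "slice j x H (x $ j) = H x" for H
    proof -
      have "(\<chi> i. if i = j then x $ j else x $ i) = x" by (simp add: vec_eq_iff)
      then show ?thesis unfolding slice_def by (rule arg_cong)
    qed
    ultimately show "H' x0 = H x0" using periodic_frac[of H x0] periodic_frac[of H' x0] H H' by (simp add: x_def)
  qed
qed

definition "series e c x = (\<Sum>k. c k * prodf (e k) x)"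

context
  fixes e :: "nat \<Rightarrow> 'd \<Rightarrow> real \<Rightarrow> real" and c :: "nat \<Rightarrow> real"
  assumes e: "\<And>k. e k \<in> families"
    and summ: "summable (\<lambda>k. \<bar>c k\<bar> * bnd (e k) * (1 + (\<Sum>j\<in>UNIV. eigs (e k) j)))"
begin

lemma bnd_nonneg: "0 \<le> bnd (e k)"
  using prodf_bound[OF e, of k 0] by linarith

text \<open>Three weights occur: \<open>1\<close> for the function, \<open>- eigs (e k) j\<close>
  for the operator and \<open>l + hom_eig A (e k)\<close> for the right-hand side. Each is at most a
  constant times one plus the sum of the eigenvalues, so a single summable majorant serves all three
  series.\<close>

lemma weighted_bound:
  assumes "\<bar>w\<bar> \<le> C * (1 + (\<Sum>j\<in>UNIV. eigs (e k) j))"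
  shows "\<bar>c k * w * prodf (e k) x\<bar> \<le> C * (\<bar>c k\<bar> * bnd (e k) * (1 + (\<Sum>j\<in>UNIV. eigs (e k) j)))"
proof -
  have "\<bar>w\<bar> * \<bar>prodf (e k) x\<bar> \<le> (C * (1 + (\<Sum>j\<in>UNIV. eigs (e k) j))) * bnd (e k)"
    using assms prodf_bound[OF e] by (intro mult_mono) auto
  then have "\<bar>c k\<bar> * (\<bar>w\<bar> * \<bar>prodf (e k) x\<bar>) \<le> \<bar>c k\<bar> * ((C * (1 + (\<Sum>j\<in>UNIV. eigs (e k) j))) * bnd (e k))"
    by (rule mult_left_mono) simp
  then show ?thesis by (simp add: abs_mult mult_ac)
qed

lemma weighted_summable: "summable (\<lambda>k. C * (\<bar>c k\<bar> * bnd (e k) * (1 + (\<Sum>j\<in>UNIV. eigs (e k) j))))"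
  using summ by (rule summable_mult)

lemma weight_one: "\<bar>1\<bar> \<le> 1 * (1 + (\<Sum>j\<in>UNIV. eigs (e k) j))"
  using eigs_nonneg[OF e] by (simp add: sum_nonneg)

lemma weight_eig: "\<bar>- eigs (e k) j\<bar> \<le> 1 * (1 + (\<Sum>j\<in>UNIV. eigs (e k) j))"
  using eigs_nonneg[OF e] member_le_sum[of j UNIV "eigs (e k)"] by simp

lemma term_summable:
  assumes "\<And>k. \<bar>w k\<bar> \<le> C * (1 + (\<Sum>j\<in>UNIV. eigs (e k) j))"
  shows "summable (\<lambda>k. c k * w k * prodf (e k) x)"
  by (rule summable_comparison_test'[OF weighted_summable[of C]]) (use weighted_bound[OF assms] in auto)

lemma weighted_cadlag:
  assumes "\<And>k. \<bar>w k\<bar> \<le> C * (1 + (\<Sum>j\<in>UNIV. eigs (e k) j))"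
  shows "cadlag (\<lambda>x. \<Sum>k. c k * w k * prodf (e k) x)"
proof (rule cadlag_suminf[OF _ weighted_bound[OF assms] weighted_summable])
  show "cadlag (\<lambda>x. c k * w k * prodf (e k) x)" for k
    by (rule cadlag_scale[OF prodf_cadlag[OF e]])
qed

lemma weighted_periodic: "periodic (\<lambda>x. \<Sum>k. c k * w k * prodf (e k) x)"
  using prodf_periodic[OF e] by (simp add: periodic_def)

lemma series_cadlag: "cadlag (series e c)"
  using weighted_cadlag[of "\<lambda>_. 1" 1] weight_one by (simp add: series_def[abs_def])

lemma series_periodic: "periodic (series e c)"
  using weighted_periodic[of "\<lambda>_. 1"] by (simp add: series_def[abs_def])

text \<open>On each slice the partial sums lie in the graph and converge boundedly, so
  \<open>LW_graph_limit\<close> applies. The limit is periodic, and cadlag by uniform convergence,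
  which identifies it as the chosen representative.\<close>

lemma LW_series: "LW W j (series e c) = (\<lambda>x. \<Sum>k. c k * (- eigs (e k) j) * prodf (e k) x)"
proof (rule LW_eqI)
  show "periodic (\<lambda>x. \<Sum>k. c k * (- eigs (e k) j) * prodf (e k) x)" by (rule weighted_periodic)
  show "cadlag (\<lambda>x. \<Sum>k. c k * (- eigs (e k) j) * prodf (e k) x)" by (rule weighted_cadlag[OF weight_eig])
  fix x :: "real^'d"
  define X where "X v = (\<chi> i. if i = j then v else x $ i)" for v :: real
  let ?M = "\<lambda>k. 1 * (\<bar>c k\<bar> * bnd (e k) * (1 + (\<Sum>j\<in>UNIV. eigs (e k) j)))"
  show "LW_graph (W j) (slice j x (series e c)) (slice j x (\<lambda>x. \<Sum>k. c k * (- eigs (e k) j) * prodf (e k) x))"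
  proof (rule G.LW_graph_limit)
    fix n
    have "LW_graph (W j) (\<lambda>u. \<Sum>k<n. c k * slice j x (prodf (e k)) u)
        (\<lambda>u. \<Sum>k<n. c k * slice j x (\<lambda>y. - eigs (e k) j * prodf (e k) y) u)"
      by (intro G.LW_graph_sum G.LW_graph_scale prodf_graph e) simp
    then show "LW_graph (W j) (\<lambda>u. \<Sum>k<n. c k * prodf (e k) (X u))
        (\<lambda>u. \<Sum>k<n. c k * (- eigs (e k) j) * prodf (e k) (X u))"
      by (simp add: slice_def X_def mult.assoc)
  next
    fix u
    have "summable (\<lambda>k. c k * 1 * prodf (e k) (X u))" by (rule term_summable[OF weight_one])
    from summable_LIMSEQ[OF this]
    show "(\<lambda>n. \<Sum>k<n. c k * prodf (e k) (X u)) \<longlonglongrightarrow> slice j x (series e c) u"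
      by (simp add: slice_def series_def X_def)
    have "summable (\<lambda>k. c k * (- eigs (e k) j) * prodf (e k) (X u))" by (rule term_summable[OF weight_eig])
    from summable_LIMSEQ[OF this]
    show "(\<lambda>n. \<Sum>k<n. c k * (- eigs (e k) j) * prodf (e k) (X u)) \<longlonglongrightarrow>
        slice j x (\<lambda>x. \<Sum>k. c k * (- eigs (e k) j) * prodf (e k) x) u"
      by (simp add: slice_def X_def)
    fix n
    have "\<bar>\<Sum>k<n. c k * (- eigs (e k) j) * prodf (e k) (X u)\<bar> \<le> (\<Sum>k<n. ?M k)"
      by (intro order_trans[OF sum_abs] sum_mono weighted_bound weight_eig)
    also have "\<dots> \<le> suminf ?M"
      using bnd_nonneg eigs_nonneg[OF e]
      by (intro sum_le_suminf weighted_summable) (auto intro!: mult_nonneg_nonneg add_nonneg_nonneg sum_nonneg)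
    finally show "\<bar>\<Sum>k<n. c k * (- eigs (e k) j) * prodf (e k) (X u)\<bar> \<le> suminf ?M" .
  qed
qed

context
  fixes \<aa> :: "'d \<Rightarrow> int^'d \<Rightarrow> real" and A :: "'d \<Rightarrow> real" and \<kappa> l :: real
  assumes \<kappa>: "0 < \<kappa>" and ell: "\<And>j x. \<kappa> \<le> \<aa> j x" and hom: "homogenization W B \<aa> A" and A: "\<And>j. 0 < A j"
    and l: "0 < l"
begin

lemma weight_rhs: "\<bar>l + hom_eig A (e k)\<bar> \<le> (l + (\<Sum>j\<in>UNIV. A j)) * (1 + (\<Sum>j\<in>UNIV. eigs (e k) j))"
proof -
  have nonneg: "0 \<le> (\<Sum>j\<in>UNIV. A j)" "0 \<le> (\<Sum>j\<in>UNIV. eigs (e k) j)" "0 \<le> hom_eig A (e k)"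
    using less_imp_le[OF A] eigs_nonneg[OF e] by (auto simp: hom_eig_def intro!: sum_nonneg mult_nonneg_nonneg)
  have "hom_eig A (e k) \<le> (\<Sum>j\<in>UNIV. A j) * (\<Sum>j\<in>UNIV. eigs (e k) j)"
    unfolding hom_eig_def sum_distrib_left
    using less_imp_le[OF A] eigs_nonneg[OF e] member_le_sum[of _ UNIV A]
    by (intro sum_mono mult_right_mono) auto
  moreover have "0 \<le> l * (\<Sum>j\<in>UNIV. eigs (e k) j)" using l nonneg by simp
  ultimately have "l + hom_eig A (e k) \<le> (l + (\<Sum>j\<in>UNIV. A j)) * (1 + (\<Sum>j\<in>UNIV. eigs (e k) j))"
    using nonneg by (simp add: algebra_simps)
  then show ?thesis using l nonneg by simp
qed

lemma series_rhs:
  "l * series e c x - (\<Sum>j\<in>UNIV. A j * LW W j (series e c) x) = (\<Sum>k. c k * (l + hom_eig A (e k)) * prodf (e k) x)"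
proof -
  have s1: "summable (\<lambda>k. c k * prodf (e k) x)" using term_summable[OF weight_one, of x] by simp
  have s2: "summable (\<lambda>k. c k * (- eigs (e k) j) * prodf (e k) x)" for j by (rule term_summable[OF weight_eig])
  have "(\<Sum>j\<in>UNIV. A j * LW W j (series e c) x) = (\<Sum>j\<in>UNIV. \<Sum>k. A j * (c k * (- eigs (e k) j) * prodf (e k) x))"
    unfolding LW_series by (intro sum.cong refl suminf_mult[symmetric] s2)
  also have "\<dots> = (\<Sum>k. \<Sum>j\<in>UNIV. A j * (c k * (- eigs (e k) j) * prodf (e k) x))"
    by (intro suminf_sum[symmetric] summable_mult s2)
  finally have "l * series e c x - (\<Sum>j\<in>UNIV. A j * LW W j (series e c) x) =
      (\<Sum>k. l * (c k * prodf (e k) x)) - (\<Sum>k. \<Sum>j\<in>UNIV. A j * (c k * (- eigs (e k) j) * prodf (e k) x))"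
    by (simp add: series_def suminf_mult[OF s1])
  also have "\<dots> = (\<Sum>k. l * (c k * prodf (e k) x) - (\<Sum>j\<in>UNIV. A j * (c k * (- eigs (e k) j) * prodf (e k) x)))"
    by (intro suminf_diff summable_mult s1 summable_sum s2)
  also have "\<dots> = (\<Sum>k. c k * (l + hom_eig A (e k)) * prodf (e k) x)"
  proof (intro suminf_cong)
    fix k
    have "(\<Sum>j\<in>UNIV. A j * (c k * (- eigs (e k) j) * prodf (e k) x)) = - (c k * hom_eig A (e k) * prodf (e k) x)"
      by (simp add: hom_eig_def sum_negf sum_distrib_left sum_distrib_right mult_ac)
    then show "l * (c k * prodf (e k) x) - (\<Sum>j\<in>UNIV. A j * (c k * (- eigs (e k) j) * prodf (e k) x)) =
        c k * (l + hom_eig A (e k)) * prodf (e k) x" by (simp add: algebra_simps)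
  qed
  finally show ?thesis .
qed

text \<open>Uniform in \<open>x\<close>, hence valid at the grid points of every \<open>N\<close> at
  once; \<open>C'\<close> permits one constant for several weights.\<close>

lemma tail_bound:
  assumes "\<And>k. \<bar>w k\<bar> \<le> C * (1 + (\<Sum>j\<in>UNIV. eigs (e k) j))" and C: "C \<le> C'"
  shows "\<bar>(\<Sum>k. c k * w k * prodf (e k) x) - (\<Sum>k<n. c k * w k * prodf (e k) x)\<bar> \<le>
    C' * (\<Sum>k. \<bar>c (k + n)\<bar> * bnd (e (k + n)) * (1 + (\<Sum>j\<in>UNIV. eigs (e (k + n)) j)))"
proof -
  let ?m = "\<lambda>k. \<bar>c k\<bar> * bnd (e k) * (1 + (\<Sum>j\<in>UNIV. eigs (e k) j))"
  have m: "0 \<le> ?m k" for k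
    using bnd_nonneg eigs_nonneg[OF e] by (intro mult_nonneg_nonneg add_nonneg_nonneg sum_nonneg) auto
  have s: "summable (\<lambda>k. ?m (k + n))" using summ by (rule summable_ignore_initial_segment)
  have "(\<Sum>k. c k * w k * prodf (e k) x) - (\<Sum>k<n. c k * w k * prodf (e k) x) =
      (\<Sum>k. c (k + n) * w (k + n) * prodf (e (k + n)) x)"
    using suminf_split_initial_segment[OF term_summable[OF assms(1)], of x n] by simp
  also have "\<bar>\<dots>\<bar> \<le> (\<Sum>k. C' * ?m (k + n))"
  proof (rule norm_suminf_le[where 'a = real, unfolded real_norm_def])
    show "summable (\<lambda>k. C' * ?m (k + n))" using s by (rule summable_mult)
    show "\<bar>c (k + n) * w (k + n) * prodf (e (k + n)) x\<bar> \<le> C' * ?m (k + n)" for k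
      using weighted_bound[OF assms(1), of "k + n" x] mult_right_mono[OF C m[of "k + n"]] by linarith
  qed
  also have "\<dots> = C' * (\<Sum>k. ?m (k + n))" by (rule suminf_mult[OF s])
  finally show ?thesis .
qed

text \<open>The order \<open>n\<close> of truncation is chosen first, from a bound that does not
  involve \<open>N\<close>; finitely many eigenfunctions then remain, each of them treated by
  \<open>eigen_convergence\<close>.\<close>

theorem corrected_series_convergence:
  "(\<lambda>N. inner_N N (\<lambda>x. series e c (grid N x) - corrected_function W \<aa> A l N (series e c) x)
     (\<lambda>x. series e c (grid N x) - corrected_function W \<aa> A l N (series e c) x)) \<longlonglongrightarrow> 0"
proof (rule LIMSEQ_I)
  fix \<epsilon> :: real assume \<epsilon>: "0 < \<epsilon>"
  have nonneg: "0 \<le> \<aa> j x" for j x using \<kappa> ell[of j x] by linarith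
  define S where "S = series e c"
  \<comment> \<open>Dominates the constants of both \<open>weight_one\<close> and
    \<open>weight_rhs\<close>.\<close>
  define C where "C = 1 + (l + (\<Sum>j\<in>UNIV. A j))"
  have A0: "0 \<le> (\<Sum>j\<in>UNIV. A j)" using less_imp_le[OF A] by (rule sum_nonneg)
  define g where "g N = corrected_function W \<aa> A l N S" for N
  let ?m = "\<lambda>k. \<bar>c k\<bar> * bnd (e k) * (1 + (\<Sum>j\<in>UNIV. eigs (e k) j))"
  define tail where "tail n = (\<Sum>k. ?m (k + n))" for n
  have m0: "0 \<le> ?m k" for k
    using bnd_nonneg eigs_nonneg[OF e] by (intro mult_nonneg_nonneg add_nonneg_nonneg sum_nonneg) auto
  \<comment> \<open>Two uses of \<open>inner_N_add_le\<close> give the factor 4 for each of the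
    tails \<open>p\<close> and \<open>q\<close>.\<close>
  define D where "D = 4 * (C / l)\<^sup>2 + 4 * C\<^sup>2"
  have "tail \<longlonglongrightarrow> 0" unfolding tail_def by (rule suminf_exist_split2[OF summ])
  then have "(\<lambda>n. D * (tail n)\<^sup>2) \<longlonglongrightarrow> D * 0\<^sup>2" by (intro tendsto_intros)
  then have "\<forall>\<^sub>F n in sequentially. D * (tail n)\<^sup>2 < \<epsilon> / 2" using \<epsilon> by (intro order_tendstoD(2)) auto
  then obtain n where n: "D * (tail n)\<^sup>2 < \<epsilon> / 2" by (auto simp: eventually_sequentially)
  have tail0: "0 \<le> tail n"
    unfolding tail_def using m0 by (intro suminf_nonneg summable_ignore_initial_segment summ) auto
  have "\<exists>h. 0 < N \<longrightarrow> (\<forall>x\<in>sites N. l * h x - random_walk_generator W \<aa> N h x = (l + hom_eig A (e k)) * prodf (e k) (grid N x))" for N k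
  proof (cases "0 < N")
    case True
    then show ?thesis
      using resolvent_exists[where \<aa> = \<aa> and r = "\<lambda>x. (l + hom_eig A (e k)) * prodf (e k) (grid N x)", OF admissible True l nonneg] by metis
  qed auto
  then have "\<forall>k. \<forall>N. \<exists>h. 0 < N \<longrightarrow> (\<forall>x\<in>sites N. l * h x - random_walk_generator W \<aa> N h x = (l + hom_eig A (e k)) * prodf (e k) (grid N x))"
    by blast
  then obtain h where "\<forall>k N. 0 < N \<longrightarrow> (\<forall>x\<in>sites N.
      l * h k N x - random_walk_generator W \<aa> N (h k N) x = (l + hom_eig A (e k)) * prodf (e k) (grid N x))"
    unfolding choice_iff by blast
  then have h: "\<And>k N x. 0 < N \<Longrightarrow> x \<in> sites N \<Longrightarrow>
      l * h k N x - random_walk_generator W \<aa> N (h k N) x = (l + hom_eig A (e k)) * prodf (e k) (grid N x)"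
    by blast
  have h_lim: "(\<lambda>N. inner_N N (\<lambda>x. h k N x - prodf (e k) (grid N x)) (\<lambda>x. h k N x - prodf (e k) (grid N x))) \<longlonglongrightarrow> 0" for k
    by (rule eigen_convergence[OF \<kappa> ell hom A e l h])
  define w where "w N x = (\<Sum>k<n. c k * (h k N x - prodf (e k) (grid N x)))" for N x
  have w_lim: "(\<lambda>N. inner_N N (w N) (w N)) \<longlonglongrightarrow> 0"
    using inner_N_sum_tendsto[of n "\<lambda>k N x. h k N x - prodf (e k) (grid N x)"] h_lim by (simp add: w_def[abs_def])
  then have "(\<lambda>N. 2 * inner_N N (w N) (w N)) \<longlonglongrightarrow> 2 * 0" by (intro tendsto_intros)
  then have "\<forall>\<^sub>F N in sequentially. 2 * inner_N N (w N) (w N) < \<epsilon> / 2"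
    by (rule order_tendstoD(2)) (use \<epsilon> in simp)
  then have "\<forall>\<^sub>F N in sequentially. norm (inner_N N (\<lambda>x. S (grid N x) - g N x) (\<lambda>x. S (grid N x) - g N x) - 0) < \<epsilon>"
    using eventually_gt_at_top[of 0]
  proof eventually_elim
    case (elim N)
    note N = \<open>0 < N\<close>
    \<comment> \<open>\<open>p\<close> solves the resolvent equation with the tail of the right-hand
      side, so its norm is at most the supremum of that tail divided by \<open>l\<close>;
      \<open>q\<close> is the tail of the function itself.\<close>
    define p where "p x = g N x - (\<Sum>k<n. c k * h k N x)" for x
    define q where "q x = S (grid N x) - (\<Sum>k<n. c k * prodf (e k) (grid N x))" for x
    have p_eq: "l * p x - random_walk_generator W \<aa> N p x =
        (\<Sum>k. c k * (l + hom_eig A (e k)) * prodf (e k) (grid N x)) - (\<Sum>k<n. c k * (l + hom_eig A (e k)) * prodf (e k) (grid N x))"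
      if x: "x \<in> sites N" for x
    proof -
      have "l * g N x - random_walk_generator W \<aa> N (g N) x = (\<Sum>k. c k * (l + hom_eig A (e k)) * prodf (e k) (grid N x))"
        unfolding g_def S_def series_rhs[symmetric]
        by (rule corrected_function_spec[where \<aa> = \<aa>, OF admissible N l nonneg x])
      moreover have "l * (\<Sum>k<n. c k * h k N x) - random_walk_generator W \<aa> N (\<lambda>x. \<Sum>k<n. c k * h k N x) x =
          (\<Sum>k<n. c k * (l + hom_eig A (e k)) * prodf (e k) (grid N x))"
      proof -
        have "l * (\<Sum>k<n. c k * h k N x) - random_walk_generator W \<aa> N (\<lambda>x. \<Sum>k<n. c k * h k N x) x =
            (\<Sum>k<n. c k * (l * h k N x - random_walk_generator W \<aa> N (h k N) x))"
          by (simp add: random_walk_generator_sum sum_distrib_left sum_subtractf[symmetric] algebra_simps)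
        also have "\<dots> = (\<Sum>k<n. c k * (l + hom_eig A (e k)) * prodf (e k) (grid N x))"
          using h[OF N x] by (intro sum.cong refl) (simp add: mult.assoc)
        finally show ?thesis .
      qed
      ultimately show ?thesis
        unfolding p_def[abs_def] random_walk_generator_diff right_diff_distrib by linarith
    qed
    define r where "r x = l * p x - random_walk_generator W \<aa> N p x" for x
    have "l\<^sup>2 * inner_N N p p \<le> inner_N N r r"
      by (rule resolvent_bound[where \<aa> = \<aa>, OF admissible N l nonneg]) (simp add: r_def)
    also have "\<dots> \<le> (C * tail n)\<^sup>2"
    proof (rule inner_N_grid_le[OF N])
      fix x :: "int^'d" assume x: "x \<in> sites N"
      have "l + (\<Sum>j\<in>UNIV. A j) \<le> C" by (simp add: C_def)
      from tail_bound[OF weight_rhs this, of "grid N x" n]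
      show "\<bar>r x\<bar> \<le> C * tail n" unfolding r_def p_eq[OF x] tail_def .
    qed
    finally have "l\<^sup>2 * inner_N N p p \<le> (C * tail n)\<^sup>2" .
    then have p: "inner_N N p p \<le> (C / l)\<^sup>2 * (tail n)\<^sup>2"
      using l by (simp add: field_simps power_divide power_mult_distrib)
    have q: "inner_N N q q \<le> (C * tail n)\<^sup>2"
    proof (rule inner_N_grid_le[OF N])
      fix x :: "int^'d" assume x: "x \<in> sites N"
      have "1 \<le> C" using l A0 by (simp add: C_def)
      from tail_bound[OF weight_one this, of "grid N x" n]
      show "\<bar>q x\<bar> \<le> C * tail n" unfolding q_def S_def series_def tail_def by simp
    qed
    have "(\<lambda>x. S (grid N x) - g N x) = (\<lambda>x. - w N x + (q x - p x))"
      by (simp add: q_def p_def w_def right_diff_distrib sum_subtractf)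
    then have "inner_N N (\<lambda>x. S (grid N x) - g N x) (\<lambda>x. S (grid N x) - g N x) \<le>
        2 * inner_N N (\<lambda>x. - w N x) (\<lambda>x. - w N x) + 2 * inner_N N (\<lambda>x. q x - p x) (\<lambda>x. q x - p x)"
      using inner_N_add_le[of N "\<lambda>x. - w N x" "\<lambda>x. q x - p x"] by simp
    also have "inner_N N (\<lambda>x. - w N x) (\<lambda>x. - w N x) = inner_N N (w N) (w N)" by (simp add: inner_N_def)
    also have "inner_N N (\<lambda>x. q x - p x) (\<lambda>x. q x - p x) \<le> 2 * inner_N N q q + 2 * inner_N N p p"
      using inner_N_add_le[of N q "\<lambda>x. - p x"] by (simp add: inner_N_def)
    finally have "inner_N N (\<lambda>x. S (grid N x) - g N x) (\<lambda>x. S (grid N x) - g N x) \<le>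
        2 * inner_N N (w N) (w N) + D * (tail n)\<^sup>2"
      using p q by (simp add: D_def power_mult_distrib distrib_right)
    then show ?case using elim(1) n inner_N_self_nonneg[of N "\<lambda>x. S (grid N x) - g N x"] by simp
  qed
  then show "\<exists>no. \<forall>N\<ge>no. norm (inner_N N (\<lambda>x. series e c (grid N x) - corrected_function W \<aa> A l N (series e c) x)
     (\<lambda>x. series e c (grid N x) - corrected_function W \<aa> A l N (series e c) x) - 0) < \<epsilon>"
    by (simp add: eventually_sequentially S_def g_def)
qed

end

end

end

section \<open>Elements of \<open>S\<^bsub>W\<^esub>\<close>\<close>

context eigen_system
begin

lemma LW_prodf:
  assumes f: "f \<in> families"
  shows "LW W j (prodf f) = (\<lambda>x. - eigs f j * prodf f x)"
proof (rule LW_eqI)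
  show "periodic (\<lambda>x. - eigs f j * prodf f x)" using prodf_periodic[OF f] by (simp add: periodic_def)
  show "cadlag (\<lambda>x. - eigs f j * prodf f x)" by (rule cadlag_scale[OF prodf_cadlag[OF f]])
qed (rule prodf_graph[OF f])

text \<open>Distinct families give orthogonal functions, while each function has norm 1.\<close>

lemma prodf_inj:
  assumes "f \<in> families" "g \<in> families" "prodf f = prodf g"
  shows "f = g"
  using prodf_inner[OF assms(1,1)] prodf_inner[OF assms(1,2)] assms(3) by (simp split: if_splits)

lemma combination_D_W:
  assumes "finite F" "F \<subseteq> families"
  shows "combination F c \<in> D_W B"
proof -
  define d where "d p = c (the_inv_into families prodf p)" for p
  have inj: "inj_on prodf families" using prodf_inj by (auto intro: inj_onI)
  have "combination F c = (\<lambda>x. \<Sum>p\<in>prodf ` F. d p * p x)"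
  proof
    fix x
    have "(\<Sum>p\<in>prodf ` F. d p * p x) = (\<Sum>f\<in>F. d (prodf f) * prodf f x)"
      using inj_on_subset[OF inj assms(2)] by (simp add: sum.reindex)
    also have "\<dots> = combination F c x"
      unfolding combination_def using assms(2)
      by (intro sum.cong refl) (auto simp: d_def the_inv_into_f_f[OF inj])
    finally show "combination F c x = (\<Sum>p\<in>prodf ` F. d p * p x)" by simp
  qed
  moreover have "finite (prodf ` F)" "prodf ` F \<subseteq> product_functions B"
    using assms by (auto simp: product_functions_eq)
  ultimately show ?thesis unfolding D_W_def by blast
qed

lemma D_W_diff:
  assumes "h \<in> D_W B" "h' \<in> D_W B"
  shows "(\<lambda>x. h x - h' x) \<in> D_W B"
proof -
  obtain F c where F: "finite F" "F \<subseteq> families" "h = combination F c" by (rule D_W_combination[OF assms(1)])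
  obtain F' c' where F': "finite F'" "F' \<subseteq> families" "h' = combination F' c'" by (rule D_W_combination[OF assms(2)])
  define d where "d f = (if f \<in> F then c f else 0) - (if f \<in> F' then c' f else 0)" for f
  have "(\<lambda>x. h x - h' x) = combination (F \<union> F') d"
  proof
    fix x
    have "combination F c x = (\<Sum>f\<in>F \<union> F'. (if f \<in> F then c f else 0) * prodf f x)"
      unfolding combination_def using F F' by (intro sum.mono_neutral_cong_left) auto
    moreover have "combination F' c' x = (\<Sum>f\<in>F \<union> F'. (if f \<in> F' then c' f else 0) * prodf f x)"
      unfolding combination_def using F F' by (intro sum.mono_neutral_cong_left) auto
    ultimately show "h x - h' x = combination (F \<union> F') d x"
      using F F' by (simp add: combination_def d_def sum_subtractf left_diff_distrib)
  qed
  then show ?thesis using F F' combination_D_W[of "F \<union> F'" d] by simp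
qed

context
  fixes \<phi> :: "nat \<Rightarrow> real^'d \<Rightarrow> real" and \<alpha> :: "nat \<Rightarrow> real"
  assumes enumeration: "eigen_enumeration W B \<phi> \<alpha>"
begin

text \<open>The enumeration lists functions on the torus; this recovers their one-dimensional
  factors, from which eigenvalues and sup bounds are read off.\<close>

definition fam :: "nat \<Rightarrow> 'd \<Rightarrow> real \<Rightarrow> real" where
  "fam k = (SOME f. f \<in> families \<and> \<phi> k = prodf f)"

lemma fam:
  assumes "1 \<le> k"
  shows "fam k \<in> families" "\<phi> k = prodf (fam k)"
proof -
  have "\<phi> k \<in> prodf ` families"
    using enumeration assms unfolding eigen_enumeration_def product_functions_eq by (auto dest: bij_betwE)
  then have "\<exists>f. f \<in> families \<and> \<phi> k = prodf f" by blast
  from someI_ex[OF this] show "fam k \<in> families" "\<phi> k = prodf (fam k)" by (auto simp: fam_def)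
qed

lemma fam_surj:
  assumes "f \<in> families"
  obtains k where "1 \<le> k" "fam k = f"
proof -
  have "prodf f \<in> \<phi> ` {1..}"
    using enumeration assms unfolding eigen_enumeration_def product_functions_eq bij_betw_def by blast
  then obtain k where "1 \<le> k" "prodf f = \<phi> k" by auto
  then show ?thesis using that fam[of k] prodf_inj[OF assms fam(1)] by metis
qed

lemma fam_inj: "inj_on fam {1..}"
proof (rule inj_onI)
  fix i k :: nat assume ik: "i \<in> {1..}" "k \<in> {1..}" "fam i = fam k"
  then have "\<phi> i = \<phi> k" using fam[of i] fam[of k] by simp
  moreover have "inj_on \<phi> {1..}" using enumeration unfolding eigen_enumeration_def bij_betw_def by blast
  ultimately show "i = k" using ik by (auto dest: inj_onD)
qed

text \<open>The eigenvalue equation is evaluated at a point where the function does not vanish; such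
  a point exists because its norm is 1.\<close>

lemma alpha_eq:
  assumes k: "1 \<le> k"
  shows "\<alpha> k = (\<Sum>j\<in>UNIV. eigs (fam k) j)"
proof -
  have "prodf (fam k) \<noteq> (\<lambda>_. 0)"
    using prodf_inner[OF fam(1)[OF k] fam(1)[OF k]] by auto
  then obtain x where x: "prodf (fam k) x \<noteq> 0" by auto
  have "\<alpha> k * prodf (fam k) x = - (\<Sum>j\<in>UNIV. LW W j (prodf (fam k)) x)"
    using enumeration k fam(2)[OF k] unfolding eigen_enumeration_def by metis
  also have "\<dots> = (\<Sum>j\<in>UNIV. eigs (fam k) j) * prodf (fam k) x"
    by (simp add: LW_prodf[OF fam(1)[OF k]] sum_negf sum_distrib_right)
  finally show ?thesis using x by simp
qed

lemma alpha_nonneg: "1 \<le> k \<Longrightarrow> 0 \<le> \<alpha> k"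
  by (simp add: alpha_eq sum_nonneg eigs_nonneg[OF fam(1)])

text \<open>Chosen so that each factor of \<open>bnd (fam k)\<close> is at most
  \<open>growth * (1 + \<alpha> k)\<close>.\<close>

definition "growth = 1 + 2 * (\<Sum>j\<in>UNIV. W j 1 - W j 0)"

lemma growth_ge_1: "1 \<le> growth"
  unfolding growth_def using less_imp_le[OF G.mass_pos] by (simp add: sum_nonneg)

lemma bnd_fam_le:
  assumes k: "1 \<le> k"
  shows "bnd (fam k) \<le> growth ^ CARD('d) * (1 + \<alpha> k) ^ CARD('d)"
proof -
  have eig: "0 \<le> eigs (fam k) j" "eigs (fam k) j \<le> \<alpha> k" for j
    using eigs_nonneg[OF fam(1)[OF k]] member_le_sum[of j UNIV "eigs (fam k)"] by (auto simp: alpha_eq[OF k])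
  have mass: "0 \<le> W j 1 - W j 0" "2 * (W j 1 - W j 0) \<le> growth - 1" for j
    using less_imp_le[OF G.mass_pos] member_le_sum[of j UNIV "\<lambda>j. W j 1 - W j 0"] by (auto simp: growth_def)
  have "bnd (fam k) \<le> (\<Prod>j\<in>(UNIV :: 'd set). growth * (1 + \<alpha> k))"
    unfolding bnd_def
  proof (intro prod_mono conjI)
    fix j
    show "0 \<le> 1 + 2 * eigs (fam k) j * (W j 1 - W j 0)"
      using eig(1)[of j] mass(1)[of j] by simp
    have "eigs (fam k) j * (2 * (W j 1 - W j 0)) \<le> \<alpha> k * (growth - 1)"
      using eig mass growth_ge_1 alpha_nonneg[OF k] by (intro mult_mono) auto
    moreover have "growth * (1 + \<alpha> k) = growth + \<alpha> k + \<alpha> k * (growth - 1)" by (simp add: algebra_simps)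
    moreover have "1 + 2 * eigs (fam k) j * (W j 1 - W j 0) = 1 + eigs (fam k) j * (2 * (W j 1 - W j 0))" by simp
    ultimately show "1 + 2 * eigs (fam k) j * (W j 1 - W j 0) \<le> growth * (1 + \<alpha> k)"
      using growth_ge_1 alpha_nonneg[OF k] by linarith
  qed
  then show ?thesis by (simp add: power_mult_distrib)
qed

definition coef :: "(real^'d \<Rightarrow> real) \<Rightarrow> nat \<Rightarrow> real" where
  "coef h k = (\<integral>y. h y * \<phi> k y \<partial>torus)"

text \<open>A finite combination is reindexed by the enumeration; by orthonormality its coefficients
  are the Fourier coefficients.\<close>

lemma D_W_coef:
  assumes "h \<in> D_W B"
  obtains K where "finite K" "K \<subseteq> {1..}" "\<And>k. 1 \<le> k \<Longrightarrow> k \<notin> K \<Longrightarrow> coef h k = 0"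
    "\<And>x. h x = (\<Sum>k\<in>K. coef h k * \<phi> k x)"
proof -
  obtain F c where F: "finite F" "F \<subseteq> families" and h: "h = combination F c" by (rule D_W_combination[OF assms])
  define K where "K = {k \<in> {1..}. fam k \<in> F}"
  have bij: "bij_betw fam K F"
    unfolding bij_betw_def
  proof
    show "inj_on fam K" by (rule inj_on_subset[OF fam_inj]) (auto simp: K_def)
    show "fam ` K = F"
    proof
      show "F \<subseteq> fam ` K"
      proof
        fix f assume f: "f \<in> F"
        then obtain k where "1 \<le> k" "fam k = f" using fam_surj F(2) by blast
        then show "f \<in> fam ` K" using f by (auto simp: K_def)
      qed
    qed (auto simp: K_def)
  qed
  have coef: "coef h k = (if fam k \<in> F then c (fam k) else 0)" if k: "1 \<le> k" for k
  proof -
    have "coef h k = (\<integral>y. (\<Sum>f\<in>F. c f * (prodf f y * prodf (fam k) y)) \<partial>torus)"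
      by (simp add: coef_def h combination_def fam(2)[OF k] sum_distrib_right mult.assoc)
    also have "\<dots> = (\<Sum>f\<in>F. c f * (\<integral>y. prodf f y * prodf (fam k) y \<partial>torus))"
      using F L2_mult_integrable[OF prodf_L2 prodf_L2[OF fam(1)[OF k]]]
      by (subst Bochner_Integration.integral_sum) (auto intro!: integrable_mult_right)
    also have "\<dots> = (\<Sum>f\<in>F. if f = fam k then c f else 0)"
      using F prodf_inner[OF _ fam(1)[OF k]] by (intro sum.cong refl) auto
    finally show ?thesis using F(1) by simp
  qed
  show ?thesis
  proof (rule that)
    show "finite K" using bij_betw_finite[OF bij] F(1) by simp
    show "K \<subseteq> {1..}" by (auto simp: K_def)
    show "coef h k = 0" if "1 \<le> k" "k \<notin> K" for k using coef[of k] that by (simp add: K_def)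
    fix x
    have "h x = (\<Sum>k\<in>K. c (fam k) * prodf (fam k) x)"
      unfolding h combination_def by (rule sum.reindex_bij_betw[OF bij, symmetric])
    also have "\<dots> = (\<Sum>k\<in>K. coef h k * \<phi> k x)"
      by (rule sum.cong) (auto simp: K_def coef fam(2))
    finally show "h x = (\<Sum>k\<in>K. coef h k * \<phi> k x)" .
  qed
qed

text \<open>The left side is the root of a single term of the sum. For elements of the span only
  finitely many terms are nonzero, so the infinite sum is a finite one and no question of
  convergence arises.\<close>

lemma coef_le_S_norm:
  assumes h: "h \<in> D_W B" and k: "1 \<le> k"
  shows "\<bar>coef h k\<bar> * ((1 + \<alpha> k) ^ n * real k ^ n) \<le> S_norm \<phi> \<alpha> n h"
proof -
  obtain K where K: "finite K" "K \<subseteq> {1..}" "\<And>k. 1 \<le> k \<Longrightarrow> k \<notin> K \<Longrightarrow> coef h k = 0"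
    by (rule D_W_coef[OF h]) blast
  define t where "t k = (L2_norm torus (proj \<phi> k h))\<^sup>2 * (1 + \<alpha> k) ^ (2 * n) * real k ^ (2 * n)" for k
  have t: "t k = (\<bar>coef h k\<bar> * ((1 + \<alpha> k) ^ n * real k ^ n))\<^sup>2" if k: "1 \<le> k" for k
  proof -
    have "(L2_norm torus (proj \<phi> k h))\<^sup>2 = (\<integral>x. (coef h k)\<^sup>2 * (prodf (fam k) x * prodf (fam k) x) \<partial>torus)"
      unfolding L2_norm_square proj_def coef_def[symmetric]
      unfolding fam(2)[OF k]
      by (intro Bochner_Integration.integral_cong refl) (simp add: power2_eq_square mult_ac)
    also have "\<dots> = (coef h k)\<^sup>2" using prodf_inner[OF fam(1)[OF k] fam(1)[OF k]] by simp
    finally show ?thesis by (simp add: t_def power_mult_distrib power_mult[symmetric] mult.commute[of 2 n])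
  qed
  have "infsum t {1..} = infsum t K"
    using K t by (intro infsum_cong_neutral) auto
  also have "\<dots> = (\<Sum>k\<in>K. t k)" using K(1) by simp
  finally have S: "S_norm \<phi> \<alpha> n h = sqrt (\<Sum>k\<in>K. t k)"     unfolding S_norm_def t_def[symmetric] by (rule arg_cong)
  have t0: "0 \<le> t i" if "i \<in> K" for i using t[of i] that K(2) by auto
  have "t k \<le> (\<Sum>k\<in>K. t k)"
  proof (cases "k \<in> K")
    case True
    then show ?thesis using K(1) t0 by (intro member_le_sum) auto
  next
    case False
    then have "t k = 0" using t[OF k] K(3)[OF k] by simp
    then show ?thesis using t0 by (simp add: sum_nonneg)
  qed
  then show ?thesis unfolding S t[OF k] by (rule real_le_rsqrt)
qed

lemma coef_diff:
  assumes "h \<in> L2 torus" "h' \<in> L2 torus" "1 \<le> k"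
  shows "coef (\<lambda>x. h x - h' x) k = coef h k - coef h' k"
  using L2_mult_integrable[OF assms(1) prodf_L2[OF fam(1)[OF assms(3)]]]
    L2_mult_integrable[OF assms(2) prodf_L2[OF fam(1)[OF assms(3)]]]
  by (simp add: coef_def fam(2)[OF assms(3)] left_diff_distrib)

text \<open>The order \<open>d + 3\<close> beats the growth \<open>O((1 + \<alpha>\<^sub>k)\<^sup>d)\<close> of the sup norms, the factor \<open>1 + \<alpha>\<^sub>k\<close> coming from the
  operator, and makes the series in \<open>k\<close> converge.\<close>

lemma S_W_series:
  assumes G: "G \<in> S_W B \<phi> \<alpha>"
  shows "G = series (\<lambda>k. fam (Suc k)) (\<lambda>k. coef G (Suc k))"
    and "summable (\<lambda>k. \<bar>coef G (Suc k)\<bar> * bnd (fam (Suc k)) * (1 + (\<Sum>j\<in>UNIV. eigs (fam (Suc k)) j)))"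
proof -
  define n where "n = CARD('d) + 3"
  have G_L2: "G \<in> L2 torus" and Gpc: "periodic G" "cadlag G" and "G \<in> S_n B \<phi> \<alpha> n"
    using G by (auto simp: S_W_def S_n_def)
  then obtain h where h: "\<And>m. h m \<in> D_W B"
    and cauchy: "\<And>\<epsilon>. 0 < \<epsilon> \<Longrightarrow> \<exists>m0. \<forall>m\<ge>m0. \<forall>m'\<ge>m0. S_norm \<phi> \<alpha> n (\<lambda>x. h m x - h m' x) < \<epsilon>"
    and lim: "(\<lambda>m. L2_norm torus (\<lambda>x. h m x - G x)) \<longlonglongrightarrow> 0"
    unfolding S_n_def by blast
  \<comment> \<open>The Cauchy condition with bound 1 gives, from \<open>m0\<close> on, one bound
    for the weighted coefficients of all approximants; \<open>H\<close> below starts at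
    \<open>m0\<close> for this reason.\<close>
  obtain m0 where m0: "\<And>m. m0 \<le> m \<Longrightarrow> S_norm \<phi> \<alpha> n (\<lambda>x. h m x - h m0 x) < 1"
    using cauchy[of 1] by fastforce
  define w where "w k = (1 + \<alpha> k) ^ n * real k ^ n" for k
  have w: "0 < w k" if "1 \<le> k" for k using that alpha_nonneg[OF that] by (simp add: w_def)
  define C where "C = 1 + S_norm \<phi> \<alpha> n (h m0)"
  have coef_h: "\<bar>coef (h m) k\<bar> * w k \<le> C" if m: "m0 \<le> m" and k: "1 \<le> k" for m k
  proof -
    have "coef (h m) k = coef (\<lambda>x. h m x - h m0 x) k + coef (h m0) k"
      by (simp add: coef_diff[OF D_W_L2[OF h] D_W_L2[OF h] k])
    then have "\<bar>coef (h m) k\<bar> * w k \<le> (\<bar>coef (\<lambda>x. h m x - h m0 x) k\<bar> + \<bar>coef (h m0) k\<bar>) * w k"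
      using w[OF k] by (intro mult_right_mono) auto
    also have "\<dots> \<le> S_norm \<phi> \<alpha> n (\<lambda>x. h m x - h m0 x) + S_norm \<phi> \<alpha> n (h m0)"
      unfolding distrib_right w_def
      by (intro add_mono coef_le_S_norm D_W_diff h k)
    finally show ?thesis using m0[OF m] by (simp add: C_def)
  qed
  have coef_lim: "(\<lambda>m. coef (h m) k) \<longlonglongrightarrow> coef G k" if "1 \<le> k" for k
    unfolding coef_def fam(2)[OF that]
    by (rule L2_inner_tendsto[OF D_W_L2[OF h] G_L2 lim prodf_L2[OF fam(1)[OF that]]])
  have coef_G: "\<bar>coef G k\<bar> * w k \<le> C" if k: "1 \<le> k" for k
  proof (rule LIMSEQ_le_const2)
    show "(\<lambda>m. \<bar>coef (h m) k\<bar> * w k) \<longlonglongrightarrow> \<bar>coef G k\<bar> * w k" by (intro tendsto_intros coef_lim k)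
    show "\<exists>N. \<forall>m\<ge>N. \<bar>coef (h m) k\<bar> * w k \<le> C" using coef_h[OF _ k] by blast
  qed
  have "0 \<le> \<bar>coef G 1\<bar> * w 1" using w[of 1] by simp
  then have C0: "0 \<le> C" by (rule order_trans) (rule coef_G, simp)
  define M where "M k = C * growth ^ CARD('d) * inverse (real (Suc k) ^ 2)" for k
  have "summable (\<lambda>k. inverse (real k ^ 2))" by (rule inverse_power_summable) simp
  then have "summable (\<lambda>k. inverse (real (Suc k) ^ 2))" by (subst summable_Suc_iff)
  then have M: "summable M" unfolding M_def by (rule summable_mult)
  \<comment> \<open>\<open>bnd\<close> costs \<open>1 + \<alpha>\<close> to the power
    \<open>d\<close> and the operator one power more; of the powers of the index in the weight, the
    square is kept for summability.\<close>
  have decay: "a * bnd (fam (Suc k)) * (1 + \<alpha> (Suc k)) \<le> M k"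
    if a: "0 \<le> a" "a * w (Suc k) \<le> C" for a k
  proof -
    define s where "s = 1 + \<alpha> (Suc k)"
    have s: "1 \<le> s" using alpha_nonneg[of "Suc k"] by (simp add: s_def)
    have b: "bnd (fam (Suc k)) * s \<le> growth ^ CARD('d) * s ^ n"
    proof -
      have "bnd (fam (Suc k)) * s \<le> (growth ^ CARD('d) * s ^ CARD('d)) * s"
        using bnd_fam_le[of "Suc k"] s by (intro mult_right_mono) (auto simp: s_def)
      also have "\<dots> = growth ^ CARD('d) * s ^ (CARD('d) + 1)" by (simp add: mult_ac)
      also have "\<dots> \<le> growth ^ CARD('d) * s ^ n"
        using s growth_ge_1 by (intro mult_left_mono power_increasing) (auto simp: n_def)
      finally show ?thesis .
    qed
    have k2: "real (Suc k) ^ 2 \<le> real (Suc k) ^ n" by (rule power_increasing) (auto simp: n_def)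
    have "a * (bnd (fam (Suc k)) * s) * real (Suc k) ^ 2 \<le> a * (growth ^ CARD('d) * s ^ n) * real (Suc k) ^ n"
    proof (rule mult_mono[OF mult_left_mono[OF b a(1)] k2])
      show "0 \<le> a * (growth ^ CARD('d) * s ^ n)" using a(1) s growth_ge_1 by simp
    qed simp
    also have "\<dots> = growth ^ CARD('d) * (a * w (Suc k))" by (simp add: w_def s_def mult_ac)
    also have "\<dots> \<le> growth ^ CARD('d) * C" using a(2) growth_ge_1 by (intro mult_left_mono) auto
    finally have "a * (bnd (fam (Suc k)) * s) * real (Suc k) ^ 2 \<le> growth ^ CARD('d) * C" .
    then show ?thesis by (simp add: M_def s_def field_simps)
  qed
  have term_le: "\<bar>a * prodf (fam (Suc k)) x\<bar> \<le> M k" if a: "\<bar>a\<bar> * w (Suc k) \<le> C" for a k x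
  proof -
    have b: "\<bar>prodf (fam (Suc k)) x\<bar> \<le> bnd (fam (Suc k))" by (rule prodf_bound[OF fam(1)]) simp
    then have "\<bar>a * prodf (fam (Suc k)) x\<bar> \<le> \<bar>a\<bar> * bnd (fam (Suc k))"
      unfolding abs_mult by (rule mult_left_mono) simp
    also have "\<dots> \<le> \<bar>a\<bar> * bnd (fam (Suc k)) * (1 + \<alpha> (Suc k))"
    proof -
      have "0 \<le> \<bar>a\<bar> * bnd (fam (Suc k))" using b by (intro mult_nonneg_nonneg) auto
      from mult_left_mono[of 1 "1 + \<alpha> (Suc k)", OF _ this] show ?thesis
        using alpha_nonneg[of "Suc k"] by simp
    qed
    also have "\<dots> \<le> M k" using a by (intro decay) auto
    finally show ?thesis .
  qed
  show summ: "summable (\<lambda>k. \<bar>coef G (Suc k)\<bar> * bnd (fam (Suc k)) * (1 + (\<Sum>j\<in>UNIV. eigs (fam (Suc k)) j)))"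
  proof (rule summable_comparison_test'[OF M])
    fix k
    have "0 \<le> bnd (fam (Suc k))" using prodf_bound[OF fam(1), of "Suc k" 0] by simp
    moreover have "\<bar>coef G (Suc k)\<bar> * bnd (fam (Suc k)) * (1 + \<alpha> (Suc k)) \<le> M k"
      by (intro decay coef_G) auto
    ultimately show "norm (\<bar>coef G (Suc k)\<bar> * bnd (fam (Suc k)) * (1 + (\<Sum>j\<in>UNIV. eigs (fam (Suc k)) j))) \<le> M k"
      using alpha_nonneg[of "Suc k"] alpha_eq[of "Suc k"] by simp
  qed
  define S where "S = series (\<lambda>k. fam (Suc k)) (\<lambda>k. coef G (Suc k))"
  have e: "fam (Suc k) \<in> families" for k by (rule fam) simp
  define H where "H m = h (m + m0)" for m
  \<comment> \<open>The finite expansion is written as a series in the same functions as the limit,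
    so that Tannery's theorem can pass to the limit in the coefficients.\<close>
  have H_series: "H m x = (\<Sum>k. coef (H m) (Suc k) * prodf (fam (Suc k)) x)" for m x
  proof -
    obtain K where K: "finite K" "K \<subseteq> {1..}" "\<And>k. 1 \<le> k \<Longrightarrow> k \<notin> K \<Longrightarrow> coef (H m) k = 0"
        "\<And>x. H m x = (\<Sum>k\<in>K. coef (H m) k * \<phi> k x)"
      using D_W_coef[of "H m"] h unfolding H_def by blast
    have K_Suc: "bij_betw Suc {k. Suc k \<in> K} K"
      unfolding bij_betw_def
    proof
      show "Suc ` {k. Suc k \<in> K} = K"
      proof
        show "K \<subseteq> Suc ` {k. Suc k \<in> K}"
        proof
          fix k assume k: "k \<in> K"
          then have "1 \<le> k" using K(2) by auto
          then have "k = Suc (k - 1)" by simp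
          then show "k \<in> Suc ` {k. Suc k \<in> K}" using k by (metis imageI mem_Collect_eq)
        qed
      qed auto
    qed simp
    have "(\<Sum>k. coef (H m) (Suc k) * prodf (fam (Suc k)) x) = (\<Sum>k\<in>{k. Suc k \<in> K}. coef (H m) (Suc k) * prodf (fam (Suc k)) x)"
      using bij_betw_finite[OF K_Suc] K(1,3) by (intro suminf_finite) auto
    also have "\<dots> = (\<Sum>k\<in>K. coef (H m) k * prodf (fam k) x)"
      by (rule sum.reindex_bij_betw[OF K_Suc])
    also have "\<dots> = (\<Sum>k\<in>K. coef (H m) k * \<phi> k x)"
      using K(2) by (intro sum.cong refl) (auto simp: fam(2))
    also have "\<dots> = H m x" by (rule K(4)[symmetric])
    finally show ?thesis by simp
  qed
  have H_term: "\<bar>coef (H m) (Suc k) * prodf (fam (Suc k)) x\<bar> \<le> M k" for m k x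
    by (intro term_le) (simp add: H_def coef_h)
  have H_lim: "(\<lambda>m. H m x) \<longlonglongrightarrow> S x" for x
  proof -
    have "(\<lambda>m. coef (H m) (Suc k)) \<longlonglongrightarrow> coef G (Suc k)" for k
      using LIMSEQ_ignore_initial_segment[OF coef_lim[of "Suc k"], of m0] by (simp add: H_def)
    then have "(\<lambda>m. \<Sum>k. coef (H m) (Suc k) * prodf (fam (Suc k)) x) \<longlonglongrightarrow> (\<Sum>k. coef G (Suc k) * prodf (fam (Suc k)) x)"
      by (intro suminf_tendsto[OF _ H_term M] tendsto_mult_right)
    then show ?thesis unfolding H_series[symmetric] S_def series_def .
  qed
  have H_bound: "\<bar>H m x\<bar> \<le> suminf M" for m x
  proof -
    have "\<bar>\<Sum>k. coef (H m) (Suc k) * prodf (fam (Suc k)) x\<bar> \<le> suminf M"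
      by (rule norm_suminf_le[where 'a = real, unfolded real_norm_def, OF H_term M])
    then show ?thesis unfolding H_series[symmetric] .
  qed
  have H_L2: "H m \<in> L2 torus" for m unfolding H_def by (rule D_W_L2[OF h])
  have S_meas: "S \<in> borel_measurable torus"
    by (rule borel_measurable_LIMSEQ_real[OF H_lim]) (use H_L2 in \<open>auto simp: L2_def\<close>)
  have S_bound: "\<bar>S x\<bar> \<le> suminf M" for x
    by (rule LIMSEQ_le_const2[OF tendsto_rabs[OF H_lim[of x]]]) (use H_bound in auto)
  have S_L2: "S \<in> L2 torus" by (rule torus.L2_bounded[OF S_meas S_bound])
  \<comment> \<open>The approximants tend to \<open>G\<close> in \<open>L2\<close> and boundedly
    pointwise to the series \<open>S\<close>. Pairing both limits with the difference
    \<open>u\<close> itself shows that its norm vanishes.\<close>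
  define u where "u x = G x - S x" for x
  have u_L2: "u \<in> L2 torus" unfolding u_def by (rule L2_diff[OF G_L2 S_L2])
  have "(\<lambda>m. \<integral>x. H m x * u x \<partial>torus) \<longlonglongrightarrow> (\<integral>x. G x * u x \<partial>torus)"
    using LIMSEQ_ignore_initial_segment[OF lim, of m0]
    by (intro L2_inner_tendsto[OF H_L2 G_L2 _ u_L2]) (simp add: H_def)
  moreover have "(\<lambda>m. \<integral>x. H m x * u x \<partial>torus) \<longlonglongrightarrow> (\<integral>x. S x * u x \<partial>torus)"
  proof (rule integral_dominated_convergence[where w = "\<lambda>x. suminf M * \<bar>u x\<bar>"])
    show "integrable torus (\<lambda>x. suminf M * \<bar>u x\<bar>)" using torus.L2_integrable[OF u_L2] by auto
    show "(\<lambda>x. S x * u x) \<in> borel_measurable torus" "(\<lambda>x. H m x * u x) \<in> borel_measurable torus" for m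
      using S_meas H_L2[of m] u_L2 by (auto simp: L2_def)
    show "AE x in torus. (\<lambda>m. H m x * u x) \<longlonglongrightarrow> S x * u x" by (intro AE_I2 tendsto_intros H_lim)
    show "AE x in torus. norm (H m x * u x) \<le> suminf M * \<bar>u x\<bar>" for m
      using H_bound by (auto simp: abs_mult intro!: mult_right_mono)
  qed
  ultimately have "(\<integral>x. G x * u x \<partial>torus) = (\<integral>x. S x * u x \<partial>torus)" by (rule LIMSEQ_unique)
  then have "(\<integral>x. (u x)\<^sup>2 \<partial>torus) = 0"
    using L2_mult_integrable[OF G_L2 u_L2] L2_mult_integrable[OF S_L2 u_L2]
    by (simp add: power2_eq_square u_def[of _] left_diff_distrib)
  then have "AE x in torus. (u x)\<^sup>2 = 0"
    using L2_D(2)[OF u_L2] by (subst (asm) integral_nonneg_eq_0_iff_AE) auto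
  then have "AE x in torus. G x = S x" by eventually_elim (simp add: u_def)
  \<comment> \<open>Equality almost everywhere becomes equality because both sides are periodic and
    cadlag.\<close>
  then show "G = series (\<lambda>k. fam (Suc k)) (\<lambda>k. coef G (Suc k))"
    using cadlag_AE_eq[OF Gpc series_periodic[OF e summ] series_cadlag[OF e summ]] by (simp add: S_def)
qed

end

end

section \<open>Stationarity\<close>

text \<open>Every term of the exponential series beyond the constant one has an outermost
  \<open>L\<close> and is annihilated by \<open>w\<close>. The bound \<open>K\<close> makes the
  series converge on the finite set, which permits exchanging it with the sum over states.\<close>

lemma markov_semigroup_invariant:
  fixes L :: "('s \<Rightarrow> real) \<Rightarrow> 's \<Rightarrow> real"
  assumes S: "finite S"
    and bound: "\<And>f M s. (\<And>s. s \<in> S \<Longrightarrow> \<bar>f s\<bar> \<le> M) \<Longrightarrow> s \<in> S \<Longrightarrow> \<bar>L f s\<bar> \<le> K * M"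
    and inv: "\<And>f. (\<Sum>s\<in>S. w s * L f s) = 0"
  shows "(\<Sum>s\<in>S. w s * markov_semigroup L t f s) = (\<Sum>s\<in>S. w s * f s)"
proof -
  define M where "M = (\<Sum>s\<in>S. \<bar>f s\<bar>)"
  have iterate: "\<bar>(L ^^ n) f s\<bar> \<le> K ^ n * M" if "s \<in> S" for n s
    using that
  proof (induction n arbitrary: s)
    case 0
    then show ?case unfolding M_def using S member_le_sum[of s S "\<lambda>s. \<bar>f s\<bar>"] by simp
  next
    case (Suc n)
    have "\<bar>L ((L ^^ n) f) s\<bar> \<le> K * (K ^ n * M)" by (rule bound[OF Suc.IH Suc.prems])
    then show ?case by (simp add: mult.assoc)
  qed
  have summable: "summable (\<lambda>n. t ^ n / fact n * (L ^^ n) f s)" if s: "s \<in> S" for s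
  proof (rule summable_comparison_test')
    have "summable (\<lambda>n. inverse (fact n) * (\<bar>t\<bar> * K) ^ n * M)"
      by (intro summable_mult2 summable_exp)
    then show "summable (\<lambda>n. \<bar>t\<bar> ^ n / fact n * (K ^ n * M))"
      by (simp add: field_simps power_mult_distrib)
    show "norm (t ^ n / fact n * (L ^^ n) f s) \<le> \<bar>t\<bar> ^ n / fact n * (K ^ n * M)" for n
      using iterate[OF s] by (auto simp: abs_mult power_abs intro!: mult_left_mono divide_right_mono)
  qed
  have "(\<Sum>s\<in>S. w s * markov_semigroup L t f s) = (\<Sum>s\<in>S. \<Sum>n. w s * (t ^ n / fact n * (L ^^ n) f s))"
    unfolding markov_semigroup_def by (intro sum.cong refl suminf_mult[symmetric] summable)
  also have "\<dots> = (\<Sum>n. \<Sum>s\<in>S. w s * (t ^ n / fact n * (L ^^ n) f s))"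
    by (intro suminf_sum[symmetric] summable_mult summable)
  also have "\<dots> = (\<Sum>n\<in>{0}. \<Sum>s\<in>S. w s * (t ^ n / fact n * (L ^^ n) f s))"
  proof (rule suminf_finite)
    fix n :: nat assume "n \<notin> {0}"
    then obtain m where n: "n = Suc m" by (cases n) auto
    have "(\<Sum>s\<in>S. w s * (t ^ n / fact n * (L ^^ n) f s)) = t ^ n / fact n * (\<Sum>s\<in>S. w s * L ((L ^^ m) f) s)"
      unfolding n by (simp add: sum_distrib_left mult.left_commute)
    then show "(\<Sum>s\<in>S. w s * (t ^ n / fact n * (L ^^ n) f s)) = 0" by (simp add: inv)
  qed simp
  finally show ?thesis by simp
qed

text \<open>Finite-dimensional laws are prescribed for times starting at 0, so the law at time
  \<open>t\<close> is obtained from the pair of times 0 and \<open>t\<close> by summing over the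
  initial state.\<close>

lemma markov_process_law:
  assumes proc: "markov_process S L \<nu> P X" and S: "finite S" and t: "0 \<le> t"
    and inv: "\<And>f. (\<Sum>s\<in>S. pmf \<nu> s * markov_semigroup L t f s) = (\<Sum>s\<in>S. pmf \<nu> s * f s)"
    and c: "c \<in> S"
  shows "measure P {w \<in> space P. X t w = c} = pmf \<nu> c"
proof -
  interpret P: prob_space P using proc by (simp add: markov_process_def)
  have X: "X s \<in> measurable P (count_space S)" if "0 \<le> s" for s
    using proc that by (simp add: markov_process_def)
  have X_sets: "{w \<in> space P. X s w = d} \<in> sets P" if "0 \<le> s" "d \<in> S" for s d
  proof -
    have "X s -` {d} \<inter> space P \<in> sets P" by (rule measurable_sets[OF X[OF that(1)]]) (simp add: that(2))
    also have "X s -` {d} \<inter> space P = {w \<in> space P. X s w = d}" by auto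
    finally show ?thesis .
  qed
  have joint: "measure P {w \<in> space P. X 0 w = d \<and> X t w = c} = pmf \<nu> d * markov_semigroup L t (indicator {c}) d"
    if d: "d \<in> S" for d
  proof -
    define \<tau> where "\<tau> i = (if i = 0 then 0 else t)" for i :: nat
    define e where "e i = (if i = 0 then d else c)" for i :: nat
    have "\<forall>n t c. t 0 = 0 \<and> (\<forall>i<n. t i \<le> t (Suc i)) \<and> (\<forall>i\<le>n. c i \<in> S) \<longrightarrow>
        measure P {w \<in> space P. \<forall>i\<le>n. X (t i) w = c i} =
        pmf \<nu> (c 0) * (\<Prod>i<n. markov_semigroup L (t (Suc i) - t i) (indicator {c (Suc i)}) (c i))"
      using proc unfolding markov_process_def by (elim conjE)
    from this[rule_format, of \<tau> 1 e] have "measure P {w \<in> space P. \<forall>i\<le>1. X (\<tau> i) w = e i} =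
        pmf \<nu> (e 0) * (\<Prod>i<1. markov_semigroup L (\<tau> (Suc i) - \<tau> i) (indicator {e (Suc i)}) (e i))"
      using t c d by (simp add: \<tau>_def e_def)
    moreover have "{w \<in> space P. \<forall>i\<le>1. X (\<tau> i) w = e i} = {w \<in> space P. X 0 w = d \<and> X t w = c}"
      by (auto simp: \<tau>_def e_def le_Suc_eq)
    ultimately show ?thesis by (simp add: \<tau>_def e_def)
  qed
  have "{w \<in> space P. X t w = c} = (\<Union>d\<in>S. {w \<in> space P. X 0 w = d \<and> X t w = c})"
    using measurable_space[OF X[of 0]] by auto
  also have "measure P \<dots> = (\<Sum>d\<in>S. measure P {w \<in> space P. X 0 w = d \<and> X t w = c})"
  proof (rule P.finite_measure_finite_Union[OF S])
    have "{w \<in> space P. X 0 w = d \<and> X t w = c} = {w \<in> space P. X 0 w = d} \<inter> {w \<in> space P. X t w = c}" for d by auto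
    then show "(\<lambda>d. {w \<in> space P. X 0 w = d \<and> X t w = c}) ` S \<subseteq> sets P"
      using X_sets[of 0] X_sets[OF t c] by auto
  qed (auto simp: disjoint_family_on_def)
  also have "\<dots> = (\<Sum>d\<in>S. pmf \<nu> d * indicator {c} d)"
    by (simp add: joint inv)
  also have "\<dots> = pmf \<nu> c" using S c by (simp add: indicator_def if_distrib[of "\<lambda>x. _ * x"] cong: if_cong)
  finally show ?thesis .
qed

lemma markov_process_expectation:
  fixes F :: "'s \<Rightarrow> real"
  assumes proc: "markov_process S L \<nu> P X" and S: "finite S" and t: "0 \<le> t"
    and inv: "\<And>f. (\<Sum>s\<in>S. pmf \<nu> s * markov_semigroup L t f s) = (\<Sum>s\<in>S. pmf \<nu> s * f s)"
  shows "(\<integral>w. F (X t w) \<partial>P) = (\<Sum>s\<in>S. F s * pmf \<nu> s)"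
proof -
  interpret P: prob_space P using proc by (simp add: markov_process_def)
  have X: "X t \<in> measurable P (count_space S)" using proc t by (simp add: markov_process_def)
  have X_sets: "{w \<in> space P. X t w = d} \<in> sets P" if "d \<in> S" for d
  proof -
    have "X t -` {d} \<inter> space P \<in> sets P" by (rule measurable_sets[OF X]) (simp add: that)
    also have "X t -` {d} \<inter> space P = {w \<in> space P. X t w = d}" by auto
    finally show ?thesis .
  qed
  have "(\<integral>w. F (X t w) \<partial>P) = (\<integral>w. (\<Sum>s\<in>S. F s * indicat_real {w \<in> space P. X t w = s} w) \<partial>P)"
  proof (rule Bochner_Integration.integral_cong[OF refl])
    fix w assume w: "w \<in> space P"
    then have "X t w \<in> S" using measurable_space[OF X w] by simp
    then show "F (X t w) = (\<Sum>s\<in>S. F s * indicat_real {w \<in> space P. X t w = s} w)"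
      using w S by (simp add: indicator_def if_distrib[of "\<lambda>x. _ * x"] cong: if_cong)
  qed
  also have "\<dots> = (\<Sum>s\<in>S. F s * measure P {w \<in> space P. X t w = s})"
  proof (subst Bochner_Integration.integral_sum)
    show "integrable P (\<lambda>w. F s * indicat_real {w \<in> space P. X t w = s} w)" if "s \<in> S" for s
      using X_sets[OF that] by (intro integrable_mult_right integrable_real_indicator) (auto simp: less_top[symmetric])
    show "(\<Sum>s\<in>S. \<integral>w. F s * indicat_real {w \<in> space P. X t w = s} w \<partial>P) =
        (\<Sum>s\<in>S. F s * measure P {w \<in> space P. X t w = s})"
    proof (intro sum.cong refl)
      fix s
      have "{w \<in> space P. X t w = s} \<inter> space P = {w \<in> space P. X t w = s}" by auto
      then show "(\<integral>w. F s * indicat_real {w \<in> space P. X t w = s} w \<partial>P) = F s * measure P {w \<in> space P. X t w = s}"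
        by simp
    qed
  qed
  also have "\<dots> = (\<Sum>s\<in>S. F s * pmf \<nu> s)"
    by (intro sum.cong refl) (simp add: markov_process_law[OF proc S t inv])
  finally show ?thesis .
qed

section \<open>The exclusion dynamics and the Bernoulli measure\<close>

lemma finite_configs: "finite (configs N)"
  unfolding configs_def by (rule finite_PiE_dflt) (auto simp: finite_sites)

lemma swap_sites_eq: "swap_sites x y \<eta> z = \<eta> (if z = x then y else if z = y then x else z)"
  by (simp add: swap_sites_def)

lemma swap_sites_involution: "swap_sites x y (swap_sites x y \<eta>) = \<eta>"
  by (rule ext) (simp add: swap_sites_def)

lemma swap_sites_configs:
  "x \<in> sites N \<Longrightarrow> y \<in> sites N \<Longrightarrow> \<eta> \<in> configs N \<Longrightarrow> swap_sites x y \<eta> \<in> configs N"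
  by (auto simp: configs_def PiE_dflt_def swap_sites_def)

lemma pmf_bernoulli_product_swap:
  assumes xy: "x \<in> sites N" "y \<in> sites N" and \<eta>: "\<eta> \<in> configs N"
  shows "pmf (bernoulli_product N \<rho>) (swap_sites x y \<eta>) = pmf (bernoulli_product N \<rho>) \<eta>"
proof -
  have out: "\<not> \<zeta> z" if "\<zeta> \<in> configs N" "z \<notin> sites N" for \<zeta> z
    using that by (auto simp: configs_def PiE_dflt_def)
  have pmf: "pmf (bernoulli_product N \<rho>) \<zeta> = (\<Prod>z\<in>sites N. pmf (bernoulli_pmf \<rho>) (\<zeta> z))" if "\<zeta> \<in> configs N" for \<zeta>
    unfolding bernoulli_product_def using out[OF that] by (subst pmf_Pi'[OF finite_sites]) auto
  show ?thesis
    unfolding pmf[OF \<eta>] pmf[OF swap_sites_configs[OF xy \<eta>]]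
    by (rule prod.reindex_bij_witness[of _ "\<lambda>z. if z = x then y else if z = y then x else z"
          "\<lambda>z. if z = x then y else if z = y then x else z"])
      (use xy in \<open>auto simp: swap_sites_eq\<close>)
qed

text \<open>The rate looks at the sites with offsets \<open>-1\<close> and \<open>2\<close>, while
  the exchange touches those with offsets \<open>0\<close> and \<open>1\<close>. Offsets of the two
  kinds differ by 1 or 2, hence stay distinct modulo \<open>N\<close> from \<open>N = 3\<close>
  on.\<close>

lemma exclusion_rate_swap:
  assumes N: "3 \<le> N" and x: "x \<in> sites N"
  shows "exclusion_rate b N j x (swap_sites x (wrap N (x + axis j 1)) \<eta>) = exclusion_rate b N j x \<eta>"
proof -
  have neq: "wrap N (x + axis j p) \<noteq> wrap N (x + axis j q)" if pq: "p - q \<noteq> 0" "\<bar>p - q\<bar> \<le> 2" for p q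
  proof
    assume "wrap N (x + axis j p) = wrap N (x + axis j q)"
    then have "(x $ j + p) mod int N = (x $ j + q) mod int N"
      by (auto simp: wrap_def vec_eq_iff axis_def dest: spec[of _ j])
    then have "int N dvd (x $ j + p) - (x $ j + q)" by (simp only: mod_eq_dvd_iff)
    then have "int N dvd \<bar>p - q\<bar>" by simp
    then have "int N \<le> \<bar>p - q\<bar>" using pq(1) by (intro zdvd_imp_le) auto
    then show False using N pq(2) by linarith
  qed
  have axis0: "axis j 0 = (0 :: int^'a)" by (simp add: vec_eq_iff axis_def)
  have axis: "x - axis j 1 = x + axis j (-1)" "x = wrap N (x + axis j 0)"
    by (simp add: vec_eq_iff axis_def) (simp only: axis0 add_0_right wrap_sites[OF x])
  have "wrap N (x - axis j 1) \<noteq> x" "wrap N (x - axis j 1) \<noteq> wrap N (x + axis j 1)"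
    "wrap N (x + axis j 2) \<noteq> x" "wrap N (x + axis j 2) \<noteq> wrap N (x + axis j 1)"
    using neq[of "-1" 0] neq[of "-1" 1] neq[of 2 0] neq[of 2 1]
    unfolding axis(1) axis(2)[symmetric] by simp_all
  then show ?thesis by (simp add: exclusion_rate_def swap_sites_def)
qed

text \<open>Each bond contributes 0 by itself: the exchange is an involution of the configurations
  preserving both the Bernoulli weight and the rate, so a change of variables undoes it.\<close>

lemma exclusion_generator_invariant:
  fixes f :: "(int^'d \<Rightarrow> bool) \<Rightarrow> real"
  assumes N: "3 \<le> N"
  shows "(\<Sum>\<eta>\<in>configs N. pmf (bernoulli_product N \<rho>) \<eta> * ((real N)\<^sup>2 * exclusion_generator W \<aa> b N f \<eta>)) = 0"
proof -
  let ?p = "\<lambda>\<eta>. pmf (bernoulli_product N \<rho>) \<eta>"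
  have N0: "0 < N" using N by simp
  have bond: "(\<Sum>\<eta>\<in>configs N. ?p \<eta> * (exclusion_rate b N j x \<eta> * (f (swap_sites x (wrap N (x + axis j 1)) \<eta>) - f \<eta>))) = 0"
    if x: "x \<in> sites N" for j and x :: "int^'d"
  proof -
    define y where "y = wrap N (x + axis j 1)"
    have y: "y \<in> sites N" unfolding y_def by (rule wrap_in_sites[OF N0])
    have "(\<Sum>\<eta>\<in>configs N. ?p \<eta> * (exclusion_rate b N j x \<eta> * f (swap_sites x y \<eta>))) =
        (\<Sum>\<eta>\<in>configs N. ?p \<eta> * (exclusion_rate b N j x \<eta> * f \<eta>))"
      by (rule sum.reindex_bij_witness[of _ "swap_sites x y" "swap_sites x y"])
        (auto simp: swap_sites_involution swap_sites_configs[OF x y] pmf_bernoulli_product_swap[OF x y]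
          exclusion_rate_swap[OF N x, of b j, folded y_def])
    then show ?thesis by (simp add: y_def right_diff_distrib sum_subtractf)
  qed
  have "(\<Sum>\<eta>\<in>configs N. ?p \<eta> * ((real N)\<^sup>2 * exclusion_generator W \<aa> b N f \<eta>)) =
      (\<Sum>\<eta>\<in>configs N. \<Sum>j\<in>UNIV. \<Sum>x\<in>sites N. (real N)\<^sup>2 * conductance W \<aa> N j x *
        (?p \<eta> * (exclusion_rate b N j x \<eta> * (f (swap_sites x (wrap N (x + axis j 1)) \<eta>) - f \<eta>))))"
    by (simp add: exclusion_generator_def sum_distrib_left mult_ac)
  also have "\<dots> = (\<Sum>j\<in>UNIV. \<Sum>x\<in>sites N. (real N)\<^sup>2 * conductance W \<aa> N j x *
        (\<Sum>\<eta>\<in>configs N. ?p \<eta> * (exclusion_rate b N j x \<eta> * (f (swap_sites x (wrap N (x + axis j 1)) \<eta>) - f \<eta>))))"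
    unfolding sum_distrib_left
    by (subst sum.swap, rule sum.cong[OF refl], rule sum.swap)
  also have "\<dots> = 0" by (simp add: bond)
  finally show ?thesis .
qed

text \<open>A crude operator bound in the supremum norm over configurations, for the convergence of
  the exponential series.\<close>

lemma exclusion_generator_bound:
  fixes f :: "(int^'d \<Rightarrow> bool) \<Rightarrow> real"
  assumes N: "0 < N"
    and f: "\<And>\<eta>. \<eta> \<in> configs N \<Longrightarrow> \<bar>f \<eta>\<bar> \<le> M" and \<eta>: "\<eta> \<in> configs N"
  shows "\<bar>(real N)\<^sup>2 * exclusion_generator W \<aa> b N f \<eta>\<bar> \<le>
    ((real N)\<^sup>2 * (\<Sum>j\<in>UNIV. \<Sum>x\<in>(sites N :: (int^'d) set). \<bar>conductance W \<aa> N j x\<bar> * (1 + 2 * \<bar>b\<bar>)) * 2) * M"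
proof -
  have "\<bar>exclusion_generator W \<aa> b N f \<eta>\<bar> \<le>
      (\<Sum>j\<in>UNIV. \<Sum>x\<in>(sites N :: (int^'d) set). (\<bar>conductance W \<aa> N j x\<bar> * (1 + 2 * \<bar>b\<bar>)) * (2 * M))"
    unfolding exclusion_generator_def
  proof (intro order_trans[OF sum_abs] sum_mono)
    fix j and x :: "int^'d" assume x: "x \<in> sites N"
    have "\<bar>exclusion_rate b N j x \<eta>\<bar> \<le> 1 + 2 * \<bar>b\<bar>" by (auto simp: exclusion_rate_def)
    moreover have "\<bar>f (swap_sites x (wrap N (x + axis j 1)) \<eta>) - f \<eta>\<bar> \<le> 2 * M"
      using f[OF \<eta>] f[OF swap_sites_configs[OF x wrap_in_sites[OF N, of "x + axis j 1"] \<eta>]] by linarith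
    ultimately show "\<bar>conductance W \<aa> N j x * exclusion_rate b N j x \<eta> *
        (f (swap_sites x (wrap N (x + axis j 1)) \<eta>) - f \<eta>)\<bar> \<le> (\<bar>conductance W \<aa> N j x\<bar> * (1 + 2 * \<bar>b\<bar>)) * (2 * M)"
      unfolding abs_mult by (intro mult_mono) auto
  qed
  then have "(real N)\<^sup>2 * \<bar>exclusion_generator W \<aa> b N f \<eta>\<bar> \<le>
      (real N)\<^sup>2 * (\<Sum>j\<in>UNIV. \<Sum>x\<in>(sites N :: (int^'d) set). (\<bar>conductance W \<aa> N j x\<bar> * (1 + 2 * \<bar>b\<bar>)) * (2 * M))"
    by (rule mult_left_mono) simp
  then show ?thesis
    unfolding abs_mult abs_power2 sum_distrib_right[symmetric] mult.assoc[of _ 2 M, symmetric]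
    by (simp only: abs_of_nat mult.assoc)
qed

lemma exclusion_process_expectation:
  fixes F :: "(int^'d \<Rightarrow> bool) \<Rightarrow> real"
  assumes proc: "exclusion_process W \<aa> b \<rho> N P \<eta>" and N: "3 \<le> N" and t: "0 \<le> t"
  shows "(\<integral>w. F (\<eta> t w) \<partial>P) = (\<Sum>\<zeta>\<in>configs N. F \<zeta> * pmf (bernoulli_product N \<rho>) \<zeta>)"
proof (rule markov_process_expectation[OF proc[unfolded exclusion_process_def] finite_configs t])
  fix f :: "(int^'d \<Rightarrow> bool) \<Rightarrow> real"
  have "0 < N" using N by simp
  show "(\<Sum>\<zeta>\<in>configs N. pmf (bernoulli_product N \<rho>) \<zeta> *
      markov_semigroup (\<lambda>f \<eta>. (real N)\<^sup>2 * exclusion_generator W \<aa> b N f \<eta>) t f \<zeta>) =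
      (\<Sum>\<zeta>\<in>configs N. pmf (bernoulli_product N \<rho>) \<zeta> * f \<zeta>)"
    by (rule markov_semigroup_invariant[OF finite_configs exclusion_generator_bound[OF \<open>0 < N\<close>] exclusion_generator_invariant[OF N]])
qed

lemma bernoulli_product_covariance:
  assumes \<rho>: "0 \<le> \<rho>" "\<rho> \<le> 1" and xy: "x \<in> sites N" "y \<in> sites N"
  shows "(\<integral>\<zeta>. (of_bool (\<zeta> x) - \<rho>) * (of_bool (\<zeta> y) - \<rho>) \<partial>bernoulli_product N \<rho>) = (if x = y then \<rho> * (1 - \<rho>) else 0)"
proof -
  let ?\<nu> = "bernoulli_product N \<rho>"
  have comp: "map_pmf (\<lambda>\<zeta>. \<zeta> z) ?\<nu> = bernoulli_pmf \<rho>" if "z \<in> sites N" for z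
    unfolding bernoulli_product_def using that by (simp add: Pi_pmf_component finite_sites)
  have marginal: "(\<integral>\<zeta>. g (\<zeta> z) \<partial>?\<nu>) = g True * \<rho> + g False * (1 - \<rho>)" if "z \<in> sites N" for z and g :: "bool \<Rightarrow> real"
  proof -
    have "(\<integral>\<zeta>. g (\<zeta> z) \<partial>?\<nu>) = (\<integral>v. g v \<partial>map_pmf (\<lambda>\<zeta>. \<zeta> z) ?\<nu>)" by simp
    then show ?thesis unfolding comp[OF that] using \<rho> by simp
  qed
  show ?thesis
  proof (cases "x = y")
    case True
    then show ?thesis
      using marginal[OF xy(1), of "\<lambda>v. (of_bool v - \<rho>) * (of_bool v - \<rho>)"] by (simp add: algebra_simps)
  next
    case False
    have "prob_space.indep_vars ?\<nu> (\<lambda>_. count_space UNIV) (\<lambda>z \<zeta>. \<zeta> z) (sites N)"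
      unfolding bernoulli_product_def by (rule indep_vars_Pi_pmf[OF finite_sites])
    then have "prob_space.indep_vars ?\<nu> (\<lambda>_. borel) (\<lambda>z \<zeta>. of_bool (\<zeta> z) - \<rho>) (sites N)"
      by (rule prob_space.indep_vars_compose2[OF prob_space_measure_pmf]) simp
    then have indep: "prob_space.indep_vars ?\<nu> (\<lambda>_. borel) (\<lambda>z \<zeta>. of_bool (\<zeta> z) - \<rho>) {x, y}"
      by (rule prob_space.indep_vars_subset[OF prob_space_measure_pmf]) (use xy in auto)
    have int: "integrable ?\<nu> (\<lambda>\<zeta>. of_bool (\<zeta> z) - \<rho>)" for z
      by (rule measure_pmf.integrable_const_bound[where B = "1 + \<bar>\<rho>\<bar>"]) (auto intro!: AE_I2)
    have "(\<integral>\<zeta>. (\<Prod>z\<in>{x, y}. of_bool (\<zeta> z) - \<rho>) \<partial>?\<nu>) = (\<Prod>z\<in>{x, y}. \<integral>\<zeta>. of_bool (\<zeta> z) - \<rho> \<partial>?\<nu>)"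
      by (rule prob_space.indep_vars_lebesgue_integral[OF prob_space_measure_pmf _ indep int]) simp
    moreover have "(\<integral>\<zeta>. of_bool (\<zeta> x) - \<rho> \<partial>?\<nu>) = 0"
      using marginal[OF xy(1), of "\<lambda>v. of_bool v - \<rho>"] by (simp add: algebra_simps)
    ultimately show ?thesis using False by simp
  qed
qed

text \<open>Distinct sites are uncorrelated, so only the diagonal of the double sum survives. The
  expectation is written as a sum over configurations to fit
  \<open>exclusion_process_expectation\<close>.\<close>

lemma fluctuation_field_second_moment:
  fixes h :: "int^'d \<Rightarrow> real"
  assumes \<rho>: "0 \<le> \<rho>" "\<rho> \<le> 1" and N: "0 < N"
  shows "(\<Sum>\<zeta>\<in>configs N. (fluctuation_field N \<rho> h \<zeta>)\<^sup>2 * pmf (bernoulli_product N \<rho>) \<zeta>) = \<rho> * (1 - \<rho>) * inner_N N h h"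
proof -
  let ?\<nu> = "bernoulli_product N \<rho> :: (int^'d \<Rightarrow> bool) pmf"
  let ?Z = "\<lambda>x \<zeta>. of_bool (\<zeta> x) - \<rho>"
  have supp: "set_pmf ?\<nu> \<subseteq> configs N"
    unfolding bernoulli_product_def configs_def
    by (rule order_trans[OF set_Pi_pmf_subset[OF finite_sites]]) (auto simp: PiE_dflt_def)
  then have fin: "finite (set_pmf ?\<nu>)" using finite_configs by (rule finite_subset)
  have scale: "(real N powr (- real CARD('d) / 2))\<^sup>2 = 1 / real N ^ CARD('d)"
    using N by (simp add: power2_eq_square powr_add[symmetric] powr_minus_divide powr_realpow)
  have "(\<Sum>\<zeta>\<in>configs N. (fluctuation_field N \<rho> h \<zeta>)\<^sup>2 * pmf ?\<nu> \<zeta>) = (\<integral>\<zeta>. (fluctuation_field N \<rho> h \<zeta>)\<^sup>2 \<partial>?\<nu>)"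
    using supp by (intro integral_measure_pmf_real[symmetric] finite_configs) auto
  also have "\<dots> = (\<integral>\<zeta>. 1 / real N ^ CARD('d) * (\<Sum>x\<in>sites N. \<Sum>y\<in>sites N. h x * h y * (?Z x \<zeta> * ?Z y \<zeta>)) \<partial>?\<nu>)"
    unfolding fluctuation_field_def power_mult_distrib scale
    by (simp add: power2_eq_square sum_product mult_ac)
  also have "\<dots> = 1 / real N ^ CARD('d) * (\<Sum>x\<in>sites N. \<Sum>y\<in>sites N. h x * h y * (\<integral>\<zeta>. ?Z x \<zeta> * ?Z y \<zeta> \<partial>?\<nu>))"
    using fin by (simp add: integrable_measure_pmf_finite)
  also have "(\<Sum>x\<in>sites N. \<Sum>y\<in>sites N. h x * h y * (\<integral>\<zeta>. ?Z x \<zeta> * ?Z y \<zeta> \<partial>?\<nu>)) =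
      (\<Sum>x\<in>sites N. h x * h x * (\<rho> * (1 - \<rho>)))"
  proof (rule sum.cong[OF refl])
    fix x :: "int^'d" assume x: "x \<in> sites N"
    have "(\<Sum>y\<in>sites N. h x * h y * (\<integral>\<zeta>. ?Z x \<zeta> * ?Z y \<zeta> \<partial>?\<nu>)) = (\<Sum>y\<in>sites N. if y = x then h x * h x * (\<rho> * (1 - \<rho>)) else 0)"
      by (rule sum.cong) (auto simp: bernoulli_product_covariance[OF \<rho> x])
    then show "(\<Sum>y\<in>sites N. h x * h y * (\<integral>\<zeta>. ?Z x \<zeta> * ?Z y \<zeta> \<partial>?\<nu>)) = h x * h x * (\<rho> * (1 - \<rho>))"
      using x by (simp add: finite_sites)
  qed
  finally show ?thesis by (simp add: inner_N_def sum_distrib_left sum_divide_distrib mult_ac)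
qed

theorem lemma4p4:
  fixes W :: "'d::finite \<Rightarrow> real \<Rightarrow> real"
    and B :: "'d \<Rightarrow> (real \<Rightarrow> real) set"
    and \<phi> :: "nat \<Rightarrow> real^'d \<Rightarrow> real"
    and \<alpha> :: "nat \<Rightarrow> real"
    and M :: "'w measure"
    and T :: "int^'d \<Rightarrow> 'w \<Rightarrow> 'w"
    and a :: "'d \<Rightarrow> 'w \<Rightarrow> real"
    and A :: "'d \<Rightarrow> real"
    and T_max \<rho> b l :: real
  assumes "T_max > 0" and "0 < \<rho>" and "\<rho> \<le> 1" and "b > - 1 / 2" and "l > 0"
    and W: "admissible_W W"
    and B: "\<And>k. eigenbasis (W k) (B k)"
    and enumeration: "eigen_enumeration W B \<phi> \<alpha>"
    and M: "standard_prob_space M"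
    and T: "ergodic_action M T"
    and a: "elliptic M a"
    and A_pos: "\<And>j. A j > 0"
    and A_hom: "AE \<omega> in M. homogenization W B (\<lambda>j x. a j (T x \<omega>)) A"
  shows "AE \<omega> in M. \<forall>t\<in>{0..T_max}. \<forall>G\<in>S_W B \<phi> \<alpha>.
    \<forall>(P :: nat \<Rightarrow> 'p measure) (\<eta> :: nat \<Rightarrow> real \<Rightarrow> 'p \<Rightarrow> (int^'d \<Rightarrow> bool)).
      (\<forall>N\<ge>1. exclusion_process W (\<lambda>j x. a j (T x \<omega>)) b \<rho> N (P N) (\<eta> N)) \<longrightarrow>
      (\<lambda>N. \<integral>w. (density_field N \<rho> G (\<eta> N t w) -
                corrected_density_field W (\<lambda>j x. a j (T x \<omega>)) A l N \<rho> G (\<eta> N t w))\<^sup>2 \<partial>P N)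
        \<longlonglongrightarrow> 0"
proof -
  interpret eigen_system W B by (rule eigen_system.intro[OF W B])
  obtain \<theta> where \<theta>: "0 < \<theta>" "\<And>j \<omega>. \<omega> \<in> space M \<Longrightarrow> inverse \<theta> \<le> a j \<omega>"
    using a by (auto simp: elliptic_def)
  have T_space: "T x \<omega> \<in> space M" if "\<omega> \<in> space M" for x \<omega>
    using T that unfolding ergodic_action_def by (meson measurable_space)
  show ?thesis
    \<comment> \<open>The typical environments are those with the homogenization property, so one
      null set serves all \<open>t\<close>, all \<open>G\<close> and all realizations of the
      process.\<close>
    using A_hom AE_space
  proof eventually_elim
    case (elim \<omega>)
    define \<aa> where "\<aa> j x = a j (T x \<omega>)" for j x
    have hom: "homogenization W B \<aa> A" using elim(1) by (simp add: \<aa>_def[abs_def])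
    have ell: "inverse \<theta> \<le> \<aa> j x" for j x using \<theta>(2)[OF T_space[OF elim(2)]] by (simp add: \<aa>_def)
    have \<kappa>: "0 < inverse \<theta>" using \<theta>(1) by simp
    have "(\<lambda>N. \<integral>w. (density_field N \<rho> G (\<eta> N t w) - corrected_density_field W \<aa> A l N \<rho> G (\<eta> N t w))\<^sup>2 \<partial>P N) \<longlonglongrightarrow> 0"
      if t: "t \<in> {0..T_max}" and G: "G \<in> S_W B \<phi> \<alpha>"
        and proc: "\<forall>N\<ge>1. exclusion_process W \<aa> b \<rho> N (P N) (\<eta> N)"
      for t G and P :: "nat \<Rightarrow> 'p measure" and \<eta> :: "nat \<Rightarrow> real \<Rightarrow> 'p \<Rightarrow> (int^'d \<Rightarrow> bool)"
    proof -
      define h where "h N x = G (grid N x) - corrected_function W \<aa> A l N G x" for N x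
      note series = S_W_series[OF enumeration G]
      have "(\<lambda>N. inner_N N (h N) (h N)) \<longlonglongrightarrow> 0"
        using corrected_series_convergence[OF fam(1)[OF enumeration] series(2) \<kappa> ell hom A_pos \<open>l > 0\<close>]
        unfolding h_def series(1)[symmetric] by simp
      then have "(\<lambda>N. \<rho> * (1 - \<rho>) * inner_N N (h N) (h N)) \<longlonglongrightarrow> \<rho> * (1 - \<rho>) * 0" by (rule tendsto_mult_left)
      moreover have "\<forall>\<^sub>F N in sequentially. \<rho> * (1 - \<rho>) * inner_N N (h N) (h N) =
          (\<integral>w. (density_field N \<rho> G (\<eta> N t w) - corrected_density_field W \<aa> A l N \<rho> G (\<eta> N t w))\<^sup>2 \<partial>P N)"
        \<comment> \<open>Stationarity is available from \<open>N = 3\<close> on, because of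
          \<open>exclusion_rate_swap\<close>; the limit ignores the smaller tori.\<close>
        using eventually_ge_at_top[of 3]
      proof eventually_elim
        case (elim N)
        have diff: "density_field N \<rho> G \<zeta> - corrected_density_field W \<aa> A l N \<rho> G \<zeta> = fluctuation_field N \<rho> (h N) \<zeta>" for \<zeta>
          by (simp add: density_field_def corrected_density_field_def fluctuation_field_def h_def
              left_diff_distrib sum_subtractf right_diff_distrib)
        have "exclusion_process W \<aa> b \<rho> N (P N) (\<eta> N)" using proc elim by simp
        from exclusion_process_expectation[OF this elim, of t "\<lambda>\<zeta>. (fluctuation_field N \<rho> (h N) \<zeta>)\<^sup>2"]
        show ?case unfolding diff
          using t fluctuation_field_second_moment[of \<rho> N "h N"] \<open>0 < \<rho>\<close> \<open>\<rho> \<le> 1\<close> elim by simp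
      qed
      ultimately show ?thesis unfolding mult_zero_right by (rule Lim_transform_eventually)
    qed
    then show ?case unfolding \<aa>_def by blast
  qed
qed

end
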